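(* Let $n\ge1$ and $l\ge3$ be integers. There exist constants $c_1(n,l)$ (for $l$ odd) and $c_2(n,l)$ (for $l$ even), depending only on $n$ and $l$, such that the following holds. Let $\Omega$ be a bounded domain with smooth boundary in the Heisenberg group $\mathbb{H}^n$, let $0<\lambda_1\le\lambda_2\le\cdots\to+\infty$ be the eigenvalues of the problem $$(-\Delta_{\mathbb{H}^n})^lu=\lambda u\ \text{ in }\Omega,\qquad u=\frac{\partial u}{\partial\nu}=\cdots=\frac{\partial^{l-1}u}{\partial\nu^{l-1}}=0\ \text{ on }\partial\Omega,$$ and let $k\ge1$. If $l\ge3$ is odd, then $$\sum_{i=1}^k(\lambda_{k+1}-\lambda_i)^2\le\frac1n\bigg[\sum_{i=1}^k(\lambda_{k+1}-\lambda_i)\lambda_i^{\frac1l}\bigg]^{\frac12}\bigg\{\sum_{i=1}^k(\lambda_{k+1}-\lambda_i)^2\Big[2l(n+l-1)\lambda_i^{\frac{l-1}{l}}+c_1(n,l)\Big(\lambda_i+\lambda_i^{\frac{l-2}{l}}\Big)\Big]\bigg\}^{\frac12},$$ and if $l\ge4$ is even, then $$\sum_{i=1}^k(\lambda_{k+1}-\lambda_i)^2\le\frac1n\bigg[\sum_{i=1}^k(\lambda_{k+1}-\lambda_i)\lambda_i^{\frac1l}\bigg]^{\frac12}\bigg\{\sum_{i=1}^k(\lambda_{k+1}-\lambda_i)^2\Big[\big(2ln+4(l-1)\big)\lambda_i^{\frac{l-1}{l}}+c_2(n,l)\lambda_i^{\frac{l-1}{l}}\Big]\bigg\}^{\fr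ac12}.$$
   Context: The Heisenberg group $\mathbb{H}^n$ is $\mathbb{R}^{2n+1}$ with coordinates $(x,y,t)$, $x,y\in\mathbb{R}^n$, $t\in\mathbb{R}$, and group law $(x,y,t)(x',y',t')=\big(x+x',\,y+y',\,t+t'+\tfrac12(\langle x',y\rangle_{\mathbb{R}^n}-\langle x,y'\rangle_{\mathbb{R}^n})\big)$. For $p=1,\dots,n$ set $X_p=\frac{\partial}{\partial x_p}+\frac{y_p}{2}\frac{\partial}{\partial t}$ and $Y_p=\frac{\partial}{\partial y_p}-\frac{x_p}{2}\frac{\partial}{\partial t}$. The (real) Kohn Laplacian is $\Delta_{\mathbb{H}^n}=\sum_{p=1}^n(X_p^2+Y_p^2)$. $\nu$ denotes the outward unit normal to $\partial\Omega$. $S^{l,2}(\Omega)$ is the Hilbert space of functions $u\in L^2(\Omega)$ such that $X_p^du,Y_p^du\in L^2(\Omega)$ for $1\le d\le l$, $1\le p\le n$, with norm $\|u\|_{S^{l,2}}^2=\int_\Omega\big(\sum_{d=1}^l\sum_{p=1}^n(|X_p^du|^2+|Y_p^du|^2)+|u|^2\big)\,dx\,dy\,dt$, and $S_0^{l,2}(\Omega)$ is the closure of $C_0^\infty(\Omega)$ in it. The eigenvalues of the problem are listed with multiplicity, with corresponding eigenfunctions $u_i\in S_0^{l,2}(\Omega)$, orthonormal in $L^2(\Omega)$. *)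

theory Defs
  imports "HOL-Analysis.Analysis"
begin

section \<open>The Heisenberg group\<close>

text \<open>Coordinates are triples \<open>(x, y, t)\<close>, and \<open>n\<close> is \<open>CARD('n)\<close>. Euclidean topology and
  Lebesgue measure come from the product type.\<close>

type_synonym 'n heis = "(real^'n) \<times> (real^'n) \<times> real"

definition heis_mult :: "('n::finite) heis \<Rightarrow> 'n heis \<Rightarrow> 'n heis" where
  "heis_mult = (\<lambda>(x, y, t) (x', y', t'). (x + x', y + y', t + t' + (x' \<bullet> y - x \<bullet> y') / 2))"

text \<open>The coefficient vectors at the point \<open>z\<close> of the fields
  \<open>X\<^sub>p = \<partial>/\<partial>x\<^sub>p + (y\<^sub>p/2) \<partial>/\<partial>t\<close> and \<open>Y\<^sub>p = \<partial>/\<partial>y\<^sub>p - (x\<^sub>p/2) \<partial>/\<partial>t\<close>.\<close>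

definition X_vec :: "'n::finite \<Rightarrow> 'n heis \<Rightarrow> 'n heis" where
  "X_vec p = (\<lambda>(x, y, t). (axis p 1, 0, (y $ p) / 2))"

definition Y_vec :: "'n::finite \<Rightarrow> 'n heis \<Rightarrow> 'n heis" where
  "Y_vec p = (\<lambda>(x, y, t). (0, axis p 1, - (x $ p) / 2))"

text \<open>Hence \<open>X\<^sub>p\<close> and \<open>Y\<^sub>p\<close> are left-invariant.\<close>

lemma X_vec_eq_right_translation:
  "heis_mult z (axis p s, 0, 0) = z + s *\<^sub>R X_vec p z"
  by (cases z) (simp add: heis_mult_def X_vec_def inner_axis' vec_eq_iff, simp add: axis_def)

lemma Y_vec_eq_right_translation:
  "heis_mult z (0, axis p s, 0) = z + s *\<^sub>R Y_vec p z"
  by (cases z) (simp add: heis_mult_def Y_vec_def inner_axis vec_eq_iff, simp add: axis_def)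

definition X_op :: "'n::finite \<Rightarrow> ('n heis \<Rightarrow> real) \<Rightarrow> 'n heis \<Rightarrow> real" where
  "X_op p f = (\<lambda>z. frechet_derivative f (at z) (X_vec p z))"

definition Y_op :: "'n::finite \<Rightarrow> ('n heis \<Rightarrow> real) \<Rightarrow> 'n heis \<Rightarrow> real" where
  "Y_op p f = (\<lambda>z. frechet_derivative f (at z) (Y_vec p z))"

definition kohn_laplacian :: "(('n::finite) heis \<Rightarrow> real) \<Rightarrow> 'n heis \<Rightarrow> real" where
  "kohn_laplacian f = (\<lambda>z. \<Sum>p\<in>UNIV. X_op p (X_op p f) z + Y_op p (Y_op p f) z)"

definition poly_kohn :: "nat \<Rightarrow> (('n::finite) heis \<Rightarrow> real) \<Rightarrow> 'n heis \<Rightarrow> real" where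
  "poly_kohn l = (\<lambda>f z. - kohn_laplacian f z) ^^ l"


section \<open>Smooth functions and domains\<close>

primrec C_k_on :: "nat \<Rightarrow> ('a::euclidean_space \<Rightarrow> real) \<Rightarrow> 'a set \<Rightarrow> bool" where
  "C_k_on 0 f S \<longleftrightarrow> continuous_on S f"
| "C_k_on (Suc k) f S \<longleftrightarrow>
     (\<forall>z\<in>S. f differentiable (at z)) \<and> (\<forall>v. C_k_on k (\<lambda>z. frechet_derivative f (at z) v) S)"

text \<open>Meant for open sets, since the derivatives are full derivatives at each point.\<close>

definition smooth_on :: "('a::euclidean_space \<Rightarrow> real) \<Rightarrow> 'a set \<Rightarrow> bool" where
  "smooth_on f S \<longleftrightarrow> (\<forall>k. C_k_on k f S)"

text \<open>Smoothness of the boundary: near each boundary point, \<open>\<Omega>\<close> is the sublevel set of a smooth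
  function with nonvanishing gradient.\<close>

definition bounded_smooth_domain :: "('a::euclidean_space) set \<Rightarrow> bool" where
  "bounded_smooth_domain \<Omega> \<longleftrightarrow>
     open \<Omega> \<and> connected \<Omega> \<and> \<Omega> \<noteq> {} \<and> bounded \<Omega> \<and>
     (\<forall>q\<in>frontier \<Omega>. \<exists>U \<rho>. open U \<and> q \<in> U \<and> smooth_on \<rho> U \<and>
        (\<forall>z\<in>U. frechet_derivative \<rho> (at z) \<noteq> (\<lambda>v. 0)) \<and> \<rho> q = 0 \<and>
        \<Omega> \<inter> U = {z\<in>U. \<rho> z < 0})"

definition test_functions :: "('a::euclidean_space) set \<Rightarrow> ('a \<Rightarrow> real) set" where
  "test_functions \<Omega> =
     {\<phi>. smooth_on \<phi> UNIV \<and> compact (closure {z. \<phi> z \<noteq> 0}) \<and> closure {z. \<phi> z \<noteq> 0} \<subseteq> \<Omega>}"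


section \<open>The spaces \<open>S\<^sup>l\<^sup>,\<^sup>2\<close>\<close>

text \<open>Elements of \<open>L\<^sup>2(\<Omega>)\<close> are represented by functions, equality being equality almost
  everywhere on \<open>\<Omega>\<close>.\<close>

definition L2_on :: "('a::euclidean_space) set \<Rightarrow> ('a \<Rightarrow> real) set" where
  "L2_on \<Omega> = {u \<in> borel_measurable (lebesgue_on \<Omega>). integrable (lebesgue_on \<Omega>) (\<lambda>z. (u z)\<^sup>2)}"

text \<open>\<open>w\<close> is \<open>D\<^sup>d u\<close> in the sense of distributions. The sign is the right one for \<open>D = X\<^sub>p\<close> and
  \<open>D = Y\<^sub>p\<close>, whose coefficients are divergence free.\<close>

definition is_weak_pow ::
  "((('n::finite) heis \<Rightarrow> real) \<Rightarrow> 'n heis \<Rightarrow> real) \<Rightarrow> nat \<Rightarrow> 'n heis set \<Rightarrow>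
     ('n heis \<Rightarrow> real) \<Rightarrow> ('n heis \<Rightarrow> real) \<Rightarrow> bool" where
  "is_weak_pow D d \<Omega> u w \<longleftrightarrow> w \<in> L2_on \<Omega> \<and>
     (\<forall>\<phi>\<in>test_functions \<Omega>.
        (LINT z|lebesgue_on \<Omega>. w z * \<phi> z) = (-1) ^ d * (LINT z|lebesgue_on \<Omega>. u z * (D ^^ d) \<phi> z))"

text \<open>The weak derivative is unique up to a null set, so the choice below does not affect the
  norm.\<close>

definition weak_pow ::
  "((('n::finite) heis \<Rightarrow> real) \<Rightarrow> 'n heis \<Rightarrow> real) \<Rightarrow> nat \<Rightarrow> 'n heis set \<Rightarrow>
     ('n heis \<Rightarrow> real) \<Rightarrow> 'n heis \<Rightarrow> real" where
  "weak_pow D d \<Omega> u = (SOME w. is_weak_pow D d \<Omega> u w)"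

definition S_space :: "nat \<Rightarrow> ('n::finite) heis set \<Rightarrow> ('n heis \<Rightarrow> real) set" where
  "S_space l \<Omega> = {u \<in> L2_on \<Omega>. \<forall>d\<in>{1..l}. \<forall>p.
     (\<exists>w. is_weak_pow (X_op p) d \<Omega> u w) \<and> (\<exists>w. is_weak_pow (Y_op p) d \<Omega> u w)}"

definition S_norm :: "nat \<Rightarrow> ('n::finite) heis set \<Rightarrow> ('n heis \<Rightarrow> real) \<Rightarrow> real" where
  "S_norm l \<Omega> u = sqrt (LINT z|lebesgue_on \<Omega>.
     (\<Sum>d=1..l. \<Sum>p\<in>UNIV. \<bar>weak_pow (X_op p) d \<Omega> u z\<bar>\<^sup>2 + \<bar>weak_pow (Y_op p) d \<Omega> u z\<bar>\<^sup>2) + \<bar>u z\<bar>\<^sup>2)"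

definition S0_space :: "nat \<Rightarrow> ('n::finite) heis set \<Rightarrow> ('n heis \<Rightarrow> real) set" where
  "S0_space l \<Omega> = {u \<in> S_space l \<Omega>.
     \<forall>\<epsilon>>0. \<exists>\<phi>\<in>test_functions \<Omega>. S_norm l \<Omega> (\<lambda>z. u z - \<phi> z) < \<epsilon>}"


section \<open>The eigenvalue problem\<close>

text \<open>Solutions of \<open>(-\<Delta>)\<^sup>l u = \<mu> u\<close> are understood in the sense of distributions in \<open>\<Omega>\<close>
  (the operator is formally self-adjoint), and the Dirichlet conditions
  \<open>u = \<partial>u/\<partial>\<nu> = \<dots> = \<partial>\<^sup>l\<^sup>-\<^sup>1u/\<partial>\<nu>\<^sup>l\<^sup>-\<^sup>1 = 0\<close> as membership in the closure of the test functions.\<close>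

definition eigenspace :: "nat \<Rightarrow> ('n::finite) heis set \<Rightarrow> real \<Rightarrow> ('n heis \<Rightarrow> real) set" where
  "eigenspace l \<Omega> \<mu> = {u \<in> S0_space l \<Omega>. \<forall>\<phi>\<in>test_functions \<Omega>.
     (LINT z|lebesgue_on \<Omega>. u z * poly_kohn l \<phi> z) = \<mu> * (LINT z|lebesgue_on \<Omega>. u z * \<phi> z)}"

text \<open>\<open>lam 1 \<le> lam 2 \<le> \<dots>\<close> lists all eigenvalues with multiplicity; the value \<open>lam 0\<close> is
  irrelevant. By the last conjunct, for every real \<open>\<mu>\<close> the eigenspace of \<open>\<mu>\<close> has as a basis (modulo
  null functions) those \<open>u i\<close> with \<open>lam i = \<mu>\<close>. These are finitely many because
  \<open>lam\<close> tends to infinity; there are none if \<open>\<mu>\<close> is not an eigenvalue.\<close>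

definition eigenvalue_listing :: "nat \<Rightarrow> ('n::finite) heis set \<Rightarrow> (nat \<Rightarrow> real) \<Rightarrow> bool" where
  "eigenvalue_listing l \<Omega> lam \<longleftrightarrow>
     0 < lam 1 \<and> (\<forall>i\<ge>1. lam i \<le> lam (i + 1)) \<and> filterlim lam at_top sequentially \<and>
     (\<exists>u. (\<forall>i\<ge>1. u i \<in> eigenspace l \<Omega> (lam i)) \<and>
          (\<forall>i\<ge>1. \<forall>j\<ge>1. (LINT z|lebesgue_on \<Omega>. u i z * u j z) = (if i = j then 1 else 0)) \<and>
          (\<forall>\<mu>. \<forall>v\<in>eigenspace l \<Omega> \<mu>. \<exists>c :: nat \<Rightarrow> real.
             AE z in lebesgue_on \<Omega>. v z = (\<Sum>i | i \<ge> 1 \<and> lam i = \<mu>. c i * u i z)))"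

end

theory Submission
  imports Defs "HOL-Probability.Probability"
begin

text \<open>Since the constants are free, it suffices to prove
  \<open>\<Sum> (\<Lambda> - \<lambda>\<^sub>i)\<^sup>2 \<le> C (\<Sum> (\<Lambda> - \<lambda>\<^sub>i) \<lambda>\<^sub>i\<^sup>1\<^sup>/\<^sup>l)\<^sup>1\<^sup>/\<^sup>2 (\<Sum> (\<Lambda> - \<lambda>\<^sub>i)\<^sup>2 \<lambda>\<^sub>i\<^sup>(\<^sup>l\<^sup>-\<^sup>1\<^sup>)\<^sup>/\<^sup>l)\<^sup>1\<^sup>/\<^sup>2\<close> with \<open>\<Lambda> = \<lambda>\<^sub>k\<^sub>+\<^sub>1\<close>.
  This is Yang's method with the trial functions \<open>x u\<^sub>i\<close>, where \<open>x\<close> is a single coordinate \<open>x\<^sub>p\<close>, projected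
  orthogonally to \<open>u\<^sub>1, \<dots>, u\<^sub>k\<close>. It requires that the double commutator of \<open>x\<close> with \<open>(-\<Delta>)\<^sup>l\<close> be bounded
  by the energy of order \<open>l - 1\<close>, which is interpolated by log-convexity.

  Everything is carried out on test functions, which form an inner product space, and passed to the
  limit along sequences converging to the \<open>u\<^sub>i\<close> in \<open>L\<^sup>2\<close> and in energy. The subelliptic estimates needed
  are that \<open>(-\<Delta>)\<^sup>m\<close> controls all words of length \<open>m\<close> in the fields, and that the pure powers \<open>X\<^sub>p\<^sup>l, Y\<^sub>p\<^sup>l\<close>
  that define the norm of \<open>S\<^sup>l\<^sup>,\<^sup>2\<close> control \<open>(-\<Delta>)\<^sup>l\<close>. Both are proved at a fixed frequency \<open>\<tau>\<close> of
  the central variable, where \<open>\<partial>/\<partial>t\<close> acts as \<open>i \<tau>\<close> and \<open>|\<tau>| \<le> -\<Delta>\<close>, and then averaged over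
  \<open>\<tau>\<close>.\<close>

section \<open>Smooth functions\<close>

text \<open>The listing hypothesis speaks of eigenspaces and contains no min-max principle, so the
  variational inequality has to be proved: a minimising sequence must converge, hence a compactness
  theorem, hence control of the full Euclidean gradient, where the central derivative T counts as
  two fields. T is also the obstacle in comparing pure powers, mixed words and powers of the
  Laplacian: each exchange of two fields leaves a term with T that has the same homogeneous order as
  the main one. At a fixed frequency such a term carries the scalar |\<tau>|, which Cauchy-Schwarz
  can divide between two factors. Functions being real, i \<tau> is represented by a skew operator
  whose square is -\<tau>^2. As the constants are free, one coordinate suffices: with C the bound
  for the double commutator, c1 = c2 = 4 n^2 C makes up for the prefactor 1/n, and the explicit
  summands of the theorem are nonnegative and only enlarge the right side. For odd l the constant
  multiplies other powers, and lambda^((l-1)/l) is estimated by their sum.\<close>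

lemma frechet_derivative_eq:
  "(f has_derivative f') (at z) \<Longrightarrow> frechet_derivative f (at z) v = f' v"
  using frechet_derivative_at by metis

lemma C_k_on_imp_continuous: "C_k_on k f UNIV \<Longrightarrow> continuous_on UNIV f"
  by (cases k) (auto intro!: differentiable_imp_continuous_on simp: differentiable_on_def differentiable_at_withinI)

lemma C_k_on_Suc_imp: "C_k_on (Suc k) f UNIV \<Longrightarrow> C_k_on k f UNIV"
proof (induction k arbitrary: f)
  case 0
  then show ?case using C_k_on_imp_continuous by (metis C_k_on.simps(1))
next
  case (Suc k)
  then show ?case by (metis C_k_on.simps(2))
qed

lemma C_k_on_const: "C_k_on k (\<lambda>z. c) UNIV"
  by (induction k arbitrary: c) auto

lemma C_k_on_add:
  "C_k_on k f UNIV \<Longrightarrow> C_k_on k g UNIV \<Longrightarrow> C_k_on k (\<lambda>z. f z + g z) UNIV"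
proof (induction k arbitrary: f g)
  case 0
  then show ?case by (auto intro: continuous_intros)
next
  case (Suc k)
  have *: "((\<lambda>z. f z + g z) has_derivative
      (\<lambda>v. frechet_derivative f (at z) v + frechet_derivative g (at z) v)) (at z)" for z
    using Suc.prems by (auto intro!: has_derivative_add simp: frechet_derivative_works[symmetric])
  then show ?case
    using Suc by (auto simp: frechet_derivative_eq[OF *] intro: differentiableI[OF *])
qed

lemma C_k_on_mult:
  "C_k_on k f UNIV \<Longrightarrow> C_k_on k g UNIV \<Longrightarrow> C_k_on k (\<lambda>z. f z * g z) UNIV"
proof (induction k arbitrary: f g)
  case 0
  then show ?case by (auto intro: continuous_intros)
next
  case (Suc k)
  have *: "((\<lambda>z. f z * g z) has_derivative
      (\<lambda>v. f z * frechet_derivative g (at z) v + frechet_derivative f (at z) v * g z)) (at z)" for z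
    using Suc.prems by (auto intro!: has_derivative_mult simp: frechet_derivative_works[symmetric])
  show ?case
    using Suc.prems C_k_on_Suc_imp[OF Suc.prems(1)] C_k_on_Suc_imp[OF Suc.prems(2)]
    by (auto simp: frechet_derivative_eq[OF *] intro!: C_k_on_add Suc.IH intro: differentiableI[OF *])
qed

lemma C_k_on_inner: "C_k_on k (\<lambda>z. z \<bullet> b) UNIV"
proof (cases k)
  case (Suc j)
  have *: "((\<lambda>z. z \<bullet> b) has_derivative (\<lambda>v. v \<bullet> b)) (at z)" for z
    by (auto intro!: derivative_eq_intros)
  show ?thesis
    by (auto simp: Suc frechet_derivative_eq[OF *] intro: differentiableI[OF *] C_k_on_const)
qed (auto intro: continuous_intros)

lemma has_derivative_translate:
  assumes "f differentiable (at (z + a))"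
  shows "((\<lambda>z. f (z + a)) has_derivative frechet_derivative f (at (z + a))) (at z)"
proof -
  have "((\<lambda>z. z + a) has_derivative (\<lambda>v. v)) (at z)"
    by (auto intro!: derivative_eq_intros)
  from has_derivative_compose[OF this] assms show ?thesis
    by (auto simp: frechet_derivative_works)
qed

lemma C_k_on_translate: "C_k_on k f UNIV \<Longrightarrow> C_k_on k (\<lambda>z. f (z + a)) UNIV"
proof (induction k arbitrary: f)
  case 0
  then show ?case
    by (auto intro!: continuous_intros intro: continuous_on_compose2)
next
  case (Suc k)
  have *: "((\<lambda>z. f (z + a)) has_derivative frechet_derivative f (at (z + a))) (at z)" for z
    using Suc.prems by (intro has_derivative_translate) auto
  have "C_k_on k (\<lambda>z. frechet_derivative f (at (z + a)) v) UNIV" for v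
    using Suc.IH[of "\<lambda>z. frechet_derivative f (at z) v"] Suc.prems by auto
  then show ?case
    by (auto simp: frechet_derivative_eq[OF *] intro: differentiableI[OF *])
qed

lemma C_k_on_frechet: "smooth_on f UNIV \<Longrightarrow> C_k_on k (\<lambda>z. frechet_derivative f (at z) v) UNIV"
  unfolding smooth_on_def by (metis C_k_on.simps(2))

lemma smooth_on_differentiable: "smooth_on f UNIV \<Longrightarrow> f differentiable (at z)"
  unfolding smooth_on_def by (metis C_k_on.simps(2) UNIV_I)

lemma smooth_on_continuous: "smooth_on f UNIV \<Longrightarrow> continuous_on UNIV f"
  unfolding smooth_on_def by (metis C_k_on.simps(1))

section \<open>The inner product space of test functions\<close>

text \<open>The support is left free because translations must act on the type, and they leave any
  fixed \<open>\<Omega>\<close>. Supports inside \<open>\<Omega>\<close> are imposed later by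
  \<open>tfs\<close>.\<close>

typedef (overloaded) 'a tf = "test_functions (UNIV :: 'a::euclidean_space set)"
  morphisms app Abs_tf
  by (rule exI[of _ "\<lambda>z. 0"]) (auto simp: test_functions_def smooth_on_def C_k_on_const)

lemma tf_eqI: "(\<And>z. app f z = app g z) \<Longrightarrow> f = g"
  using app_inject by blast

lemma smooth_app: "smooth_on (app f) UNIV"
  using app[of f] by (auto simp: test_functions_def)

lemma compact_supp: "compact (closure {z. app f z \<noteq> 0})"
  using app[of f] by (auto simp: test_functions_def)

lemma bounded_supp: "bounded {z. app f z \<noteq> 0}"
  using compact_supp[of f] compact_closure by blast

lemma app_Abs_tf:
  "smooth_on \<phi> UNIV \<Longrightarrow> bounded {z. \<phi> z \<noteq> 0} \<Longrightarrow> app (Abs_tf \<phi>) = \<phi>"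
  by (rule Abs_tf_inverse) (auto simp: test_functions_def compact_closure)

lemma smooth_C_k: "C_k_on k (app f) UNIV"
  using smooth_app[of f] by (auto simp: smooth_on_def)

lemma app_has_derivative: "(app f has_derivative frechet_derivative (app f) (at z)) (at z)"
  using smooth_on_differentiable[OF smooth_app] frechet_derivative_works by blast

lemma continuous_app: "continuous_on S (app f)"
  using smooth_on_continuous[OF smooth_app] continuous_on_subset by blast

lemma borel_app [measurable]: "app f \<in> borel_measurable borel"
  by (intro borel_measurable_continuous_onI continuous_app)

definition pd :: "'a::euclidean_space \<Rightarrow> 'a tf \<Rightarrow> 'a tf" where
  "pd v f = Abs_tf (\<lambda>z. frechet_derivative (app f) (at z) v)"

definition crd :: "'a::euclidean_space \<Rightarrow> 'a tf \<Rightarrow> 'a tf" where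
  "crd b f = Abs_tf (\<lambda>z. (z \<bullet> b) * app f z)"

definition tr :: "'a::euclidean_space \<Rightarrow> 'a tf \<Rightarrow> 'a tf" where
  "tr a f = Abs_tf (\<lambda>z. app f (z + a))"

lemma frechet_derivative_outside_support:
  assumes "z \<notin> closure {z. \<phi> z \<noteq> 0}"
  shows "frechet_derivative \<phi> (at z) = (\<lambda>v. 0 :: real)"
proof -
  have op: "open (- closure {z. \<phi> z \<noteq> 0})" by auto
  have eq: "0 = \<phi> w" if "w \<in> - closure {z. \<phi> z \<noteq> 0}" for w
    using that closure_subset[of "{z. \<phi> z \<noteq> 0}"] by auto
  have "(\<phi> has_derivative (\<lambda>v. 0)) (at z)"
  proof (rule has_derivative_transform_within_open)
    show "((\<lambda>_. 0) has_derivative (\<lambda>v. 0)) (at z)" by simp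
    show "z \<in> - closure {z. \<phi> z \<noteq> 0}" using assms by simp
  qed (fact op, fact eq)
  then show ?thesis by (rule frechet_derivative_at[symmetric])
qed

lemma app_pd: "app (pd v f) z = frechet_derivative (app f) (at z) v"
proof -
  have "{z. frechet_derivative (app f) (at z) v \<noteq> 0} \<subseteq> closure {z. app f z \<noteq> 0}"
    using frechet_derivative_outside_support[of _ "app f"] by (smt (verit) mem_Collect_eq subsetI)
  then have "bounded {z. frechet_derivative (app f) (at z) v \<noteq> 0}"
    using compact_supp compact_imp_bounded bounded_subset by blast
  then show ?thesis unfolding pd_def
    by (subst app_Abs_tf) (use C_k_on_frechet[OF smooth_app] in \<open>auto simp: smooth_on_def\<close>)
qed

lemma app_crd: "app (crd b f) z = (z \<bullet> b) * app f z"
  unfolding crd_def using bounded_supp[of f]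
  by (subst app_Abs_tf) (auto simp: smooth_on_def C_k_on_mult C_k_on_inner smooth_C_k elim: bounded_subset)

lemma app_tr: "app (tr a f) z = app f (z + a)"
proof -
  have "{z. app f (z + a) \<noteq> 0} \<subseteq> (\<lambda>z. z - a) ` {z. app f z \<noteq> 0}"
    by (metis (no_types, lifting) add_diff_cancel_right' image_eqI mem_Collect_eq subsetI)
  then have "bounded {z. app f (z + a) \<noteq> 0}"
    using bounded_subset[OF bounded_translation_minus[OF bounded_supp[of f], of a]] by blast
  then show ?thesis unfolding tr_def
    by (subst app_Abs_tf) (auto simp: smooth_on_def C_k_on_translate smooth_C_k)
qed

instantiation tf :: (euclidean_space) real_vector
begin

definition "0 = Abs_tf (\<lambda>z. 0)"
definition "f + g = Abs_tf (\<lambda>z. app f z + app g z)"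
definition "- f = Abs_tf (\<lambda>z. - app f z)" for f :: "'a tf"
definition "f - g = Abs_tf (\<lambda>z. app f z - app g z)" for f :: "'a tf"
definition "scaleR c f = Abs_tf (\<lambda>z. c * app f z)"

lemma app_zero: "app 0 z = 0"
  unfolding zero_tf_def by (subst app_Abs_tf) (auto simp: smooth_on_def C_k_on_const)

lemma app_add: "app (f + g) z = app f z + app g z"
proof -
  have "bounded {z. app f z + app g z \<noteq> 0}"
    by (rule bounded_subset[of "{z. app f z \<noteq> 0} \<union> {z. app g z \<noteq> 0}"]) (auto simp: bounded_supp)
  then show ?thesis
    unfolding plus_tf_def by (subst app_Abs_tf) (auto simp: smooth_on_def C_k_on_add smooth_C_k)
qed

lemma app_scaleR: "app (c *\<^sub>R f) z = c * app f z"
  unfolding scaleR_tf_def using bounded_supp[of f]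
  by (subst app_Abs_tf) (auto simp: smooth_on_def C_k_on_mult C_k_on_const smooth_C_k elim: bounded_subset)

lemma app_uminus: "app (- f) z = - app f z"
proof -
  have "- f = (-1) *\<^sub>R f" unfolding uminus_tf_def scaleR_tf_def by simp
  then show ?thesis by (simp add: app_scaleR)
qed

lemma app_minus: "app (f - g) z = app f z - app g z"
proof -
  have "f - g = f + (-1) *\<^sub>R g"
    unfolding minus_tf_def plus_tf_def by (simp add: app_scaleR)
  then show ?thesis by (simp add: app_scaleR app_add)
qed

instance
  by standard (rule tf_eqI; simp add: app_zero app_add app_scaleR app_uminus app_minus algebra_simps)+

end

lemmas app_simps = app_zero app_add app_scaleR app_uminus app_minus app_tr app_crd app_pd

section \<open>The L2 inner product\<close>

lemma integrable_compact_supp: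
  fixes h :: "'a::euclidean_space \<Rightarrow> real"
  assumes "continuous_on UNIV h" "bounded {z. h z \<noteq> 0}"
  shows "integrable lborel h"
proof -
  let ?K = "closure {z. h z \<noteq> 0}"
  have "integrable lborel (\<lambda>z. indicator ?K z *\<^sub>R h z)"
    using assms by (intro borel_integrable_compact) (auto simp: compact_closure intro: continuous_on_subset)
  moreover have "(\<lambda>z. indicator ?K z *\<^sub>R h z) = h"
    using closure_subset[of "{z. h z \<noteq> 0}"] by (auto simp: indicator_def fun_eq_iff)
  ultimately show ?thesis by simp
qed

lemma integrable_app_mult [simp, intro]: "integrable lborel (\<lambda>z. app f z * app g z)"
  using bounded_supp[of f]
  by (intro integrable_compact_supp continuous_intros continuous_app) (auto elim: bounded_subset)

text \<open>The zero set of a continuous function is closed, so if it has full measure it is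
  everything. Thus the L2 product is definite on functions and not merely on classes.\<close>

lemma integral_app_square_eq_0:
  assumes "(\<integral>z. app f z * app f z \<partial>lborel) = 0"
  shows "f = 0"
proof (rule tf_eqI)
  fix z
  have "AE x in lborel. app f x * app f x = 0"
    using assms by (subst integral_nonneg_eq_0_iff_AE[symmetric]) auto
  then have "AE x in lebesgue. x \<in> {x. app f x = 0}"
    by (auto dest: AE_completion)
  moreover have "closed {x. app f x = 0}"
    using continuous_app by (intro closed_Collect_eq continuous_intros)
  ultimately have "app f z = 0"
    using mem_closed_if_AE_lebesgue by blast
  then show "app f z = app 0 z" by (simp add: app_zero)
qed

instantiation tf :: (euclidean_space) real_inner
begin

definition inner_tf :: "'a tf \<Rightarrow> 'a tf \<Rightarrow> real" where
  "inner_tf f g = (\<integral>z. app f z * app g z \<partial>lborel)"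
definition norm_tf :: "'a tf \<Rightarrow> real" where "norm_tf f = sqrt (f \<bullet> f)"
definition dist_tf :: "'a tf \<Rightarrow> 'a tf \<Rightarrow> real" where "dist_tf f g = norm (f - g)"
definition sgn_tf :: "'a tf \<Rightarrow> 'a tf" where "sgn_tf f = f /\<^sub>R norm f"
definition uniformity_tf :: "('a tf \<times> 'a tf) filter" where
  "uniformity_tf = (INF e\<in>{0<..}. principal {(x, y). dist x y < e})"
definition open_tf :: "'a tf set \<Rightarrow> bool" where
  "open_tf U = (\<forall>x\<in>U. \<forall>\<^sub>F (x', y) in uniformity. x' = x \<longrightarrow> y \<in> U)"

instance
proof
  fix f g h :: "'a tf" and c :: real
  show "f \<bullet> g = g \<bullet> f" by (simp add: inner_tf_def mult.commute)
  show "(f + g) \<bullet> h = f \<bullet> h + g \<bullet> h"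
    unfolding inner_tf_def by (subst Bochner_Integration.integral_add[symmetric]) (auto simp: app_simps algebra_simps)
  show "(c *\<^sub>R f) \<bullet> g = c * (f \<bullet> g)"
    unfolding inner_tf_def by (subst Bochner_Integration.integral_mult_right_zero[symmetric]) (auto simp: app_simps algebra_simps)
  show "0 \<le> f \<bullet> f"
    unfolding inner_tf_def by (intro integral_nonneg_AE) auto
  show "(f \<bullet> f = 0) = (f = 0)"
    unfolding inner_tf_def using integral_app_square_eq_0 by (auto simp: app_zero)
qed (simp_all add: norm_tf_def dist_tf_def sgn_tf_def uniformity_tf_def open_tf_def)

end

section \<open>Derivatives, coordinates and translations as operators\<close>

lemma linear_pd: "linear (pd v)"
proof (rule linearI; rule tf_eqI)
  fix f g :: "'a tf" and c z
  have "app (f + g) = (\<lambda>z. app f z + app g z)" by (auto simp: app_simps)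
  then have "(app (f + g) has_derivative (\<lambda>v. frechet_derivative (app f) (at z) v + frechet_derivative (app g) (at z) v)) (at z)"
    using has_derivative_add[OF app_has_derivative app_has_derivative] by auto
  then show "app (pd v (f + g)) z = app (pd v f + pd v g) z"
    by (simp add: app_simps frechet_derivative_eq)
  have "app (c *\<^sub>R f) = (\<lambda>z. c * app f z)" by (auto simp: app_simps)
  then have "(app (c *\<^sub>R f) has_derivative (\<lambda>v. c * frechet_derivative (app f) (at z) v)) (at z)"
    using has_derivative_mult_right[OF app_has_derivative] by auto
  then show "app (pd v (c *\<^sub>R f)) z = app (c *\<^sub>R pd v f) z"
    by (simp add: app_simps frechet_derivative_eq)
qed

lemma linear_crd: "linear (crd b)"
  by (rule linearI; rule tf_eqI) (auto simp: app_simps algebra_simps)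

lemma linear_tr: "linear (tr a)"
  by (rule linearI; rule tf_eqI) (auto simp: app_simps algebra_simps)

lemma pd_add_vec: "pd (v + w) f = pd v f + pd w f"
  by (rule tf_eqI) (simp add: app_simps linear_add[OF has_derivative_linear[OF app_has_derivative]])

lemma pd_scale_vec: "pd (c *\<^sub>R v) f = c *\<^sub>R pd v f"
  by (rule tf_eqI) (simp add: app_simps linear_scale[OF has_derivative_linear[OF app_has_derivative]])

lemma crd_commute: "crd a (crd b f) = crd b (crd a f)"
  by (rule tf_eqI) (simp add: app_simps)

lemma pd_crd: "pd v (crd b f) = crd b (pd v f) + (v \<bullet> b) *\<^sub>R f"
proof (rule tf_eqI)
  fix z
  have "((\<lambda>z. z \<bullet> b) has_derivative (\<lambda>v. v \<bullet> b)) (at z)"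
    by (auto intro!: derivative_eq_intros)
  moreover have "app (crd b f) = (\<lambda>z. (z \<bullet> b) * app f z)" by (auto simp: app_simps)
  ultimately have "(app (crd b f) has_derivative
     (\<lambda>v. (z \<bullet> b) * frechet_derivative (app f) (at z) v + (v \<bullet> b) * app f z)) (at z)"
    using has_derivative_mult[OF _ app_has_derivative] by auto
  then show "app (pd v (crd b f)) z = app (crd b (pd v f) + (v \<bullet> b) *\<^sub>R f) z"
    by (simp add: app_simps frechet_derivative_eq)
qed

lemma pd_tr: "pd v (tr a f) = tr a (pd v f)"
proof (rule tf_eqI)
  fix z
  have "app (tr a f) = (\<lambda>z. app f (z + a))" by (auto simp: app_simps)
  then have "(app (tr a f) has_derivative frechet_derivative (app f) (at (z + a))) (at z)"
    using has_derivative_translate[OF smooth_on_differentiable[OF smooth_app]] by simp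
  then show "app (pd v (tr a f)) z = app (tr a (pd v f)) z"
    by (simp add: app_simps frechet_derivative_eq)
qed

lemma tr_crd: "tr a (crd b f) = crd b (tr a f) + (a \<bullet> b) *\<^sub>R tr a f"
  by (rule tf_eqI) (simp add: app_simps algebra_simps)

lemma tr_tr: "tr a (tr b f) = tr (a + b) f"
  by (rule tf_eqI) (simp add: app_simps algebra_simps)

lemma tr_0: "tr 0 f = f"
  by (rule tf_eqI) (simp add: app_simps)

lemma inner_crd: "crd b f \<bullet> g = f \<bullet> crd b g"
  by (simp add: inner_tf_def app_simps algebra_simps)

lemma lborel_integral_translate:
  fixes g :: "'a::euclidean_space \<Rightarrow> real"
  assumes [measurable]: "g \<in> borel_measurable borel"
  shows "(\<integral>z. g (z + a) \<partial>lborel) = (\<integral>z. g z \<partial>lborel)"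
proof -
  have "(\<integral>z. g z \<partial>lborel) = (\<integral>z. g z \<partial>distr lborel borel ((+) a))"
    by (simp add: lborel_distr_plus)
  also have "\<dots> = (\<integral>z. g (a + z) \<partial>lborel)"
    by (rule integral_distr) measurable
  finally show ?thesis by (simp add: add.commute)
qed

lemma inner_tr_tr: "tr a f \<bullet> tr a g = f \<bullet> g"
  unfolding inner_tf_def app_simps
  by (rule lborel_integral_translate[of "\<lambda>z. app f z * app g z"]) measurable

lemma inner_tr: "tr a f \<bullet> g = f \<bullet> tr (- a) g"
  using inner_tr_tr[of a f "tr (- a) g"] by (simp add: tr_tr tr_0)

lemma norm_tr: "norm (tr a f) = norm f"
  by (simp add: norm_eq_sqrt_inner inner_tr_tr)

lemma app_bounded: obtains M where "M \<ge> 0" "\<And>z. \<bar>app f z\<bar> \<le> M"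
proof -
  have "compact (app f ` closure {z. app f z \<noteq> 0})"
    by (intro compact_continuous_image continuous_app compact_supp)
  then obtain M where M: "\<And>y. y \<in> app f ` closure {z. app f z \<noteq> 0} \<Longrightarrow> norm y \<le> M"
    using compact_imp_bounded bounded_iff by metis
  have "\<bar>app f z\<bar> \<le> max M 0" for z
  proof (cases "app f z = 0")
    case False
    then have "z \<in> closure {z. app f z \<noteq> 0}"
      using closure_subset[of "{z. app f z \<noteq> 0}"] by auto
    then show ?thesis using M[of "app f z"] by auto
  qed auto
  then show ?thesis using that[of "max M 0"] by auto
qed

lemma app_support_radius: obtains R where "R > 0" "\<And>z. app f z \<noteq> 0 \<Longrightarrow> norm z \<le> R"
  using bounded_supp[of f] unfolding bounded_pos by auto

text \<open>Difference quotients converge uniformly with supports in one ball; this bound turns that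
  into convergence in norm.\<close>

lemma inner_self_le:
  fixes g :: "'a::euclidean_space tf"
  assumes c: "\<And>z. \<bar>app g z\<bar> \<le> c" and R: "\<And>z. app g z \<noteq> 0 \<Longrightarrow> norm z \<le> R"
  shows "g \<bullet> g \<le> c\<^sup>2 * measure lborel (cball (0::'a) R)"
proof -
  have "c \<ge> 0" using c[of 0] by auto
  have "g \<bullet> g \<le> (\<integral>z. c\<^sup>2 * indicator (cball (0::'a) R) z \<partial>lborel)"
    unfolding inner_tf_def
  proof (rule Bochner_Integration.integral_mono)
    show "integrable lborel (\<lambda>z. c\<^sup>2 * indicat_real (cball (0::'a) R) z)"
      by (intro integrable_mult_right integrable_real_indicator) (auto intro!: emeasure_bounded_finite[unfolded infinity_ennreal_def])
    show "app g z * app g z \<le> c\<^sup>2 * indicat_real (cball 0 R) z" for z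
    proof (cases "app g z = 0")
      case False
      have "app g z * app g z \<le> c\<^sup>2"
        using c[of z] \<open>c \<ge> 0\<close> by (metis abs_mult_self_eq abs_ge_zero mult_mono power2_eq_square)
      then show ?thesis using R[OF False] by simp
    qed auto
  qed auto
  then show ?thesis by simp
qed

lemma app_line_has_derivative:
  "((\<lambda>s. app f (z + s *\<^sub>R v)) has_real_derivative app (pd v f) (z + s *\<^sub>R v)) (at s within S)"
proof -
  have "((\<lambda>s. z + s *\<^sub>R v) has_derivative (\<lambda>h. h *\<^sub>R v)) (at s)"
    by (auto intro!: derivative_eq_intros)
  from has_derivative_compose[OF this app_has_derivative]
  have "((\<lambda>s. app f (z + s *\<^sub>R v)) has_derivative
      (\<lambda>h. frechet_derivative (app f) (at (z + s *\<^sub>R v)) (h *\<^sub>R v))) (at s)" .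
  moreover have "(\<lambda>h. frechet_derivative (app f) (at (z + s *\<^sub>R v)) (h *\<^sub>R v)) = (*) (app (pd v f) (z + s *\<^sub>R v))"
    by (auto simp: app_pd linear_scale[OF has_derivative_linear[OF app_has_derivative]])
  ultimately show ?thesis
    by (simp add: has_field_derivative_def has_derivative_at_withinI)
qed

lemma app_line_lipschitz:
  assumes "\<And>z. \<bar>app (pd v f) z\<bar> \<le> M"
  shows "\<bar>app f (z + s *\<^sub>R v) - app f z\<bar> \<le> M * \<bar>s\<bar>"
  using field_differentiable_bound[of UNIV "\<lambda>s. app f (z + s *\<^sub>R v)" "\<lambda>s. app (pd v f) (z + s *\<^sub>R v)" M s 0,
    OF convex_UNIV app_line_has_derivative] assms by auto

text \<open>The error is the first-order Taylor remainder divided by \<open>s\<close>. The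
  derivative of the remainder along the line is O(s) by the mean value theorem, so the remainder is
  O(s^2); for |s| at most 1 all supports lie in one ball.\<close>

lemma difference_quotient_bound:
  obtains K where "\<And>s. s \<noteq> 0 \<Longrightarrow> \<bar>s\<bar> \<le> 1 \<Longrightarrow>
    norm ((1 / s) *\<^sub>R (tr (s *\<^sub>R v) f - f) - pd v f) \<le> K * \<bar>s\<bar>"
proof -
  obtain M where M: "M \<ge> 0" "\<And>z. \<bar>app (pd v (pd v f)) z\<bar> \<le> M"
    using app_bounded[of "pd v (pd v f)"] by metis
  obtain R where R: "R > 0" "\<And>z. app f z \<noteq> 0 \<Longrightarrow> norm z \<le> R"
    using app_support_radius[of f] by metis
  obtain R' where R': "R' > 0" "\<And>z. app (pd v f) z \<noteq> 0 \<Longrightarrow> norm z \<le> R'"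
    using app_support_radius[of "pd v f"] by metis
  define Q where "Q = R + R' + norm v"
  define V where "V = measure lborel (cball (0::'a) Q)"
  have "norm ((1 / s) *\<^sub>R (tr (s *\<^sub>R v) f - f) - pd v f) \<le> (M * sqrt V) * \<bar>s\<bar>"
    if s: "s \<noteq> 0" "\<bar>s\<bar> \<le> 1" for s
  proof -
    let ?g = "(1 / s) *\<^sub>R (tr (s *\<^sub>R v) f - f) - pd v f"
    have "\<bar>app ?g z\<bar> \<le> M * \<bar>s\<bar>" for z
    proof -
      define \<psi> where "\<psi> = (\<lambda>r. app f (z + r *\<^sub>R v) - app f z - r * app (pd v f) z)"
      have "norm (\<psi> s - \<psi> 0) \<le> (M * \<bar>s\<bar>) * norm (s - 0)"
      proof (rule field_differentiable_bound[of "cball 0 \<bar>s\<bar>"])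
        fix r :: real assume r: "r \<in> cball 0 \<bar>s\<bar>"
        show "(\<psi> has_field_derivative app (pd v f) (z + r *\<^sub>R v) - app (pd v f) z) (at r within cball 0 \<bar>s\<bar>)"
          unfolding \<psi>_def by (auto intro!: derivative_eq_intros app_line_has_derivative)
        show "norm (app (pd v f) (z + r *\<^sub>R v) - app (pd v f) z) \<le> M * \<bar>s\<bar>"
          using app_line_lipschitz[OF M(2), of z r] r M(1)
          by (smt (verit) mem_cball_0 mult_left_mono real_norm_def)
      qed auto
      then have "\<bar>\<psi> s\<bar> \<le> M * \<bar>s\<bar> * \<bar>s\<bar>" by (simp add: \<psi>_def)
      moreover have "app ?g z = \<psi> s / s"
        using s by (simp add: \<psi>_def app_simps field_simps)
      moreover have "\<bar>\<psi> s / s\<bar> = \<bar>\<psi> s\<bar> / \<bar>s\<bar>" by (rule abs_divide)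
      ultimately show ?thesis using s by (simp add: divide_le_eq)
    qed
    moreover have "norm z \<le> Q" if "app ?g z \<noteq> 0" for z
    proof -
      have "app f (z + s *\<^sub>R v) \<noteq> 0 \<or> app f z \<noteq> 0 \<or> app (pd v f) z \<noteq> 0"
        using that by (auto simp: app_add app_minus app_scaleR app_tr)
      moreover have "norm z \<le> norm (z + s *\<^sub>R v) + norm v"
      proof -
        have "norm (s *\<^sub>R v) \<le> norm v" using s by (simp add: mult_left_le_one_le)
        then show ?thesis using norm_triangle_ineq4[of "z + s *\<^sub>R v" "s *\<^sub>R v"] by simp
      qed
      ultimately show ?thesis
        using R R' norm_ge_zero[of v] unfolding Q_def by (smt (verit))
    qed
    ultimately have "?g \<bullet> ?g \<le> (M * \<bar>s\<bar>)\<^sup>2 * V"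
      unfolding V_def by (rule inner_self_le)
    then have "norm ?g \<le> sqrt ((M * \<bar>s\<bar>)\<^sup>2 * V)"
      by (simp add: norm_eq_sqrt_inner)
    also have "\<dots> = (M * sqrt V) * \<bar>s\<bar>" using M by (simp add: real_sqrt_mult)
    finally show ?thesis .
  qed
  then show ?thesis using that by blast
qed

lemma difference_quotient_tendsto:
  "((\<lambda>s. (1 / s) *\<^sub>R (tr (s *\<^sub>R v) f - f)) \<longlongrightarrow> pd v f) (at 0)"
proof -
  obtain K where K: "\<And>s. s \<noteq> 0 \<Longrightarrow> \<bar>s\<bar> \<le> 1 \<Longrightarrow>
    norm ((1 / s) *\<^sub>R (tr (s *\<^sub>R v) f - f) - pd v f) \<le> K * \<bar>s\<bar>"
    using difference_quotient_bound[of v f] by metis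
  have "\<forall>\<^sub>F s in at 0. norm ((1 / s) *\<^sub>R (tr (s *\<^sub>R v) f - f) - pd v f) \<le> K * \<bar>s\<bar>"
    unfolding eventually_at by (rule exI[of _ 1]) (auto intro: K)
  moreover have "((\<lambda>s::real. K * \<bar>s\<bar>) \<longlongrightarrow> K * \<bar>0\<bar>) (at 0)" by (intro tendsto_intros)
  ultimately have "((\<lambda>s. (1 / s) *\<^sub>R (tr (s *\<^sub>R v) f - f) - pd v f) \<longlongrightarrow> 0) (at 0)"
    by (auto elim: Lim_null_comparison)
  then show ?thesis by (simp add: LIM_zero_iff)
qed

text \<open>Translations are isometries, so the adjoint of a difference quotient is minus the
  quotient with step \<open>- s\<close>. Integration by parts is the limit of this identity.\<close>

lemma inner_pd: "pd v f \<bullet> g = - (f \<bullet> pd v g)"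
proof -
  have 1: "((\<lambda>s. ((1 / s) *\<^sub>R (tr (s *\<^sub>R v) f - f)) \<bullet> g) \<longlongrightarrow> pd v f \<bullet> g) (at 0)"
    by (intro tendsto_intros difference_quotient_tendsto)
  have 2: "((\<lambda>s. f \<bullet> (- ((1 / (- s)) *\<^sub>R (tr ((- s) *\<^sub>R v) g - g)))) \<longlongrightarrow> f \<bullet> (- pd v g)) (at 0)"
  proof (intro tendsto_intros)
    have "filterlim (\<lambda>s::real. - s) (at 0) (at 0)"
      by (auto simp: filterlim_at intro!: tendsto_eq_intros eventually_neq_at_within)
    from filterlim_compose[OF difference_quotient_tendsto this]
    show "((\<lambda>s. (1 / - s) *\<^sub>R (tr (- s *\<^sub>R v) g - g)) \<longlongrightarrow> pd v g) (at 0)" .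
  qed
  have 3: "((1 / s) *\<^sub>R (tr (s *\<^sub>R v) f - f)) \<bullet> g = f \<bullet> (- ((1 / (- s)) *\<^sub>R (tr ((- s) *\<^sub>R v) g - g)))" for s
    by (simp add: inner_diff_left inner_diff_right inner_tr algebra_simps diff_divide_distrib)
  from tendsto_unique[OF _ 1[unfolded 3] 2] show ?thesis by simp
qed

text \<open>Equality of mixed derivatives: both sides have the same inner products with all test
  functions, since translations commute with derivatives.\<close>

lemma pd_commute: "pd v (pd w f) = pd w (pd v f)"
proof -
  have "pd v (pd w f) \<bullet> g = pd w (pd v f) \<bullet> g" for g
  proof -
    have 1: "((\<lambda>s. ((1 / s) *\<^sub>R (tr (s *\<^sub>R v) (pd w f) - pd w f)) \<bullet> g) \<longlongrightarrow> pd v (pd w f) \<bullet> g) (at 0)"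
      by (intro tendsto_intros difference_quotient_tendsto)
    have 2: "((\<lambda>s. - (((1 / s) *\<^sub>R (tr (s *\<^sub>R v) f - f)) \<bullet> pd w g)) \<longlongrightarrow> - (pd v f \<bullet> pd w g)) (at 0)"
      by (intro tendsto_intros difference_quotient_tendsto)
    have 3: "((1 / s) *\<^sub>R (tr (s *\<^sub>R v) (pd w f) - pd w f)) \<bullet> g
       = - (((1 / s) *\<^sub>R (tr (s *\<^sub>R v) f - f)) \<bullet> pd w g)" for s
    proof -
      have "(1 / s) *\<^sub>R (tr (s *\<^sub>R v) (pd w f) - pd w f) = pd w ((1 / s) *\<^sub>R (tr (s *\<^sub>R v) f - f))"
        by (simp add: pd_tr linear_diff[OF linear_pd] linear_scale[OF linear_pd])
      then show ?thesis by (simp only: inner_pd)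
    qed
    from tendsto_unique[OF _ 1[unfolded 3] 2] have "pd v (pd w f) \<bullet> g = - (pd v f \<bullet> pd w g)"
      by simp
    then show ?thesis by (simp only: inner_pd)
  qed
  then have "(pd v (pd w f) - pd w (pd v f)) \<bullet> (pd v (pd w f) - pd w (pd v f)) = 0"
    by (simp add: inner_diff_left)
  then show ?thesis by simp
qed

text \<open>A translation by \<open>v\<close> consists of \<open>n\<close> translations by
  \<open>v / n\<close>, and each contributes equally since translations are isometries. The factor
  \<open>n\<close> turns the small difference into a difference quotient, which tends to
  \<open>pd v f\<close>.\<close>

lemma norm_tr_diff_le: "norm (tr v f - f) \<le> norm (pd v f)"
proof -
  have step: "norm (tr (real n *\<^sub>R w) f - f) \<le> real n * norm (tr w f - f)" for n w
  proof (induction n)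
    case (Suc n)
    have "tr (real (Suc n) *\<^sub>R w) f - f = tr w (tr (real n *\<^sub>R w) f - f) + (tr w f - f)"
      by (simp add: linear_diff[OF linear_tr] tr_tr algebra_simps)
    also have "norm \<dots> \<le> norm (tr (real n *\<^sub>R w) f - f) + norm (tr w f - f)"
      by (rule norm_triangle_le) (simp add: norm_tr)
    finally show ?case using Suc by (simp add: algebra_simps)
  qed (simp add: tr_0)
  have "norm (tr v f - f) \<le> norm ((1 / (1 / real (Suc n))) *\<^sub>R (tr ((1 / real (Suc n)) *\<^sub>R v) f - f))" for n
    using step[of "Suc n" "(1 / real (Suc n)) *\<^sub>R v"] by simp
  moreover have "filterlim (\<lambda>n. 1 / real (Suc n)) (at 0) sequentially"
    using LIMSEQ_Suc[OF lim_1_over_n] by (auto simp: filterlim_at intro!: eventuallyI)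
  then have "(\<lambda>n. norm ((1 / (1 / real (Suc n))) *\<^sub>R (tr ((1 / real (Suc n)) *\<^sub>R v) f - f))) \<longlonglongrightarrow> norm (pd v f)"
    by (intro tendsto_norm filterlim_compose[OF difference_quotient_tendsto])
  ultimately show ?thesis
    by (intro LIMSEQ_le_const) auto
qed

text \<open>Moving the translation by \<open>r\<close> to the other factor reduces the derivative at
  \<open>r\<close> to the difference quotient at 0.\<close>

lemma tr_inner_has_derivative:
  "((\<lambda>r. f \<bullet> tr (r *\<^sub>R e) g) has_real_derivative f \<bullet> tr (r *\<^sub>R e) (pd e g)) (at r within S)"
proof -
  have "((\<lambda>s. tr (- (r *\<^sub>R e)) f \<bullet> ((1 / s) *\<^sub>R (tr (s *\<^sub>R e) g - g))) \<longlongrightarrow> tr (- (r *\<^sub>R e)) f \<bullet> pd e g) (at 0)"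
    by (intro tendsto_intros difference_quotient_tendsto)
  moreover have "tr (- (r *\<^sub>R e)) f \<bullet> ((1 / s) *\<^sub>R (tr (s *\<^sub>R e) g - g))
      = (f \<bullet> tr ((r + s) *\<^sub>R e) g - f \<bullet> tr (r *\<^sub>R e) g) / s" for s
    by (simp add: inner_tr inner_diff_right diff_divide_distrib tr_tr algebra_simps)
  moreover have "tr (- (r *\<^sub>R e)) f \<bullet> pd e g = f \<bullet> tr (r *\<^sub>R e) (pd e g)"
    by (simp add: inner_tr)
  ultimately have "((\<lambda>r. f \<bullet> tr (r *\<^sub>R e) g) has_real_derivative f \<bullet> tr (r *\<^sub>R e) (pd e g)) (at r)"
    unfolding DERIV_def by (simp only:)
  then show ?thesis by (rule has_field_derivative_at_within)
qed

lemma tr_inner_continuous: "continuous_on S (\<lambda>r. f \<bullet> tr (r *\<^sub>R e) g)"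
  using tr_inner_has_derivative by (intro DERIV_continuous_on)

text \<open>For large shifts the supports are disjoint. The functions of \<open>r\<close> whose
  transforms are taken later therefore have compact support.\<close>

lemma tr_inner_support:
  assumes "norm e = 1"
  obtains R where "R > 0" "\<And>r. \<bar>r\<bar> > R \<Longrightarrow> f \<bullet> tr (r *\<^sub>R e) g = 0"
proof -
  obtain R where R: "R > 0" "\<And>z. app f z \<noteq> 0 \<Longrightarrow> norm z \<le> R"
    using app_support_radius[of f] by metis
  obtain R' where R': "R' > 0" "\<And>z. app g z \<noteq> 0 \<Longrightarrow> norm z \<le> R'"
    using app_support_radius[of g] by metis
  have "f \<bullet> tr (r *\<^sub>R e) g = 0" if "\<bar>r\<bar> > R + R'" for r
  proof -
    have "app f z * app (tr (r *\<^sub>R e) g) z = 0" for z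
    proof (rule ccontr)
      assume "\<not> ?thesis"
      then have "norm z \<le> R" "norm (z + r *\<^sub>R e) \<le> R'" using R R' by (auto simp: app_tr)
      then have "norm (r *\<^sub>R e) \<le> R + R'" using norm_triangle_ineq4[of "z + r *\<^sub>R e" z] by simp
      then show False using that assms by simp
    qed
    then show ?thesis unfolding inner_tf_def by (simp only: Bochner_Integration.integral_zero)
  qed
  then show ?thesis using that[of "R + R'"] R R' by auto
qed

section \<open>The left-invariant fields on test functions\<close>

type_synonym 'n htf = "('n heis) tf"

abbreviation ex :: "'n::finite \<Rightarrow> 'n heis" where "ex p \<equiv> (axis p 1, 0, 0)"
abbreviation ey :: "'n::finite \<Rightarrow> 'n heis" where "ey p \<equiv> (0, axis p 1, 0)"
abbreviation et :: "'n::finite heis" where "et \<equiv> (0, 0, 1)"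

definition T :: "'n::finite htf \<Rightarrow> 'n htf" where "T = pd et"

text \<open>\<open>Inl p\<close> stands for X_p and \<open>Inr p\<close> for Y_p, so that words and
  sums over all fields have a single index.\<close>

definition Z :: "'n::finite + 'n \<Rightarrow> 'n htf \<Rightarrow> 'n htf" where
  "Z i f = (case i of
     Inl p \<Rightarrow> pd (ex p) f + (1/2) *\<^sub>R crd (ey p) (T f)
   | Inr p \<Rightarrow> pd (ey p) f - (1/2) *\<^sub>R crd (ex p) (T f))"

text \<open>The one field with which \<open>Z i\<close> does not commute; \<open>sg i\<close> is the
  sign in [Z i, Z (sw i)] = sg i T.\<close>

definition sw :: "'n + 'n \<Rightarrow> 'n + 'n" where "sw i = (case i of Inl p \<Rightarrow> Inr p | Inr p \<Rightarrow> Inl p)"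
definition sg :: "'n + 'n \<Rightarrow> real" where "sg i = (case i of Inl p \<Rightarrow> -1 | Inr p \<Rightarrow> 1)"

lemma app_Z_Inl: "app (Z (Inl p) f) = X_op p (app f)"
proof
  fix z :: "'a heis"
  obtain x y t where z: "z = (x, y, t)" by (cases z)
  have "X_vec p z = ex p + ((y $ p) / 2) *\<^sub>R et"
    by (simp add: X_vec_def z)
  then have "X_op p (app f) z = app (pd (ex p + ((y $ p) / 2) *\<^sub>R et) f) z"
    by (simp add: X_op_def app_pd)
  also have "\<dots> = app (Z (Inl p) f) z"
    by (simp only: pd_add_vec pd_scale_vec Z_def T_def app_simps sum.case) (simp add: z inner_axis)
  finally show "app (Z (Inl p) f) z = X_op p (app f) z" ..
qed

lemma app_Z_Inr: "app (Z (Inr p) f) = Y_op p (app f)"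
proof
  fix z :: "'a heis"
  obtain x y t where z: "z = (x, y, t)" by (cases z)
  have "Y_vec p z = ey p + (- (x $ p) / 2) *\<^sub>R et"
    by (simp add: Y_vec_def z)
  then have "Y_op p (app f) z = app (pd (ey p + (- (x $ p) / 2) *\<^sub>R et) f) z"
    by (simp add: Y_op_def app_pd)
  also have "\<dots> = app (Z (Inr p) f) z"
    by (simp only: pd_add_vec pd_scale_vec Z_def T_def app_simps sum.case) (simp add: z inner_axis)
  finally show "app (Z (Inr p) f) z = Y_op p (app f) z" ..
qed

lemma linear_T: "linear T"
  unfolding T_def by (rule linear_pd)

lemma linear_Z: "linear (Z i)"
proof (cases i)
  case (Inl p)
  show ?thesis unfolding Inl Z_def sum.case
    by (intro linear_compose_add linear_compose_scale_right linear_compose[OF linear_T linear_crd, unfolded o_def] linear_pd)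
next
  case (Inr p)
  show ?thesis unfolding Inr Z_def sum.case
    by (intro linear_compose_sub linear_compose_scale_right linear_compose[OF linear_T linear_crd, unfolded o_def] linear_pd)
qed

lemmas pd_lin = linear_add[OF linear_pd] linear_diff[OF linear_pd] linear_scale[OF linear_pd]
lemmas crd_lin = linear_add[OF linear_crd] linear_diff[OF linear_crd] linear_scale[OF linear_crd]
lemmas tr_lin = linear_add[OF linear_tr] linear_diff[OF linear_tr] linear_scale[OF linear_tr]

lemma T_Z: "T (Z i f) = Z i (T f)"
  by (cases i) (auto simp: Z_def T_def pd_lin pd_crd pd_commute inner_prod_def)

lemma T_crd_ex: "T (crd (ex p) f) = crd (ex p) (T f)"
  by (simp add: T_def pd_crd inner_prod_def)

lemma T_tr: "T (tr a f) = tr a (T f)"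
  by (simp add: T_def pd_tr)

lemma Z_tr: "Z i (tr (r *\<^sub>R et) f) = tr (r *\<^sub>R et) (Z i f)"
  by (cases i) (auto simp: Z_def T_tr tr_lin tr_crd pd_tr inner_prod_def)

lemma inner_T: "T f \<bullet> g = - (f \<bullet> T g)"
  by (simp add: T_def inner_pd)

lemma inner_Z: "Z i f \<bullet> g = - (f \<bullet> Z i g)"
proof -
  have 1: "T (crd (ey p) f) = crd (ey p) (T f)" for p and f :: "'a htf"
    by (simp add: T_def pd_crd inner_prod_def)
  have "crd a (T f) \<bullet> g = - (f \<bullet> T (crd a g))" for a :: "'a heis"
    by (simp add: inner_crd inner_T)
  then show ?thesis
    by (cases i) (simp_all add: Z_def inner_add_left inner_diff_left inner_add_right inner_diff_right inner_pd 1 T_crd_ex)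
qed

lemma Z_crd_ex: "Z i (crd (ex p) f) = crd (ex p) (Z i f) + (if i = Inl p then 1 else 0) *\<^sub>R f"
  by (cases i) (auto simp: Z_def T_crd_ex pd_crd crd_lin inner_prod_def inner_axis_axis crd_commute algebra_simps)

text \<open>A single computation for operators of the shape \<open>pd v + c crd b T\<close> covers
  all pairs of fields: only the derivatives of the coefficients survive, and orthogonality to
  \<open>et\<close> makes these coefficients independent of the central variable.\<close>

lemma commutator_general:
  fixes f :: "'n::finite htf"
  assumes "et \<bullet> a = 0" "et \<bullet> b = 0"
  shows "pd v (pd w f + d *\<^sub>R crd a (pd et f)) + c *\<^sub>R crd b (pd et (pd w f + d *\<^sub>R crd a (pd et f)))
    = pd w (pd v f + c *\<^sub>R crd b (pd et f)) + d *\<^sub>R crd a (pd et (pd v f + c *\<^sub>R crd b (pd et f)))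
      + (d * (v \<bullet> a) - c * (w \<bullet> b)) *\<^sub>R pd et f"
  by (simp add: pd_lin crd_lin pd_crd assms pd_commute crd_commute
      scaleR_left_diff_distrib scaleR_right_distrib)

lemma Z_commute: "Z i (Z j f) = Z j (Z i f) + (if j = sw i then sg i else 0) *\<^sub>R T f"
proof -
  \<comment> \<open>Every field is the derivative along \<open>dir i\<close> plus \<open>c i\<close>
    times the coordinate along \<open>cod i\<close> times T.\<close>
  define dir where "dir i = (case i of Inl p \<Rightarrow> ex p | Inr p \<Rightarrow> ey p)" for i :: "'a + 'a"
  define cod where "cod i = (case i of Inl p \<Rightarrow> ey p | Inr p \<Rightarrow> ex p)" for i :: "'a + 'a"
  define c :: "'a + 'a \<Rightarrow> real" where "c i = (case i of Inl p \<Rightarrow> 1/2 | Inr p \<Rightarrow> -1/2)" for i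
  have Z: "Z i f = pd (dir i) f + c i *\<^sub>R crd (cod i) (pd et f)" for i and f :: "'a htf"
    by (cases i) (simp_all add: Z_def T_def dir_def cod_def c_def)
  have o: "et \<bullet> cod i = 0" for i by (cases i) (simp_all add: cod_def inner_prod_def)
  have "c j * (dir i \<bullet> cod j) - c i * (dir j \<bullet> cod i) = (if j = sw i then sg i else 0)"
    by (cases i; cases j) (auto simp: c_def dir_def cod_def sw_def sg_def inner_prod_def inner_axis_axis)
  then show ?thesis
    unfolding Z T_def using commutator_general[OF o[of j] o[of i], of "dir i" "dir j" f "c j" "c i"] by simp
qed

section \<open>Estimates in a fixed frequency of the central variable\<close>

lemmas Z_lin = linear_add[OF linear_Z] linear_diff[OF linear_Z] linear_scale[OF linear_Z] linear_sum[OF linear_Z] linear_0[OF linear_Z]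
lemmas T_lin = linear_add[OF linear_T] linear_diff[OF linear_T] linear_scale[OF linear_T] linear_sum[OF linear_T] linear_0[OF linear_T]

lemma sw_sw [simp]: "sw (sw i) = i" by (cases i) (auto simp: sw_def)
lemma sw_neq [simp]: "sw i \<noteq> i" by (cases i) (auto simp: sw_def)
lemma sg_sw [simp]: "sg (sw i) = - sg i" by (cases i) (auto simp: sw_def sg_def)
lemma sg_sq [simp]: "sg i * sg i = 1" by (cases i) (auto simp: sg_def)
lemma bij_sw: "bij sw" by (rule o_bij[of sw]) auto

lemma sum_sw: "(\<Sum>i\<in>UNIV. h (sw i)) = (\<Sum>i\<in>UNIV. h i)" for h :: "'n::finite + 'n \<Rightarrow> 'b::comm_monoid_add"
  using sum.reindex_bij_betw[OF bij_sw] .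

text \<open>Minus the Kohn Laplacian; \<open>poly_kohn_app\<close> identifies its powers with the
  operator of the eigenvalue problem.\<close>

definition A :: "'n::finite htf \<Rightarrow> 'n htf" where
  "A f = - (\<Sum>i\<in>UNIV. Z i (Z i f))"

lemma linear_A: "linear A"
  by (rule linearI) (simp_all add: A_def Z_lin sum.distrib scaleR_sum_right)

lemmas A_lin = linear_add[OF linear_A] linear_diff[OF linear_A] linear_scale[OF linear_A] linear_sum[OF linear_A]

lemma T_A: "T (A f) = A (T f)"
  by (simp add: A_def T_lin linear_neg[OF linear_T] T_Z)

lemma T_A_pow: "T ((A ^^ m) f) = (A ^^ m) (T f)"
  by (induction m) (simp_all add: T_A)

text \<open>Among the squares in \<open>A\<close> only that of the partner \<open>Z (sw i)\<close>
  fails to commute with \<open>Z i\<close>, and it is passed twice, whence the factor 2.\<close>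

lemma A_Z: "A (Z i f) = Z i (A f) + (2 * sg i) *\<^sub>R Z (sw i) (T f)"
proof -
  have "Z j (Z j (Z i f)) = Z i (Z j (Z j f)) - (if j = sw i then 2 * sg i else 0) *\<^sub>R Z (sw i) (T f)" for j
  proof -
    have 1: "Z j (Z i f) = Z i (Z j f) - (if j = sw i then sg i else 0) *\<^sub>R T f" for f
      using Z_commute[of i j f] by simp
    show ?thesis
      by (subst 1, subst Z_lin(2), subst 1) (auto simp: Z_lin T_Z scaleR_add_left[symmetric] algebra_simps)
  qed
  then show ?thesis
    by (simp add: A_def sum_subtractf Z_lin linear_neg[OF linear_Z] scaleR_left.sum[symmetric] sum.delta)
qed

section \<open>Semidefinite bilinear forms\<close>

definition sform :: "('v::real_vector \<Rightarrow> 'v \<Rightarrow> real) \<Rightarrow> bool" where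
  "sform B \<longleftrightarrow> (\<forall>f. linear (B f)) \<and> (\<forall>f g. B f g = B g f) \<and> (\<forall>f. 0 \<le> B f f)"

lemma sform_lin:
  assumes "sform B"
  shows "B f (g + h) = B f g + B f h" "B f (g - h) = B f g - B f h" "B f (c *\<^sub>R g) = c * B f g" "B f (- g) = - B f g"
    "B f (sum k S) = (\<Sum>x\<in>S. B f (k x))"
    "B (g + h) f = B g f + B h f" "B (g - h) f = B g f - B h f" "B (c *\<^sub>R g) f = c * B g f" "B (- g) f = - B g f"
    "B (sum k S) f = (\<Sum>x\<in>S. B (k x) f)"
proof -
  have l: "linear (B f)" for f using assms by (simp add: sform_def)
  have s: "B f g = B g f" for f g using assms by (auto simp: sform_def)
  show 1: "B f (g + h) = B f g + B f h" "B f (g - h) = B f g - B f h" "B f (c *\<^sub>R g) = c * B f g" "B f (- g) = - B f g"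
    "B f (sum k S) = (\<Sum>x\<in>S. B f (k x))"
    using linear_add[OF l] linear_diff[OF l] linear_scale[OF l] linear_neg[OF l] linear_sum[OF l] by auto
  show "B (g + h) f = B g f + B h f" "B (g - h) f = B g f - B h f" "B (c *\<^sub>R g) f = c * B g f" "B (- g) f = - B g f"
    "B (sum k S) f = (\<Sum>x\<in>S. B (k x) f)"
    using 1 s by simp_all
qed

lemma sform_nonneg: "sform B \<Longrightarrow> 0 \<le> B f f" by (simp add: sform_def)
lemma sform_sym: "sform B \<Longrightarrow> B f g = B g f" by (simp add: sform_def)

lemma sform_weighted:
  assumes B: "sform B" and c: "c > 0"
  shows "2 * \<bar>B f g\<bar> \<le> c * B f f + B g g / c"
proof -
  have "B (c *\<^sub>R f - s *\<^sub>R g) (c *\<^sub>R f - s *\<^sub>R g) = c * c * B f f - 2 * c * s * B f g + s * s * B g g" for s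
    by (simp add: sform_lin[OF B] sform_sym[OF B, of g f] algebra_simps)
  then have *: "0 \<le> c * c * B f f - 2 * c * s * B f g + s * s * B g g" for s
    using sform_nonneg[OF B, of "c *\<^sub>R f - s *\<^sub>R g"] by simp
  have "2 * c * \<bar>B f g\<bar> \<le> c * c * B f f + B g g"
    using *[of 1] *[of "-1"] by (auto simp: abs_if)
  then have "2 * c * \<bar>B f g\<bar> / c \<le> (c * c * B f f + B g g) / c"
    using c by (intro divide_right_mono) auto
  then show ?thesis using c by (simp add: add_divide_distrib)
qed

lemma sform_cauchy:
  assumes B: "sform B"
  shows "(B f g)\<^sup>2 \<le> B f f * B g g"
proof (cases "B f f = 0")
  case True
  have "B f g = 0"
  proof (rule ccontr)
    assume n: "B f g \<noteq> 0"
    \<comment> \<open>When \<open>B f f = 0\<close> the weighted inequality bounds 2 |B f g| c by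
      \<open>B g g\<close> for all positive c. This choice makes the left side 2 (B g g + 1), which
      is too large.\<close>
    define c where "c = (B g g + 1) / \<bar>B f g\<bar>"
    have "c > 0" using n sform_nonneg[OF B, of g] by (simp add: c_def add_nonneg_pos)
    with sform_weighted[OF B this, of f g] True have "2 * \<bar>B f g\<bar> * c \<le> B g g"
      by (simp add: field_simps)
    then show False using n sform_nonneg[OF B, of g] by (simp add: c_def)
  qed
  then show ?thesis using True by simp
next
  case False
  then have p: "B f f > 0" using sform_nonneg[OF B, of f] by simp
  define s where "s = B f g / B f f"
  have "0 \<le> B (g - s *\<^sub>R f) (g - s *\<^sub>R f)" by (rule sform_nonneg[OF B])
  also have "\<dots> = B g g - 2 * s * B f g + s * s * B f f"
    by (simp add: sform_lin[OF B] sform_sym[OF B, of g f] algebra_simps)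
  also have "\<dots> = B g g - (B f g)\<^sup>2 / B f f"
    using p by (simp add: s_def power2_eq_square)
  finally show ?thesis using p by (simp add: field_simps)
qed

lemma sform_cauchy_sqrt:
  assumes B: "sform B"
  shows "\<bar>B f g\<bar> \<le> sqrt (B f f) * sqrt (B g g)"
  using real_sqrt_le_mono[OF sform_cauchy[OF B, of f g]] by (simp add: real_sqrt_mult)

text \<open>Forms that behave like the \<open>L\<^sup>2\<close> product of functions on which \<open>T\<close> acts as \<open>i \<tau>\<close>. In \<open>formA\<close> the
  commutation rules with the single fields are given up for the bound \<open>\<bar>\<tau>\<bar> \<le> A\<close>, so that the notion
  is stable under passing from \<open>B\<close> to \<open>B (A f) g\<close>.\<close>

definition form :: "real \<Rightarrow> ('n::finite htf \<Rightarrow> 'n htf \<Rightarrow> real) \<Rightarrow> bool" where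
  "form \<tau> B \<longleftrightarrow> sform B \<and> (\<forall>i f g. B (Z i f) g = - B f (Z i g)) \<and>
     (\<forall>f g. B (T f) g = - B f (T g)) \<and> (\<forall>f g. B (T f) (T g) = \<tau>\<^sup>2 * B f g)"

definition formA :: "real \<Rightarrow> ('n::finite htf \<Rightarrow> 'n htf \<Rightarrow> real) \<Rightarrow> bool" where
  "formA \<tau> B \<longleftrightarrow> sform B \<and> (\<forall>f g. B (A f) g = B f (A g)) \<and>
     (\<forall>f g. B (T f) g = - B f (T g)) \<and> (\<forall>f g. B (T f) (T g) = \<tau>\<^sup>2 * B f g) \<and>
     (\<forall>f. \<bar>\<tau>\<bar> * B f f \<le> B (A f) f)"

lemma formD:
  assumes "form \<tau> B"
  shows "sform B" "B (Z i f) g = - B f (Z i g)" "B (T f) g = - B f (T g)" "B (T f) (T g) = \<tau>\<^sup>2 * B f g"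
  using assms by (auto simp: form_def)

lemma formAD:
  assumes "formA \<tau> B"
  shows "sform B" "B (A f) g = B f (A g)" "B (T f) g = - B f (T g)" "B (T f) (T g) = \<tau>\<^sup>2 * B f g"
    "\<bar>\<tau>\<bar> * B f f \<le> B (A f) f"
  using assms by (auto simp: formA_def)

lemma form_A:
  assumes "form \<tau> B"
  shows "B (A f) g = (\<Sum>i\<in>UNIV. B (Z i f) (Z i g))"
  by (simp add: A_def sform_lin[OF formD(1)[OF assms]] formD(2)[OF assms] sum_negf)

text \<open>The Heisenberg uncertainty principle: \<open>T\<close> is a commutator.\<close>

lemma form_uncertainty:
  assumes B: "form \<tau> B"
  shows "\<bar>\<tau>\<bar> * B f f \<le> B (Z i f) (Z i f) + B (Z (sw i) f) (Z (sw i) f)"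
proof (cases "\<tau> = 0")
  case True
  then show ?thesis by (simp add: sform_nonneg[OF formD(1)[OF B]])
next
  case False
  note l = sform_lin[OF formD(1)[OF B]]
  note sym = sform_sym[OF formD(1)[OF B]]
  have "T f = sg i *\<^sub>R (Z i (Z (sw i) f) - Z (sw i) (Z i f))"
    using Z_commute[of i "sw i" f] by simp
  then have "B (T f) (T f) = sg i * (B (Z i (Z (sw i) f)) (T f) - B (Z (sw i) (Z i f)) (T f))"
    by (metis l(7) l(8))
  also have "\<dots> = sg i * (B (Z i f) (T (Z (sw i) f)) + B (Z i f) (T (Z (sw i) f)))"
    using formD(3)[OF B, of "Z (sw i) f" "Z i f"] sym[of "Z i f" "T (Z (sw i) f)"]
    by (simp add: formD(2)[OF B] T_Z)
  also have "\<dots> \<le> 2 * \<bar>B (Z i f) (T (Z (sw i) f))\<bar>"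
    by (cases i) (auto simp: sg_def)
  also have "\<dots> \<le> \<bar>\<tau>\<bar> * B (Z i f) (Z i f) + B (T (Z (sw i) f)) (T (Z (sw i) f)) / \<bar>\<tau>\<bar>"
    using False by (intro sform_weighted formD(1)[OF B]) auto
  also have "\<dots> = \<bar>\<tau>\<bar> * (B (Z i f) (Z i f) + B (Z (sw i) f) (Z (sw i) f))"
    using False by (simp add: formD(4)[OF B] field_simps power2_eq_square)
  finally have "\<bar>\<tau>\<bar> * (\<bar>\<tau>\<bar> * B f f) \<le> \<bar>\<tau>\<bar> * (B (Z i f) (Z i f) + B (Z (sw i) f) (Z (sw i) f))"
    by (simp add: formD(4)[OF B] power2_eq_square mult.assoc[symmetric])
  then show ?thesis using False by simp
qed

lemma form_imp_formA:
  assumes B: "form \<tau> B"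
  shows "formA \<tau> B"
proof -
  note sym = sform_sym[OF formD(1)[OF B]]
  have "\<bar>\<tau>\<bar> * B f f \<le> B (A f) f" for f
  proof -
    \<comment> \<open>Any one conjugate pair of fields gives the bound; \<open>undefined\<close> is
      an arbitrary index.\<close>
    let ?i = "Inl undefined"
    have "\<bar>\<tau>\<bar> * B f f \<le> (\<Sum>i\<in>{?i, sw ?i}. B (Z i f) (Z i f))"
      using form_uncertainty[OF B, of f ?i] sw_neq[of ?i] by (simp add: sw_neq[of ?i, symmetric])
    also have "\<dots> \<le> (\<Sum>i\<in>UNIV. B (Z i f) (Z i f))"
      by (rule sum_mono2) (auto simp: sform_nonneg[OF formD(1)[OF B]])
    finally show ?thesis by (simp add: form_A[OF B])
  qed
  moreover have "B (A f) g = B f (A g)" for f g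
    unfolding sym[of f "A g"] form_A[OF B] by (intro sum.cong refl sym)
  ultimately show ?thesis
    unfolding formA_def using B[unfolded form_def] by blast
qed

text \<open>Multiply the Cauchy-Schwarz inequality B(Af,f)^2 \<le> B(Af,Af) B(f,f) by |\<tau>| and
  insert |\<tau>| B(f,f) \<le> B(Af,f). Cancelling factors B(Af,f) gives |\<tau>| B(Af,f) \<le>
  B(Af,Af), the bound one power higher.\<close>

lemma formA_shift:
  assumes B: "formA \<tau> B"
  shows "formA \<tau> (\<lambda>f g. B (A f) g)"
proof -
  note S = formAD(1)[OF B] and D = formAD[OF B]
  have 0: "0 \<le> B (A f) f" for f
    using D(5)[of f] sform_nonneg[OF S, of f] by (meson abs_ge_zero mult_nonneg_nonneg order_trans)
  have "\<bar>\<tau>\<bar> * B (A f) f \<le> B (A (A f)) f" for f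
  proof (cases "B (A f) f = 0")
    case True
    then show ?thesis using D(2)[of "A f" f] sform_nonneg[OF S, of "A f"] by simp
  next
    case False
    then have p: "B (A f) f > 0" using 0[of f] by simp
    have "(\<bar>\<tau>\<bar> * B (A f) f) * B (A f) f \<le> \<bar>\<tau>\<bar> * (B (A f) (A f) * B f f)"
      using sform_cauchy[OF S, of "A f" f] by (simp add: power2_eq_square mult.assoc mult_left_mono)
    also have "\<dots> = (\<bar>\<tau>\<bar> * B f f) * B (A f) (A f)" by simp
    also have "\<dots> \<le> B (A f) f * B (A f) (A f)"
      by (intro mult_right_mono D(5) sform_nonneg[OF S])
    finally have "(\<bar>\<tau>\<bar> * B (A f) f) * B (A f) f \<le> B (A f) (A f) * B (A f) f" by (simp add: mult.commute)
    then have "\<bar>\<tau>\<bar> * B (A f) f \<le> B (A f) (A f)" using p by simp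
    then show ?thesis using D(2)[of "A f" f] by simp
  qed
  moreover have "B (A f) g = B (A g) f" for f g
    using D(2)[of f g] sform_sym[OF S, of f "A g"] by simp
  moreover have "linear (B (A f))" for f using S by (simp add: sform_def)
  moreover have "B (A (T f)) g = - B (A f) (T g)" "B (A (T f)) (T g) = \<tau>\<^sup>2 * B (A f) g" for f g
    by (simp only: T_A[symmetric] D(3), simp only: T_A[symmetric] D(4))
  ultimately show ?thesis
    unfolding formA_def sform_def using 0 D(2) by blast
qed

lemma formA_pow: "formA \<tau> B \<Longrightarrow> formA \<tau> (\<lambda>f g. B ((A ^^ m) f) g)"
proof (induction m arbitrary: B)
  case (Suc m)
  then show ?case using Suc.IH[OF formA_shift[OF Suc.prems]] by simp
qed simp

lemma formA_pow_mono:
  assumes "formA \<tau> B"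
  shows "\<bar>\<tau>\<bar> * B ((A ^^ m) f) f \<le> B ((A ^^ Suc m) f) f"
  using formAD(5)[OF formA_pow[OF assms, of m], of f] by (simp add: funpow_swap1)

lemma formA_pow_nonneg: "formA \<tau> B \<Longrightarrow> 0 \<le> B ((A ^^ m) f) f"
  using sform_nonneg[OF formAD(1)[OF formA_pow]] by blast

text \<open>Homogeneous polynomials in the commuting operators \<open>A\<close> and
  \<open>T\<close>. Both get degree one, because at frequency \<tau> the operator \<open>T\<close>
  has size |\<tau>|, which is at most \<open>A\<close>.\<close>

inductive cen :: "nat \<Rightarrow> ('n::finite htf \<Rightarrow> 'n htf) \<Rightarrow> bool" where
  cen_id: "cen 0 (\<lambda>f. f)"
| cen_A: "cen m P \<Longrightarrow> cen (Suc m) (\<lambda>f. A (P f))"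
| cen_T: "cen m P \<Longrightarrow> cen (Suc m) (\<lambda>f. T (P f))"
| cen_add: "cen m P \<Longrightarrow> cen m Q \<Longrightarrow> cen m (\<lambda>f. P f + Q f)"
| cen_scale: "cen m P \<Longrightarrow> cen m (\<lambda>f. c *\<^sub>R P f)"

text \<open>Conjugation by the fields preserves the algebra generated by \<open>A\<close> and \<open>T\<close>: the second sum closes
  the recursion because \<open>[A, Z i]\<close> is a multiple of \<open>T Z (sw i)\<close>.\<close>

lemma cen_conjugate:
  "cen m P \<Longrightarrow> cen (Suc m) (\<lambda>f. \<Sum>i\<in>UNIV. Z i (P (Z i f))) \<and>
     cen (Suc m) (\<lambda>f. \<Sum>i\<in>UNIV. sg i *\<^sub>R Z i (P (Z (sw i) f)))"
proof (induction rule: cen.induct)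
  case cen_id
  have "(\<Sum>i\<in>UNIV. Z i (Z i f)) = (-1) *\<^sub>R A f" for f :: "'a htf" by (simp add: A_def)
  moreover have "(\<Sum>i\<in>UNIV. sg i *\<^sub>R Z i (Z (sw i) f)) = (real CARD('a + 'a) / 2) *\<^sub>R T f" for f :: "'a htf"
  proof -
    \<comment> \<open>Adding the sum reindexed by \<open>sw\<close> turns every summand into a
      commutator equal to \<open>T\<close>, one for each field; halving gives the
      coefficient.\<close>
    let ?R = "\<Sum>i\<in>UNIV. sg i *\<^sub>R Z i (Z (sw i) f)"
    have "?R = (\<Sum>i\<in>UNIV. sg (sw i) *\<^sub>R Z (sw i) (Z (sw (sw i)) f))"
      by (rule sum_sw[symmetric])
    then have "?R + ?R = (\<Sum>i\<in>UNIV. sg i *\<^sub>R Z i (Z (sw i) f) - sg i *\<^sub>R Z (sw i) (Z i f))"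
      by (simp add: sum.distrib sum_subtractf sum_negf)
    also have "\<dots> = (\<Sum>i\<in>(UNIV::('a + 'a) set). T f)"
    proof (rule sum.cong)
      fix i :: "'a + 'a"
      show "sg i *\<^sub>R Z i (Z (sw i) f) - sg i *\<^sub>R Z (sw i) (Z i f) = T f"
        by (subst Z_commute[of i "sw i" f]) (simp add: scaleR_add_right)
    qed simp
    finally have "2 *\<^sub>R ?R = real CARD('a + 'a) *\<^sub>R T f" by (simp add: scaleR_2 sum_constant_scaleR)
    then have "(1/2) *\<^sub>R (2 *\<^sub>R ?R) = (1/2) *\<^sub>R (real CARD('a + 'a) *\<^sub>R T f)" by simp
    then show ?thesis by simp
  qed
  ultimately show ?case
    using cen.cen_scale[OF cen.cen_A[OF cen.cen_id], of "-1"] cen.cen_scale[OF cen.cen_T[OF cen.cen_id], of "real CARD('a + 'a) / 2"]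
    by simp
next
  case (cen_A m P)
  have 1: "Z i (A g) = A (Z i g) - (2 * sg i) *\<^sub>R Z (sw i) (T g)" for i and g :: "'a htf"
    using A_Z[of i g] by simp
  have "(\<Sum>i\<in>UNIV. Z i (A (P (Z i f)))) = A (\<Sum>i\<in>UNIV. Z i (P (Z i f))) + 2 *\<^sub>R T (\<Sum>i\<in>UNIV. sg i *\<^sub>R Z i (P (Z (sw i) f)))" for f
  proof -
    have "(\<Sum>i\<in>UNIV. sg i *\<^sub>R Z i (P (Z (sw i) f))) = (\<Sum>i\<in>UNIV. sg (sw i) *\<^sub>R Z (sw i) (P (Z (sw (sw i)) f)))"
      by (rule sum_sw[symmetric])
    then show ?thesis
      by (simp add: 1 A_lin T_lin T_Z sum_subtractf scaleR_sum_right sum_negf linear_neg[OF linear_T])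
  qed
  moreover have "(\<Sum>i\<in>UNIV. sg i *\<^sub>R Z i (A (P (Z (sw i) f)))) = A (\<Sum>i\<in>UNIV. sg i *\<^sub>R Z i (P (Z (sw i) f))) + (- 2) *\<^sub>R T (\<Sum>i\<in>UNIV. Z i (P (Z i f)))" for f
  proof -
    have "(\<Sum>i\<in>UNIV. Z i (P (Z i f))) = (\<Sum>i\<in>UNIV. Z (sw i) (P (Z (sw i) f)))"
      by (rule sum_sw[symmetric])
    then show ?thesis
      by (simp add: 1 A_lin T_lin T_Z sum_subtractf scaleR_sum_right scaleR_diff_right mult.left_commute[of "sg _" 2] sum_negf)
  qed
  ultimately show ?case
    using cen.cen_add[OF cen.cen_A[OF conjunct1[OF cen_A.IH]] cen.cen_scale[OF cen.cen_T[OF conjunct2[OF cen_A.IH]], of 2]]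
      cen.cen_add[OF cen.cen_A[OF conjunct2[OF cen_A.IH]] cen.cen_scale[OF cen.cen_T[OF conjunct1[OF cen_A.IH]], of "-2"]]
    by simp
next
  case (cen_T m P)
  have "(\<Sum>i\<in>UNIV. Z i (T (P (Z i f)))) = T (\<Sum>i\<in>UNIV. Z i (P (Z i f)))" for f
    by (simp add: T_lin T_Z)
  moreover have "(\<Sum>i\<in>UNIV. sg i *\<^sub>R Z i (T (P (Z (sw i) f)))) = T (\<Sum>i\<in>UNIV. sg i *\<^sub>R Z i (P (Z (sw i) f)))" for f
    by (simp add: T_lin T_Z)
  ultimately show ?case
    using cen.cen_T[OF conjunct1[OF cen_T.IH]] cen.cen_T[OF conjunct2[OF cen_T.IH]] by simp
next
  case (cen_add m P Q)
  then show ?case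
    using cen.cen_add[OF conjunct1[OF cen_add.IH(1)] conjunct1[OF cen_add.IH(2)]]
      cen.cen_add[OF conjunct2[OF cen_add.IH(1)] conjunct2[OF cen_add.IH(2)]]
    by (simp add: Z_lin sum.distrib scaleR_add_right)
next
  case (cen_scale m P c)
  then show ?case
    using cen.cen_scale[OF conjunct1[OF cen_scale.IH], of c] cen.cen_scale[OF conjunct2[OF cen_scale.IH], of c]
    by (simp add: Z_lin scaleR_sum_right mult.commute)
qed

text \<open>The constant must be uniform in the form, because a factor \<open>A\<close> is absorbed
  by passing to the form \<open>B (A f) g\<close>. A factor \<open>T\<close> is moved to the other
  argument, where it has size |\<tau>|; this is shared as a square root by both sides, and
  \<open>formA_pow_mono\<close> trades it for one more power of \<open>A\<close>.\<close>

lemma cen_bound: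
  "cen m P \<Longrightarrow> \<exists>C\<ge>0. \<forall>\<tau> B f g. formA \<tau> B \<longrightarrow>
     \<bar>B (P f) g\<bar> \<le> C * (sqrt (B ((A ^^ m) f) f) * sqrt (B ((A ^^ m) g) g))"
proof (induction rule: cen.induct)
  case cen_id
  then show ?case
    using sform_cauchy_sqrt[OF formAD(1)] by (intro exI[of _ 1]) auto
next
  case (cen_A m P)
  then obtain C where C: "C \<ge> 0" "\<And>\<tau> B f g. formA \<tau> B \<Longrightarrow>
     \<bar>B (P f) g\<bar> \<le> C * (sqrt (B ((A ^^ m) f) f) * sqrt (B ((A ^^ m) g) g))" by blast
  have "\<bar>B (A (P f)) g\<bar> \<le> C * (sqrt (B ((A ^^ Suc m) f) f) * sqrt (B ((A ^^ Suc m) g) g))"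
    if "formA \<tau> B" for \<tau> B f g
    using C(2)[OF formA_shift[OF that], of f g] by simp
  then show ?case using C(1) by blast
next
  case (cen_T m P)
  then obtain C where C: "C \<ge> 0" "\<And>\<tau> B f g. formA \<tau> B \<Longrightarrow>
     \<bar>B (P f) g\<bar> \<le> C * (sqrt (B ((A ^^ m) f) f) * sqrt (B ((A ^^ m) g) g))" by blast
  have "\<bar>B (T (P f)) g\<bar> \<le> C * (sqrt (B ((A ^^ Suc m) f) f) * sqrt (B ((A ^^ Suc m) g) g))"
    if B: "formA \<tau> B" for \<tau> B f g
  proof -
    have "\<bar>B (T (P f)) g\<bar> = \<bar>B (P f) (T g)\<bar>" by (simp add: formAD(3)[OF B])
    also have "\<dots> \<le> C * (sqrt (B ((A ^^ m) f) f) * sqrt (B ((A ^^ m) (T g)) (T g)))"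
      by (rule C(2)[OF B])
    also have "B ((A ^^ m) (T g)) (T g) = \<tau>\<^sup>2 * B ((A ^^ m) g) g"
      by (simp add: T_A_pow[symmetric] formAD(4)[OF B])
    also have "sqrt (B ((A ^^ m) f) f) * sqrt (\<tau>\<^sup>2 * B ((A ^^ m) g) g)
        = sqrt (\<bar>\<tau>\<bar> * B ((A ^^ m) f) f) * sqrt (\<bar>\<tau>\<bar> * B ((A ^^ m) g) g)"
      by (simp add: real_sqrt_mult)
    also have "\<dots> \<le> sqrt (B ((A ^^ Suc m) f) f) * sqrt (B ((A ^^ Suc m) g) g)"
      using formA_pow_mono[OF B, of m] formA_pow_nonneg[OF B, of m] formA_pow_nonneg[OF B, of "Suc m"]
      by (intro mult_mono real_sqrt_le_mono) (auto simp del: funpow.simps)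
    finally show ?thesis using C(1) by (simp add: mult_left_mono)
  qed
  then show ?case using C(1) by blast
next
  case (cen_add m P Q)
  then obtain C D where C: "C \<ge> 0" "\<And>\<tau> B f g. formA \<tau> B \<Longrightarrow>
     \<bar>B (P f) g\<bar> \<le> C * (sqrt (B ((A ^^ m) f) f) * sqrt (B ((A ^^ m) g) g))"
    and D: "D \<ge> 0" "\<And>\<tau> B f g. formA \<tau> B \<Longrightarrow>
     \<bar>B (Q f) g\<bar> \<le> D * (sqrt (B ((A ^^ m) f) f) * sqrt (B ((A ^^ m) g) g))" by blast
  have "\<bar>B (P f + Q f) g\<bar> \<le> (C + D) * (sqrt (B ((A ^^ m) f) f) * sqrt (B ((A ^^ m) g) g))"
    if "formA \<tau> B" for \<tau> B f g
    using C(2)[OF that, of f g] D(2)[OF that, of f g] by (simp add: sform_lin[OF formAD(1)[OF that]] distrib_right)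
  then show ?case using C(1) D(1) by (intro exI[of _ "C + D"]) auto
next
  case (cen_scale m P c)
  then obtain C where C: "C \<ge> 0" "\<And>\<tau> B f g. formA \<tau> B \<Longrightarrow>
     \<bar>B (P f) g\<bar> \<le> C * (sqrt (B ((A ^^ m) f) f) * sqrt (B ((A ^^ m) g) g))" by blast
  have "\<bar>B (c *\<^sub>R P f) g\<bar> \<le> (\<bar>c\<bar> * C) * (sqrt (B ((A ^^ m) f) f) * sqrt (B ((A ^^ m) g) g))"
    if "formA \<tau> B" for \<tau> B f g
    using C(2)[OF that, of f g] by (simp add: sform_lin[OF formAD(1)[OF that]] abs_mult mult.assoc mult_left_mono)
  then show ?case using C(1) by (intro exI[of _ "\<bar>c\<bar> * C"]) auto
qed

text \<open>For the L2 product this is the full horizontal energy of order \<open>m\<close>: the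
  squared norms of all words of length \<open>m\<close> in the fields, mixed ones included.\<close>

primrec q :: "('n::finite htf \<Rightarrow> 'n htf \<Rightarrow> real) \<Rightarrow> nat \<Rightarrow> 'n htf \<Rightarrow> real" where
  "q B 0 f = B f f"
| "q B (Suc m) f = (\<Sum>i\<in>UNIV. q B m (Z i f))"

lemma q_nonneg: "sform B \<Longrightarrow> 0 \<le> q B m f"
  by (induction m arbitrary: f) (auto simp: sform_nonneg sum_nonneg)

text \<open>Integration by parts in the field applied first replaces \<open>P\<close> by minus the
  sum of its conjugates, and \<open>cen_conjugate\<close> keeps this among the polynomials in
  \<open>A\<close> and \<open>T\<close>, one degree higher.\<close>

lemma q_eq_cen: "\<exists>P :: 'n::finite htf \<Rightarrow> 'n htf. cen m P \<and> (\<forall>\<tau> B f. form \<tau> B \<longrightarrow> q B m f = B (P f) f)"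
proof (induction m)
  case 0
  then show ?case by (intro exI[of _ "\<lambda>f. f"]) (auto intro: cen_id)
next
  case (Suc m)
  then obtain P :: "'n htf \<Rightarrow> 'n htf" where P: "cen m P" "\<And>\<tau> B f. form \<tau> B \<Longrightarrow> q B m f = B (P f) f" by blast
  have "q B (Suc m) f = B ((-1) *\<^sub>R (\<Sum>i\<in>UNIV. Z i (P (Z i f)))) f" if "form \<tau> B" for \<tau> B f
    by (simp add: P(2)[OF that] sform_lin[OF formD(1)[OF that]] formD(2)[OF that] sum_negf)
  then show ?case
    using cen_scale[OF conjunct1[OF cen_conjugate[OF P(1)]], of "-1"] by blast
qed

lemma q_le_A_pow:
  "\<exists>C\<ge>0. \<forall>\<tau> B. \<forall>f :: 'n::finite htf. form \<tau> B \<longrightarrow> q B m f \<le> C * B ((A ^^ m) f) f"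
proof -
  obtain P :: "'n htf \<Rightarrow> 'n htf" where P: "cen m P" "\<And>\<tau> B f. form \<tau> B \<Longrightarrow> q B m f = B (P f) f" using q_eq_cen by blast
  obtain C where C: "C \<ge> 0" "\<And>\<tau> B f g. formA \<tau> B \<Longrightarrow>
     \<bar>B (P f) g\<bar> \<le> C * (sqrt (B ((A ^^ m) f) f) * sqrt (B ((A ^^ m) g) g))" using cen_bound[OF P(1)] by blast
  have "q B m f \<le> C * B ((A ^^ m) f) f" if "form \<tau> B" for \<tau> B and f :: "'n htf"
    using P(2)[OF that] C(2)[OF form_imp_formA[OF that], of f f] formA_pow_nonneg[OF form_imp_formA[OF that], of m f] by simp
  then show ?thesis using C(1) by blast
qed

section \<open>Pure powers, mixed words and the central frequency\<close>

lemma abs_le_amgm: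
  fixes x a b :: real
  assumes "x\<^sup>2 \<le> a * b" "a \<ge> 0" "b \<ge> 0" "\<epsilon> > 0"
  shows "x \<le> \<epsilon> * a + b / (4 * \<epsilon>)"
proof (rule power2_le_imp_le)
  have "(\<epsilon> * a + b / (4 * \<epsilon>))\<^sup>2 - a * b / 1 = (\<epsilon> * a - b / (4 * \<epsilon>))\<^sup>2"
    using assms(4) by (simp add: power2_eq_square field_simps)
  then have "a * b \<le> (\<epsilon> * a + b / (4 * \<epsilon>))\<^sup>2"
    using zero_le_power2[of "\<epsilon> * a - b / (4 * \<epsilon>)"] by linarith
  then show "x\<^sup>2 \<le> (\<epsilon> * a + b / (4 * \<epsilon>))\<^sup>2" using assms(1) by simp
qed (use assms in auto)

text \<open>Meant for \<open>g j\<close> the squared size of the power \<open>(Z i ^^ j) f\<close>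
  and \<open>t\<close> equal to |\<tau>|: a factor |\<tau>| weighs as much as one more field in both
  arguments, so all terms have the same order. That \<open>K\<close> is independent of
  \<open>t\<close> and \<open>g\<close> makes the estimate uniform in the frequency.\<close>

lemma log_convex_interpolation:
  "0 < \<epsilon> \<Longrightarrow> \<exists>K\<ge>1. \<forall>t\<ge>0. \<forall>g :: nat \<Rightarrow> real. (\<forall>j. 0 \<le> g j) \<longrightarrow> (\<forall>j. (g (Suc j))\<^sup>2 \<le> g j * g (Suc (Suc j))) \<longrightarrow>
     t * g (Suc m) \<le> K * g (Suc (Suc m)) + \<epsilon> * t ^ Suc (Suc m) * g 0"
proof (induction m)
  case 0
  define K where "K = max 1 (1 / (4 * \<epsilon>))"
  have "t * g 1 \<le> K * g 2 + \<epsilon> * t ^ 2 * g 0"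
    if t: "t \<ge> 0" and g: "\<forall>j. 0 \<le> g j" and c: "\<forall>j. (g (Suc j))\<^sup>2 \<le> g j * g (Suc (Suc j))" for t and g :: "nat \<Rightarrow> real"
  proof -
    have "(t * g 1)\<^sup>2 \<le> (t\<^sup>2 * g 0) * g 2"
      using mult_left_mono[OF c[rule_format, of 0], of "t\<^sup>2"] by (simp add: power_mult_distrib mult_ac numeral_2_eq_2)
    then have "t * g 1 \<le> \<epsilon> * (t\<^sup>2 * g 0) + g 2 / (4 * \<epsilon>)"
      using g 0 by (intro abs_le_amgm) auto
    also have "g 2 / (4 * \<epsilon>) \<le> K * g 2"
      using g mult_right_mono[of "1 / (4 * \<epsilon>)" K "g 2"] by (simp add: K_def)
    finally show ?thesis by (simp add: mult.assoc)
  qed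
  then show ?case by (intro exI[of _ K]) (auto simp: K_def numeral_2_eq_2)
next
  case (Suc m)
  then obtain K where K: "K \<ge> 1" and I: "\<And>t g. t \<ge> 0 \<Longrightarrow> (\<forall>j. 0 \<le> g j) \<Longrightarrow> (\<forall>j. (g (Suc j))\<^sup>2 \<le> g j * g (Suc (Suc j))) \<Longrightarrow>
     t * g (Suc m) \<le> K * g (Suc (Suc m)) + \<epsilon> * t ^ Suc (Suc m) * g 0" by blast
  have "t * g (Suc (Suc m)) \<le> K * g (Suc (Suc (Suc m))) + \<epsilon> * t ^ Suc (Suc (Suc m)) * g 0"
    if t: "t \<ge> 0" and g: "\<forall>j. 0 \<le> g j" and c: "\<forall>j. (g (Suc j))\<^sup>2 \<le> g j * g (Suc (Suc j))" for t and g :: "nat \<Rightarrow> real"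
  proof -
    define x where "x = t * g (Suc (Suc m))"
    define y where "y = g (Suc (Suc (Suc m)))"
    define w where "w = \<epsilon> * t ^ Suc (Suc (Suc m)) * g 0"
    have w: "w \<ge> 0" using g t Suc.prems by (simp add: w_def)
    have y: "y \<ge> 0" using g by (simp add: y_def)
    have "x\<^sup>2 \<le> (t\<^sup>2 * g (Suc m)) * y"
      using c[rule_format, of "Suc m"] by (simp add: x_def y_def power_mult_distrib mult.assoc mult_left_mono)
    \<comment> \<open>With the weight 1 / (2 K) the term \<open>K * x\<close> of the induction
      hypothesis comes back as x / 2 and can be absorbed, leaving \<open>K\<close>
      unchanged.\<close>
    then have "x \<le> (1 / (2 * K)) * (t\<^sup>2 * g (Suc m)) + y / (4 * (1 / (2 * K)))"
      using g y K by (intro abs_le_amgm) auto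
    moreover have "t\<^sup>2 * g (Suc m) \<le> K * x + w"
      using mult_left_mono[OF I[OF t g c] t] by (simp add: x_def w_def power2_eq_square algebra_simps)
    then have "(1 / (2 * K)) * (t\<^sup>2 * g (Suc m)) \<le> (1 / (2 * K)) * (K * x + w)"
      using K by (intro mult_left_mono) auto
    ultimately have "x \<le> x / 2 + w / (2 * K) + K * y / 2"
      using K by (simp add: field_simps)
    moreover have "w / (2 * K) \<le> w / 2" using K w by (intro divide_left_mono) auto
    ultimately have "x \<le> K * y + w" by (simp add: field_simps)
    then show ?thesis by (simp add: x_def y_def w_def)
  qed
  then show ?case using K by blast
qed

text \<open>The part of highest order in the norm of \<open>S_space\<close>, which contains powers
  of single fields but no mixed words.\<close>

definition pure :: "('n::finite htf \<Rightarrow> 'n htf \<Rightarrow> real) \<Rightarrow> nat \<Rightarrow> 'n htf \<Rightarrow> real" where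
  "pure B m f = (\<Sum>i\<in>UNIV. B ((Z i ^^ m) f) ((Z i ^^ m) f))"

lemma pure_nonneg: "sform B \<Longrightarrow> 0 \<le> pure B m f"
  by (simp add: pure_def sform_nonneg sum_nonneg)

text \<open>The head of the list acts first.\<close>

primrec wd :: "('n::finite + 'n) list \<Rightarrow> 'n htf \<Rightarrow> 'n htf" where
  "wd [] f = f"
| "wd (i # w) f = wd w (Z i f)"

lemma wd_append: "wd (v @ w) f = wd w (wd v f)"
  by (induction v arbitrary: f) auto

lemma wd_replicate: "wd (replicate m i) f = (Z i ^^ m) f"
  by (induction m arbitrary: f) (auto simp: funpow_swap1)

lemma wd_le_q:
  assumes "sform B"
  shows "B (wd w f) (wd w f) \<le> q B (length w) f"
proof (induction w arbitrary: f)
  case (Cons i w)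
  have "B (wd w (Z i f)) (wd w (Z i f)) \<le> q B (length w) (Z i f)" by (rule Cons)
  also have "\<dots> \<le> (\<Sum>i\<in>UNIV. q B (length w) (Z i f))"
    by (rule member_le_sum) (auto simp: q_nonneg[OF assms])
  finally show ?case by simp
qed simp

lemma pow_le_q:
  assumes "sform B"
  shows "B ((Z i ^^ m) f) ((Z i ^^ m) f) \<le> q B m f"
  using wd_le_q[OF assms, of "replicate m i" f] by (simp add: wd_replicate)

text \<open>As \<open>T\<close> is central, each of the \<open>Suc m\<close> exchanges of
  \<open>Z j\<close> with a factor \<open>Z i\<close> leaves the same term.\<close>

lemma Z_pow_commute:
  "(Z i ^^ Suc m) (Z j f) = Z j ((Z i ^^ Suc m) f) + (real (Suc m) * (if j = sw i then sg i else 0)) *\<^sub>R T ((Z i ^^ m) f)"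
proof (induction m)
  case 0
  show ?case using Z_commute[of i j f] by simp
next
  case (Suc m)
  have "(Z i ^^ Suc (Suc m)) (Z j f) = Z i ((Z i ^^ Suc m) (Z j f))" by simp
  also have "\<dots> = Z i (Z j ((Z i ^^ Suc m) f)) + (real (Suc m) * (if j = sw i then sg i else 0)) *\<^sub>R T ((Z i ^^ Suc m) f)"
    by (subst Suc) (simp add: Z_lin T_Z)
  also have "Z i (Z j ((Z i ^^ Suc m) f)) = Z j ((Z i ^^ Suc (Suc m)) f) + (if j = sw i then sg i else 0) *\<^sub>R T ((Z i ^^ Suc m) f)"
    by (subst Z_commute) simp
  finally show ?case by (simp add: algebra_simps scaleR_2[symmetric])
qed

text \<open>One field \<open>Z i\<close> moves across the form, so the middle value is a pairing of
  the two neighbouring powers; then Cauchy-Schwarz.\<close>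

lemma pow_log_convex:
  assumes B: "form \<tau> B"
  shows "(B ((Z i ^^ Suc j) f) ((Z i ^^ Suc j) f))\<^sup>2
    \<le> B ((Z i ^^ j) f) ((Z i ^^ j) f) * B ((Z i ^^ Suc (Suc j)) f) ((Z i ^^ Suc (Suc j)) f)"
  using sform_cauchy[OF formD(1)[OF B], of "(Z i ^^ j) f" "(Z i ^^ Suc (Suc j)) f"]
  by (simp add: formD(2)[OF B])

text \<open>Powers of a fixed field are log-convex in the exponent, so the interpolation applies
  field by field, with \<epsilon> divided among the fields. It is kept free so that the frequency
  term can be absorbed.\<close>

lemma frequency_pure:
  assumes "0 < \<epsilon>"
  shows "\<exists>K\<ge>1. \<forall>\<tau> B. \<forall>f :: 'n::finite htf. form \<tau> B \<longrightarrow>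
    \<bar>\<tau>\<bar> * pure B (Suc m) f \<le> K * pure B (Suc (Suc m)) f + \<epsilon> * (\<bar>\<tau>\<bar> ^ Suc (Suc m) * B f f)"
proof -
  let ?N = "real CARD('n + 'n)"
  have N: "?N > 0" by simp
  with assms have "\<epsilon> / ?N > 0" by simp
  from log_convex_interpolation[OF this, of m]
  obtain K where K: "K \<ge> 1" "\<And>t g. t \<ge> 0 \<Longrightarrow> (\<forall>j. 0 \<le> g j) \<Longrightarrow> (\<forall>j. (g (Suc j))\<^sup>2 \<le> g j * g (Suc (Suc j))) \<Longrightarrow>
     t * g (Suc m) \<le> K * g (Suc (Suc m)) + \<epsilon> / ?N * t ^ Suc (Suc m) * g 0" by blast
  have "\<bar>\<tau>\<bar> * pure B (Suc m) f \<le> K * pure B (Suc (Suc m)) f + \<epsilon> * (\<bar>\<tau>\<bar> ^ Suc (Suc m) * B f f)"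
    if B: "form \<tau> B" for \<tau> B and f :: "'n htf"
  proof -
    let ?g = "\<lambda>i j. B ((Z i ^^ j) f) ((Z i ^^ j) f)"
    have "\<bar>\<tau>\<bar> * ?g i (Suc m) \<le> K * ?g i (Suc (Suc m)) + \<epsilon> / ?N * \<bar>\<tau>\<bar> ^ Suc (Suc m) * B f f" for i
    proof -
      have "\<forall>j. 0 \<le> ?g i j" using sform_nonneg[OF formD(1)[OF B]] by blast
      moreover have "\<forall>j. (?g i (Suc j))\<^sup>2 \<le> ?g i j * ?g i (Suc (Suc j))" using pow_log_convex[OF B] by blast
      ultimately show ?thesis using K(2)[of "\<bar>\<tau>\<bar>" "?g i"] by simp
    qed
    then have "(\<Sum>i\<in>UNIV. \<bar>\<tau>\<bar> * ?g i (Suc m)) \<le> (\<Sum>i\<in>(UNIV::('n+'n) set). K * ?g i (Suc (Suc m)) + \<epsilon> / ?N * \<bar>\<tau>\<bar> ^ Suc (Suc m) * B f f)"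
      by (rule sum_mono)
    also have "\<dots> = K * pure B (Suc (Suc m)) f + ?N * (\<epsilon> / ?N * \<bar>\<tau>\<bar> ^ Suc (Suc m) * B f f)"
      unfolding pure_def by (simp only: sum.distrib sum_distrib_left sum_constant)
    also have "?N * (\<epsilon> / ?N * \<bar>\<tau>\<bar> ^ Suc (Suc m) * B f f) = \<epsilon> * (\<bar>\<tau>\<bar> ^ Suc (Suc m) * B f f)"
      using N by simp
    finally show ?thesis unfolding pure_def by (simp only: sum_distrib_left)
  qed
  then show ?thesis using K(1) by blast
qed

text \<open>Order one is the uncertainty principle. Multiplying a bound by |\<tau>| and
  interpolating reproduces the left side one order higher with a coefficient small enough to absorb.
  The result controls the commutator terms that arise when mixed words are reduced to pure
  powers.\<close>

lemma frequency_le_pure: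
  "\<exists>K\<ge>0. \<forall>\<tau> B. \<forall>f :: 'n::finite htf. form \<tau> B \<longrightarrow> \<bar>\<tau>\<bar> ^ Suc m * B f f \<le> K * pure B (Suc m) f"
proof (induction m)
  case 0
  have "\<bar>\<tau>\<bar> ^ Suc 0 * B f f \<le> 1 * pure B (Suc 0) f" if B: "form \<tau> B" for \<tau> B and f :: "'n htf"
    using formAD(5)[OF form_imp_formA[OF B], of f] by (simp add: form_A[OF B] pure_def)
  then show ?case by (intro exI[of _ 1]) auto
next
  case (Suc m)
  then obtain K where K: "K \<ge> 0" "\<And>\<tau> B (f :: 'n htf). form \<tau> B \<Longrightarrow> \<bar>\<tau>\<bar> ^ Suc m * B f f \<le> K * pure B (Suc m) f" by blast
  \<comment> \<open>Makes \<open>K * \<epsilon>\<close> at most one half.\<close>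
  define \<epsilon> where "\<epsilon> = 1 / (2 * (K + 1))"
  have e: "\<epsilon> > 0" using K(1) by (simp add: \<epsilon>_def)
  from frequency_pure[OF this, of m] obtain L where L: "L \<ge> 1" "\<And>\<tau> B (f :: 'n htf). form \<tau> B \<Longrightarrow>
    \<bar>\<tau>\<bar> * pure B (Suc m) f \<le> L * pure B (Suc (Suc m)) f + \<epsilon> * (\<bar>\<tau>\<bar> ^ Suc (Suc m) * B f f)" by blast
  have "\<bar>\<tau>\<bar> ^ Suc (Suc m) * B f f \<le> (2 * K * L) * pure B (Suc (Suc m)) f" if B: "form \<tau> B" for \<tau> B and f :: "'n htf"
  proof -
    let ?x = "\<bar>\<tau>\<bar> ^ Suc (Suc m) * B f f"
    have x: "?x \<ge> 0" using sform_nonneg[OF formD(1)[OF B]] by simp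
    have "?x \<le> K * (\<bar>\<tau>\<bar> * pure B (Suc m) f)"
      using mult_left_mono[OF K(2)[OF B, of f], of "\<bar>\<tau>\<bar>"] by (simp add: mult.assoc mult.left_commute)
    also have "\<dots> \<le> K * (L * pure B (Suc (Suc m)) f + \<epsilon> * ?x)"
      by (intro mult_left_mono L(2)[OF B] K(1))
    also have "\<dots> = K * L * pure B (Suc (Suc m)) f + (K * \<epsilon>) * ?x" by (simp add: algebra_simps)
    also have "(K * \<epsilon>) * ?x \<le> (1/2) * ?x"
      using K(1) by (intro mult_right_mono x) (simp add: \<epsilon>_def field_simps)
    finally show ?thesis by simp
  qed
  then show ?case using K(1) L(1) by (intro exI[of _ "2 * K * L"]) auto
qed

text \<open>Moving one \<open>Z i\<close> across the form produces the power m + 2 of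
  \<open>Z i\<close> acting on \<open>Z j f\<close>. Bringing \<open>Z j\<close> to the outside and
  integrating it by parts pairs a pure power of \<open>f\<close> with a word of length m + 2, whose
  share can be made small. The exchange costs a term with \<open>T\<close>, that is a factor
  |\<tau>| on words of length m + 1.\<close>

lemma mixed_word_bound:
  assumes B: "form \<tau> B" and e: "\<epsilon> > 0"
  shows "B ((Z i ^^ Suc m) (Z j f)) ((Z i ^^ Suc m) (Z j f))
    \<le> \<epsilon> * q B (Suc (Suc m)) f + B ((Z i ^^ Suc (Suc m)) f) ((Z i ^^ Suc (Suc m)) f) / \<epsilon>
      + real (Suc (Suc m)) * (\<bar>\<tau>\<bar> * q B (Suc m) f)"
proof -
  note S = formD(1)[OF B]
  define h where "h = (Z i ^^ m) (Z j f)"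
  define c where "c = real (Suc (Suc m)) * (if j = sw i then sg i else 0)"
  have c: "\<bar>c\<bar> \<le> real (Suc (Suc m))" by (cases i) (auto simp: c_def sg_def)
  have "(Z i ^^ Suc (Suc m)) (Z j f) = Z i (Z i h)" by (simp add: h_def)
  then have eq: "Z i (Z i h) = Z j ((Z i ^^ Suc (Suc m)) f) + c *\<^sub>R T ((Z i ^^ Suc m) f)"
    using Z_pow_commute[of "Suc m" i j f] unfolding c_def by simp
  have "B (Z i h) (Z i h) = - B (Z i (Z i h)) h"
    using formD(2)[OF B, of i "Z i h" h] by simp
  also have "\<dots> = B ((Z i ^^ Suc (Suc m)) f) (Z j h) - c * B (T ((Z i ^^ Suc m) f)) h"
    unfolding eq by (simp add: sform_lin[OF S] formD(2)[OF B, of j] del: funpow.simps)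
  also have "\<dots> \<le> \<bar>B ((Z i ^^ Suc (Suc m)) f) (Z j h)\<bar> + \<bar>c\<bar> * \<bar>B (T ((Z i ^^ Suc m) f)) h\<bar>"
    by (simp add: abs_mult[symmetric] del: funpow.simps)
  also have "\<bar>c\<bar> * \<bar>B (T ((Z i ^^ Suc m) f)) h\<bar> \<le> real (Suc (Suc m)) * (\<bar>\<tau>\<bar> * q B (Suc m) f)"
  proof (intro mult_mono c)
    have "\<bar>B (T ((Z i ^^ Suc m) f)) h\<bar> \<le> sqrt (B (T ((Z i ^^ Suc m) f)) (T ((Z i ^^ Suc m) f))) * sqrt (B h h)"
      by (rule sform_cauchy_sqrt[OF S])
    also have "\<dots> = \<bar>\<tau>\<bar> * (sqrt (B ((Z i ^^ Suc m) f) ((Z i ^^ Suc m) f)) * sqrt (B h h))"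
      by (simp add: formD(4)[OF B] real_sqrt_mult del: funpow.simps)
    also have "sqrt (B ((Z i ^^ Suc m) f) ((Z i ^^ Suc m) f)) * sqrt (B h h) \<le> sqrt (q B (Suc m) f) * sqrt (q B (Suc m) f)"
    proof (intro mult_mono real_sqrt_le_mono pow_le_q S)
      show "B h h \<le> q B (Suc m) f"
        using wd_le_q[OF S, of "j # replicate m i" f] by (simp add: wd_replicate h_def)
    qed (auto simp: sform_nonneg[OF S] q_nonneg[OF S] simp del: q.simps)
    also have "\<dots> = q B (Suc m) f" using q_nonneg[OF S, of "Suc m" f] by (simp del: q.simps)
    finally show "\<bar>B (T ((Z i ^^ Suc m) f)) h\<bar> \<le> \<bar>\<tau>\<bar> * q B (Suc m) f" by (simp add: mult_left_mono del: q.simps)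
  qed auto
  also have "\<bar>B ((Z i ^^ Suc (Suc m)) f) (Z j h)\<bar> \<le> \<epsilon> * q B (Suc (Suc m)) f + B ((Z i ^^ Suc (Suc m)) f) ((Z i ^^ Suc (Suc m)) f) / \<epsilon>"
  proof -
    have 1: "2 * \<bar>B (Z j h) ((Z i ^^ Suc (Suc m)) f)\<bar> \<le> \<epsilon> * B (Z j h) (Z j h) + B ((Z i ^^ Suc (Suc m)) f) ((Z i ^^ Suc (Suc m)) f) / \<epsilon>"
      by (rule sform_weighted[OF S e])
    have "B (Z j h) (Z j h) \<le> q B (Suc (Suc m)) f"
      using wd_le_q[OF S, of "j # replicate m i @ [j]" f] by (simp add: wd_append wd_replicate h_def del: q.simps)
    then have "\<epsilon> * B (Z j h) (Z j h) \<le> \<epsilon> * q B (Suc (Suc m)) f" using e by simp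
    moreover have "0 \<le> \<epsilon> * B (Z j h) (Z j h)" "0 \<le> B ((Z i ^^ Suc (Suc m)) f) ((Z i ^^ Suc (Suc m)) f) / \<epsilon>"
      using sform_nonneg[OF S] e by auto
    ultimately show ?thesis using 1 sform_sym[OF S, of "Z j h" "(Z i ^^ Suc (Suc m)) f"] by (simp del: q.simps funpow.simps)
  qed
  finally show ?thesis by (simp add: h_def)
qed

text \<open>The induction hypothesis, applied to \<open>Z j f\<close>, leaves words that consist of
  \<open>Z j\<close> followed by a power of one field; these are handled by
  \<open>mixed_word_bound\<close>, and the factor |\<tau>| by the two frequency lemmas.\<close>

lemma q_le_pure:
  "\<exists>C\<ge>1. \<forall>\<tau> B. \<forall>f :: 'n::finite htf. form \<tau> B \<longrightarrow> q B (Suc m) f \<le> C * pure B (Suc m) f"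
proof (induction m)
  case 0
  show ?case by (intro exI[of _ 1]) (auto simp: pure_def)
next
  case (Suc m)
  then obtain C where C: "C \<ge> 1" "\<And>\<tau> B (f :: 'n htf). form \<tau> B \<Longrightarrow> q B (Suc m) f \<le> C * pure B (Suc m) f" by blast
  let ?N = "real CARD('n + 'n)"
  have N: "?N > 0" by simp
  \<comment> \<open>The double sum contains \<open>?N * ?N\<close> copies of
    \<open>\<epsilon> * ?Q\<close> with factor \<open>C\<close>; together they are half of
    \<open>?Q\<close> and can be absorbed.\<close>
  define \<epsilon> where "\<epsilon> = 1 / (2 * C * ?N * ?N)"
  have e: "\<epsilon> > 0" using C N by (simp add: \<epsilon>_def)
  obtain K where K: "K \<ge> 0" "\<And>\<tau> B (f :: 'n htf). form \<tau> B \<Longrightarrow> \<bar>\<tau>\<bar> ^ Suc (Suc m) * B f f \<le> K * pure B (Suc (Suc m)) f"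
    using frequency_le_pure[where 'n = 'n, of "Suc m"] by blast
  obtain L where L: "L \<ge> 1" "\<And>\<tau> B (f :: 'n htf). form \<tau> B \<Longrightarrow>
    \<bar>\<tau>\<bar> * pure B (Suc m) f \<le> L * pure B (Suc (Suc m)) f + 1 * (\<bar>\<tau>\<bar> ^ Suc (Suc m) * B f f)"
    using frequency_pure[where 'n = 'n, of 1 m] by auto
  define M where "M = C * ?N * ?N * real (Suc (Suc m)) * C * (L + K)"
  have "q B (Suc (Suc m)) f \<le> (2 * (C * ?N / \<epsilon> + M)) * pure B (Suc (Suc m)) f" if B: "form \<tau> B" for \<tau> B and f :: "'n htf"
  proof -
    note S = formD(1)[OF B]
    let ?p = "pure B (Suc (Suc m)) f"
    let ?b = "\<lambda>i. B ((Z i ^^ Suc (Suc m)) f) ((Z i ^^ Suc (Suc m)) f)"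
    let ?Q = "q B (Suc (Suc m)) f"
    have t: "\<bar>\<tau>\<bar> * q B (Suc m) f \<le> C * (L + K) * ?p"
    proof -
      have "\<bar>\<tau>\<bar> * q B (Suc m) f \<le> C * (\<bar>\<tau>\<bar> * pure B (Suc m) f)"
        using mult_left_mono[OF C(2)[OF B, of f], of "\<bar>\<tau>\<bar>"] by (simp add: mult.left_commute del: q.simps)
      also have "\<dots> \<le> C * (L * ?p + K * ?p)"
        using L(2)[OF B, of f] K(2)[OF B, of f] C(1) by (intro mult_left_mono) auto
      finally show ?thesis by (simp add: algebra_simps del: q.simps)
    qed
    have "?Q = (\<Sum>j\<in>UNIV. q B (Suc m) (Z j f))" by simp
    also have "\<dots> \<le> (\<Sum>j\<in>UNIV. C * pure B (Suc m) (Z j f))"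
      by (intro sum_mono C(2)[OF B])
    also have "\<dots> = C * (\<Sum>j\<in>UNIV. \<Sum>i\<in>UNIV. B ((Z i ^^ Suc m) (Z j f)) ((Z i ^^ Suc m) (Z j f)))"
      unfolding pure_def by (simp only: sum_distrib_left)
    also have "\<dots> \<le> C * (\<Sum>j\<in>(UNIV::('n+'n) set). \<Sum>i\<in>UNIV. \<epsilon> * ?Q + ?b i / \<epsilon> + real (Suc (Suc m)) * (\<bar>\<tau>\<bar> * q B (Suc m) f))"
      using C(1) by (intro mult_left_mono sum_mono mixed_word_bound[OF B e]) auto
    also have "\<dots> = C * (?N * (?N * (\<epsilon> * ?Q) + ?p / \<epsilon> + ?N * (real (Suc (Suc m)) * (\<bar>\<tau>\<bar> * q B (Suc m) f))))"
      unfolding pure_def by (simp only: sum.distrib sum_constant sum_divide_distrib distrib_left)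
    also have "\<dots> = ?Q / 2 + C * ?N / \<epsilon> * ?p + C * ?N * ?N * real (Suc (Suc m)) * (\<bar>\<tau>\<bar> * q B (Suc m) f)"
    proof -
      have "C * ?N * ?N * \<epsilon> = 1/2" using N C by (simp add: \<epsilon>_def)
      then have "C * (?N * (?N * (\<epsilon> * ?Q))) = ?Q / 2" by (simp add: mult.assoc[symmetric] del: q.simps)
      then show ?thesis by (simp add: algebra_simps del: q.simps)
    qed
    also have "\<dots> \<le> ?Q / 2 + C * ?N / \<epsilon> * ?p + C * ?N * ?N * real (Suc (Suc m)) * (C * (L + K) * ?p)"
      using C(1) by (intro add_left_mono mult_left_mono t) auto
    also have "\<dots> = ?Q / 2 + (C * ?N / \<epsilon> + M) * ?p" by (simp add: M_def algebra_simps del: q.simps)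
    finally have "?Q / 2 \<le> (C * ?N / \<epsilon> + M) * ?p" by linarith
    then show ?thesis unfolding mult.assoc by linarith
  qed
  then have "q B (Suc (Suc m)) f \<le> max 1 (2 * (C * ?N / \<epsilon> + M)) * pure B (Suc (Suc m)) f"
    if "form \<tau> B" for \<tau> B and f :: "'n htf"
    using that pure_nonneg[OF formD(1)[OF that]] by (meson max.cobounded2 mult_right_mono order_trans)
  then show ?case by (intro exI[of _ "max 1 (2 * (C * ?N / \<epsilon> + M))"]) auto
qed

section \<open>Fourier decomposition in the central variable\<close>

lemma cc_integrable_pair:
  fixes h :: "'a::euclidean_space \<times> 'b::euclidean_space \<Rightarrow> real"
  assumes "continuous_on UNIV h" "bounded {z. h z \<noteq> 0}"
  shows "integrable (lborel \<Otimes>\<^sub>M lborel) h"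
  unfolding lborel_prod using assms by (rule integrable_compact_supp)

lemma cc_swap:
  fixes h :: "'a::euclidean_space \<times> 'b::euclidean_space \<Rightarrow> real"
  assumes "continuous_on UNIV h" "bounded {z. h z \<noteq> 0}"
  shows "(\<integral>y. (\<integral>x. h (x, y) \<partial>lborel) \<partial>lborel) = (\<integral>x. (\<integral>y. h (x, y) \<partial>lborel) \<partial>lborel)"
  using lborel_pair.Fubini_integral[of "\<lambda>x y. h (x, y)"] cc_integrable_pair[OF assms] by simp

lemma bounded_abs_le: "bounded {r :: real. \<bar>r\<bar> \<le> R}"
  unfolding bounded_iff by (rule exI[of _ R]) auto

text \<open>The Wiener-Khinchin identity: the transform of an autocorrelation is the squared modulus
  of the transform, here as cosine and sine parts. It follows from Fubini and the addition formula
  for the cosine of \<tau> (r - s).\<close>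

lemma autocorrelation_transform:
  fixes \<phi> :: "real \<Rightarrow> real"
  assumes c: "continuous_on UNIV \<phi>" and R: "\<And>s. \<phi> s \<noteq> 0 \<Longrightarrow> \<bar>s\<bar> \<le> R"
  shows "(\<integral>r. cos (\<tau> * r) * (\<integral>s. \<phi> s * \<phi> (s + r) \<partial>lborel) \<partial>lborel)
    = (\<integral>s. cos (\<tau> * s) * \<phi> s \<partial>lborel)\<^sup>2 + (\<integral>s. sin (\<tau> * s) * \<phi> s \<partial>lborel)\<^sup>2"
proof -
  define C where "C = (\<integral>s. cos (\<tau> * s) * \<phi> s \<partial>lborel)"
  define S where "S = (\<integral>s. sin (\<tau> * s) * \<phi> s \<partial>lborel)"
  have c2 [continuous_intros]: "continuous_on X (\<lambda>x. \<phi> (g x))" if "continuous_on X g" for X and g :: "'x::topological_space \<Rightarrow> real"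
    using continuous_on_compose2[OF c that] by auto
  have b: "bounded {s. \<phi> s \<noteq> 0}"
    by (rule bounded_subset[OF bounded_abs_le[of R]]) (use R in auto)
  have int: "integrable lborel (\<lambda>s. h s * \<phi> s)" if "continuous_on UNIV h" for h :: "real \<Rightarrow> real"
    by (rule integrable_compact_supp) (auto intro!: continuous_intros that c intro: bounded_subset[OF b])
  have "(\<integral>r. cos (\<tau> * r) * (\<integral>s. \<phi> s * \<phi> (s + r) \<partial>lborel) \<partial>lborel)
      = (\<integral>r. (\<integral>s. (\<lambda>(s, r). cos (\<tau> * r) * \<phi> s * \<phi> (s + r)) (s, r) \<partial>lborel) \<partial>lborel)"
    by (simp add: mult.assoc)
  also have "\<dots> = (\<integral>s. (\<integral>r. (\<lambda>(s, r). cos (\<tau> * r) * \<phi> s * \<phi> (s + r)) (s, r) \<partial>lborel) \<partial>lborel)"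
  proof (rule cc_swap)
    show "continuous_on UNIV (\<lambda>(s, r). cos (\<tau> * r) * \<phi> s * \<phi> (s + r))"
      unfolding case_prod_beta by (intro continuous_intros)
    have "\<bar>s\<bar> \<le> R \<and> \<bar>r\<bar> \<le> 2 * R" if "cos (\<tau> * r) * \<phi> s * \<phi> (s + r) \<noteq> 0" for s r
      using that R[of s] R[of "s + r"] by auto
    then have "{z. (\<lambda>(s, r). cos (\<tau> * r) * \<phi> s * \<phi> (s + r)) z \<noteq> 0} \<subseteq> {s. \<bar>s\<bar> \<le> R} \<times> {r. \<bar>r\<bar> \<le> 2 * R}"
      by auto
    then show "bounded {z. (\<lambda>(s, r). cos (\<tau> * r) * \<phi> s * \<phi> (s + r)) z \<noteq> 0}"
      by (rule bounded_subset[rotated]) (intro bounded_Times bounded_abs_le)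
  qed
  also have "\<dots> = (\<integral>s. C * (cos (\<tau> * s) * \<phi> s) + S * (sin (\<tau> * s) * \<phi> s) \<partial>lborel)"
  proof (rule Bochner_Integration.integral_cong[OF refl])
    fix s
    have "(\<integral>r. cos (\<tau> * r) * \<phi> (s + r) \<partial>lborel) = (\<integral>r. (\<lambda>r. cos (\<tau> * (r - s)) * \<phi> r) (r + s) \<partial>lborel)"
      by (simp add: add.commute)
    also have "\<dots> = (\<integral>r. cos (\<tau> * (r - s)) * \<phi> r \<partial>lborel)"
      by (rule lborel_integral_translate) (intro borel_measurable_continuous_onI continuous_intros c)
    also have "\<dots> = (\<integral>r. cos (\<tau> * s) * (cos (\<tau> * r) * \<phi> r) + sin (\<tau> * s) * (sin (\<tau> * r) * \<phi> r) \<partial>lborel)"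
      by (rule Bochner_Integration.integral_cong) (auto simp: right_diff_distrib cos_diff algebra_simps)
    also have "\<dots> = cos (\<tau> * s) * C + sin (\<tau> * s) * S"
      unfolding C_def S_def by (subst Bochner_Integration.integral_add) (auto intro!: int continuous_intros)
    finally have "(\<integral>r. cos (\<tau> * r) * \<phi> (s + r) \<partial>lborel) = cos (\<tau> * s) * C + sin (\<tau> * s) * S" .
    moreover have "(\<integral>r. (\<lambda>(s, r). cos (\<tau> * r) * \<phi> s * \<phi> (s + r)) (s, r) \<partial>lborel) = (\<integral>r. \<phi> s * (cos (\<tau> * r) * \<phi> (s + r)) \<partial>lborel)"
      by (simp add: ac_simps)
    ultimately show "(\<integral>r. (\<lambda>(s, r). cos (\<tau> * r) * \<phi> s * \<phi> (s + r)) (s, r) \<partial>lborel)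
        = C * (cos (\<tau> * s) * \<phi> s) + S * (sin (\<tau> * s) * \<phi> s)"
      by (simp add: algebra_simps)
  qed
  also have "\<dots> = C * C + S * S"
    by (subst Bochner_Integration.integral_add) (auto intro!: int continuous_intros simp: C_def S_def)
  finally show ?thesis by (simp add: C_def S_def power2_eq_square)
qed

text \<open>A window along the central axis. With it one can integrate over the whole space where
  the quotient by the centre would be natural.\<close>

definition hat :: "real \<Rightarrow> real" where "hat x = max 0 (1 - \<bar>x\<bar>)"

lemma continuous_hat [continuous_intros]: "continuous_on X g \<Longrightarrow> continuous_on X (\<lambda>x. hat (g x))"
  unfolding hat_def by (intro continuous_intros)

lemma hat_nonneg: "hat x \<ge> 0" by (simp add: hat_def)

lemma hat_support: "hat x \<noteq> 0 \<Longrightarrow> \<bar>x\<bar> \<le> 1" by (auto simp: hat_def max_def split: if_splits)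

lemma integrable_hat: "integrable lborel hat"
  using continuous_hat[OF continuous_on_id, of UNIV] bounded_subset[OF bounded_abs_le[of 1], of "{x. hat x \<noteq> 0}"] hat_support
  by (intro integrable_compact_supp) auto

lemma integral_hat_pos: "(\<integral>x. hat x \<partial>lborel) > 0"
proof -
  have "(\<integral>x. (1/2) * indicat_real {-1/2..1/2::real} x \<partial>lborel) \<le> (\<integral>x. hat x \<partial>lborel)"
  proof (rule Bochner_Integration.integral_mono)
    show "integrable lborel (\<lambda>x. (1/2) * indicat_real {-1/2..1/2::real} x)"
      by (intro integrable_mult_right integrable_real_indicator) auto
  qed (auto simp: integrable_hat, auto simp: hat_def indicator_def)
  then show ?thesis by simp
qed

lemma integral_hat_reflect: "(\<integral>s. hat (a - s) \<partial>lborel) = (\<integral>x. hat x \<partial>lborel)"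
  using lborel_integral_real_affine[of "-1" hat a] by simp

text \<open>Shifting \<open>h\<close> back along \<open>e\<close> shifts the window instead, and at
  a fixed point the integral of the shifted window over all \<open>s\<close> is that of
  \<open>hat\<close>.\<close>

lemma window:
  fixes h :: "'a::euclidean_space \<Rightarrow> real"
  assumes e: "norm e = 1" and c: "continuous_on UNIV h" and R: "\<And>z. h z \<noteq> 0 \<Longrightarrow> norm z \<le> R"
  shows "(\<integral>s. (\<integral>z. hat (z \<bullet> e) * h (z + s *\<^sub>R e) \<partial>lborel) \<partial>lborel) = (\<integral>x. hat x \<partial>lborel) * (\<integral>z. h z \<partial>lborel)"
proof -
  have c2 [continuous_intros]: "continuous_on X (\<lambda>x. h (g x))" if "continuous_on X g" for X and g :: "'x::topological_space \<Rightarrow> 'a"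
    using continuous_on_compose2[OF c that] by auto
  have ee: "e \<bullet> e = 1" using e by (simp add: norm_eq_1)
  have "(\<integral>z. hat (z \<bullet> e) * h (z + s *\<^sub>R e) \<partial>lborel) = (\<integral>z. hat (z \<bullet> e - s) * h z \<partial>lborel)" for s
  proof -
    have "(\<integral>z. (\<lambda>z. hat (z \<bullet> e - s) * h z) (z + s *\<^sub>R e) \<partial>lborel) = (\<integral>z. hat (z \<bullet> e - s) * h z \<partial>lborel)"
      by (rule lborel_integral_translate) (intro borel_measurable_continuous_onI continuous_intros c)
    then show ?thesis by (simp add: inner_add_left ee)
  qed
  then have "(\<integral>s. (\<integral>z. hat (z \<bullet> e) * h (z + s *\<^sub>R e) \<partial>lborel) \<partial>lborel)
      = (\<integral>s. (\<integral>z. (\<lambda>(z, s). hat (z \<bullet> e - s) * h z) (z, s) \<partial>lborel) \<partial>lborel)" by simp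
  also have "\<dots> = (\<integral>z. (\<integral>s. (\<lambda>(z, s). hat (z \<bullet> e - s) * h z) (z, s) \<partial>lborel) \<partial>lborel)"
  proof (rule cc_swap)
    show "continuous_on UNIV (\<lambda>(z, s). hat (z \<bullet> e - s) * h z)"
      unfolding case_prod_beta by (intro continuous_intros)
    have "norm z \<le> R \<and> \<bar>s\<bar> \<le> R + 1" if "hat (z \<bullet> e - s) * h z \<noteq> 0" for z s
    proof -
      have "norm z \<le> R" "\<bar>z \<bullet> e - s\<bar> \<le> 1" using that R hat_support by auto
      moreover have "\<bar>z \<bullet> e\<bar> \<le> norm z" using Cauchy_Schwarz_ineq2[of z e] e by simp
      ultimately show ?thesis by linarith
    qed
    then have "{p. (\<lambda>(z, s). hat (z \<bullet> e - s) * h z) p \<noteq> 0} \<subseteq> cball 0 R \<times> {s. \<bar>s\<bar> \<le> R + 1}"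
      by auto
    then show "bounded {p. (\<lambda>(z, s). hat (z \<bullet> e - s) * h z) p \<noteq> 0}"
      by (rule bounded_subset[rotated]) (intro bounded_Times bounded_abs_le bounded_cball)
  qed
  also have "\<dots> = (\<integral>z. (\<integral>x. hat x \<partial>lborel) * h z \<partial>lborel)"
    by (simp add: integral_hat_reflect)
  finally show ?thesis by simp
qed

text \<open>The real part of the product of the partial Fourier transforms of \<open>f\<close> and
  \<open>g\<close> at frequency \<tau> in the central variable. Expressed through translations, it
  stays within real functions and leaves the coordinates of the space unsplit.\<close>

definition freq :: "real \<Rightarrow> 'n::finite htf \<Rightarrow> 'n htf \<Rightarrow> real" where
  "freq \<tau> f g = (\<integral>r. cos (\<tau> * r) * (f \<bullet> tr (r *\<^sub>R et) g) \<partial>lborel)"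

lemma norm_et: "norm (et :: 'n::finite heis) = 1" by (simp add: norm_prod_def)

lemma freq_integrable:
  assumes "continuous_on UNIV h"
  shows "integrable lborel (\<lambda>r. h r * (f \<bullet> tr (r *\<^sub>R et) g))"
proof -
  obtain R where "\<And>r. \<bar>r\<bar> > R \<Longrightarrow> f \<bullet> tr (r *\<^sub>R et) g = 0" using tr_inner_support[OF norm_et, of f g] by metis
  then have "{r. h r * (f \<bullet> tr (r *\<^sub>R et) g) \<noteq> 0} \<subseteq> {r. \<bar>r\<bar> \<le> R}" by force
  then have "bounded {r. h r * (f \<bullet> tr (r *\<^sub>R et) g) \<noteq> 0}" by (rule bounded_subset[OF bounded_abs_le])
  then show ?thesis
    by (intro integrable_compact_supp continuous_intros assms tr_inner_continuous)
qed

text \<open>Once the window is inserted, Fubini leaves for each base point the autocorrelation of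
  \<open>f\<close> along the central line through it, and its transform is a sum of two
  squares.\<close>

lemma freq_nonneg: "0 \<le> freq \<tau> f f"
proof -
  obtain R where R: "R > 0" "\<And>z. app f z \<noteq> 0 \<Longrightarrow> norm z \<le> R" using app_support_radius[of f] by metis
  define c where "c = (\<integral>x. hat x \<partial>lborel)"
  \<comment> \<open>The integrand common to all orders of integration: base point \<open>z\<close>,
    lag \<open>r\<close>, position \<open>s\<close> on the line.\<close>
  define k where "k = (\<lambda>(z :: 'a heis, r, s). cos (\<tau> * r) * hat (z \<bullet> et) * (app f (z + s *\<^sub>R et) * app f (z + s *\<^sub>R et + r *\<^sub>R et)))"
  have cf [continuous_intros]: "continuous_on X (\<lambda>x. app f (g x))" if "continuous_on X g" for X and g :: "'x::topological_space \<Rightarrow> 'a heis"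
    using continuous_on_compose2[OF continuous_app[of UNIV] that] by auto
  have et: "norm (s *\<^sub>R (et :: 'a heis)) = \<bar>s\<bar>" for s by (simp only: norm_scaleR norm_et; simp)
  have b: "\<bar>s\<bar> \<le> R + 1 \<and> \<bar>r\<bar> \<le> 2 * R \<and> norm z \<le> 2 * R + 1"
    if "cos (\<tau> * r) * hat (z \<bullet> et) * (app f (z + s *\<^sub>R et) * app f (z + s *\<^sub>R et + r *\<^sub>R et)) \<noteq> 0" for z r s
  proof -
    have "hat (z \<bullet> et) \<noteq> 0 \<and> app f (z + s *\<^sub>R et) \<noteq> 0 \<and> app f (z + s *\<^sub>R et + r *\<^sub>R et) \<noteq> 0"
      using that unfolding mult_eq_0_iff by blast
    then have 1: "norm (z + s *\<^sub>R et) \<le> R" "norm (z + s *\<^sub>R et + r *\<^sub>R et) \<le> R" "\<bar>z \<bullet> et\<bar> \<le> 1"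
      using R(2) hat_support by blast+
    have ee: "(et :: 'a heis) \<bullet> et = 1" using norm_et by (simp add: norm_eq_1)
    have "\<bar>(z + s *\<^sub>R et) \<bullet> et\<bar> \<le> R"
      using Cauchy_Schwarz_ineq2[of "z + s *\<^sub>R et" et] 1 by (simp only: norm_et)
    then have s: "\<bar>s\<bar> \<le> R + 1" using 1(3) unfolding inner_add_left inner_scaleR_left ee by linarith
    have "\<bar>r\<bar> \<le> 2 * R" using 1 norm_triangle_ineq4[of "z + s *\<^sub>R et + r *\<^sub>R et" "z + s *\<^sub>R et"]
      unfolding add_diff_cancel_left' et by linarith
    moreover have "norm z \<le> 2 * R + 1" using 1 s norm_triangle_ineq4[of "z + s *\<^sub>R et" "s *\<^sub>R et"]
      unfolding add_diff_cancel_right' et by linarith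
    ultimately show ?thesis using s by simp
  qed
  have kc: "continuous_on UNIV k" unfolding k_def case_prod_beta by (intro continuous_intros)
  have kb: "bounded {p. k p \<noteq> 0}"
  proof (rule bounded_subset)
    show "{p. k p \<noteq> 0} \<subseteq> cball 0 (2 * R + 1) \<times> {r. \<bar>r\<bar> \<le> 2 * R} \<times> {s. \<bar>s\<bar> \<le> R + 1}"
      using b unfolding k_def by (auto simp only: mem_Times_iff mem_cball_0 mem_Collect_eq split_paired_all case_prod_conv fst_conv snd_conv)
  qed (intro bounded_Times bounded_cball bounded_abs_le)
  have kzc: "continuous_on UNIV (\<lambda>p. k (z, p))" for z
    by (rule continuous_on_compose2[OF kc]) (auto intro!: continuous_intros)
  have kzb: "bounded {p. k (z, p) \<noteq> 0}" for z
  proof (rule bounded_subset)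
    show "{p. k (z, p) \<noteq> 0} \<subseteq> snd ` {p. k p \<noteq> 0}" by force
  qed (intro bounded_snd kb)
  have "c * freq \<tau> f f = (\<integral>r. cos (\<tau> * r) * (c * (\<integral>z. app f z * app f (z + r *\<^sub>R et) \<partial>lborel)) \<partial>lborel)"
    unfolding freq_def inner_tf_def
    by (simp add: app_tr integral_mult_right_zero[symmetric] mult.left_commute del: integral_mult_right_zero scaleR_Pair)
  also have "\<dots> = (\<integral>r. cos (\<tau> * r) * (\<integral>s. (\<integral>z. hat (z \<bullet> et) * (app f (z + s *\<^sub>R et) * app f (z + s *\<^sub>R et + r *\<^sub>R et)) \<partial>lborel) \<partial>lborel) \<partial>lborel)"
    unfolding c_def
    by (subst window[OF norm_et, where R = R, symmetric]) (use R in \<open>auto intro!: continuous_intros\<close>)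
  also have "\<dots> = (\<integral>r. (\<integral>s. (\<integral>z. k (z, r, s) \<partial>lborel) \<partial>lborel) \<partial>lborel)"
    unfolding k_def case_prod_conv mult.assoc integral_mult_right_zero ..
  also have "\<dots> = (\<integral>p. (\<integral>z. k (z, p) \<partial>lborel) \<partial>(lborel \<Otimes>\<^sub>M lborel))"
  proof -
    have "integrable lborel (\<lambda>p. \<integral>z. k (z, p) \<partial>lborel)"
      using cc_integrable_pair[OF kc kb] by (intro lborel_pair.integrable_snd) simp
    then have "integrable (lborel \<Otimes>\<^sub>M lborel) (\<lambda>p. \<integral>z. k (z, p) \<partial>lborel)" by (simp add: lborel_prod)
    from lborel_pair.integral_fst'[OF this] show ?thesis by simp
  qed
  also have "\<dots> = (\<integral>p. (\<integral>z. k (z, p) \<partial>lborel) \<partial>lborel)" by (simp add: lborel_prod)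
  also have "\<dots> = (\<integral>z. (\<integral>p. k (z, p) \<partial>lborel) \<partial>lborel)"
    by (rule cc_swap[OF kc kb])
  also have "\<dots> = (\<integral>z. (\<integral>r. (\<integral>s. k (z, r, s) \<partial>lborel) \<partial>lborel) \<partial>lborel)"
  proof (rule Bochner_Integration.integral_cong[OF refl])
    fix z
    show "(\<integral>p. k (z, p) \<partial>lborel) = (\<integral>r. (\<integral>s. k (z, r, s) \<partial>lborel) \<partial>lborel)"
      using lborel_pair.integral_fst'[OF cc_integrable_pair[OF kzc kzb, of z]] by (simp add: lborel_prod)
  qed
  also have "\<dots> = (\<integral>z. hat (z \<bullet> et) * ((\<integral>s. cos (\<tau> * s) * app f (z + s *\<^sub>R et) \<partial>lborel)\<^sup>2 + (\<integral>s. sin (\<tau> * s) * app f (z + s *\<^sub>R et) \<partial>lborel)\<^sup>2) \<partial>lborel)"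
  proof (rule Bochner_Integration.integral_cong[OF refl])
    fix z :: "'a heis"
    have "(\<integral>r. (\<integral>s. k (z, r, s) \<partial>lborel) \<partial>lborel)
      = hat (z \<bullet> et) * (\<integral>r. cos (\<tau> * r) * (\<integral>s. app f (z + s *\<^sub>R et) * app f (z + (s + r) *\<^sub>R et) \<partial>lborel) \<partial>lborel)"
      unfolding k_def case_prod_conv mult.assoc mult.left_commute[of "cos _" "hat _"] scaleR_add_left add.assoc integral_mult_right_zero ..
    also have "(\<integral>r. cos (\<tau> * r) * (\<integral>s. app f (z + s *\<^sub>R et) * app f (z + (s + r) *\<^sub>R et) \<partial>lborel) \<partial>lborel)
      = (\<integral>s. cos (\<tau> * s) * app f (z + s *\<^sub>R et) \<partial>lborel)\<^sup>2 + (\<integral>s. sin (\<tau> * s) * app f (z + s *\<^sub>R et) \<partial>lborel)\<^sup>2"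
    proof (rule autocorrelation_transform)
      show "\<bar>s\<bar> \<le> R + norm z" if "app f (z + s *\<^sub>R et) \<noteq> 0" for s
        using R(2)[OF that] norm_triangle_ineq4[of "z + s *\<^sub>R et" z] unfolding add_diff_cancel_left' et by linarith
    qed (intro continuous_intros)
    finally show "(\<integral>r. (\<integral>s. k (z, r, s) \<partial>lborel) \<partial>lborel)
      = hat (z \<bullet> et) * ((\<integral>s. cos (\<tau> * s) * app f (z + s *\<^sub>R et) \<partial>lborel)\<^sup>2 + (\<integral>s. sin (\<tau> * s) * app f (z + s *\<^sub>R et) \<partial>lborel)\<^sup>2)" .
  qed
  also have "\<dots> \<ge> 0" by (intro integral_nonneg_AE AE_I2 mult_nonneg_nonneg hat_nonneg add_nonneg_nonneg) auto
  finally show ?thesis using integral_hat_pos by (simp add: c_def zero_le_mult_iff)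
qed

lemma freq_linear: "linear (freq \<tau> f)"
proof (rule linearI)
  fix g h :: "'a htf" and c
  have i: "integrable lborel (\<lambda>r. cos (\<tau> * r) * (f \<bullet> tr (r *\<^sub>R et) g))" for g
    by (intro freq_integrable continuous_intros)
  show "freq \<tau> f (g + h) = freq \<tau> f g + freq \<tau> f h"
    unfolding freq_def by (subst Bochner_Integration.integral_add[OF i i, symmetric]) (simp add: tr_lin inner_add_right distrib_left)
  show "freq \<tau> f (c *\<^sub>R g) = c *\<^sub>R freq \<tau> f g"
    unfolding freq_def by (simp add: tr_lin mult.left_commute[of _ c])
qed

lemma freq_sym: "freq \<tau> f g = freq \<tau> g f"
proof -
  have "freq \<tau> f g = (\<integral>r. cos (\<tau> * - r) * (f \<bullet> tr (- r *\<^sub>R et) g) \<partial>lborel)"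
    unfolding freq_def using lborel_integral_real_affine[of "-1" "\<lambda>r. cos (\<tau> * r) * (f \<bullet> tr (r *\<^sub>R et) g)" 0] by simp
  also have "\<dots> = freq \<tau> g f"
  proof -
    have "f \<bullet> tr (- r *\<^sub>R et) g = g \<bullet> tr (r *\<^sub>R et) f" for r
      using inner_tr[of "r *\<^sub>R et" f g] by (simp add: inner_commute)
    then show ?thesis unfolding freq_def by simp
  qed
  finally show ?thesis .
qed

lemma freq_Z: "freq \<tau> (Z i f) g = - freq \<tau> f (Z i g)"
  unfolding freq_def by (simp only: inner_Z Z_tr mult_minus_right Bochner_Integration.integral_minus)

lemma freq_T: "freq \<tau> (T f) g = - freq \<tau> f (T g)"
  unfolding freq_def by (simp only: inner_T T_tr mult_minus_right Bochner_Integration.integral_minus)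

lemma freq_T_T: "freq \<tau> f (T (T g)) = - (\<tau>\<^sup>2 * freq \<tau> f g)"
proof -
  let ?F = "\<lambda>g r. f \<bullet> tr (r *\<^sub>R et) g"
  obtain R1 where R1: "R1 > 0" "\<And>r. \<bar>r\<bar> > R1 \<Longrightarrow> ?F g r = 0" using tr_inner_support[OF norm_et, of f g] by metis
  obtain R2 where R2: "R2 > 0" "\<And>r. \<bar>r\<bar> > R2 \<Longrightarrow> ?F (T g) r = 0" using tr_inner_support[OF norm_et, of f "T g"] by metis
  obtain R3 where R3: "R3 > 0" "\<And>r. \<bar>r\<bar> > R3 \<Longrightarrow> ?F (T (T g)) r = 0" using tr_inner_support[OF norm_et, of f "T (T g)"] by metis
  define R where "R = R1 + R2 + R3"
  \<comment> \<open>The sine terms cancel in the derivative \<open>G'\<close>. As \<open>G\<close>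
    has compact support, the integral of \<open>G'\<close> vanishes, which amounts to two
    integrations by parts at once.\<close>
  define G where "G = (\<lambda>r. cos (\<tau> * r) * ?F (T g) r + \<tau> * sin (\<tau> * r) * ?F g r)"
  define G' where "G' = (\<lambda>r. cos (\<tau> * r) * ?F (T (T g)) r + \<tau>\<^sup>2 * (cos (\<tau> * r) * ?F g r))"
  have d: "((\<lambda>r. f \<bullet> tr (r *\<^sub>R et) h) has_real_derivative ?F (T h) r) (at r)" for h r
    unfolding T_def by (rule tr_inner_has_derivative)
  have "(\<integral>r. G' r * indicator {-(R + 1) .. R + 1} r \<partial>lborel) = G (R + 1) - G (- (R + 1))"
  proof (rule integral_FTC_Icc_real)
    show "- (R + 1) \<le> R + 1" using R1 R2 R3 by (simp add: R_def)
    show "(G has_real_derivative G' r) (at r)" for r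
      unfolding G_def G'_def
      by (auto intro!: derivative_eq_intros d simp: power2_eq_square algebra_simps simp del: scaleR_Pair)
    show "isCont G' r" for r
    proof -
      have "continuous_on UNIV G'" unfolding G'_def by (intro continuous_intros tr_inner_continuous)
      then show ?thesis by (simp add: continuous_on_eq_continuous_at)
    qed
  qed
  also have "G (R + 1) - G (- (R + 1)) = 0"
    using R1 R2 R3 by (simp add: G_def R_def)
  also have "(\<lambda>r. G' r * indicator {-(R + 1) .. R + 1} r) = G'"
  proof
    fix r
    have "G' r = 0" if "r \<notin> {-(R + 1) .. R + 1}"
    proof -
      have "\<bar>r\<bar> > R + 1" using that by auto
      then have "\<bar>r\<bar> > R1" "\<bar>r\<bar> > R3" using R1(1) R2(1) R3(1) by (simp_all add: R_def)
      then show ?thesis by (simp only: G'_def R1(2) R3(2); simp)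
    qed
    then show "G' r * indicator {-(R + 1) .. R + 1} r = G' r"
      by (cases "r \<in> {-(R + 1) .. R + 1}") simp_all
  qed
  also have "(\<integral>r. G' r \<partial>lborel) = freq \<tau> f (T (T g)) + \<tau>\<^sup>2 * freq \<tau> f g"
    unfolding G'_def freq_def
    by (subst Bochner_Integration.integral_add)
       (auto intro!: freq_integrable integrable_mult_right continuous_intros simp del: scaleR_Pair)
  finally show ?thesis by simp
qed

lemma form_freq: "form \<tau> (freq \<tau>)"
proof -
  have "freq \<tau> (T f) (T g) = \<tau>\<^sup>2 * freq \<tau> f g" for f g :: "'a htf" by (simp only: freq_T freq_T_T; simp)
  then show ?thesis
    unfolding form_def sform_def using freq_linear freq_sym freq_nonneg freq_Z freq_T by blast
qed

section \<open>Recovery of the L2 product from its frequencies\<close>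

lemma gaussian_cos: "(\<integral>\<tau>. std_normal_density \<tau> * cos (t * \<tau>) \<partial>lborel) = exp (- t\<^sup>2 / 2)"
proof -
  have "Re (char std_normal_distribution t) = (\<integral>x. Re (iexp (t * x)) \<partial>std_normal_distribution)"
    unfolding char_def by (rule integral_Re[symmetric]) (intro prob_space.integrable_iexp real_distribution.axioms(1) real_dist_normal_dist; simp)
  also have "\<dots> = (\<integral>x. cos (t * x) \<partial>std_normal_distribution)"
    by (simp add: Re_exp)
  also have "\<dots> = (\<integral>x. std_normal_density x * cos (t * x) \<partial>lborel)"
    by (subst integral_density) auto
  finally show ?thesis by (simp add: char_std_normal_distribution)
qed

text \<open>Gaussian weights in the frequency turn the transforms into integrals of \<open>Q\<close>
  against exp(-(L r)^2 / 2), which stay nonnegative. After rescaling, dominated convergence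
  concentrates them at 0 as L grows.\<close>

lemma nonneg_of_nonneg_transform:
  fixes Q :: "real \<Rightarrow> real"
  assumes c: "continuous_on UNIV Q" and R: "\<And>r. \<bar>r\<bar> > R \<Longrightarrow> Q r = 0"
    and pos: "\<And>\<tau>. 0 \<le> (\<integral>r. cos (\<tau> * r) * Q r \<partial>lborel)"
  shows "0 \<le> Q 0"
proof -
  have [measurable]: "Q \<in> borel_measurable borel" by (intro borel_measurable_continuous_onI c)
  have b: "bounded {r. Q r \<noteq> 0}"
    by (rule bounded_subset[OF bounded_abs_le[of R]]) (use R in force)
  have iQ: "integrable lborel Q" by (rule integrable_compact_supp[OF c b])
  have "compact (Q ` {-\<bar>R\<bar>..\<bar>R\<bar>})"
    by (intro compact_continuous_image continuous_on_subset[OF c]) auto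
  then have "bounded (Q ` {-\<bar>R\<bar>..\<bar>R\<bar>})" by (rule compact_imp_bounded)
  then obtain M where "\<forall>y\<in>Q ` {-\<bar>R\<bar>..\<bar>R\<bar>}. norm y \<le> M" unfolding bounded_iff by blast
  then have M: "\<And>r. r \<in> {-\<bar>R\<bar>..\<bar>R\<bar>} \<Longrightarrow> \<bar>Q r\<bar> \<le> M" by auto
  have Mb: "\<bar>Q r\<bar> \<le> \<bar>M\<bar>" for r
  proof (cases "\<bar>r\<bar> > \<bar>R\<bar>")
    case True
    then show ?thesis using R[of r] by simp
  next
    case False
    then have "r \<in> {-\<bar>R\<bar>..\<bar>R\<bar>}" by auto
    then show ?thesis using M[of r] by linarith
  qed
  have gauss: "0 \<le> (\<integral>r. Q r * exp (- (L * r)\<^sup>2 / 2) \<partial>lborel)" for L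
  proof -
    let ?h = "\<lambda>\<tau> r. std_normal_density \<tau> * (cos ((L * \<tau>) * r) * Q r)"
    have int: "integrable (lborel \<Otimes>\<^sub>M lborel) (case_prod ?h)"
    proof (rule lborel_pair.Fubini_integrable)
      show "integrable lborel (\<lambda>\<tau>. \<integral>r. norm (case_prod ?h (\<tau>, r)) \<partial>lborel)"
      proof (rule Bochner_Integration.integrable_bound)
        show "integrable lborel (\<lambda>\<tau>. std_normal_density \<tau> * (\<integral>r. \<bar>Q r\<bar> \<partial>lborel))" by simp
        show "AE \<tau> in lborel. norm (\<integral>r. norm (case_prod ?h (\<tau>, r)) \<partial>lborel) \<le> norm (std_normal_density \<tau> * (\<integral>r. \<bar>Q r\<bar> \<partial>lborel))"
        proof (rule AE_I2)
          fix \<tau> :: real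
          have "(\<integral>r. norm (case_prod ?h (\<tau>, r)) \<partial>lborel) \<le> (\<integral>r. std_normal_density \<tau> * \<bar>Q r\<bar> \<partial>lborel)"
          proof (rule integral_mono')
            show "integrable lborel (\<lambda>r. std_normal_density \<tau> * \<bar>Q r\<bar>)" using iQ by auto
            show "norm (case_prod ?h (\<tau>, r)) \<le> std_normal_density \<tau> * \<bar>Q r\<bar>" for r
              using mult_right_mono[OF abs_cos_le_one[of "L * \<tau> * r"], of "\<bar>Q r\<bar>"]
              by (simp add: abs_mult mult_left_mono)
          qed auto
          moreover have "0 \<le> (\<integral>r. norm (case_prod ?h (\<tau>, r)) \<partial>lborel)" by (rule integral_nonneg_AE) auto
          moreover have "0 \<le> (\<integral>r. \<bar>Q r\<bar> \<partial>lborel)" by (rule integral_nonneg_AE) auto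
          ultimately show "norm (\<integral>r. norm (case_prod ?h (\<tau>, r)) \<partial>lborel) \<le> norm (std_normal_density \<tau> * (\<integral>r. \<bar>Q r\<bar> \<partial>lborel))"
            by simp
        qed
      qed measurable
      show "AE \<tau> in lborel. integrable lborel (\<lambda>r. case_prod ?h (\<tau>, r))"
      proof (rule AE_I2)
        fix \<tau> :: real
        have "integrable lborel (\<lambda>r. cos ((L * \<tau>) * r) * Q r)"
          by (rule integrable_compact_supp) (auto intro!: continuous_intros c intro: bounded_subset[OF b])
        then show "integrable lborel (\<lambda>r. case_prod ?h (\<tau>, r))" by simp
      qed
    qed measurable
    have "0 \<le> (\<integral>\<tau>. std_normal_density \<tau> * (\<integral>r. cos ((L * \<tau>) * r) * Q r \<partial>lborel) \<partial>lborel)"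
      by (intro integral_nonneg_AE AE_I2 mult_nonneg_nonneg pos) auto
    also have "\<dots> = (\<integral>\<tau>. (\<integral>r. ?h \<tau> r \<partial>lborel) \<partial>lborel)" by simp
    also have "\<dots> = (\<integral>r. (\<integral>\<tau>. ?h \<tau> r \<partial>lborel) \<partial>lborel)"
      by (rule lborel_pair.Fubini_integral[OF int, symmetric])
    also have "\<dots> = (\<integral>r. Q r * exp (- (L * r)\<^sup>2 / 2) \<partial>lborel)"
    proof (rule Bochner_Integration.integral_cong[OF refl])
      fix r
      have "(\<integral>\<tau>. ?h \<tau> r \<partial>lborel) = (\<integral>\<tau>. Q r * (std_normal_density \<tau> * cos ((L * r) * \<tau>)) \<partial>lborel)"
        by (rule Bochner_Integration.integral_cong) (auto simp: ac_simps)
      also have "\<dots> = Q r * exp (- (L * r)\<^sup>2 / 2)" using gaussian_cos[of "L * r"] by simp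
      finally show "(\<integral>\<tau>. ?h \<tau> r \<partial>lborel) = Q r * exp (- (L * r)\<^sup>2 / 2)" .
    qed
    finally show ?thesis .
  qed
  have scaled: "0 \<le> (\<integral>s. Q (s / real (Suc m)) * exp (- s\<^sup>2 / 2) \<partial>lborel)" for m
  proof -
    have "0 \<le> \<bar>1 / real (Suc m)\<bar> *\<^sub>R (\<integral>s. Q (0 + 1 / real (Suc m) * s) * exp (- (real (Suc m) * (0 + 1 / real (Suc m) * s))\<^sup>2 / 2) \<partial>lborel)"
      using gauss[of "real (Suc m)"]
      by (subst (asm) lborel_integral_real_affine[of "1 / real (Suc m)" _ 0]) auto
    then show ?thesis by (simp add: zero_le_divide_iff)
  qed
  have ie: "integrable lborel (\<lambda>s::real. exp (- s\<^sup>2 / 2))"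
  proof -
    have "integrable lborel (\<lambda>s. sqrt (2 * pi) * std_normal_density s)" by simp
    then show ?thesis by (simp add: std_normal_density_def)
  qed
  have "(\<lambda>m. \<integral>s. Q (s / real (Suc m)) * exp (- s\<^sup>2 / 2) \<partial>lborel) \<longlonglongrightarrow> (\<integral>s. Q 0 * exp (- s\<^sup>2 / 2) \<partial>lborel)"
  proof (rule integral_dominated_convergence[where w = "\<lambda>s. \<bar>M\<bar> * exp (- s\<^sup>2 / 2)"])
    show "integrable lborel (\<lambda>s. \<bar>M\<bar> * exp (- s\<^sup>2 / 2))" using ie by simp
    show "AE s in lborel. (\<lambda>m. Q (s / real (Suc m)) * exp (- s\<^sup>2 / 2)) \<longlonglongrightarrow> Q 0 * exp (- s\<^sup>2 / 2)"
    proof (intro AE_I2 tendsto_intros)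
      fix s :: real
      have "(\<lambda>m. s / real (Suc m)) \<longlonglongrightarrow> 0"
        using tendsto_mult_right[OF LIMSEQ_Suc[OF lim_1_over_n], of s] by (simp add: divide_inverse mult.commute)
      moreover have "isCont Q 0" using c by (simp add: continuous_on_eq_continuous_at)
      ultimately show "(\<lambda>m. Q (s / real (Suc m))) \<longlonglongrightarrow> Q 0" by (rule isCont_tendsto_compose[rotated])
    qed
    show "AE s in lborel. norm (Q (s / real (Suc m)) * exp (- s\<^sup>2 / 2)) \<le> \<bar>M\<bar> * exp (- s\<^sup>2 / 2)" for m
      using Mb by (auto simp: abs_mult mult_right_mono)
  qed measurable
  then have "0 \<le> (\<integral>s. Q 0 * exp (- s\<^sup>2 / 2) \<partial>lborel)"
    by (rule LIMSEQ_le_const) (use scaled in auto)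
  then have "0 \<le> Q 0 * (\<integral>s. exp (- s\<^sup>2 / 2) \<partial>lborel)" by simp
  moreover have "(\<integral>s. exp (- (s::real)\<^sup>2 / 2) \<partial>lborel) > 0"
  proof -
    have "(\<integral>s. exp (- (s::real)\<^sup>2 / 2) \<partial>lborel) = sqrt (2 * pi) * (\<integral>s. std_normal_density s \<partial>lborel)"
      by (subst integral_mult_right_zero[symmetric]) (simp add: std_normal_density_def)
    then show ?thesis using gaussian_cos[of 0] by simp
  qed
  ultimately show ?thesis by (simp add: zero_le_mult_iff)
qed

text \<open>The form is an argument, so that one and the same combination can be read at each
  frequency and for the L2 product.\<close>

definition evalc :: "(real \<times> 'v \<times> 'v) list \<Rightarrow> ('v \<Rightarrow> 'v \<Rightarrow> real) \<Rightarrow> real" where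
  "evalc L B = sum_list (map (\<lambda>(c, f, g). c * B f g) L)"

text \<open>Averaging \<open>freq \<tau>\<close> over \<open>\<tau>\<close> with Gaussian weights gives an approximate identity in the
  translation parameter at \<open>0\<close>, where the integrand is the \<open>L\<^sup>2\<close> product.\<close>

lemma transfer_nonneg:
  assumes "\<And>\<tau>. 0 \<le> evalc L (freq \<tau>)"
  shows "0 \<le> evalc L (\<lambda>f g :: 'n::finite htf. f \<bullet> g)"
proof -
  define Q where "Q r = evalc L (\<lambda>f g. f \<bullet> tr (r *\<^sub>R et) g)" for r
  have c: "continuous_on UNIV (\<lambda>r. evalc L (\<lambda>f g. f \<bullet> tr (r *\<^sub>R et) g))" for L :: "(real \<times> 'n htf \<times> 'n htf) list"
    by (induction L) (auto simp: evalc_def intro!: continuous_intros tr_inner_continuous simp del: scaleR_Pair)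
  have R: "\<exists>R. \<forall>r. \<bar>r\<bar> > R \<longrightarrow> evalc L (\<lambda>f g. f \<bullet> tr (r *\<^sub>R et) g) = 0" for L :: "(real \<times> 'n htf \<times> 'n htf) list"
  proof (induction L)
    case (Cons x L)
    obtain c f g where x: "x = (c, f, g)" by (cases x)
    obtain R1 where "\<forall>r. \<bar>r\<bar> > R1 \<longrightarrow> evalc L (\<lambda>f g. f \<bullet> tr (r *\<^sub>R et) g) = 0" using Cons by blast
    moreover obtain R2 where "\<And>r. \<bar>r\<bar> > R2 \<Longrightarrow> f \<bullet> tr (r *\<^sub>R et) g = 0" using tr_inner_support[OF norm_et, of f g] by metis
    ultimately show ?case by (intro exI[of _ "max R1 R2"]) (auto simp: evalc_def x simp del: scaleR_Pair)
  qed (simp add: evalc_def)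
  have t: "integrable lborel (\<lambda>r. cos (\<tau> * r) * evalc L (\<lambda>f g. f \<bullet> tr (r *\<^sub>R et) g)) \<and>
     (\<integral>r. cos (\<tau> * r) * evalc L (\<lambda>f g. f \<bullet> tr (r *\<^sub>R et) g) \<partial>lborel) = evalc L (freq \<tau>)" for \<tau> and L :: "(real \<times> 'n htf \<times> 'n htf) list"
  proof (induction L)
    case (Cons x L)
    obtain c f g where x: "x = (c, f, g)" by (cases x)
    have i: "integrable lborel (\<lambda>r. c * (cos (\<tau> * r) * (f \<bullet> tr (r *\<^sub>R et) g)))"
      by (intro integrable_mult_right freq_integrable continuous_intros)
    have "cos (\<tau> * r) * evalc (x # L) (\<lambda>f g. f \<bullet> tr (r *\<^sub>R et) g)
      = c * (cos (\<tau> * r) * (f \<bullet> tr (r *\<^sub>R et) g)) + cos (\<tau> * r) * evalc L (\<lambda>f g. f \<bullet> tr (r *\<^sub>R et) g)" for r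
      by (simp only: evalc_def x list.map sum_list.Cons case_prod_conv) (simp only: algebra_simps)
    moreover have "evalc (x # L) (freq \<tau>) = c * freq \<tau> f g + evalc L (freq \<tau>)"
      by (simp add: evalc_def x)
    ultimately show ?case
      using Bochner_Integration.integral_add[OF i conjunct1[OF Cons]] Bochner_Integration.integrable_add[OF i conjunct1[OF Cons]] Cons
      unfolding freq_def by (simp only: integral_mult_right_zero)
  qed (simp add: evalc_def)
  obtain R where R: "\<And>r. \<bar>r\<bar> > R \<Longrightarrow> Q r = 0" using R[of L] by (auto simp: Q_def)
  have pos: "0 \<le> (\<integral>r. cos (\<tau> * r) * Q r \<partial>lborel)" for \<tau> using t[of \<tau> L] assms by (simp add: Q_def)
  have "continuous_on UNIV Q" using c[of L] by (simp add: Q_def[abs_def])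
  then have "0 \<le> Q 0" by (rule nonneg_of_nonneg_transform[OF _ R pos])
  then show ?thesis by (simp add: Q_def tr_0 zero_prod_def[symmetric])
qed

section \<open>Square-integrable estimates for test functions\<close>

abbreviation ip :: "'n::finite htf \<Rightarrow> 'n htf \<Rightarrow> real" where "ip \<equiv> (\<lambda>f g. f \<bullet> g)"

lemma sform_ip: "sform (ip :: 'n::finite htf \<Rightarrow> _)"
  by (auto simp: sform_def inner_commute intro!: linearI inner_add_right inner_scaleR_right)

text \<open>Averaging over frequencies respects exactly what is linear in the form. An inequality
  between two such functionals, whatever operators occur inside, passes from all
  \<open>freq \<tau>\<close> to L2.\<close>

definition repr :: "((('v \<Rightarrow> 'v \<Rightarrow> real)) \<Rightarrow> real) \<Rightarrow> bool" where
  "repr K \<longleftrightarrow> (\<exists>L. \<forall>B. K B = evalc L B)"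

lemma repr_single: "repr (\<lambda>B. c * B f g)"
  unfolding repr_def by (rule exI[of _ "[(c, f, g)]"]) (simp add: evalc_def)

lemma repr_single': "repr (\<lambda>B. B f g)"
  using repr_single[of 1] by simp

lemma repr_add: "repr K \<Longrightarrow> repr K' \<Longrightarrow> repr (\<lambda>B. K B + K' B)"
proof -
  assume "repr K" "repr K'"
  then obtain L L' where "\<forall>B. K B = evalc L B" "\<forall>B. K' B = evalc L' B" unfolding repr_def by blast
  then show ?thesis unfolding repr_def by (intro exI[of _ "L @ L'"]) (simp add: evalc_def)
qed

lemma repr_scale: "repr K \<Longrightarrow> repr (\<lambda>B. c * K B)"
proof -
  assume "repr K"
  then obtain L where L: "\<forall>B. K B = evalc L B" unfolding repr_def by blast
  have "c * evalc L B = evalc (map (\<lambda>(d, f, g). (c * d, f, g)) L) B" for B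
    by (induction L) (auto simp: evalc_def distrib_left)
  then show ?thesis using L unfolding repr_def by metis
qed

lemma repr_sum: "finite I \<Longrightarrow> (\<And>i. i \<in> I \<Longrightarrow> repr (K i)) \<Longrightarrow> repr (\<lambda>B. \<Sum>i\<in>I. K i B)"
proof (induction I rule: finite_induct)
  case empty
  then show ?case unfolding repr_def by (intro exI[of _ "[]"]) (simp add: evalc_def)
next
  case (insert i I)
  then show ?case using repr_add[of "K i"] by simp
qed

lemma transfer_le:
  fixes K K' :: "('n::finite htf \<Rightarrow> 'n htf \<Rightarrow> real) \<Rightarrow> real"
  assumes "repr K" "repr K'" "\<And>\<tau>. K (freq \<tau>) \<le> K' (freq \<tau>)"
  shows "K ip \<le> K' ip"
proof -
  have "repr (\<lambda>B. K' B + (-1) * K B)" using assms by (intro repr_add repr_scale)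
  then obtain L where L: "\<And>B. K' B + (-1) * K B = evalc L B" unfolding repr_def by blast
  have "0 \<le> evalc L (freq \<tau>)" for \<tau> using assms(3)[of \<tau>] L[of "freq \<tau>"] by simp
  then have "0 \<le> evalc L ip" by (rule transfer_nonneg)
  then show ?thesis using L[of ip] by simp
qed

lemma repr_q: "repr (\<lambda>B. q B m f)"
  by (induction m arbitrary: f) (auto intro: repr_single' repr_sum)

lemma repr_pure: "repr (\<lambda>B. pure B m f)"
  unfolding pure_def by (intro repr_sum repr_single') simp

text \<open>Avoids square roots of \<open>A\<close>, so that odd and even orders are treated alike.
  For \<open>m = l\<close> it is the energy of the eigenvalue problem.\<close>

definition en :: "nat \<Rightarrow> 'n::finite htf \<Rightarrow> real" where "en m f = (A ^^ m) f \<bullet> f"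

lemma q_le_en: "\<exists>C\<ge>0. \<forall>f :: 'n::finite htf. q ip m f \<le> C * en m f"
proof -
  obtain C where C: "C \<ge> 0" "\<And>\<tau> B (f :: 'n htf). form \<tau> B \<Longrightarrow> q B m f \<le> C * B ((A ^^ m) f) f"
    using q_le_A_pow by blast
  have "q ip m f \<le> C * en m f" for f :: "'n htf"
    unfolding en_def
    by (rule transfer_le[where K = "\<lambda>B. q B m f" and K' = "\<lambda>B. C * B ((A ^^ m) f) f"])
       (auto intro: repr_q repr_single C(2) form_freq)
  then show ?thesis using C(1) by blast
qed

lemma q_le_pure_ip: "\<exists>C\<ge>0. \<forall>f :: 'n::finite htf. q ip (Suc m) f \<le> C * pure ip (Suc m) f"
proof -
  obtain C where C: "C \<ge> 1" "\<And>\<tau> B (f :: 'n htf). form \<tau> B \<Longrightarrow> q B (Suc m) f \<le> C * pure B (Suc m) f"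
    using q_le_pure by blast
  have "q ip (Suc m) f \<le> C * pure ip (Suc m) f" for f :: "'n htf"
    by (rule transfer_le[where K = "\<lambda>B. q B (Suc m) f" and K' = "\<lambda>B. C * pure B (Suc m) f"])
       (auto intro!: repr_q repr_scale repr_pure C(2) form_freq simp del: q.simps)
  then show ?thesis using C(1) by (intro exI[of _ C]) auto
qed

section \<open>Log-convexity of the energies\<close>

lemma inner_A: "A f \<bullet> g = f \<bullet> A g"
  by (simp add: A_def inner_sum_left inner_sum_right inner_Z)

lemma inner_A_self: "A f \<bullet> f = (\<Sum>i\<in>UNIV. Z i f \<bullet> Z i f)"
  by (simp add: A_def inner_sum_left inner_Z sum_negf)

lemma inner_A_pow: "(A ^^ m) f \<bullet> g = f \<bullet> (A ^^ m) g"
  by (induction m arbitrary: f g) (simp_all add: inner_A funpow_swap1)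

text \<open>Induction in steps of two: with one \<open>A\<close> on either side, the same form two
  orders lower is evaluated at \<open>A f\<close>.\<close>

lemma en_nonneg: "0 \<le> en m f"
proof (induction m arbitrary: f rule: induct_nat_012)
  case (ge2 m)
  have "(A ^^ Suc (Suc m)) f = A ((A ^^ m) (A f))" by (simp add: funpow_swap1)
  then show ?case using ge2(1)[of "A f"] by (simp only: en_def inner_A)
qed (auto simp: en_def inner_A_self sum_nonneg)

lemma sform_en: "sform (\<lambda>f g. (A ^^ m) f \<bullet> g)"
proof -
  have "(A ^^ m) f \<bullet> g = (A ^^ m) g \<bullet> f" for f g :: "'a htf"
    by (subst inner_A_pow) (rule inner_commute)
  then show ?thesis
    using en_nonneg[of m] unfolding sform_def en_def
    by (auto intro!: linearI simp: inner_add_right)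
qed

lemma en_log_convex: "(en (Suc j) f)\<^sup>2 \<le> en j f * en (Suc (Suc j)) f"
  using sform_cauchy[OF sform_en[of j], of f "A f"]
  by (simp add: en_def inner_A[symmetric] funpow_swap1)

text \<open>Stated with integer powers in place of roots. With m + 1 = l, \<open>g 0\<close> near 1
  and \<open>g (Suc m)\<close> near an eigenvalue it produces the exponent (l - 1) / l for the
  energy of order l - 1.\<close>

lemma log_convex_last:
  fixes g :: "nat \<Rightarrow> real"
  assumes g: "\<And>j. 0 \<le> g j" and c: "\<And>j. (g (Suc j))\<^sup>2 \<le> g j * g (Suc (Suc j))"
  shows "g m ^ Suc m \<le> g 0 * g (Suc m) ^ m"
proof (induction m)
  case (Suc m)
  show ?case
  proof (cases "g (Suc m) = 0")
    case False
    then have p: "g (Suc m) ^ m > 0" using g[of "Suc m"] by simp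
    have "g (Suc m) ^ m * g (Suc m) ^ Suc (Suc m) = ((g (Suc m))\<^sup>2) ^ Suc m"
      by (simp add: power_add[symmetric] power_mult[symmetric] mult_2 del: power_Suc)
    also have "\<dots> \<le> (g m * g (Suc (Suc m))) ^ Suc m" by (intro power_mono c) simp
    also have "\<dots> = g m ^ Suc m * g (Suc (Suc m)) ^ Suc m" by (rule power_mult_distrib)
    also have "\<dots> \<le> (g 0 * g (Suc m) ^ m) * g (Suc (Suc m)) ^ Suc m"
      by (intro mult_right_mono Suc.IH zero_le_power g)
    finally have "g (Suc m) ^ m * g (Suc m) ^ Suc (Suc m) \<le> g (Suc m) ^ m * (g 0 * g (Suc (Suc m)) ^ Suc m)"
      by (simp only: mult_ac)
    then show ?thesis using p by (simp only: mult_le_cancel_left_pos)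
  qed (simp add: g)
qed simp

text \<open>The induction hypothesis is raised to the power in which \<open>log_convex_last\<close>
  can replace \<open>g (Suc m)\<close>, and the common exponent is cancelled at the end. This is the
  source of the exponent 1 / l.\<close>

lemma log_convex_first:
  fixes g :: "nat \<Rightarrow> real"
  assumes g: "\<And>j. 0 \<le> g j" and c: "\<And>j. (g (Suc j))\<^sup>2 \<le> g j * g (Suc (Suc j))"
  shows "g 1 ^ Suc m \<le> g 0 ^ m * g (Suc m)"
proof (induction m)
  case (Suc m)
  have "(g 1 ^ Suc (Suc m)) ^ Suc m = (g 1 ^ Suc m) ^ Suc (Suc m)"
    by (simp only: power_mult[symmetric] mult.commute)
  also have "\<dots> \<le> (g 0 ^ m * g (Suc m)) ^ Suc (Suc m)"
    by (intro power_mono Suc.IH zero_le_power g)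
  also have "\<dots> = (g 0 ^ m) ^ Suc (Suc m) * g (Suc m) ^ Suc (Suc m)" by (rule power_mult_distrib)
  also have "\<dots> \<le> (g 0 ^ m) ^ Suc (Suc m) * (g 0 * g (Suc (Suc m)) ^ Suc m)"
    by (intro mult_left_mono log_convex_last[of g, OF g c] zero_le_power g)
  also have "(g 0 ^ m) ^ Suc (Suc m) * (g 0 * g (Suc (Suc m)) ^ Suc m) = (g 0 ^ Suc m * g (Suc (Suc m))) ^ Suc m"
  proof -
    have "(g 0 ^ m) ^ Suc (Suc m) * g 0 = (g 0 ^ Suc m) ^ Suc m"
      by (simp add: power_mult[symmetric] power_add[symmetric] power_Suc2[symmetric] del: power_Suc)
    then show ?thesis by (simp only: power_mult_distrib mult.assoc[symmetric])
  qed
  finally show ?case by (rule power_le_imp_le_base) (intro mult_nonneg_nonneg zero_le_power g)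
qed simp

text \<open>A log-convex sequence stays below the larger of its end values; the sum is the form in
  which norm and energy occur later.\<close>

lemma log_convex_le:
  fixes g :: "nat \<Rightarrow> real"
  assumes g: "\<And>j. 0 \<le> g j" and c: "\<And>j. (g (Suc j))\<^sup>2 \<le> g j * g (Suc (Suc j))" and "j \<le> l"
  shows "g j \<le> g 0 + g l"
proof -
  have step: "g m \<le> max (g 0) (g (Suc m))" for m
  proof (rule power_le_imp_le_base)
    have "g 0 * g (Suc m) ^ m \<le> max (g 0) (g (Suc m)) * max (g 0) (g (Suc m)) ^ m"
      by (intro mult_mono power_mono) (auto simp: g le_max_iff_disj)
    then show "g m ^ Suc m \<le> max (g 0) (g (Suc m)) ^ Suc m"
      using order_trans[OF log_convex_last[of g, OF g c, of m]] by (simp only: power_Suc)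
  qed (simp add: g le_max_iff_disj)
  have "g j \<le> max (g 0) (g l)"
    using \<open>j \<le> l\<close>
  proof (induction rule: inc_induct)
    case (step m)
    then show ?case using \<open>\<And>m. g m \<le> max (g 0) (g (Suc m))\<close>[of m] by linarith
  qed simp
  then show ?thesis using g[of 0] g[of l] by linarith
qed

lemma en_0: "en 0 f = f \<bullet> f" by (simp add: en_def)

lemma q_le_energy: "\<exists>C\<ge>0. \<forall>f :: 'n::finite htf. \<forall>j\<le>l. q ip j f \<le> C * (en l f + f \<bullet> f)"
proof -
  obtain C where C: "\<And>m. C m \<ge> 0" "\<And>m (f :: 'n htf). q ip m f \<le> C m * en m f"
    using q_le_en[where 'n = 'n] by metis
  have "q ip j f \<le> (\<Sum>j\<le>l. C j) * (en l f + f \<bullet> f)" if "j \<le> l" for f :: "'n htf" and j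
  proof -
    have "q ip j f \<le> C j * en j f" by (rule C(2))
    also have "\<dots> \<le> (\<Sum>j\<le>l. C j) * (en l f + f \<bullet> f)"
    proof (rule mult_mono)
      show "C j \<le> (\<Sum>j\<le>l. C j)" using that by (intro member_le_sum) (auto simp: C)
      show "en j f \<le> en l f + f \<bullet> f"
        using log_convex_le[of "\<lambda>j. en j f", OF en_nonneg en_log_convex that] by (simp add: en_0)
    qed (auto simp: en_nonneg sum_nonneg C)
    finally show ?thesis .
  qed
  then show ?thesis using C(1) by (intro exI[of _ "\<Sum>j\<le>l. C j"]) (auto intro: sum_nonneg)
qed

section \<open>Words in the fields and their commutators with a coordinate\<close>

text \<open>Only the homogeneous order matters for the estimates: \<open>T\<close> counts as order two.\<close>

inductive hop :: "nat \<Rightarrow> ('n::finite htf \<Rightarrow> 'n htf) \<Rightarrow> bool" where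
  hop_id: "hop 0 (\<lambda>f. f)"
| hop_Z: "hop m P \<Longrightarrow> hop (Suc m) (\<lambda>f. P (Z i f))"
| hop_add: "hop m P \<Longrightarrow> hop m Q \<Longrightarrow> hop m (\<lambda>f. P f + Q f)"
| hop_scale: "hop m P \<Longrightarrow> hop m (\<lambda>f. c *\<^sub>R P f)"

lemma hop_linear: "hop m P \<Longrightarrow> linear P"
proof (induction rule: hop.induct)
  case (hop_Z m P i)
  then show ?case using linear_compose[OF linear_Z, of P i] by (simp add: o_def)
qed (auto intro: linear_compose_add linear_compose_scale_right linear_id[unfolded id_def])

lemma hop_zero: "hop m (\<lambda>f :: 'n::finite htf. 0)"
proof (induction m)
  case 0
  show ?case using hop_scale[OF hop_id, of 0] by simp
next
  case (Suc m)
  then show ?case using hop_Z[OF Suc] by blast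
qed

lemma hop_sum: "finite I \<Longrightarrow> (\<And>i. i \<in> I \<Longrightarrow> hop m (P i)) \<Longrightarrow> hop m (\<lambda>f. \<Sum>i\<in>I. P i f)"
  by (induction I rule: finite_induct) (auto intro: hop_zero hop_add)

lemma hop_Z_left: "hop m P \<Longrightarrow> hop (Suc m) (\<lambda>f. Z i (P f))"
proof (induction rule: hop.induct)
  case hop_id
  show ?case using hop.hop_Z[OF hop.hop_id, of i] by simp
next
  case (hop_Z m P j)
  then show ?case using hop.hop_Z[OF hop_Z.IH] by simp
qed (auto simp: Z_lin intro: hop.hop_add hop.hop_scale)

lemma hop_comp: "hop k Q \<Longrightarrow> hop m P \<Longrightarrow> hop (m + k) (\<lambda>f. P (Q f))"
proof (induction rule: hop.induct)
  case (hop_Z k Q i)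
  then show ?case using hop.hop_Z[of "m + k" "\<lambda>f. P (Q f)" i] by simp
next
  case (hop_add k Q Q')
  then show ?case using linear_add[OF hop_linear[OF hop_add.prems]] by (simp add: hop.hop_add)
next
  case (hop_scale k Q c)
  then show ?case using linear_scale[OF hop_linear[OF hop_scale.prems]] by (simp add: hop.hop_scale)
qed simp

lemma hop_Z_Z: "hop 2 (\<lambda>f. Z i (Z j f))"
  using hop_Z[OF hop_Z[OF hop_id, of i], of j] by (simp add: numeral_2_eq_2)

lemma hop_A: "hop 2 A"
proof -
  have "hop 2 (\<lambda>f. (-1) *\<^sub>R (\<Sum>i\<in>UNIV. Z i (Z i f)))"
    by (intro hop_scale hop_sum hop_Z_Z) simp
  then show ?thesis by (simp add: A_def[abs_def])
qed

lemma hop_A_pow: "hop (2 * m) (A ^^ m)"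
proof (induction m)
  case 0
  show ?case using hop_id by (simp add: id_def)
next
  case (Suc m)
  then show ?case using hop_comp[OF Suc hop_A] by (simp add: o_def)
qed

lemma hop_T: "hop 2 T"
proof -
  fix i :: "'a + 'a"
  have "T f = sg i *\<^sub>R (Z i (Z (sw i) f) + (-1) *\<^sub>R Z (sw i) (Z i f))" for f :: "'a htf"
    using Z_commute[of i "sw i" f] by simp
  then have "T = (\<lambda>f :: 'a htf. sg i *\<^sub>R (Z i (Z (sw i) f) + (-1) *\<^sub>R Z (sw i) (Z i f)))" by blast
  moreover have "hop 2 (\<lambda>f :: 'a htf. sg i *\<^sub>R (Z i (Z (sw i) f) + (-1) *\<^sub>R Z (sw i) (Z i f)))"
    by (intro hop_scale hop_add hop_Z_Z)
  ultimately show "hop 2 (T :: 'a htf \<Rightarrow> _)" by simp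
qed

lemma q_Z_le: "q ip m (Z i f) \<le> q ip (Suc m) f"
  unfolding q.simps by (rule member_le_sum) (auto simp: q_nonneg[OF sform_ip])

lemma inner_self_add_le: "(a + b) \<bullet> (a + b) \<le> 2 * (a \<bullet> a) + 2 * (b \<bullet> b)" for a b :: "'v::real_inner"
  using inner_ge_zero[of "a - b"] by (simp add: inner_add_left inner_add_right inner_diff_left inner_diff_right inner_commute)

lemma hop_bound: "hop m P \<Longrightarrow> \<exists>C\<ge>0. \<forall>f. P f \<bullet> P f \<le> C * q ip m f"
proof (induction rule: hop.induct)
  case hop_id
  show ?case by (rule exI[of _ 1]) simp
next
  case (hop_Z m P i)
  then obtain C where C: "C \<ge> 0" "\<And>f. P f \<bullet> P f \<le> C * q ip m f" by blast
  have "P (Z i f) \<bullet> P (Z i f) \<le> C * q ip (Suc m) f" for f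
    using C(2)[of "Z i f"] mult_left_mono[OF q_Z_le C(1)] by (meson order_trans)
  then show ?case using C(1) by blast
next
  case (hop_add m P Q)
  then obtain C D where C: "C \<ge> 0" "\<And>f. P f \<bullet> P f \<le> C * q ip m f"
    and D: "D \<ge> 0" "\<And>f. Q f \<bullet> Q f \<le> D * q ip m f" by blast
  have "(P f + Q f) \<bullet> (P f + Q f) \<le> (2 * C + 2 * D) * q ip m f" for f
    using inner_self_add_le[of "P f" "Q f"] C(2)[of f] D(2)[of f] by (simp add: distrib_right)
  then show ?case using C(1) D(1) by (intro exI[of _ "2 * C + 2 * D"]) auto
next
  case (hop_scale m P c)
  then obtain C where C: "C \<ge> 0" "\<And>f. P f \<bullet> P f \<le> C * q ip m f" by blast
  have "(c *\<^sub>R P f) \<bullet> (c *\<^sub>R P f) \<le> (c * c * C) * q ip m f" for f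
    using mult_left_mono[OF C(2)[of f], of "c * c"] by (simp add: mult.assoc)
  then show ?case using C(1) by (intro exI[of _ "c * c * C"]) auto
qed

lemma hop_adjoint: "hop m P \<Longrightarrow> \<exists>P'. hop m P' \<and> (\<forall>f g. P f \<bullet> g = f \<bullet> P' g)"
proof (induction rule: hop.induct)
  case hop_id
  show ?case using hop.hop_id by blast
next
  case (hop_Z m P i)
  then obtain P' where "hop m P'" "\<And>f g. P f \<bullet> g = f \<bullet> P' g" by blast
  then show ?case
    by (intro exI[of _ "\<lambda>f. (-1) *\<^sub>R Z i (P' f)"]) (auto intro!: hop.hop_scale[of _ _ "-1", simplified] hop_Z_left simp: inner_Z)
next
  case (hop_add m P Q)
  then obtain P' Q' where "hop m P'" "\<And>f g. P f \<bullet> g = f \<bullet> P' g" "hop m Q'" "\<And>f g. Q f \<bullet> g = f \<bullet> Q' g" by blast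
  then show ?case
    by (intro exI[of _ "\<lambda>f. P' f + Q' f"]) (auto intro: hop.hop_add simp: inner_add_left inner_add_right)
next
  case (hop_scale m P c)
  then obtain P' where "hop m P'" "\<And>f g. P f \<bullet> g = f \<bullet> P' g" by blast
  then show ?case
    by (intro exI[of _ "\<lambda>f. c *\<^sub>R P' f"]) (auto intro: hop.hop_scale)
qed

text \<open>Integration by parts distributes the total order at will: fields acting on
  \<open>f\<close> first are charged to \<open>f\<close> while \<open>j\<close> lasts, and what
  remains of the operator goes over to \<open>g\<close> as its adjoint.\<close>

lemma hop_pair:
  "hop n P \<Longrightarrow> (\<forall>j k. n = j + k \<longrightarrow> (\<exists>C\<ge>0. \<forall>f g. \<bar>P f \<bullet> g\<bar> \<le> C * (sqrt (q ip j f) * sqrt (q ip k g))))"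
proof (induction rule: hop.induct)
  case hop_id
  show ?case using sform_cauchy_sqrt[OF sform_ip] by (auto intro!: exI[of _ 1])
next
  case (hop_Z m P i)
  show ?case
  proof (intro allI impI)
    fix j k assume jk: "Suc m = j + k"
    show "\<exists>C\<ge>0. \<forall>f g. \<bar>P (Z i f) \<bullet> g\<bar> \<le> C * (sqrt (q ip j f) * sqrt (q ip k g))"
    proof (cases j)
      case 0
      obtain P' where P': "hop (Suc m) P'" "\<And>f g. P (Z i f) \<bullet> g = f \<bullet> P' g"
        using hop_adjoint[OF hop.hop_Z[OF hop_Z.hyps, of i]] by blast
      obtain C where C: "C \<ge> 0" "\<And>f. P' f \<bullet> P' f \<le> C * q ip (Suc m) f" using hop_bound[OF P'(1)] by blast
      have "\<bar>P (Z i f) \<bullet> g\<bar> \<le> sqrt C * (sqrt (q ip j f) * sqrt (q ip k g))" for f g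
      proof -
        have "\<bar>P (Z i f) \<bullet> g\<bar> \<le> sqrt (f \<bullet> f) * sqrt (P' g \<bullet> P' g)"
          unfolding P'(2) by (rule sform_cauchy_sqrt[OF sform_ip])
        also have "\<dots> \<le> sqrt (f \<bullet> f) * sqrt (C * q ip (Suc m) g)"
          by (intro mult_left_mono real_sqrt_le_mono C(2)) simp
        finally show ?thesis using 0 jk by (simp add: real_sqrt_mult mult_ac del: q.simps(2))
      qed
      then show ?thesis using C(1) by (intro exI[of _ "sqrt C"]) auto
    next
      case (Suc j')
      then obtain C where C: "C \<ge> 0" "\<And>f g. \<bar>P f \<bullet> g\<bar> \<le> C * (sqrt (q ip j' f) * sqrt (q ip k g))"
        using hop_Z.IH[rule_format, of j' k] jk by auto
      have "\<bar>P (Z i f) \<bullet> g\<bar> \<le> C * (sqrt (q ip j f) * sqrt (q ip k g))" for f g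
      proof -
        have "\<bar>P (Z i f) \<bullet> g\<bar> \<le> C * (sqrt (q ip j' (Z i f)) * sqrt (q ip k g))" by (rule C(2))
        also have "\<dots> \<le> C * (sqrt (q ip j f) * sqrt (q ip k g))"
          unfolding Suc by (intro mult_left_mono mult_right_mono real_sqrt_le_mono q_Z_le C(1)) (simp add: q_nonneg[OF sform_ip])
        finally show ?thesis .
      qed
      then show ?thesis using C(1) by blast
    qed
  qed
next
  case (hop_add m P Q)
  show ?case
  proof (intro allI impI)
    fix j k assume jk: "m = j + k"
    obtain C where C: "C \<ge> 0" "\<And>f g. \<bar>P f \<bullet> g\<bar> \<le> C * (sqrt (q ip j f) * sqrt (q ip k g))" using hop_add.IH(1) jk by blast
    obtain D where D: "D \<ge> 0" "\<And>f g. \<bar>Q f \<bullet> g\<bar> \<le> D * (sqrt (q ip j f) * sqrt (q ip k g))" using hop_add.IH(2) jk by blast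
    have "\<bar>(P f + Q f) \<bullet> g\<bar> \<le> (C + D) * (sqrt (q ip j f) * sqrt (q ip k g))" for f g
      using C(2)[of f g] D(2)[of f g] by (simp add: inner_add_left distrib_right)
    then show "\<exists>C\<ge>0. \<forall>f g. \<bar>(P f + Q f) \<bullet> g\<bar> \<le> C * (sqrt (q ip j f) * sqrt (q ip k g))"
      using C(1) D(1) by (intro exI[of _ "C + D"]) auto
  qed
next
  case (hop_scale m P c)
  show ?case
  proof (intro allI impI)
    fix j k assume jk: "m = j + k"
    obtain C where C: "C \<ge> 0" "\<And>f g. \<bar>P f \<bullet> g\<bar> \<le> C * (sqrt (q ip j f) * sqrt (q ip k g))" using hop_scale.IH jk by blast
    have "\<bar>(c *\<^sub>R P f) \<bullet> g\<bar> \<le> (\<bar>c\<bar> * C) * (sqrt (q ip j f) * sqrt (q ip k g))" for f g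
      using mult_left_mono[OF C(2)[of f g], of "\<bar>c\<bar>"] by (simp add: abs_mult mult.assoc)
    then show "\<exists>C\<ge>0. \<forall>f g. \<bar>(c *\<^sub>R P f) \<bullet> g\<bar> \<le> C * (sqrt (q ip j f) * sqrt (q ip k g))"
      using C(1) by (intro exI[of _ "\<bar>c\<bar> * C"]) auto
  qed
qed

text \<open>The commutator of a field with the coordinate is a constant, so one order is lost.
  Truncated subtraction cannot express this at \<open>m = 0\<close>; the extra clause makes the
  remainder vanish there, and the step from order 0 to order 1 relies on it.\<close>

lemma hop_commutator:
  "hop m P \<Longrightarrow> \<exists>P'. hop (m - 1) P' \<and> (m = 0 \<longrightarrow> P' = (\<lambda>f. 0)) \<and> (\<forall>f. P (crd (ex p) f) = crd (ex p) (P f) + P' f)"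
proof (induction rule: hop.induct)
  case hop_id
  show ?case by (rule exI[of _ "\<lambda>f. 0"]) (simp add: hop_zero)
next
  case (hop_Z m P i)
  then obtain P' where P': "hop (m - 1) P'" "m = 0 \<Longrightarrow> P' = (\<lambda>f. 0)" "\<And>f. P (crd (ex p) f) = crd (ex p) (P f) + P' f" by blast
  have "hop m (\<lambda>f. P' (Z i f))"
  proof (cases m)
    case 0
    then show ?thesis using P'(2) by (simp add: hop_zero)
  next
    case (Suc k)
    then show ?thesis using hop.hop_Z[OF P'(1)] by simp
  qed
  then have "hop m (\<lambda>f. P' (Z i f) + (if i = Inl p then 1 else 0) *\<^sub>R P f)"
    by (intro hop.hop_add hop.hop_scale hop_Z.hyps)
  moreover have "P (Z i (crd (ex p) f)) = crd (ex p) (P (Z i f)) + (P' (Z i f) + (if i = Inl p then 1 else 0) *\<^sub>R P f)" for f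
    by (simp only: Z_crd_ex linear_add[OF hop_linear[OF hop_Z.hyps]] linear_scale[OF hop_linear[OF hop_Z.hyps]] P'(3) add.assoc)
  ultimately show ?case by (intro exI[of _ "\<lambda>f. P' (Z i f) + (if i = Inl p then 1 else 0) *\<^sub>R P f"]) auto
next
  case (hop_add m P Q)
  then obtain P' Q' where "hop (m - 1) P'" "m = 0 \<longrightarrow> P' = (\<lambda>f. 0)" "\<And>f. P (crd (ex p) f) = crd (ex p) (P f) + P' f"
     "hop (m - 1) Q'" "m = 0 \<longrightarrow> Q' = (\<lambda>f. 0)" "\<And>f. Q (crd (ex p) f) = crd (ex p) (Q f) + Q' f" by blast
  then show ?case
    by (intro exI[of _ "\<lambda>f. P' f + Q' f"]) (auto simp: crd_lin intro: hop.hop_add)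
next
  case (hop_scale m P c)
  then obtain P' where "hop (m - 1) P'" "m = 0 \<longrightarrow> P' = (\<lambda>f. 0)" "\<And>f. P (crd (ex p) f) = crd (ex p) (P f) + P' f" by blast
  then show ?case
    by (intro exI[of _ "\<lambda>f. c *\<^sub>R P' f"]) (auto simp: crd_lin scaleR_add_right intro: hop.hop_scale)
qed

text \<open>\<open>P1\<close> is the commutator of the symmetric operators \<open>?H\<close> and
  \<open>?M\<close>, hence skew, so the cross term \<open>P1 f \<bullet> ?M f\<close> equals minus
  half of \<open>P2 f \<bullet> f\<close> with \<open>P2\<close> the double commutator. Its order
  \<open>2 * m\<close>, split evenly, gives the energy of order \<open>m\<close>.\<close>

lemma double_commutator:
  "\<exists>C\<ge>0. \<forall>f :: 'n::finite htf. en (Suc m) (crd (ex p) f) \<le> (A ^^ Suc m) f \<bullet> crd (ex p) (crd (ex p) f) + C * en m f"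
proof -
  let ?M = "crd (ex p) :: 'n htf \<Rightarrow> 'n htf" and ?H = "(A ^^ Suc m) :: 'n htf \<Rightarrow> 'n htf"
  obtain P1 where P1: "hop (2 * Suc m - 1) P1" "\<And>f. ?H (?M f) = ?M (?H f) + P1 f"
    using hop_commutator[OF hop_A_pow, of "Suc m" p] by blast
  obtain P2 where P2: "hop (2 * Suc m - 1 - 1) P2" "\<And>f. P1 (?M f) = ?M (P1 f) + P2 f"
    using hop_commutator[OF P1(1), of p] by blast
  have "hop (2 * m) P2" using P2(1) by simp
  from hop_pair[OF this] obtain C where C: "C \<ge> 0" "\<And>f g. \<bar>P2 f \<bullet> g\<bar> \<le> C * (sqrt (q ip m f) * sqrt (q ip m g))"
    using mult_2 by blast
  obtain D where D: "D \<ge> 0" "\<And>f :: 'n htf. q ip m f \<le> D * en m f" using q_le_en by blast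
  have anti: "P1 f \<bullet> g = - (f \<bullet> P1 g)" for f g
  proof -
    have "P1 f = ?H (?M f) - ?M (?H f)" for f using P1(2)[of f] by simp
    then show ?thesis by (simp add: inner_diff_left inner_diff_right inner_crd inner_A_pow[of "Suc m"] del: funpow.simps)
  qed
  have "en (Suc m) (?M f) \<le> ?H f \<bullet> ?M (?M f) + (C * D) * en m f" for f
  proof -
    have "en (Suc m) (?M f) = ?H f \<bullet> ?M (?M f) + P1 f \<bullet> ?M f"
      unfolding en_def P1(2) by (simp add: inner_add_left inner_crd del: funpow.simps)
    moreover have "2 * (P1 f \<bullet> ?M f) = - (P2 f \<bullet> f)"
    proof -
      have "P1 f \<bullet> ?M f = ?M (P1 f) \<bullet> f" by (simp add: inner_crd)
      also have "\<dots> = P1 (?M f) \<bullet> f - P2 f \<bullet> f" by (simp add: P2(2) inner_add_left)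
      also have "P1 (?M f) \<bullet> f = - (P1 f \<bullet> ?M f)"
        using anti[of "?M f" f] inner_commute[of "?M f" "P1 f"] by linarith
      finally show ?thesis by simp
    qed
    moreover have "\<bar>P2 f \<bullet> f\<bar> \<le> C * D * en m f"
      using C(2)[of f f] q_nonneg[OF sform_ip, of m f] mult_left_mono[OF D(2)[of f] C(1)] by (simp add: mult.assoc)
    ultimately show ?thesis by linarith
  qed
  then show ?thesis using C(1) D(1) by (intro exI[of _ "C * D"]) auto
qed

section \<open>Test functions with support in a given set\<close>

definition tfs :: "'a::euclidean_space set \<Rightarrow> 'a tf set" where
  "tfs S = {f. closure {z. app f z \<noteq> 0} \<subseteq> S}"

lemma tfs_app: "f \<in> tfs S \<Longrightarrow> z \<notin> S \<Longrightarrow> app f z = 0"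
  using closure_subset[of "{z. app f z \<noteq> 0}"] by (auto simp: tfs_def)

lemma tfs_mono: "S \<subseteq> S' \<Longrightarrow> tfs S \<subseteq> tfs S'" by (auto simp: tfs_def)

lemma tfs_subset_supp:
  assumes "f \<in> tfs S" "{z. app g z \<noteq> 0} \<subseteq> closure {z. app f z \<noteq> 0}"
  shows "g \<in> tfs S"
  using closure_minimal[OF assms(2)] assms(1) by (auto simp: tfs_def)

lemma tfs_pd: "f \<in> tfs S \<Longrightarrow> pd v f \<in> tfs S"
proof (erule tfs_subset_supp, safe)
  fix z assume "app (pd v f) z \<noteq> 0"
  then show "z \<in> closure {z. app f z \<noteq> 0}"
    using frechet_derivative_outside_support[of z "app f"] by (metis app_pd)
qed

lemma tfs_crd: "f \<in> tfs S \<Longrightarrow> crd b f \<in> tfs S"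
  by (erule tfs_subset_supp) (auto simp: app_crd intro: subsetD[OF closure_subset])

lemma tfs_scale: "f \<in> tfs S \<Longrightarrow> c *\<^sub>R f \<in> tfs S"
  by (erule tfs_subset_supp) (auto simp: app_scaleR intro: subsetD[OF closure_subset])

lemma tfs_add: "f \<in> tfs S \<Longrightarrow> g \<in> tfs S \<Longrightarrow> f + g \<in> tfs S"
proof -
  assume fg: "f \<in> tfs S" "g \<in> tfs S"
  have "{z. app (f + g) z \<noteq> 0} \<subseteq> {z. app f z \<noteq> 0} \<union> {z. app g z \<noteq> 0}" by (auto simp: app_add)
  then have "closure {z. app (f + g) z \<noteq> 0} \<subseteq> closure {z. app f z \<noteq> 0} \<union> closure {z. app g z \<noteq> 0}"
    unfolding closure_Un[symmetric] by (rule closure_mono)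
  then show ?thesis using fg by (auto simp: tfs_def)
qed

lemma tfs_diff: "f \<in> tfs S \<Longrightarrow> g \<in> tfs S \<Longrightarrow> f - g \<in> tfs S"
  using tfs_add[of f S "(-1) *\<^sub>R g"] tfs_scale[of g S "-1"] by simp

lemma tfs_T: "f \<in> tfs S \<Longrightarrow> T f \<in> tfs S"
  by (simp add: T_def tfs_pd)

lemma tfs_Z: "f \<in> tfs S \<Longrightarrow> Z i f \<in> tfs S"
  by (cases i) (auto simp: Z_def intro!: tfs_add tfs_diff tfs_scale tfs_crd tfs_pd tfs_T)

lemma tfs_Z_pow: "f \<in> tfs S \<Longrightarrow> (Z i ^^ m) f \<in> tfs S"
  by (induction m) (auto intro: tfs_Z)

section \<open>Multiplication by a coordinate and the Euclidean gradient\<close>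

lemma crd_bound:
  fixes f :: "'a::euclidean_space tf"
  assumes f: "f \<in> tfs S" and S: "\<And>z. z \<in> S \<Longrightarrow> norm z \<le> R" and b: "norm b \<le> 1"
  shows "crd b f \<bullet> crd b f \<le> R\<^sup>2 * (f \<bullet> f)"
  unfolding inner_tf_def integral_mult_right_zero[symmetric]
proof (rule Bochner_Integration.integral_mono)
  show "app (crd b f) z * app (crd b f) z \<le> R\<^sup>2 * (app f z * app f z)" for z
  proof (cases "app f z = 0")
    case False
    then have "norm z \<le> R" using tfs_app[OF f] S by blast
    then have "\<bar>z \<bullet> b\<bar> \<le> R"
      using Cauchy_Schwarz_ineq2[of z b] mult_left_mono[OF b norm_ge_zero[of z]] by linarith
    then have "(z \<bullet> b)\<^sup>2 \<le> R\<^sup>2" by (metis abs_ge_zero power2_abs power_mono)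
    then have "(z \<bullet> b)\<^sup>2 * (app f z * app f z) \<le> R\<^sup>2 * (app f z * app f z)" by (intro mult_right_mono) auto
    then show ?thesis by (simp add: app_crd power2_eq_square mult_ac)
  qed (simp add: app_crd)
qed auto

lemma q_add_le: "q ip m (f + g) \<le> 2 * q ip m f + 2 * q ip m g"
proof (induction m arbitrary: f g)
  case (Suc m)
  have "q ip (Suc m) (f + g) \<le> (\<Sum>i\<in>UNIV. 2 * q ip m (Z i f) + 2 * q ip m (Z i g))"
    using Suc by (auto simp: Z_lin intro!: sum_mono)
  then show ?case by (simp add: sum.distrib sum_distrib_left)
qed (use inner_self_add_le in auto)

lemma q_scale: "q ip m (c *\<^sub>R f) = c\<^sup>2 * q ip m f"
  by (induction m arbitrary: f) (simp_all add: Z_lin sum_distrib_left power2_eq_square)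

text \<open>Leibniz' rule: the coordinate is bounded on \<open>S\<close> and its derivatives along
  the fields are constants.\<close>

lemma q_crd_le:
  fixes S :: "'n::finite heis set"
  assumes S: "\<And>z. z \<in> S \<Longrightarrow> norm z \<le> R"
  shows "\<exists>C\<ge>0. \<forall>f\<in>tfs S. q ip m (crd (ex p) f) \<le> C * (\<Sum>j\<le>m. q ip j f)"
proof (induction m)
  case 0
  have "q ip 0 (crd (ex p) f) \<le> R\<^sup>2 * (\<Sum>j\<le>0. q ip j f)" if "f \<in> tfs S" for f
    using crd_bound[OF that S, where b = "ex p"] by (simp add: norm_prod_def)
  then show ?case by (intro exI[of _ "R\<^sup>2"]) auto
next
  case (Suc m)
  then obtain C where C: "C \<ge> 0" "\<And>f. f \<in> tfs S \<Longrightarrow> q ip m (crd (ex p) f) \<le> C * (\<Sum>j\<le>m. q ip j f)" by blast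
  have "q ip (Suc m) (crd (ex p) f) \<le> (2 * C + 2) * (\<Sum>j\<le>Suc m. q ip j f)" if f: "f \<in> tfs S" for f
  proof -
    let ?d = "\<lambda>i. (if i = Inl p then 1 else 0 :: real)"
    have "q ip (Suc m) (crd (ex p) f) = (\<Sum>i\<in>UNIV. q ip m (crd (ex p) (Z i f) + ?d i *\<^sub>R f))"
      by (simp add: Z_crd_ex)
    also have "\<dots> \<le> (\<Sum>i\<in>UNIV. 2 * (C * (\<Sum>j\<le>m. q ip j (Z i f))) + 2 * ((?d i)\<^sup>2 * q ip m f))"
    proof (rule sum_mono)
      fix i
      show "q ip m (crd (ex p) (Z i f) + ?d i *\<^sub>R f) \<le> 2 * (C * (\<Sum>j\<le>m. q ip j (Z i f))) + 2 * ((?d i)\<^sup>2 * q ip m f)"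
        using q_add_le[of m "crd (ex p) (Z i f)" "?d i *\<^sub>R f"] C(2)[OF tfs_Z[OF f], of i] unfolding q_scale by linarith
    qed
    also have "\<dots> = 2 * C * (\<Sum>i\<in>UNIV. \<Sum>j\<le>m. q ip j (Z i f)) + 2 * q ip m f"
      by (simp add: sum.distrib sum_distrib_left[symmetric] mult.assoc sum_distrib_right[symmetric] if_distrib[of "\<lambda>x. x\<^sup>2"] cong: if_cong)
    also have "(\<Sum>i\<in>UNIV. \<Sum>j\<le>m. q ip j (Z i f)) = (\<Sum>j\<le>m. q ip (Suc j) f)"
      by (subst sum.swap) simp
    also have "2 * C * (\<Sum>j\<le>m. q ip (Suc j) f) + 2 * q ip m f \<le> 2 * C * (\<Sum>j\<le>Suc m. q ip j f) + 2 * (\<Sum>j\<le>Suc m. q ip j f)"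
    proof (intro add_mono mult_left_mono)
      show "(\<Sum>j\<le>m. q ip (Suc j) f) \<le> (\<Sum>j\<le>Suc m. q ip j f)"
        unfolding sum.atMost_Suc_shift[of "\<lambda>j. q ip j f" m] using q_nonneg[OF sform_ip, of 0 f] by linarith
      show "q ip m f \<le> (\<Sum>j\<le>Suc m. q ip j f)"
        by (rule member_le_sum) (auto simp: q_nonneg[OF sform_ip] simp del: q.simps)
    qed (use C(1) in auto)
    finally show ?thesis by (simp only: distrib_right)
  qed
  then show ?case using C(1) by (intro exI[of _ "2 * C + 2"]) auto
qed

lemma en_le_q: "\<exists>C\<ge>0. \<forall>f :: 'n::finite htf. en m f \<le> C * q ip m f"
proof -
  obtain C where C: "C \<ge> 0" "\<And>f g :: 'n htf. \<bar>(A ^^ m) f \<bullet> g\<bar> \<le> C * (sqrt (q ip m f) * sqrt (q ip m g))"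
    using hop_pair[OF hop_A_pow, rule_format, of m m m] mult_2 by blast
  have "en m f \<le> C * q ip m f" for f :: "'n htf"
    using C(2)[of f f] q_nonneg[OF sform_ip, of m f] by (simp add: en_def)
  then show ?thesis using C(1) by blast
qed

text \<open>The eigenvalue equation will be tested with x_p^2 times an approximating sequence, and
  for this the energies must stay bounded.\<close>

lemma en_crd_crd_le:
  fixes S :: "'n::finite heis set"
  assumes S: "\<And>z. z \<in> S \<Longrightarrow> norm z \<le> R"
  shows "\<exists>C\<ge>0. \<forall>f\<in>tfs S. en l (crd (ex p) (crd (ex p) f)) \<le> C * (en l f + f \<bullet> f)"
proof -
  obtain C1 where C1: "C1 \<ge> 0" "\<And>f :: 'n htf. en l f \<le> C1 * q ip l f" using en_le_q by blast
  obtain C2 where C2: "C2 \<ge> 0" "\<And>f :: 'n htf. \<And>j. j \<le> l \<Longrightarrow> q ip j f \<le> C2 * (en l f + f \<bullet> f)"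
    using q_le_energy by blast
  obtain D where D: "\<And>m. D m \<ge> 0" "\<And>m f. f \<in> tfs S \<Longrightarrow> q ip m (crd (ex p) f) \<le> D m * (\<Sum>j\<le>m. q ip j f)"
    using q_crd_le[OF S, where p = p] by metis
  define E where "E = (\<Sum>j\<le>l. D j)"
  have E: "E \<ge> 0" by (simp add: E_def sum_nonneg D)
  have Q0: "0 \<le> q ip j f" for j and f :: "'n htf" by (rule q_nonneg[OF sform_ip])
  have DE: "q ip m (crd (ex p) f) \<le> E * (\<Sum>j\<le>l. q ip j f)" if "m \<le> l" "f \<in> tfs S" for m f
  proof -
    have "D m * (\<Sum>j\<le>m. q ip j f) \<le> E * (\<Sum>j\<le>l. q ip j f)"
    proof (rule mult_mono)
      show "D m \<le> E" unfolding E_def using that by (intro member_le_sum) (auto simp: D)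
      show "(\<Sum>j\<le>m. q ip j f) \<le> (\<Sum>j\<le>l. q ip j f)" using that by (intro sum_mono2) (auto simp: Q0)
    qed (auto simp: E Q0 sum_nonneg)
    then show ?thesis using D(2)[OF that(2), of m] by linarith
  qed
  have "en l (crd (ex p) (crd (ex p) f)) \<le> (C1 * (E * (\<Sum>j\<le>l. E * (\<Sum>j\<le>l. C2)))) * (en l f + f \<bullet> f)" if f: "f \<in> tfs S" for f
  proof -
    have "en l (crd (ex p) (crd (ex p) f)) \<le> C1 * q ip l (crd (ex p) (crd (ex p) f))" by (rule C1(2))
    also have "\<dots> \<le> C1 * (E * (\<Sum>j\<le>l. q ip j (crd (ex p) f)))"
      by (intro mult_left_mono DE C1(1) tfs_crd f) simp
    also have "\<dots> \<le> C1 * (E * (\<Sum>j\<le>l. E * (\<Sum>j\<le>l. q ip j f)))"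
      by (intro mult_left_mono sum_mono DE C1(1) E f) simp
    also have "\<dots> \<le> C1 * (E * (\<Sum>j\<le>l. E * (\<Sum>j\<le>l. C2 * (en l f + f \<bullet> f))))"
      by (intro mult_left_mono sum_mono C2(2) C1(1) E) auto
    finally show ?thesis by (simp add: sum_distrib_right mult_ac)
  qed
  moreover have "0 \<le> C1 * (E * (\<Sum>j\<le>l. E * (\<Sum>j\<le>l. C2)))"
    by (intro mult_nonneg_nonneg sum_nonneg C1(1) E C2(1))
  ultimately show ?thesis by blast
qed

lemma Basis_heis_cases:
  assumes "b \<in> (Basis :: 'n::finite heis set)"
  obtains p where "b = ex p" | p where "b = ey p" | "b = et"
  using assms by (auto simp: Basis_prod_def Basis_vec_def zero_prod_def)

text \<open>Euclidean derivatives are combinations of the fields and \<open>T\<close> with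
  coefficients bounded on \<open>S\<close>; \<open>T\<close> has order two, hence
  \<open>l \<ge> 2\<close>. In this way bounded energy supplies the hypothesis of
  \<open>rellich\<close>.\<close>

lemma gradient_bound:
  fixes S :: "'n::finite heis set"
  assumes S: "\<And>z. z \<in> S \<Longrightarrow> norm z \<le> R" and l: "l \<ge> 2"
  shows "\<exists>C\<ge>0. \<forall>f\<in>tfs S. \<forall>b\<in>Basis. pd b f \<bullet> pd b f \<le> C * (en l f + f \<bullet> f)"
proof -
  obtain C1 where C1: "C1 \<ge> 0" "\<And>f :: 'n htf. T f \<bullet> T f \<le> C1 * q ip 2 f" using hop_bound[OF hop_T] by blast
  obtain C2 where C2: "C2 \<ge> 0" "\<And>f :: 'n htf. \<And>j. j \<le> l \<Longrightarrow> q ip j f \<le> C2 * (en l f + f \<bullet> f)"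
    using q_le_energy by blast
  define C where "C = 2 * C2 + R\<^sup>2 * (C1 * C2) + C1 * C2"
  have C: "pd b f \<bullet> pd b f \<le> C * (en l f + f \<bullet> f)" if f: "f \<in> tfs S" and b: "b \<in> Basis" for f b
  proof -
    let ?N = "en l f + f \<bullet> f"
    have N: "?N \<ge> 0" using en_nonneg[of l f] by simp
    have Tf: "T f \<bullet> T f \<le> C1 * C2 * ?N"
      using C1(2)[of f] mult_left_mono[OF C2(2)[OF l, of f] C1(1)] by (simp add: mult.assoc)
    have Zf: "Z i f \<bullet> Z i f \<le> C2 * ?N" for i
      using q_Z_le[of 0 i f] C2(2)[of 1 f] l by simp
    have key: "pd b f \<bullet> pd b f \<le> C * ?N" if "pd b f = Z i f + c *\<^sub>R crd e (T f)" "c\<^sup>2 \<le> 1/4" "norm e \<le> 1" for i c e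
    proof -
      have "pd b f \<bullet> pd b f \<le> 2 * (Z i f \<bullet> Z i f) + 2 * (c\<^sup>2 * (crd e (T f) \<bullet> crd e (T f)))"
        unfolding that(1) using inner_self_add_le[of "Z i f" "c *\<^sub>R crd e (T f)"] by (simp add: power2_eq_square)
      also have "\<dots> \<le> 2 * (C2 * ?N) + 2 * (1/4 * (R\<^sup>2 * (C1 * C2 * ?N)))"
        using crd_bound[OF tfs_T[OF f] S that(3)] mult_left_mono[OF Tf, of "R\<^sup>2"]
        by (intro add_mono mult_left_mono mult_mono Zf that(2)) auto
      also have "\<dots> \<le> C * ?N"
      proof -
        have "0 \<le> R\<^sup>2 * (C1 * C2 * ?N)" "0 \<le> C1 * C2 * ?N" using N C1(1) C2(1) by auto
        then show ?thesis unfolding C_def distrib_right mult.assoc by linarith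
      qed
      finally show ?thesis .
    qed
    from b show ?thesis
    proof (cases rule: Basis_heis_cases)
      case (1 p)
      show ?thesis by (rule key[of "Inl p" "-1/2" "ey p"]) (auto simp: 1 Z_def norm_prod_def power2_eq_square)
    next
      case (2 p)
      show ?thesis by (rule key[of "Inr p" "1/2" "ex p"]) (auto simp: 2 Z_def norm_prod_def power2_eq_square)
    next
      case 3
      have "0 \<le> R\<^sup>2 * (C1 * C2 * ?N)" "0 \<le> C2 * ?N" using N C1(1) C2(1) by auto
      then show ?thesis using Tf unfolding 3 T_def[symmetric] C_def distrib_right mult.assoc by linarith
    qed
  qed
  then show ?thesis using C1(1) C2(1) by (intro exI[of _ C]) (auto simp: C_def)
qed

section \<open>Compactness\<close>

text \<open>The integer index of the half-open grid cube of side \<open>h\<close> containing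
  \<open>z\<close>, written as a point of the same space; \<open>cell\<close> is that cube.\<close>

definition lat :: "real \<Rightarrow> 'a::euclidean_space \<Rightarrow> 'a" where
  "lat h z = (\<Sum>b\<in>Basis. real_of_int \<lfloor>z \<bullet> b / h\<rfloor> *\<^sub>R b)"

definition cell :: "real \<Rightarrow> 'a::euclidean_space \<Rightarrow> 'a set" where
  "cell h k = {z. lat h z = k}"

lemma lat_inner: "b \<in> Basis \<Longrightarrow> lat h z \<bullet> b = real_of_int \<lfloor>z \<bullet> b / h\<rfloor>"
  unfolding lat_def by (simp add: inner_sum_left_Basis)

lemma lat_bounds:
  assumes "b \<in> Basis" "h > 0"
  shows "h * (lat h z \<bullet> b) \<le> z \<bullet> b" "z \<bullet> b < h * (lat h z \<bullet> b) + h"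
proof -
  have 1: "real_of_int \<lfloor>z \<bullet> b / h\<rfloor> \<le> z \<bullet> b / h" "z \<bullet> b / h < real_of_int \<lfloor>z \<bullet> b / h\<rfloor> + 1"
    by linarith+
  show "h * (lat h z \<bullet> b) \<le> z \<bullet> b" "z \<bullet> b < h * (lat h z \<bullet> b) + h"
    using assms mult_left_mono[OF 1(1), of h] mult_strict_left_mono[OF 1(2), of h]
    by (simp_all add: lat_inner distrib_left)
qed

lemma lat_measurable [measurable]: "lat h \<in> borel_measurable borel"
  unfolding lat_def by measurable

lemma cell_sets [measurable]: "cell h k \<in> sets borel"
proof -
  have "cell h k = lat h -` {k} \<inter> space borel" by (auto simp: cell_def)
  then show ?thesis using measurable_sets[OF lat_measurable, of "{k}"] by simp
qed

lemma cell_diff: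
  assumes "z \<in> cell h k" "w \<in> cell h k" "h > 0"
  shows "w - z \<in> cbox (- h *\<^sub>R One) (h *\<^sub>R One)"
  unfolding mem_box
proof (intro ballI)
  fix b :: 'a assume b: "b \<in> Basis"
  have "lat h z = lat h w" using assms by (simp add: cell_def)
  with lat_bounds[OF b \<open>h > 0\<close>, of z] lat_bounds[OF b \<open>h > 0\<close>, of w]
  show "(- h *\<^sub>R One) \<bullet> b \<le> (w - z) \<bullet> b \<and> (w - z) \<bullet> b \<le> (h *\<^sub>R One) \<bullet> b"
    using b by (simp add: inner_diff_left)
qed

lemma cell_emeasure_finite:
  assumes "h > 0" shows "emeasure lborel (cell h k) < \<infinity>"
proof -
  have "cell h k \<subseteq> cbox (h *\<^sub>R k) (h *\<^sub>R k + h *\<^sub>R One)"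
  proof
    fix z assume "z \<in> cell h k"
    then have k: "lat h z = k" by (simp add: cell_def)
    show "z \<in> cbox (h *\<^sub>R k) (h *\<^sub>R k + h *\<^sub>R One)"
      unfolding mem_box
    proof
      fix b :: 'a assume b: "b \<in> Basis"
      then show "(h *\<^sub>R k) \<bullet> b \<le> z \<bullet> b \<and> z \<bullet> b \<le> (h *\<^sub>R k + h *\<^sub>R One) \<bullet> b"
        using lat_bounds[OF b assms, of z] unfolding k by (simp add: inner_add_left)
    qed
  qed
  then have "emeasure lborel (cell h k) \<le> emeasure lborel (cbox (h *\<^sub>R k) (h *\<^sub>R k + h *\<^sub>R One))"
    by (intro emeasure_mono) auto
  then show ?thesis using emeasure_lborel_cbox_finite order_le_less_trans by (metis infinity_ennreal_def)
qed

lemma cell_measure_ge: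
  assumes "h > 0" shows "h ^ DIM('a) \<le> measure lborel (cell h (lat h (z :: 'a::euclidean_space)))"
proof -
  let ?k = "lat h z"
  have "box (h *\<^sub>R ?k) (h *\<^sub>R ?k + h *\<^sub>R One) \<subseteq> cell h ?k"
  proof
    fix w assume w: "w \<in> box (h *\<^sub>R ?k) (h *\<^sub>R ?k + h *\<^sub>R One)"
    have "\<lfloor>w \<bullet> b / h\<rfloor> = \<lfloor>z \<bullet> b / h\<rfloor>" if "b \<in> Basis" for b
    proof (rule floor_unique)
      have "h * real_of_int \<lfloor>z \<bullet> b / h\<rfloor> < w \<bullet> b \<and> w \<bullet> b < h * real_of_int \<lfloor>z \<bullet> b / h\<rfloor> + h"
        using w that by (auto simp: mem_box inner_add_left lat_inner)
      then show "real_of_int \<lfloor>z \<bullet> b / h\<rfloor> \<le> w \<bullet> b / h" "w \<bullet> b / h < real_of_int \<lfloor>z \<bullet> b / h\<rfloor> + 1"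
        using assms by (simp_all add: field_simps)
    qed
    then show "w \<in> cell h ?k" by (auto simp: cell_def lat_def intro!: sum.cong)
  qed
  then have "measure lborel (box (h *\<^sub>R ?k) (h *\<^sub>R ?k + h *\<^sub>R One)) \<le> measure lborel (cell h ?k)"
    using cell_emeasure_finite[OF assms, of ?k] by (intro measure_mono_fmeasurable) (auto simp: fmeasurable_def)
  moreover have "measure lborel (box (h *\<^sub>R ?k) (h *\<^sub>R ?k + h *\<^sub>R (One :: 'a))) = h ^ DIM('a)"
    using assms by (subst measure_lborel_box) (auto simp: inner_add_left)
  ultimately show ?thesis by simp
qed

lemma floor_mem_symmetric_interval:
  assumes "\<bar>x\<bar> \<le> (y :: real)"
  shows "\<lfloor>x\<rfloor> \<in> {- (\<lceil>y\<rceil> + 1) .. \<lceil>y\<rceil> + 1}"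
proof -
  have "x \<le> y" "- y \<le> x" using assms by linarith+
  then have "\<lfloor>x\<rfloor> \<le> \<lceil>y\<rceil>" "- \<lceil>y\<rceil> - 1 \<le> \<lfloor>x\<rfloor>" by linarith+
  then show ?thesis by simp
qed

lemma finite_lat_ball: "finite (lat h ` cball (0 :: 'a::euclidean_space) R)" if "h > 0"
proof -
  let ?m = "\<lceil>R / h\<rceil> + 1"
  have "lat h ` cball (0 :: 'a) R \<subseteq> (\<lambda>k. \<Sum>b\<in>Basis. real_of_int (k b) *\<^sub>R b) ` (Basis \<rightarrow>\<^sub>E {-?m..?m})"
  proof (rule image_subsetI)
    fix z :: 'a assume z: "z \<in> cball 0 R"
    have "\<lfloor>z \<bullet> b / h\<rfloor> \<in> {-?m..?m}" if b: "b \<in> Basis" for b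
    proof -
      have "\<bar>z \<bullet> b\<bar> \<le> R" using Basis_le_norm[OF b, of z] z by simp
      then have "\<bar>z \<bullet> b / h\<bar> \<le> R / h" using \<open>h > 0\<close> by (simp add: divide_right_mono)
      then show ?thesis by (rule floor_mem_symmetric_interval)
    qed
    then have "restrict (\<lambda>b. \<lfloor>z \<bullet> b / h\<rfloor>) Basis \<in> Basis \<rightarrow>\<^sub>E {-?m..?m}" by auto
    moreover have "lat h z = (\<Sum>b\<in>Basis. real_of_int (restrict (\<lambda>b. \<lfloor>z \<bullet> b / h\<rfloor>) Basis b) *\<^sub>R b)"
      by (simp add: lat_def)
    ultimately show "lat h z \<in> (\<lambda>k. \<Sum>b\<in>Basis. real_of_int (k b) *\<^sub>R b) ` (Basis \<rightarrow>\<^sub>E {-?m..?m})" by blast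
  qed
  then show ?thesis by (rule finite_subset) (intro finite_imageI finite_PiE; simp)
qed

definition cint :: "real \<Rightarrow> 'a::euclidean_space \<Rightarrow> 'a tf \<Rightarrow> real" where
  "cint h k f = (\<integral>z. indicator (cell h k) z * app f z \<partial>lborel)"

lemma integrable_indicator_mult:
  fixes g :: "'a::euclidean_space \<Rightarrow> real"
  assumes "integrable lborel g" "C \<in> sets borel"
  shows "integrable lborel (\<lambda>z. indicator C z * g z)"
  using integrable_mult_indicator[of C lborel g] assms by simp

lemma integrable_app: "integrable lborel (app f)"
  by (intro integrable_compact_supp continuous_app bounded_supp)

lemma cint_linear: "linear (cint h k)"
  by (rule linearI)
     (simp_all add: cint_def app_add app_scaleR distrib_left mult.left_commute[of "indicator _ _"]
       Bochner_Integration.integral_add integrable_indicator_mult integrable_app)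

text \<open>The variance identity for one cell, by expanding the square. Its left side is
  nonnegative, which yields the Cauchy-Schwarz bound of the second claim.\<close>

lemma cell_variance:
  fixes f :: "'a::euclidean_space tf" and k :: 'a
  assumes h: "h > 0"
  defines "\<mu> \<equiv> measure lborel (cell h k)" and "b \<equiv> (\<integral>z. indicator (cell h k) z * (app f z * app f z) \<partial>lborel)"
  shows "(\<integral>z. (\<integral>w. indicator (cell h k) z * (indicator (cell h k) w * (app f z - app f w)\<^sup>2) \<partial>lborel) \<partial>lborel)
     = 2 * (\<mu> * b - (cint h k f)\<^sup>2)"
    and "(cint h k f)\<^sup>2 \<le> \<mu> * (f \<bullet> f)"
proof -
  let ?I = "\<lambda>z. indicator (cell h k) z :: real"
  have iI: "integrable lborel ?I"
    using cell_emeasure_finite[OF h] by (intro integrable_real_indicator) auto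
  have i1: "integrable lborel (\<lambda>z. ?I z * app f z)"
    by (intro integrable_indicator_mult integrable_app) auto
  have i2: "integrable lborel (\<lambda>z. ?I z * (app f z * app f z))"
    by (intro integrable_indicator_mult) auto
  have inner: "(\<integral>w. ?I z * (?I w * (app f z - app f w)\<^sup>2) \<partial>lborel)
    = \<mu> * (?I z * (app f z * app f z)) - 2 * cint h k f * (?I z * app f z) + b * ?I z" for z
  proof -
    have "(\<integral>w. ?I w * (app f z - app f w)\<^sup>2 \<partial>lborel)
      = (\<integral>w. (app f z * app f z) * ?I w - 2 * app f z * (?I w * app f w) + ?I w * (app f w * app f w) \<partial>lborel)"
      by (rule Bochner_Integration.integral_cong) (auto simp: power2_eq_square algebra_simps)
    also have "\<dots> = (app f z * app f z) * \<mu> - 2 * app f z * cint h k f + b"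
      using iI i1 i2 by (simp add: cint_def b_def \<mu>_def)
    finally have *: "(\<integral>w. ?I w * (app f z - app f w)\<^sup>2 \<partial>lborel) = (app f z * app f z) * \<mu> - 2 * app f z * cint h k f + b" .
    show ?thesis unfolding integral_mult_right_zero * by (simp add: algebra_simps)
  qed
  show eq: "(\<integral>z. (\<integral>w. ?I z * (?I w * (app f z - app f w)\<^sup>2) \<partial>lborel) \<partial>lborel) = 2 * (\<mu> * b - (cint h k f)\<^sup>2)"
    unfolding inner using iI i1 i2 by (simp add: cint_def[symmetric] b_def[symmetric] \<mu>_def[symmetric] power2_eq_square)
  have "0 \<le> 2 * (\<mu> * b - (cint h k f)\<^sup>2)"
    unfolding eq[symmetric] by (intro integral_nonneg_AE AE_I2 mult_nonneg_nonneg) auto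
  then have "(cint h k f)\<^sup>2 \<le> \<mu> * b" by simp
  also have "\<dots> \<le> \<mu> * (f \<bullet> f)"
    unfolding b_def inner_tf_def \<mu>_def
    by (intro mult_left_mono Bochner_Integration.integral_mono) (use i2 in \<open>auto simp: indicator_def\<close>)
  finally show "(cint h k f)\<^sup>2 \<le> \<mu> * (f \<bullet> f)" .
qed

text \<open>After the substitution w = z + v the integral over z is the squared norm of
  \<open>tr v f - f\<close>. In \<open>grid_poincare\<close> the set \<open>C\<close> contains all
  differences of points from a common cell.\<close>

lemma translation_average:
  fixes f :: "'a::euclidean_space tf" and C :: "'a set"
  assumes C: "C \<in> sets borel" "bounded C" and d: "\<And>v. v \<in> C \<Longrightarrow> norm (tr v f - f) \<le> \<delta>"
  defines "E \<equiv> (\<lambda>z w. indicator C (w - z) * (app f z - app f w)\<^sup>2)"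
  shows "integrable (lborel \<Otimes>\<^sub>M lborel) (\<lambda>(z, w). E z w)"
    and "(\<integral>z. (\<integral>w. E z w \<partial>lborel) \<partial>lborel) \<le> measure lborel C * \<delta>\<^sup>2"
proof -
  note C(1)[measurable]
  obtain M where M: "M \<ge> 0" "\<And>z. \<bar>app f z\<bar> \<le> M" using app_bounded[of f] by metis
  obtain R where R: "R > 0" "\<And>z. app f z \<noteq> 0 \<Longrightarrow> norm z \<le> R" using app_support_radius[of f] by metis
  obtain L where L: "L > 0" "\<And>v. v \<in> C \<Longrightarrow> norm v \<le> L" using C(2) unfolding bounded_pos by auto
  have sq: "(app f z - app f w)\<^sup>2 \<le> (2 * M)\<^sup>2" for z w
  proof -
    have "\<bar>app f z - app f w\<bar> \<le> 2 * M" using M(2)[of z] M(2)[of w] by linarith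
    then show ?thesis by (metis abs_ge_zero power2_abs power_mono)
  qed
  have finC: "emeasure lborel C < \<infinity>" by (rule emeasure_bounded_finite[OF C(2)])
  show intE: "integrable (lborel \<Otimes>\<^sub>M lborel) (\<lambda>(z, w). E z w)"
    unfolding lborel_prod
  proof (rule Bochner_Integration.integrable_bound)
    show "integrable lborel (\<lambda>p. (2 * M)\<^sup>2 * indicat_real (cball (0::'a) (R + L) \<times> cball (0::'a) (R + L)) p)"
      by (intro integrable_mult_right integrable_real_indicator)
         (auto intro!: emeasure_bounded_finite[unfolded infinity_ennreal_def] bounded_Times borel_closed closed_Times)
    show "(\<lambda>(z, w). E z w) \<in> borel_measurable lborel" unfolding E_def lborel_prod[symmetric] by measurable
    have "\<bar>E z w\<bar> \<le> (2 * M)\<^sup>2 * indicat_real (cball 0 (R + L) \<times> cball 0 (R + L)) (z, w)" for z w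
    proof (cases "E z w = 0")
      case False
      then have "w - z \<in> C" "app f z \<noteq> 0 \<or> app f w \<noteq> 0" by (auto simp: E_def indicator_def split: if_splits)
      then have "norm (w - z) \<le> L" "norm z \<le> R \<or> norm w \<le> R" using L R by auto
      then have "norm z \<le> R + L" "norm w \<le> R + L"
        using norm_triangle_ineq4[of w "w - z"] norm_triangle_ineq[of z "w - z"] R(1) L(1) by auto
      then show ?thesis using sq[of z w] by (simp add: E_def indicator_def)
    qed auto
    then show "AE p in lborel. norm (case p of (z, w) \<Rightarrow> E z w) \<le> norm ((2 * M)\<^sup>2 * indicat_real (cball (0::'a) (R + L) \<times> cball (0::'a) (R + L)) p)"
      by (intro AE_I2) (auto split: prod.split)
  qed
  let ?F = "\<lambda>z v. indicator C v * (app f z - app f (z + v))\<^sup>2"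
  have intF: "integrable (lborel \<Otimes>\<^sub>M lborel) (\<lambda>(z, v). ?F z v)"
    unfolding lborel_prod
  proof (rule Bochner_Integration.integrable_bound)
    show "integrable lborel (\<lambda>p. (2 * M)\<^sup>2 * indicat_real (cball (0::'a) (R + L) \<times> cball (0::'a) L) p)"
      by (intro integrable_mult_right integrable_real_indicator)
         (auto intro!: emeasure_bounded_finite[unfolded infinity_ennreal_def] bounded_Times borel_closed closed_Times)
    show "(\<lambda>(z, v). ?F z v) \<in> borel_measurable lborel" unfolding lborel_prod[symmetric] by measurable
    have "\<bar>?F z v\<bar> \<le> (2 * M)\<^sup>2 * indicat_real (cball 0 (R + L) \<times> cball 0 L) (z, v)" for z v
    proof (cases "?F z v = 0")
      case False
      then have "v \<in> C" "app f z \<noteq> 0 \<or> app f (z + v) \<noteq> 0" by (auto simp: indicator_def split: if_splits)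
      then have "norm v \<le> L" "norm z \<le> R \<or> norm (z + v) \<le> R" using L R by auto
      then have "norm z \<le> R + L" "norm v \<le> L"
        using norm_triangle_ineq4[of "z + v" v] R(1) L(1) by auto
      then show ?thesis using sq[of z "z + v"] by (simp add: indicator_def)
    qed auto
    then show "AE p in lborel. norm (case p of (z, v) \<Rightarrow> ?F z v) \<le> norm ((2 * M)\<^sup>2 * indicat_real (cball (0::'a) (R + L) \<times> cball (0::'a) L) p)"
      by (intro AE_I2) (auto split: prod.split)
  qed
  have "(\<integral>w. E z w \<partial>lborel) = (\<integral>v. ?F z v \<partial>lborel)" for z
  proof -
    have "(\<integral>v. (\<lambda>w. E z w) (v + z) \<partial>lborel) = (\<integral>w. E z w \<partial>lborel)"
      unfolding E_def by (rule lborel_integral_translate) measurable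
    then show ?thesis by (simp add: E_def add.commute)
  qed
  then have "(\<integral>z. (\<integral>w. E z w \<partial>lborel) \<partial>lborel) = (\<integral>z. (\<integral>v. ?F z v \<partial>lborel) \<partial>lborel)" by simp
  also have "\<dots> = (\<integral>v. (\<integral>z. ?F z v \<partial>lborel) \<partial>lborel)"
    by (rule lborel_pair.Fubini_integral[OF intF, symmetric])
  also have "\<dots> \<le> (\<integral>v. \<delta>\<^sup>2 * indicator C v \<partial>lborel)"
  proof (rule Bochner_Integration.integral_mono)
    show "integrable lborel (\<lambda>v. \<integral>z. ?F z v \<partial>lborel)"
      by (rule lborel_pair.integrable_snd[OF intF])
    show "integrable lborel (\<lambda>v. \<delta>\<^sup>2 * indicat_real C v)"
      using finC by (intro integrable_mult_right integrable_real_indicator) auto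
    show "(\<integral>z. ?F z v \<partial>lborel) \<le> \<delta>\<^sup>2 * indicator C v" for v
    proof (cases "v \<in> C")
      case True
      have "(\<integral>z. ?F z v \<partial>lborel) = (tr v f - f) \<bullet> (tr v f - f)"
        unfolding inner_tf_def using True
        by (intro Bochner_Integration.integral_cong) (auto simp: app_minus app_tr power2_eq_square algebra_simps)
      also have "\<dots> = (norm (tr v f - f))\<^sup>2" by (simp add: power2_norm_eq_inner)
      also have "\<dots> \<le> \<delta>\<^sup>2" using d[OF True] by (intro power_mono) auto
      finally show ?thesis using True by simp
    qed simp
  qed
  finally show "(\<integral>z. (\<integral>w. E z w \<partial>lborel) \<partial>lborel) \<le> measure lborel C * \<delta>\<^sup>2" by (simp add: mult.commute)
qed

text \<open>Poincare's inequality on a grid of cells, in the form needed for compactness: up to the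
  finitely many cell integrals, the norm is small.\<close>

lemma grid_poincare:
  fixes f :: "'a::euclidean_space tf"
  assumes h: "h > 0" and f: "f \<in> tfs S" and S: "S \<subseteq> cball 0 R" and K: "\<And>b. b \<in> Basis \<Longrightarrow> norm (pd b f) \<le> K"
  shows "h ^ DIM('a) * (f \<bullet> f) \<le> (\<Sum>k\<in>lat h ` cball 0 R. (cint h k f)\<^sup>2) + (2 * h) ^ DIM('a) * (h * (real DIM('a) * K))\<^sup>2 / 2"
proof -
  let ?W = "lat h ` cball (0::'a) R"
  let ?C = "cbox (- h *\<^sub>R One) (h *\<^sub>R (One :: 'a))"
  let ?\<mu> = "\<lambda>k. measure lborel (cell h k)"
  let ?b = "\<lambda>k. \<integral>z. indicator (cell h k) z * (app f z * app f z) \<partial>lborel"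
  define \<delta> where "\<delta> = h * (real DIM('a) * K)"
  have fin: "finite ?W" by (rule finite_lat_ball[OF h])
  have d: "norm (tr v f - f) \<le> \<delta>" if v: "v \<in> ?C" for v
  proof -
    have K0: "K \<ge> 0" using K[OF SOME_Basis] norm_ge_zero order_trans by blast
    have "pd v f = (\<Sum>b\<in>Basis. (v \<bullet> b) *\<^sub>R pd b f)"
    proof -
      have "pd (\<Sum>b\<in>B. (v \<bullet> b) *\<^sub>R b) f = (\<Sum>b\<in>B. (v \<bullet> b) *\<^sub>R pd b f)" if "finite B" for B
        using that
      proof (induction B rule: finite_induct)
        case empty
        show ?case using pd_scale_vec[of 0 0 f] by simp
      qed (simp add: pd_add_vec pd_scale_vec)
      then show ?thesis using euclidean_representation[of v] by (metis finite_Basis)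
    qed
    then have "norm (pd v f) \<le> (\<Sum>b\<in>Basis. norm ((v \<bullet> b) *\<^sub>R pd b f))" by (simp only: norm_sum)
    also have "\<dots> \<le> (\<Sum>b\<in>(Basis::'a set). h * K)"
    proof (rule sum_mono)
      fix b :: 'a assume b: "b \<in> Basis"
      have "\<bar>v \<bullet> b\<bar> \<le> h" using v b by (auto simp: mem_box abs_le_iff)
      then show "norm ((v \<bullet> b) *\<^sub>R pd b f) \<le> h * K" using K[OF b] K0 h by (simp add: mult_mono)
    qed
    finally show ?thesis using norm_tr_diff_le[of v f] by (simp add: \<delta>_def mult_ac)
  qed
  let ?D = "\<lambda>k z w. indicator (cell h k) z * (indicator (cell h k) w * (app f z - app f w)\<^sup>2)"
  let ?E = "\<lambda>z w. indicator ?C (w - z) * (app f z - app f w)\<^sup>2"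
  have intE: "integrable (lborel \<Otimes>\<^sub>M lborel) (\<lambda>(z, w). ?E z w)"
    using d by (intro translation_average(1)) auto
  \<comment> \<open>Two points share at most one cell, and then their difference lies in
    \<open>?C\<close>. Hence a single translation average dominates all cell integrals
    together.\<close>
  have DE: "(\<Sum>k\<in>?W. ?D k z w) \<le> ?E z w" for z w
  proof (cases "lat h z = lat h w")
    case True
    have "(\<Sum>k\<in>?W. ?D k z w) = (\<Sum>k\<in>?W. if k = lat h z then (app f z - app f w)\<^sup>2 else 0)"
      using True by (intro sum.cong) (auto simp: cell_def)
    also have "\<dots> \<le> ?D (lat h z) z w" using fin True by (simp add: sum.delta cell_def)
    also have "\<dots> \<le> ?E z w"
      using cell_diff[OF _ _ h, of z "lat h z" w] True by (auto simp: cell_def indicator_def)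
    finally show ?thesis .
  next
    case False
    then have 0: "?D k z w = 0" for k by (auto simp: cell_def indicator_def)
    show ?thesis unfolding 0 by simp
  qed
  have D0: "0 \<le> ?D k z w" for k z w by simp
  have intD: "integrable (lborel \<Otimes>\<^sub>M lborel) (\<lambda>(z, w). ?D k z w)" if "k \<in> ?W" for k
    unfolding lborel_prod
  proof (rule Bochner_Integration.integrable_bound[OF intE[unfolded lborel_prod]])
    show "(\<lambda>(z, w). ?D k z w) \<in> borel_measurable lborel" unfolding lborel_prod[symmetric] by measurable
    have "?D k z w \<le> ?E z w" for z w
      using member_le_sum[OF that, of "\<lambda>k. ?D k z w"] DE[of z w] fin D0 by (meson order_trans)
    then show "AE p in lborel. norm (case p of (z, w) \<Rightarrow> ?D k z w) \<le> norm (case p of (z, w) \<Rightarrow> ?E z w)"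
      by (intro AE_I2) (auto split: prod.split simp: abs_of_nonneg D0)
  qed
  have "(\<Sum>k\<in>?W. 2 * (?\<mu> k * ?b k - (cint h k f)\<^sup>2)) = (\<Sum>k\<in>?W. \<integral>z. (\<integral>w. ?D k z w \<partial>lborel) \<partial>lborel)"
    by (simp only: cell_variance(1)[OF h])
  also have "\<dots> = (\<Sum>k\<in>?W. \<integral>p. (case p of (z, w) \<Rightarrow> ?D k z w) \<partial>(lborel \<Otimes>\<^sub>M lborel))"
    using lborel_pair.integral_fst'[OF intD] by (intro sum.cong) auto
  also have "\<dots> = (\<integral>p. (\<Sum>k\<in>?W. case p of (z, w) \<Rightarrow> ?D k z w) \<partial>(lborel \<Otimes>\<^sub>M lborel))"
    by (rule Bochner_Integration.integral_sum[symmetric]) (rule intD)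
  also have "\<dots> \<le> (\<integral>p. (case p of (z, w) \<Rightarrow> ?E z w) \<partial>(lborel \<Otimes>\<^sub>M lborel))"
    by (rule Bochner_Integration.integral_mono)
       (use DE intE intD in \<open>auto intro!: Bochner_Integration.integrable_sum simp del: mult_eq_0_iff\<close>)
  also have "\<dots> = (\<integral>z. (\<integral>w. ?E z w \<partial>lborel) \<partial>lborel)"
    using lborel_pair.integral_fst'[OF intE] by simp
  also have "\<dots> \<le> measure lborel ?C * \<delta>\<^sup>2"
    using d by (intro translation_average(2)) auto
  also have "measure lborel ?C = (2 * h) ^ DIM('a)"
  proof -
    have "measure lborel ?C = (\<Prod>b\<in>Basis. (h *\<^sub>R One - - h *\<^sub>R (One :: 'a)) \<bullet> b)"
      using h by (intro measure_lborel_cbox) auto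
    also have "\<dots> = (\<Prod>b\<in>(Basis :: 'a set). 2 * h)"
      by (rule prod.cong) (auto simp: inner_add_left inner_diff_left)
    finally show ?thesis by simp
  qed
  finally have main: "(\<Sum>k\<in>?W. 2 * (?\<mu> k * ?b k - (cint h k f)\<^sup>2)) \<le> (2 * h) ^ DIM('a) * \<delta>\<^sup>2" .
  have "f \<bullet> f = (\<integral>z. (\<Sum>k\<in>?W. indicator (cell h k) z * (app f z * app f z)) \<partial>lborel)"
    unfolding inner_tf_def
  proof (rule Bochner_Integration.integral_cong[OF refl])
    fix z
    show "app f z * app f z = (\<Sum>k\<in>?W. indicator (cell h k) z * (app f z * app f z))"
    proof (cases "app f z = 0")
      case False
      then have "z \<in> cball 0 R" using tfs_app[OF f] S by blast
      then have zW: "lat h z \<in> ?W" by (rule imageI)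
      have "(\<Sum>k\<in>?W. indicator (cell h k) z * (app f z * app f z)) = (\<Sum>k\<in>?W. if k = lat h z then app f z * app f z else 0)"
        by (intro sum.cong) (auto simp: cell_def indicator_def)
      then show ?thesis using zW fin by (simp add: sum.delta)
    qed simp
  qed
  also have "\<dots> = (\<Sum>k\<in>?W. ?b k)"
    by (rule Bochner_Integration.integral_sum) (auto intro!: integrable_indicator_mult)
  finally have fb: "f \<bullet> f = (\<Sum>k\<in>?W. ?b k)" .
  have "h ^ DIM('a) * (f \<bullet> f) \<le> (\<Sum>k\<in>?W. ?\<mu> k * ?b k)"
    unfolding fb sum_distrib_left
  proof (rule sum_mono)
    fix k assume "k \<in> ?W"
    then show "h ^ DIM('a) * ?b k \<le> ?\<mu> k * ?b k"
      using cell_measure_ge[OF h] by (intro mult_right_mono integral_nonneg_AE) auto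
  qed
  also have "\<dots> \<le> (\<Sum>k\<in>?W. (cint h k f)\<^sup>2) + (2 * h) ^ DIM('a) * \<delta>\<^sup>2 / 2"
    using main by (simp add: sum_subtractf sum_distrib_left[symmetric])
  finally show ?thesis by (simp add: \<delta>_def)
qed

text \<open>Rounding the cell integrals, which are finitely many bounded numbers, leaves finitely
  many classes, and by \<open>grid_poincare\<close> two functions of one class are
  \<epsilon>-close.\<close>

lemma rellich_totally_bounded:
  fixes S :: "'a::euclidean_space set" and K :: real
  assumes S: "S \<subseteq> cball 0 R" and \<epsilon>: "\<epsilon> > 0"
  defines "F \<equiv> {f \<in> tfs S. norm f \<le> K \<and> (\<forall>b\<in>Basis. norm (pd b f) \<le> K)}"
  shows "\<exists>G. finite G \<and> G \<subseteq> F \<and> F \<subseteq> (\<Union>g\<in>G. ball g \<epsilon>)"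
proof -
  define D where "D = real DIM('a)"
  have "((\<lambda>h. 2 ^ DIM('a) * (h * (D * (2 * K)))\<^sup>2 / 2) \<longlongrightarrow> 2 ^ DIM('a) * (0 * (D * (2 * K)))\<^sup>2 / 2) (at_right 0)"
    by (intro tendsto_intros) auto
  then have "\<forall>\<^sub>F h in at_right 0. 2 ^ DIM('a) * (h * (D * (2 * K)))\<^sup>2 / 2 < \<epsilon>\<^sup>2 / 2"
    using \<epsilon> by (intro order_tendstoD) auto
  then obtain h0 where "h0 > 0" "\<And>h. 0 < h \<Longrightarrow> h < h0 \<Longrightarrow> 2 ^ DIM('a) * (h * (D * (2 * K)))\<^sup>2 / 2 < \<epsilon>\<^sup>2 / 2"
    unfolding eventually_at_right_field by blast
  note h0 = this
  define h where "h = h0 / 2"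
  have "h < h0" and h: "h > 0" using h0(1) by (simp_all add: h_def)
  then have hs: "2 ^ DIM('a) * (h * (D * (2 * K)))\<^sup>2 / 2 < \<epsilon>\<^sup>2 / 2" by (intro h0(2))
  define W where "W = lat h ` cball (0::'a) R"
  have fin: "finite W" unfolding W_def by (rule finite_lat_ball[OF h])
  define N where "N = real (card W) + 1"
  \<comment> \<open>Makes \<open>N * \<eta>\<^sup>2\<close> half of
    \<open>h ^ DIM('a) * \<epsilon>\<^sup>2\<close>. The choice of \<open>h\<close> keeps the
    gradient term below the other half; it uses \<open>2 * K\<close> because the estimate is applied
    to a difference.\<close>
  define \<eta> where "\<eta> = sqrt (h ^ DIM('a) * (\<epsilon>\<^sup>2 / (2 * N)))"
  have N: "N > 0" by (simp add: N_def add_nonneg_pos)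
  have \<eta>: "\<eta> > 0" using h \<epsilon> N by (simp add: \<eta>_def)
  define key where "key f = restrict (\<lambda>k. \<lfloor>cint h k f / \<eta>\<rfloor>) W" for f :: "'a tf"
  define B where "B k = \<lceil>sqrt (measure lborel (cell h k)) * \<bar>K\<bar> / \<eta>\<rceil> + 1" for k :: 'a
  have "key ` F \<subseteq> Pi\<^sub>E W (\<lambda>k. {- B k .. B k})"
  proof (rule image_subsetI)
    fix f assume f: "f \<in> F"
    have "\<lfloor>cint h k f / \<eta>\<rfloor> \<in> {- B k .. B k}" for k
    proof -
      have "\<bar>cint h k f\<bar> \<le> sqrt (measure lborel (cell h k)) * norm f"
        using real_sqrt_le_mono[OF cell_variance(2)[OF h, of k f]] by (simp add: real_sqrt_mult norm_eq_sqrt_inner)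
      also have "\<dots> \<le> sqrt (measure lborel (cell h k)) * \<bar>K\<bar>"
        using f by (intro mult_left_mono) (auto simp: F_def)
      finally have "\<bar>cint h k f / \<eta>\<bar> \<le> sqrt (measure lborel (cell h k)) * \<bar>K\<bar> / \<eta>"
        using \<eta> by (simp add: divide_right_mono)
      then show ?thesis unfolding B_def by (rule floor_mem_symmetric_interval)
    qed
    then show "key f \<in> Pi\<^sub>E W (\<lambda>k. {- B k .. B k})" by (auto simp: key_def)
  qed
  then have finkey: "finite (key ` F)" by (rule finite_subset) (intro finite_PiE fin; simp)
  define rep where "rep y = (SOME f. f \<in> F \<and> key f = y)" for y
  have rep: "rep y \<in> F \<and> key (rep y) = y" if "y \<in> key ` F" for y
    unfolding rep_def by (rule someI_ex) (use that in auto)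
  have close: "norm (f - g) < \<epsilon>" if f: "f \<in> F" and g: "g \<in> F" and kk: "key f = key g" for f g
  proof -
    have c: "(cint h k (f - g))\<^sup>2 \<le> \<eta>\<^sup>2" if "k \<in> W" for k
    proof -
      have "\<lfloor>cint h k f / \<eta>\<rfloor> = \<lfloor>cint h k g / \<eta>\<rfloor>" using kk that unfolding key_def by (metis restrict_apply')
      then have "\<bar>cint h k f / \<eta> - cint h k g / \<eta>\<bar> < 1" by linarith
      then have "\<bar>(cint h k f - cint h k g) / \<eta>\<bar> < 1" by (simp add: diff_divide_distrib)
      then have "\<bar>cint h k (f - g)\<bar> < \<eta>" using \<eta> by (simp add: linear_diff[OF cint_linear])
      then show ?thesis by (metis abs_ge_zero less_eq_real_def power2_abs power_mono)
    qed
    have p: "norm (pd b (f - g)) \<le> 2 * K" if "b \<in> Basis" for b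
    proof -
      have "norm (pd b f) \<le> K" "norm (pd b g) \<le> K" using f g that by (auto simp: F_def)
      then show ?thesis using norm_triangle_ineq4[of "pd b f" "pd b g"] by (simp add: pd_lin)
    qed
    have "h ^ DIM('a) * ((f - g) \<bullet> (f - g)) \<le> (\<Sum>k\<in>W. (cint h k (f - g))\<^sup>2) + (2 * h) ^ DIM('a) * (h * (real DIM('a) * (2 * K)))\<^sup>2 / 2"
      unfolding W_def using f g by (intro grid_poincare[OF h _ S p] tfs_diff) (auto simp: F_def)
    also have "(\<Sum>k\<in>W. (cint h k (f - g))\<^sup>2) \<le> (\<Sum>k\<in>W. \<eta>\<^sup>2)" by (rule sum_mono) (rule c)
    also have "\<dots> \<le> N * \<eta>\<^sup>2" by (simp add: N_def distrib_right)
    also have "N * \<eta>\<^sup>2 = h ^ DIM('a) * (\<epsilon>\<^sup>2 / 2)"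
      using N h \<epsilon> by (simp add: \<eta>_def)
    also have "(2 * h) ^ DIM('a) * (h * (real DIM('a) * (2 * K)))\<^sup>2 / 2 = h ^ DIM('a) * (2 ^ DIM('a) * (h * (D * (2 * K)))\<^sup>2 / 2)"
      by (simp add: power_mult_distrib D_def)
    also have "h ^ DIM('a) * (\<epsilon>\<^sup>2 / 2) + h ^ DIM('a) * (2 ^ DIM('a) * (h * (D * (2 * K)))\<^sup>2 / 2) < h ^ DIM('a) * \<epsilon>\<^sup>2"
    proof -
      have "h ^ DIM('a) * (2 ^ DIM('a) * (h * (D * (2 * K)))\<^sup>2 / 2) < h ^ DIM('a) * (\<epsilon>\<^sup>2 / 2)"
        using hs h by (intro mult_strict_left_mono) auto
      then show ?thesis by simp
    qed
    finally have "(f - g) \<bullet> (f - g) < \<epsilon>\<^sup>2" using h by simp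
    then have "(norm (f - g))\<^sup>2 < \<epsilon>\<^sup>2" by (simp add: power2_norm_eq_inner)
    then show ?thesis using \<epsilon> by (simp add: power_less_imp_less_base)
  qed
  have "F \<subseteq> (\<Union>g\<in>rep ` key ` F. ball g \<epsilon>)"
  proof
    fix f assume f: "f \<in> F"
    then have "rep (key f) \<in> F \<and> key (rep (key f)) = key f" using rep by blast
    then have "f \<in> ball (rep (key f)) \<epsilon>" using close[of "rep (key f)" f] f by (simp add: dist_norm)
    then show "f \<in> (\<Union>g\<in>rep ` key ` F. ball g \<epsilon>)" using f by blast
  qed
  moreover have "finite (rep ` key ` F)" using finkey by (rule finite_imageI)
  moreover have "rep ` key ` F \<subseteq> F" using rep by (intro image_subsetI) (meson imageE)
  ultimately show ?thesis by blast
qed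

text \<open>Test functions are not complete in this norm, so the conclusion is a Cauchy subsequence;
  \<open>Cauchy_converges\<close> later finds the limit in L2.\<close>

lemma rellich:
  fixes f :: "nat \<Rightarrow> 'a::euclidean_space tf"
  assumes "bounded S" "\<And>m. f m \<in> tfs S" "\<And>m. norm (f m) \<le> K" "\<And>m b. b \<in> Basis \<Longrightarrow> norm (pd b (f m)) \<le> K"
  obtains r where "strict_mono r" "Cauchy (f \<circ> r)"
proof -
  obtain R where "\<forall>z\<in>S. norm z \<le> R" using assms(1) unfolding bounded_iff by blast
  then have R: "S \<subseteq> cball 0 R" by auto
  define F where "F = {f \<in> tfs S. norm f \<le> K \<and> (\<forall>b\<in>Basis. norm (pd b f) \<le> K)}"
  have "Met_TC.mtotally_bounded F"
    unfolding Met_TC.mtotally_bounded_def mball_eq_ball F_def using rellich_totally_bounded[OF R, of _ K] by simp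
  moreover have "range f \<subseteq> F" using assms by (auto simp: F_def)
  ultimately obtain r where "strict_mono r" "Cauchy (f \<circ> r)"
    unfolding Met_TC.mtotally_bounded_sequentially MCauchy_iff_Cauchy by meson
  then show ?thesis by (rule that)
qed

section \<open>Bump functions and uniqueness of weak derivatives\<close>

text \<open>The derivatives of \<open>s \<mapsto> exp (- c / s)\<close>, extended by zero, are combinations of these functions.\<close>

definition flat :: "real \<Rightarrow> nat \<Rightarrow> real \<Rightarrow> real" where
  "flat c j s = (if s > 0 then (1 / s) ^ j * exp (- c / s) else 0)"

lemma power_le_fact_exp:
  fixes x :: real
  assumes "x \<ge> 0" shows "x ^ k \<le> fact k * exp x"
proof -
  have "(\<Sum>n\<in>{k}. x ^ n /\<^sub>R fact n) \<le> (\<Sum>n. x ^ n /\<^sub>R fact n)"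
    using assms by (intro sum_le_suminf sums_summable[OF exp_converges]) auto
  then have "x ^ k / fact k \<le> exp x" by (simp add: exp_def divide_inverse mult.commute)
  then show ?thesis by (simp add: divide_le_eq mult.commute)
qed

text \<open>The bound of x^k by k! exp x, taken at x = c / s with k = j + 2, leaves a factor s^2. So
  the derivative at 0 vanishes for every \<open>j\<close>.\<close>

lemma flat_le:
  assumes "c > 0" shows "\<bar>flat c j s\<bar> \<le> fact (j + 2) / c ^ (j + 2) * s\<^sup>2"
proof (cases "s > 0")
  case True
  have "(c / s) ^ (j + 2) \<le> fact (j + 2) * exp (c / s)"
    using True assms by (intro power_le_fact_exp) auto
  then have "(c / s) ^ (j + 2) * exp (- (c / s)) \<le> fact (j + 2) * exp (c / s) * exp (- (c / s))"
    by (rule mult_right_mono) simp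
  also have "\<dots> = fact (j + 2)" by (simp add: exp_minus)
  finally have "c ^ (j + 2) / s ^ (j + 2) * exp (- (c / s)) \<le> fact (j + 2)" by (simp add: power_divide)
  then have "c ^ (j + 2) * ((1 / s) ^ j * exp (- (c / s))) \<le> fact (j + 2) * s\<^sup>2"
    using True by (simp add: power_add power_divide field_simps power2_eq_square)
  then show ?thesis using True assms by (simp add: flat_def field_simps)
next
  case False
  then show ?thesis using assms by (simp add: flat_def)
qed

lemma flat_has_derivative:
  assumes c: "c > 0"
  shows "(flat c j has_real_derivative (- real j * flat c (Suc j) s + c * flat c (Suc (Suc j)) s)) (at s)"
proof -
  consider "s > 0" | "s < 0" | "s = 0" by linarith
  then show ?thesis
  proof cases
    case 1
    have "((\<lambda>s. (1 / s) ^ j * exp (- c / s)) has_real_derivative (- real j * flat c (Suc j) s + c * flat c (Suc (Suc j)) s)) (at s)"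
    proof -
      have p: "((\<lambda>s. (1 / s) ^ j) has_real_derivative (- real j * (1 / s) ^ Suc j)) (at s)"
      proof (induction j)
        case (Suc j)
        have "((\<lambda>s. 1 / s) has_real_derivative (- ((1 / s)\<^sup>2))) (at s)"
          using 1 by (auto intro!: derivative_eq_intros simp: power2_eq_square field_simps)
        from DERIV_mult[OF this Suc] show ?case
          by (simp add: algebra_simps power2_eq_square diff_divide_distrib)
      qed simp
      have e: "((\<lambda>s. exp (- c / s)) has_real_derivative exp (- c / s) * (c * (1 / s)\<^sup>2)) (at s)"
        using 1 by (auto intro!: derivative_eq_intros simp: power2_eq_square field_simps)
      have "- real j * (1 / s) ^ Suc j * exp (- c / s) + exp (- c / s) * (c * (1 / s)\<^sup>2) * (1 / s) ^ j
          = - real j * flat c (Suc j) s + c * flat c (Suc (Suc j)) s"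
        using 1 by (simp add: flat_def power2_eq_square mult_ac)
      then show ?thesis using DERIV_mult[OF p e] by simp
    qed
    then show ?thesis
      by (rule has_field_derivative_transform_within_open[where S = "{0<..}"]) (use 1 in \<open>auto simp: flat_def\<close>)
  next
    case 2
    have "((\<lambda>s. 0) has_real_derivative 0) (at s)" by simp
    then have "(flat c j has_real_derivative 0) (at s)"
      by (rule has_field_derivative_transform_within_open[where S = "{..<0}"]) (use 2 in \<open>auto simp: flat_def\<close>)
    then show ?thesis using 2 by (simp add: flat_def)
  next
    case 3
    define K where "K = fact (j + 2) / c ^ (j + 2)"
    have "((\<lambda>h. flat c j h / h) \<longlongrightarrow> 0) (at 0)"
    proof (rule Lim_null_comparison)
      have "norm (flat c j h / h) \<le> K * \<bar>h\<bar>" for h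
        using flat_le[OF c, of j h] by (cases "h = 0") (auto simp: K_def divide_le_eq power2_eq_square abs_mult[symmetric] mult.assoc)
      then show "\<forall>\<^sub>F h in at 0. norm (flat c j h / h) \<le> K * \<bar>h\<bar>" by simp
      show "((\<lambda>h. K * \<bar>h\<bar>) \<longlongrightarrow> 0) (at 0)" by (auto intro!: tendsto_eq_intros)
    qed
    then show ?thesis using 3 by (simp add: DERIV_def flat_def)
  qed
qed

lemma C_k_on_flat:
  assumes c: "c > 0" and g: "smooth_on g UNIV"
  shows "C_k_on k (\<lambda>z. flat c j (g z)) UNIV"
proof (induction k arbitrary: j)
  case 0
  have "continuous_on UNIV (flat c j)"
    using flat_has_derivative[OF c] by (intro DERIV_continuous_on) (auto intro: has_field_derivative_at_within)
  then show ?case using smooth_on_continuous[OF g] by (auto intro: continuous_on_compose2)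
next
  case (Suc k)
  let ?d = "\<lambda>z. - real j * flat c (Suc j) (g z) + c * flat c (Suc (Suc j)) (g z)"
  have *: "((\<lambda>z. flat c j (g z)) has_derivative (\<lambda>v. ?d z * frechet_derivative g (at z) v)) (at z)" for z
    using has_derivative_compose[OF _ flat_has_derivative[OF c, unfolded has_field_derivative_def], of g "frechet_derivative g (at z)" z UNIV j]
      smooth_on_differentiable[OF g] by (auto simp: frechet_derivative_works)
  have "C_k_on k (\<lambda>z. ?d z * frechet_derivative g (at z) v) UNIV" for v
    by (intro C_k_on_mult C_k_on_add C_k_on_const Suc C_k_on_frechet g)
  then show ?case
    by (auto simp: frechet_derivative_eq[OF *] intro: differentiableI[OF *])
qed

lemma C_k_on_prod:
  "finite I \<Longrightarrow> (\<And>i. i \<in> I \<Longrightarrow> C_k_on k (f i) UNIV) \<Longrightarrow> C_k_on k (\<lambda>z. \<Prod>i\<in>I. f i z) UNIV"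
  by (induction I rule: finite_induct) (auto intro: C_k_on_const C_k_on_mult)

text \<open>The parameter \<open>1 / real (Suc m)\<close> tends to 0, and the functions tend
  pointwise to the indicator of the open box while staying between 0 and 1.\<close>

definition boxbump :: "'a::euclidean_space \<Rightarrow> 'a \<Rightarrow> nat \<Rightarrow> 'a \<Rightarrow> real" where
  "boxbump a c m z = (\<Prod>b\<in>Basis. flat (1 / real (Suc m)) 0 (z \<bullet> b + - (a \<bullet> b)) * flat (1 / real (Suc m)) 0 (c \<bullet> b + (-1) * (z \<bullet> b)))"

lemma flat_0_bounds: "c \<ge> 0 \<Longrightarrow> 0 \<le> flat c 0 s" "c \<ge> 0 \<Longrightarrow> flat c 0 s \<le> 1"
  by (auto simp: flat_def divide_nonneg_nonneg)

lemma boxbump_bounds: "0 \<le> boxbump a c m z" "boxbump a c m z \<le> 1"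
  unfolding boxbump_def
  by (auto intro!: prod_nonneg prod_le_1 mult_nonneg_nonneg mult_le_one flat_0_bounds)

lemma boxbump_outside: "z \<notin> box a c \<Longrightarrow> boxbump a c m z = 0"
proof -
  assume "z \<notin> box a c"
  then obtain b where "b \<in> Basis" "\<not> a \<bullet> b < z \<bullet> b \<or> \<not> z \<bullet> b < c \<bullet> b" unfolding mem_box by auto
  then show ?thesis unfolding boxbump_def
    by (intro prod_zero) (auto simp: flat_def intro!: bexI[of _ b])
qed

lemma boxbump_tendsto: "(\<lambda>m. boxbump a c m z) \<longlonglongrightarrow> indicator (box a c) z"
proof (cases "z \<in> box a c")
  case True
  have f: "(\<lambda>m. flat (1 / real (Suc m)) 0 s) \<longlonglongrightarrow> 1" if "s > 0" for s
  proof -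
    have "(\<lambda>m. exp (- (1 / real (Suc m)) / s)) \<longlonglongrightarrow> exp (- 0 / s)"
      using that by (intro tendsto_intros LIMSEQ_Suc[OF lim_1_over_n]) auto
    then show ?thesis using that by (simp add: flat_def)
  qed
  have "(\<lambda>m. boxbump a c m z) \<longlonglongrightarrow> (\<Prod>b\<in>(Basis::'a set). 1 * 1)"
    unfolding boxbump_def using True by (intro tendsto_prod tendsto_mult f) (auto simp: mem_box)
  then show ?thesis using True by simp
next
  case False
  then show ?thesis by (simp add: boxbump_outside)
qed

lemma boxbump_tf:
  obtains f where "app f = boxbump a c m" "f \<in> tfs (cbox a c)"
proof -
  have "smooth_on (\<lambda>z. z \<bullet> b + - (a \<bullet> b)) UNIV" "smooth_on (\<lambda>z. c \<bullet> b + (-1) * (z \<bullet> b)) UNIV" for b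
    unfolding smooth_on_def by (intro allI C_k_on_add C_k_on_mult C_k_on_inner C_k_on_const)+
  then have sm: "smooth_on (boxbump a c m) UNIV"
    unfolding smooth_on_def[of "boxbump a c m"] boxbump_def
    by (intro allI C_k_on_prod C_k_on_mult C_k_on_flat) auto
  have s: "{z. boxbump a c m z \<noteq> 0} \<subseteq> box a c" using boxbump_outside by blast
  then have "app (Abs_tf (boxbump a c m)) = boxbump a c m"
    by (intro app_Abs_tf sm) (rule bounded_subset[OF bounded_box])
  moreover have "closure {z. boxbump a c m z \<noteq> 0} \<subseteq> cbox a c"
    using s box_subset_cbox[of a c] by (intro closure_minimal) auto
  ultimately show ?thesis using that[of "Abs_tf (boxbump a c m)"] by (simp add: tfs_def)
qed

text \<open>Bumps tending to the indicator of a box show that \<open>w\<close> has integral zero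
  over every box inside \<open>\<Omega>\<close>. Lebesgue differentiation over cubes shrinking to a
  point then gives the value almost everywhere.\<close>

lemma weak_unique:
  fixes \<Omega> :: "'a::euclidean_space set"
  assumes \<Omega>: "open \<Omega>" and w: "integrable (lebesgue_on \<Omega>) w"
    and 0: "\<And>f. f \<in> tfs \<Omega> \<Longrightarrow> (LINT z|lebesgue_on \<Omega>. w z * app f z) = 0"
  shows "AE z in lebesgue_on \<Omega>. w z = 0"
proof -
  have m\<Omega>: "\<Omega> \<inter> space lebesgue \<in> sets lebesgue" using \<Omega> by auto
  define g where "g z = indicator \<Omega> z * w z" for z
  have ig: "integrable lebesgue g"
    using w unfolding integrable_restrict_space[OF m\<Omega>] by (simp add: g_def[abs_def])
  have aig: "g absolutely_integrable_on S" if "S \<in> sets lebesgue" for S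
    using integrable_mult_indicator[OF that ig] by (simp add: set_integrable_def)
  have cb: "integral (cbox a c) g = 0" if sub: "cbox a c \<subseteq> \<Omega>" for a c
  proof -
    have "\<exists>f. app f = boxbump a c m \<and> f \<in> tfs (cbox a c)" for m using boxbump_tf by metis
    then obtain F where F: "\<And>m. app (F m) = boxbump a c m" "\<And>m. F m \<in> tfs (cbox a c)" by metis
    have "(\<lambda>m. \<integral>z. g z * boxbump a c m z \<partial>lebesgue) \<longlonglongrightarrow> (\<integral>z. g z * indicator (box a c) z \<partial>lebesgue)"
    proof (rule integral_dominated_convergence[where w = "\<lambda>z. norm (g z)"])
      show "AE z in lebesgue. (\<lambda>m. g z * boxbump a c m z) \<longlonglongrightarrow> g z * indicator (box a c) z"
        by (intro AE_I2 tendsto_intros boxbump_tendsto)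
      show "AE z in lebesgue. norm (g z * boxbump a c m z) \<le> norm (g z)" for m
        using boxbump_bounds by (intro AE_I2) (auto simp: abs_mult abs_of_nonneg[OF boxbump_bounds(1)] intro!: mult_left_le)
      have "boxbump a c m \<in> borel_measurable lebesgue" for m
        using borel_app[of "F m"] unfolding F(1) by (intro measurable_completion) simp
      then show "(\<lambda>z. g z * boxbump a c m z) \<in> borel_measurable lebesgue" for m
        using ig by (intro borel_measurable_times) auto
      show "(\<lambda>z. g z * indicator (box a c) z) \<in> borel_measurable lebesgue"
        using ig by (intro borel_measurable_times borel_measurable_indicator) auto
    qed (use ig in auto)
    moreover have "(\<integral>z. g z * boxbump a c m z \<partial>lebesgue) = 0" for m
    proof -
      have "F m \<in> tfs \<Omega>" using F(2) tfs_mono[OF sub] by blast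
      from 0[OF this] show ?thesis
        unfolding integral_restrict_space[OF m\<Omega>] F(1) by (simp add: g_def mult.assoc)
    qed
    ultimately have "(\<integral>z. g z * indicator (box a c) z \<partial>lebesgue) = 0"
      using LIMSEQ_unique by (simp add: LIMSEQ_const_iff)
    moreover have "integral (box a c) g = (LINT z:box a c|lebesgue. g z)"
      using set_lebesgue_integral_eq_integral(2)[OF aig, of "box a c"] by simp
    ultimately show ?thesis
      by (simp add: set_lebesgue_integral_def mult.commute integral_open_interval)
  qed
  have "g integrable_on cbox a c" for a c
    using aig[of "cbox a c"] by (simp add: absolutely_integrable_on_def)
  then obtain N where N: "negligible N" "\<And>x e. \<lbrakk>x \<notin> N; 0 < e\<rbrakk> \<Longrightarrow>
     \<exists>d>0. \<forall>h. 0 < h \<and> h < d \<longrightarrow> norm (integral (cbox x (x + h *\<^sub>R One)) g /\<^sub>R h ^ DIM('a) - g x) < e"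
    using integrable_ccontinuous_explicit by blast
  have z: "g x = 0" if x: "x \<in> \<Omega>" "x \<notin> N" for x
  proof (rule ccontr)
    assume "g x \<noteq> 0"
    then obtain d where d: "d > 0" "\<And>h. 0 < h \<Longrightarrow> h < d \<Longrightarrow> norm (integral (cbox x (x + h *\<^sub>R One)) g /\<^sub>R h ^ DIM('a) - g x) < norm (g x)"
      using N(2)[OF x(2), of "norm (g x)"] by auto
    obtain r where r: "r > 0" "cball x r \<subseteq> \<Omega>" using \<Omega> x(1) open_contains_cball by blast
    define D where "D = norm (One :: 'a)"
    have D: "D > 0" by (simp add: D_def)
    \<comment> \<open>The cube of this side fits into the ball of radius \<open>r\<close>, hence
      into \<open>\<Omega>\<close>, where its integral is zero.\<close>
    define h where "h = min (d / 2) (r / D)"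
    have h: "h > 0" "h < d" "h * D \<le> r" using d(1) r(1) D by (auto simp: h_def min_def field_simps split: if_splits)
    have "cbox x (x + h *\<^sub>R One) \<subseteq> cball x r"
    proof
      fix y assume y: "y \<in> cbox x (x + h *\<^sub>R One)"
      have "norm (y - x) \<le> norm (h *\<^sub>R (One :: 'a))"
      proof (rule norm_le_componentwise)
        fix b :: 'a assume b: "b \<in> Basis"
        have "x \<bullet> b \<le> y \<bullet> b" "y \<bullet> b \<le> x \<bullet> b + h" using y b by (auto simp: mem_box inner_add_left)
        then show "\<bar>(y - x) \<bullet> b\<bar> \<le> \<bar>(h *\<^sub>R One) \<bullet> b\<bar>" using b h by (simp add: inner_diff_left)
      qed
      then show "y \<in> cball x r" using h by (simp add: dist_norm norm_minus_commute D_def)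
    qed
    then have "integral (cbox x (x + h *\<^sub>R One)) g = 0" using cb r(2) by blast
    then show False using d(2)[OF h(1,2)] by simp
  qed
  have "AE x in lebesgue. x \<notin> N" using N(1) by (simp add: negligible_iff_null_sets AE_not_in)
  then have "AE x in lebesgue. x \<in> \<Omega> \<longrightarrow> w x = 0"
    by eventually_elim (use z in \<open>auto simp: g_def\<close>)
  then show ?thesis using m\<Omega> by (simp add: AE_restrict_space_iff)
qed

section \<open>Square-integrable functions on a bounded open set\<close>

definition l2ip :: "'a::euclidean_space set \<Rightarrow> ('a \<Rightarrow> real) \<Rightarrow> ('a \<Rightarrow> real) \<Rightarrow> real" where
  "l2ip \<Omega> u v = (LINT z|lebesgue_on \<Omega>. u z * v z)"

lemma L2_onD:
  assumes "u \<in> L2_on \<Omega>"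
  shows "u \<in> borel_measurable (lebesgue_on \<Omega>)" "integrable (lebesgue_on \<Omega>) (\<lambda>z. u z * u z)"
  using assms by (simp_all add: L2_on_def power2_eq_square)

lemma L2_on_integrable_mult:
  assumes u: "u \<in> L2_on \<Omega>" and v: "v \<in> L2_on \<Omega>"
  shows "integrable (lebesgue_on \<Omega>) (\<lambda>z. u z * v z)"
proof (rule Bochner_Integration.integrable_bound)
  show "integrable (lebesgue_on \<Omega>) (\<lambda>z. u z * u z + v z * v z)"
    using L2_onD(2)[OF u] L2_onD(2)[OF v] by (rule Bochner_Integration.integrable_add)
  show "(\<lambda>z. u z * v z) \<in> borel_measurable (lebesgue_on \<Omega>)"
    using L2_onD(1)[OF u] L2_onD(1)[OF v] by (rule borel_measurable_times)
  have "\<bar>a * b\<bar> \<le> \<bar>a * a + b * b\<bar>" for a b :: real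
  proof -
    have "0 \<le> (\<bar>a\<bar> - \<bar>b\<bar>)\<^sup>2" by simp
    then have "2 * (\<bar>a\<bar> * \<bar>b\<bar>) \<le> a * a + b * b" by (simp add: power2_eq_square algebra_simps)
    moreover have "0 \<le> \<bar>a\<bar> * \<bar>b\<bar>" by simp
    ultimately show ?thesis unfolding abs_mult by linarith
  qed
  then show "AE z in lebesgue_on \<Omega>. norm (u z * v z) \<le> norm (u z * u z + v z * v z)"
    by (intro AE_I2) simp
qed

lemma L2_on_lincomb:
  assumes u: "u \<in> L2_on \<Omega>" and v: "v \<in> L2_on \<Omega>"
  shows "(\<lambda>z. u z + c * v z) \<in> L2_on \<Omega>"
proof -
  have "integrable (lebesgue_on \<Omega>) (\<lambda>z. u z * u z + 2 * c * (u z * v z) + c * c * (v z * v z))"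
    using L2_onD(2)[OF u] L2_onD(2)[OF v] L2_on_integrable_mult[OF u v]
    by (intro Bochner_Integration.integrable_add integrable_mult_right)
  moreover have "(\<lambda>z. (u z + c * v z)\<^sup>2) = (\<lambda>z. u z * u z + 2 * c * (u z * v z) + c * c * (v z * v z))"
    by (auto simp: power2_eq_square algebra_simps)
  ultimately show ?thesis
    using L2_onD(1)[OF u] L2_onD(1)[OF v] by (auto simp: L2_on_def)
qed

lemma L2_on_diff: "u \<in> L2_on \<Omega> \<Longrightarrow> v \<in> L2_on \<Omega> \<Longrightarrow> (\<lambda>z. u z - v z) \<in> L2_on \<Omega>"
  using L2_on_lincomb[of u \<Omega> v "-1"] by simp

lemma L2_on_add: "u \<in> L2_on \<Omega> \<Longrightarrow> v \<in> L2_on \<Omega> \<Longrightarrow> (\<lambda>z. u z + v z) \<in> L2_on \<Omega>"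
  using L2_on_lincomb[of u \<Omega> v 1] by simp

lemma l2ip_sym: "l2ip \<Omega> u v = l2ip \<Omega> v u"
  by (simp add: l2ip_def mult.commute)

lemma l2ip_lincomb:
  assumes "u \<in> L2_on \<Omega>" "v \<in> L2_on \<Omega>" "w \<in> L2_on \<Omega>"
  shows "l2ip \<Omega> (\<lambda>z. u z + c * v z) w = l2ip \<Omega> u w + c * l2ip \<Omega> v w"
proof -
  have "l2ip \<Omega> (\<lambda>z. u z + c * v z) w = (LINT z|lebesgue_on \<Omega>. u z * w z + c * (v z * w z))"
    unfolding l2ip_def by (rule Bochner_Integration.integral_cong) (auto simp: algebra_simps)
  also have "\<dots> = l2ip \<Omega> u w + c * l2ip \<Omega> v w"
    unfolding l2ip_def using L2_on_integrable_mult assms by (subst Bochner_Integration.integral_add) auto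
  finally show ?thesis .
qed

lemma l2ip_diff_left:
  assumes "u \<in> L2_on \<Omega>" "v \<in> L2_on \<Omega>" "w \<in> L2_on \<Omega>"
  shows "l2ip \<Omega> (\<lambda>z. u z - v z) w = l2ip \<Omega> u w - l2ip \<Omega> v w"
  using l2ip_lincomb[OF assms, of "-1"] by simp

lemma l2ip_nonneg: "0 \<le> l2ip \<Omega> u u"
  unfolding l2ip_def by (intro integral_nonneg_AE AE_I2) simp

lemma discriminant_le:
  fixes a b c :: real
  assumes *: "\<And>s. 0 \<le> a + 2 * s * b + s * s * c" and c: "0 \<le> c"
  shows "b\<^sup>2 \<le> a * c"
proof (cases "c = 0")
  case True
  have "b = 0"
  proof (rule ccontr)
    assume b: "b \<noteq> 0"
    have "2 * (- (a + 1) / (2 * b)) * b = - (a + 1)" using b by simp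
    with *[of "- (a + 1) / (2 * b)"] True show False by simp
  qed
  then show ?thesis using True by simp
next
  case False
  then have c: "c > 0" using c by simp
  have "0 \<le> a - b\<^sup>2 / c" using *[of "- b / c"] c by (simp add: power2_eq_square field_simps)
  then show ?thesis using c by (simp add: field_simps)
qed

lemma l2ip_cauchy:
  assumes u: "u \<in> L2_on \<Omega>" and v: "v \<in> L2_on \<Omega>"
  shows "\<bar>l2ip \<Omega> u v\<bar> \<le> sqrt (l2ip \<Omega> u u) * sqrt (l2ip \<Omega> v v)"
proof -
  have *: "0 \<le> l2ip \<Omega> u u + 2 * s * l2ip \<Omega> u v + s * s * l2ip \<Omega> v v" for s
  proof -
    have sv: "(\<lambda>z. u z + s * v z) \<in> L2_on \<Omega>" by (rule L2_on_lincomb[OF u v])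
    have "l2ip \<Omega> (\<lambda>z. u z + s * v z) (\<lambda>z. u z + s * v z) = l2ip \<Omega> u (\<lambda>z. u z + s * v z) + s * l2ip \<Omega> v (\<lambda>z. u z + s * v z)"
      by (rule l2ip_lincomb[OF u v sv])
    also have "\<dots> = (l2ip \<Omega> u u + s * l2ip \<Omega> v u) + s * (l2ip \<Omega> u v + s * l2ip \<Omega> v v)"
      using l2ip_lincomb[OF u v u, of s] l2ip_lincomb[OF u v v, of s] by (simp add: l2ip_sym)
    finally show ?thesis
      using l2ip_nonneg[of \<Omega> "\<lambda>z. u z + s * v z"] l2ip_sym[of \<Omega> v u] by (simp add: algebra_simps)
  qed
  have "(l2ip \<Omega> u v)\<^sup>2 \<le> l2ip \<Omega> u u * l2ip \<Omega> v v" by (rule discriminant_le[OF * l2ip_nonneg])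
  then have "sqrt ((l2ip \<Omega> u v)\<^sup>2) \<le> sqrt (l2ip \<Omega> u u * l2ip \<Omega> v v)" by (rule real_sqrt_le_mono)
  then show ?thesis by (simp add: real_sqrt_mult)
qed

section \<open>L2 limits of test functions\<close>

locale bounded_open =
  fixes \<Omega> :: "'a::euclidean_space set"
  assumes op: "open \<Omega>" and bd: "bounded \<Omega>"
begin

lemma Omega_sets: "\<Omega> \<inter> space lebesgue \<in> sets lebesgue" using op by auto

lemma finite_measure_Omega: "finite_measure (lebesgue_on \<Omega>)"
proof -
  have "\<Omega> \<in> lmeasurable" using op bd by (intro lmeasurable_open)
  then show ?thesis by (rule finite_measure_lebesgue_on)
qed

lemma app_measurable_Omega: "app f \<in> borel_measurable (lebesgue_on \<Omega>)"
proof -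
  have "app f \<in> borel_measurable lebesgue"
    by (intro measurable_completion) simp
  then show ?thesis by (rule measurable_restrict_space1)
qed

lemma integrable_app_Omega: "integrable (lebesgue_on \<Omega>) (\<lambda>z. app f z * app g z)"
proof -
  have "integrable lebesgue (\<lambda>z. app f z * app g z)"
    by (subst integrable_completion) auto
  then have "integrable lebesgue (\<lambda>z. indicator \<Omega> z *\<^sub>R (app f z * app g z))"
    using op by (intro integrable_mult_indicator) auto
  then show ?thesis by (simp add: integrable_restrict_space[OF Omega_sets])
qed

lemma app_L2: "app f \<in> L2_on \<Omega>"
  using integrable_app_Omega[of f f] app_measurable_Omega by (simp add: L2_on_def power2_eq_square)

lemma l2ip_app:
  assumes "f \<in> tfs \<Omega>"
  shows "l2ip \<Omega> (app f) (app g) = f \<bullet> g"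
proof -
  have "l2ip \<Omega> (app f) (app g) = (\<integral>z. indicator \<Omega> z *\<^sub>R (app f z * app g z) \<partial>lebesgue)"
    unfolding l2ip_def by (rule integral_restrict_space[OF Omega_sets])
  also have "(\<lambda>z. indicator \<Omega> z *\<^sub>R (app f z * app g z)) = (\<lambda>z. app f z * app g z)"
    using tfs_app[OF assms] by (auto simp: indicator_def fun_eq_iff)
  also have "(\<integral>z. app f z * app g z \<partial>lebesgue) = f \<bullet> g"
    unfolding inner_tf_def by (rule integral_completion) simp
  finally show ?thesis .
qed

lemma weak_unique_L2:
  assumes w: "w \<in> L2_on \<Omega>" and 0: "\<And>f. f \<in> tfs \<Omega> \<Longrightarrow> l2ip \<Omega> w (app f) = 0"
  shows "AE z in lebesgue_on \<Omega>. w z = 0"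
proof (rule weak_unique[OF op])
  interpret finite_measure "lebesgue_on \<Omega>" by (rule finite_measure_Omega)
  have "(\<lambda>z. 1) \<in> L2_on \<Omega>" by (simp add: L2_on_def)
  from L2_on_integrable_mult[OF w this] show "integrable (lebesgue_on \<Omega>) w" by simp
qed (use 0 in \<open>simp add: l2ip_def\<close>)

definition converges :: "(nat \<Rightarrow> 'a tf) \<Rightarrow> ('a \<Rightarrow> real) \<Rightarrow> bool" where
  "converges f u \<longleftrightarrow> u \<in> L2_on \<Omega> \<and> (\<forall>m. f m \<in> tfs \<Omega>) \<and>
     (\<lambda>m. l2ip \<Omega> (\<lambda>z. u z - app (f m) z) (\<lambda>z. u z - app (f m) z)) \<longlonglongrightarrow> 0"

lemma converges_inner:
  assumes f: "converges f u" and v: "v \<in> L2_on \<Omega>"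
  shows "(\<lambda>m. l2ip \<Omega> (app (f m)) v) \<longlonglongrightarrow> l2ip \<Omega> u v"
proof -
  let ?d = "\<lambda>m z. u z - app (f m) z"
  have u: "u \<in> L2_on \<Omega>" using f by (simp add: converges_def)
  have d: "?d m \<in> L2_on \<Omega>" for m by (intro L2_on_diff u app_L2)
  have "(\<lambda>m. sqrt (l2ip \<Omega> (?d m) (?d m)) * sqrt (l2ip \<Omega> v v)) \<longlonglongrightarrow> sqrt 0 * sqrt (l2ip \<Omega> v v)"
    using f by (intro tendsto_intros) (simp add: converges_def)
  then have "(\<lambda>m. sqrt (l2ip \<Omega> (?d m) (?d m)) * sqrt (l2ip \<Omega> v v)) \<longlonglongrightarrow> 0" by simp
  moreover have "\<forall>\<^sub>F m in sequentially. norm (l2ip \<Omega> (?d m) v) \<le> sqrt (l2ip \<Omega> (?d m) (?d m)) * sqrt (l2ip \<Omega> v v)"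
    using l2ip_cauchy[OF d v] by simp
  ultimately have "(\<lambda>m. l2ip \<Omega> (?d m) v) \<longlonglongrightarrow> 0" by (rule Lim_null_comparison[rotated])
  then have "(\<lambda>m. l2ip \<Omega> u v - l2ip \<Omega> (?d m) v) \<longlonglongrightarrow> l2ip \<Omega> u v - 0" by (intro tendsto_intros)
  then show ?thesis by (simp add: l2ip_diff_left u v app_L2)
qed

lemma converges_inner_tf:
  assumes "converges f u"
  shows "(\<lambda>m. f m \<bullet> g) \<longlonglongrightarrow> l2ip \<Omega> u (app g)"
  using converges_inner[OF assms app_L2[of g]] assms by (simp add: l2ip_app converges_def)

lemma converges_Cauchy:
  assumes f: "converges f u"
  shows "Cauchy f"
proof -
  let ?d = "\<lambda>m z. u z - app (f m) z"
  let ?n = "\<lambda>m. sqrt (l2ip \<Omega> (?d m) (?d m))"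
  have u: "u \<in> L2_on \<Omega>" and t: "\<And>m. f m \<in> tfs \<Omega>" using f by (auto simp: converges_def)
  have d: "?d m \<in> L2_on \<Omega>" for m by (intro L2_on_diff u app_L2)
  have "norm (f m - f k) \<le> ?n k + ?n m" for m k
  proof -
    have L: "app (f m - f k) \<in> L2_on \<Omega>" by (rule app_L2)
    have "app (f m - f k) = (\<lambda>z. ?d k z - ?d m z)" by (auto simp: app_minus)
    then have "l2ip \<Omega> (app (f m - f k)) (app (f m - f k)) = l2ip \<Omega> (?d k) (app (f m - f k)) - l2ip \<Omega> (?d m) (app (f m - f k))"
      using l2ip_diff_left[OF d[of k] d[of m] L] by simp
    also have "\<dots> \<le> (?n k + ?n m) * sqrt (l2ip \<Omega> (app (f m - f k)) (app (f m - f k)))"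
      using l2ip_cauchy[OF d[of k] L] l2ip_cauchy[OF d[of m] L] by (simp add: distrib_right)
    finally have "norm (f m - f k) * norm (f m - f k) \<le> (?n k + ?n m) * norm (f m - f k)"
      unfolding l2ip_app[OF tfs_diff[OF t t]] by (simp add: norm_eq_sqrt_inner)
    moreover have "0 \<le> ?n k + ?n m" by (simp add: l2ip_nonneg)
    ultimately show ?thesis by (cases "norm (f m - f k) = 0") (simp_all add: mult_le_cancel_right)
  qed
  moreover have n0: "?n \<longlonglongrightarrow> 0" using f tendsto_real_sqrt unfolding converges_def by fastforce
  show ?thesis
  proof (rule metric_CauchyI)
    fix e :: real assume e: "0 < e"
    then have "\<forall>\<^sub>F m in sequentially. ?n m < e / 2" using n0 by (intro order_tendstoD) auto
    then obtain N where N: "\<And>m. m \<ge> N \<Longrightarrow> ?n m < e / 2" unfolding eventually_sequentially by blast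
    have "dist (f m) (f k) < e" if "m \<ge> N" "k \<ge> N" for m k
      using \<open>norm (f m - f k) \<le> ?n k + ?n m\<close> N[OF that(1)] N[OF that(2)] by (simp add: dist_norm)
    then show "\<exists>M. \<forall>m\<ge>M. \<forall>n\<ge>M. dist (f m) (f n) < e" by blast
  qed
qed

lemma Cauchy_inner_convergent:
  fixes p r :: "nat \<Rightarrow> 'b::real_inner"
  assumes p: "Cauchy p" and r: "Cauchy r"
  shows "convergent (\<lambda>m. p m \<bullet> r m)"
proof -
  obtain P where P: "\<And>m. norm (p m) \<le> P" using Cauchy_Bseq[OF p] unfolding Bseq_def by blast
  obtain R where R: "\<And>m. norm (r m) \<le> R" using Cauchy_Bseq[OF r] unfolding Bseq_def by blast
  have PR: "P \<ge> 0" "R \<ge> 0" using P[of 0] R[of 0] norm_ge_zero order_trans by blast+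
  have "Cauchy (\<lambda>m. p m \<bullet> r m)"
  proof (rule metric_CauchyI)
    fix e :: real assume e: "0 < e"
    define d where "d = e / (P + R + 1)"
    have d: "d > 0" using e PR by (simp add: d_def)
    obtain M where M: "\<And>m n. m \<ge> M \<Longrightarrow> n \<ge> M \<Longrightarrow> dist (p m) (p n) < d" using metric_CauchyD[OF p d] by blast
    obtain N where N: "\<And>m n. m \<ge> N \<Longrightarrow> n \<ge> N \<Longrightarrow> dist (r m) (r n) < d" using metric_CauchyD[OF r d] by blast
    have "dist (p m \<bullet> r m) (p n \<bullet> r n) < e" if "m \<ge> max M N" "n \<ge> max M N" for m n
    proof -
      have "p m \<bullet> r m - p n \<bullet> r n = (p m - p n) \<bullet> r m + p n \<bullet> (r m - r n)"
        by (simp add: inner_diff_left inner_diff_right)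
      then have "\<bar>p m \<bullet> r m - p n \<bullet> r n\<bar> \<le> norm (p m - p n) * norm (r m) + norm (p n) * norm (r m - r n)"
        using Cauchy_Schwarz_ineq2[of "p m - p n" "r m"] Cauchy_Schwarz_ineq2[of "p n" "r m - r n"] by linarith
      also have "\<dots> \<le> d * R + P * d"
        using M[of m n] N[of m n] that PR d by (intro add_mono mult_mono P R) (auto simp: dist_norm)
      also have "\<dots> < e"
      proof -
        have "d * (P + R + 1) = e" using PR by (simp add: d_def)
        then show ?thesis using d by (simp add: algebra_simps)
      qed
      finally show ?thesis by (simp add: dist_real_def)
    qed
    then show "\<exists>M. \<forall>m\<ge>M. \<forall>n\<ge>M. dist (p m \<bullet> r m) (p n \<bullet> r n) < e" by blast
  qed
  then show ?thesis by (rule Cauchy_convergent)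
qed

lemma converges_inner_both:
  assumes f: "converges f u" and g: "converges g v"
  shows "(\<lambda>m. f m \<bullet> g m) \<longlonglongrightarrow> l2ip \<Omega> u v"
proof -
  obtain L where L: "(\<lambda>m. f m \<bullet> g m) \<longlonglongrightarrow> L"
    using Cauchy_inner_convergent[OF converges_Cauchy[OF f] converges_Cauchy[OF g]] unfolding convergent_def by blast
  have v: "v \<in> L2_on \<Omega>" using g by (simp add: converges_def)
  have gt: "g m \<in> tfs \<Omega>" for m using g by (simp add: converges_def)
  obtain P where P: "\<And>m. norm (f m) \<le> P" using Cauchy_Bseq[OF converges_Cauchy[OF f]] unfolding Bseq_def by blast
  have ft: "f m \<in> tfs \<Omega>" for m using f by (simp add: converges_def)
  let ?d = "\<lambda>m z. v z - app (g m) z"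
  have d: "?d m \<in> L2_on \<Omega>" for m by (intro L2_on_diff v app_L2)
  have "(\<lambda>m. P * sqrt (l2ip \<Omega> (?d m) (?d m))) \<longlonglongrightarrow> P * sqrt 0"
    using g by (intro tendsto_intros) (simp add: converges_def)
  then have "(\<lambda>m. P * sqrt (l2ip \<Omega> (?d m) (?d m))) \<longlonglongrightarrow> 0" by simp
  moreover have "\<forall>\<^sub>F m in sequentially. norm (l2ip \<Omega> (app (f m)) (?d m)) \<le> P * sqrt (l2ip \<Omega> (?d m) (?d m))"
  proof (intro always_eventually allI)
    fix m
    have "\<bar>l2ip \<Omega> (app (f m)) (?d m)\<bar> \<le> norm (f m) * sqrt (l2ip \<Omega> (?d m) (?d m))"
      using l2ip_cauchy[OF app_L2 d, of "f m" m] by (simp add: l2ip_app ft norm_eq_sqrt_inner)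
    also have "\<dots> \<le> P * sqrt (l2ip \<Omega> (?d m) (?d m))" by (intro mult_right_mono P) (simp add: l2ip_nonneg)
    finally show "norm (l2ip \<Omega> (app (f m)) (?d m)) \<le> P * sqrt (l2ip \<Omega> (?d m) (?d m))" by simp
  qed
  ultimately have "(\<lambda>m. l2ip \<Omega> (app (f m)) (?d m)) \<longlonglongrightarrow> 0" by (rule Lim_null_comparison[rotated])
  with converges_inner[OF f v] have "(\<lambda>m. l2ip \<Omega> (app (f m)) v - l2ip \<Omega> (app (f m)) (?d m)) \<longlonglongrightarrow> l2ip \<Omega> u v - 0"
    by (rule tendsto_diff)
  moreover have "l2ip \<Omega> (app (f m)) v - l2ip \<Omega> (app (f m)) (?d m) = f m \<bullet> g m" for m
    using l2ip_diff_left[OF v app_L2 app_L2, of "g m" "f m"] l2ip_sym[of \<Omega> "app (f m)"]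
    by (simp add: l2ip_app gt inner_commute)
  ultimately show ?thesis by simp
qed

text \<open>Completeness of L2. On a finite measure space the sequence is also Cauchy in L1, so a
  subsequence converges almost everywhere, and Fatou's lemma bounds the L2 distance of its limit
  from each late member.\<close>

lemma Cauchy_converges:
  assumes t: "\<And>m. f m \<in> tfs \<Omega>" and C: "Cauchy f"
  shows "\<exists>u. converges f u"
proof -
  let ?M = "lebesgue_on \<Omega>"
  interpret finite_measure ?M by (rule finite_measure_Omega)
  have one: "(\<lambda>z. 1) \<in> L2_on \<Omega>" by (simp add: L2_on_def)
  have i1: "integrable ?M (app g)" for g using L2_on_integrable_mult[OF app_L2 one, of g] by simp
  have L1: "(LINT z|?M. norm (app (f i) z - app (f j) z)) \<le> norm (f i - f j) * sqrt (measure ?M (space ?M))" for i j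
  proof -
    let ?a = "\<lambda>z. \<bar>app (f i - f j) z\<bar>"
    have a: "?a \<in> L2_on \<Omega>" using app_L2[of "f i - f j"] by (auto simp: L2_on_def)
    have "(LINT z|?M. norm (app (f i) z - app (f j) z)) = l2ip \<Omega> ?a (\<lambda>z. 1)" by (simp add: l2ip_def app_minus)
    also have "\<dots> \<le> sqrt (l2ip \<Omega> ?a ?a) * sqrt (l2ip \<Omega> (\<lambda>z. 1) (\<lambda>z. 1))"
      using l2ip_cauchy[OF a one] by linarith
    also have "l2ip \<Omega> ?a ?a = l2ip \<Omega> (app (f i - f j)) (app (f i - f j))" by (simp add: l2ip_def)
    also have "\<dots> = (f i - f j) \<bullet> (f i - f j)" by (rule l2ip_app[OF tfs_diff[OF t t]])
    finally show ?thesis by (simp add: norm_eq_sqrt_inner l2ip_def)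
  qed
  have ex: "\<exists>N. \<forall>i\<ge>N. \<forall>j\<ge>N. LINT z|?M. norm (app (f i) z - app (f j) z) < e" if e: "e > 0" for e
  proof -
    define s where "s = sqrt (measure ?M (space ?M)) + 1"
    have s: "s > 0" by (simp add: s_def add_nonneg_pos)
    obtain N where N: "\<And>i j. i \<ge> N \<Longrightarrow> j \<ge> N \<Longrightarrow> dist (f i) (f j) < e / s" using metric_CauchyD[OF C, of "e / s"] e s by auto
    have "LINT z|?M. norm (app (f i) z - app (f j) z) < e" if "i \<ge> N" "j \<ge> N" for i j
    proof -
      have "norm (f i - f j) * sqrt (measure ?M (space ?M)) \<le> norm (f i - f j) * s"
        by (intro mult_left_mono) (auto simp: s_def)
      also have "\<dots> < e" using N[OF that] s by (simp add: dist_norm field_simps)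
      finally show ?thesis using L1[of i j] by linarith
    qed
    then show ?thesis by blast
  qed
  obtain r where r: "strict_mono r" "AE z in ?M. Cauchy (\<lambda>i. app (f (r i)) z)"
    using cauchy_L1_AE_cauchy_subseq[where s = "\<lambda>n. app (f n)", OF i1 ex] by blast
  define u where "u z = lim (\<lambda>i. app (f (r i)) z)" for z
  note app_measurable_Omega[measurable]
  have um [measurable]: "u \<in> borel_measurable ?M" unfolding u_def by measurable
  have lim: "AE z in ?M. (\<lambda>i. app (f (r i)) z) \<longlonglongrightarrow> u z"
    using r(2) by eventually_elim (simp add: u_def convergent_LIMSEQ_iff[symmetric] Cauchy_convergent)
  have fatou: "integrable ?M (\<lambda>z. (u z - app g z) * (u z - app g z)) \<and> l2ip \<Omega> (\<lambda>z. u z - app g z) (\<lambda>z. u z - app g z) \<le> c\<^sup>2"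
    if g: "g \<in> tfs \<Omega>" and c: "\<forall>\<^sub>F i in sequentially. norm (f (r i) - g) \<le> c" "c \<ge> 0" for g c
  proof -
    have "(\<integral>\<^sup>+z. ennreal ((u z - app g z) * (u z - app g z)) \<partial>?M)
      = (\<integral>\<^sup>+z. liminf (\<lambda>i. ennreal ((app (f (r i)) z - app g z) * (app (f (r i)) z - app g z))) \<partial>?M)"
    proof (rule nn_integral_cong_AE)
      show "AE z in ?M. ennreal ((u z - app g z) * (u z - app g z)) = liminf (\<lambda>i. ennreal ((app (f (r i)) z - app g z) * (app (f (r i)) z - app g z)))"
        using lim
      proof eventually_elim
        case (elim z)
        have "(\<lambda>i. ennreal ((app (f (r i)) z - app g z) * (app (f (r i)) z - app g z))) \<longlonglongrightarrow> ennreal ((u z - app g z) * (u z - app g z))"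
          by (intro tendsto_ennrealI tendsto_intros elim)
        from lim_imp_Liminf[OF trivial_limit_sequentially this] show ?case by (rule sym)
      qed
    qed
    also have "\<dots> \<le> liminf (\<lambda>i. \<integral>\<^sup>+z. ennreal ((app (f (r i)) z - app g z) * (app (f (r i)) z - app g z)) \<partial>?M)"
      by (rule nn_integral_liminf) measurable
    also have "\<dots> \<le> ennreal (c\<^sup>2)"
    proof -
      have n: "(\<integral>\<^sup>+z. ennreal ((app (f (r i)) z - app g z) * (app (f (r i)) z - app g z)) \<partial>?M) = ennreal ((norm (f (r i) - g))\<^sup>2)" for i
      proof -
        have "(\<integral>\<^sup>+z. ennreal (app (f (r i) - g) z * app (f (r i) - g) z) \<partial>?M) = ennreal (l2ip \<Omega> (app (f (r i) - g)) (app (f (r i) - g)))"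
          unfolding l2ip_def by (rule nn_integral_eq_integral[OF integrable_app_Omega]) auto
        then show ?thesis by (simp add: app_minus l2ip_app[OF tfs_diff[OF t g]] power2_norm_eq_inner)
      qed
      have "\<forall>\<^sub>F i in sequentially. (\<integral>\<^sup>+z. ennreal ((app (f (r i)) z - app g z) * (app (f (r i)) z - app g z)) \<partial>?M) \<le> ennreal (c\<^sup>2)"
        unfolding n using c(1) by eventually_elim (auto intro!: ennreal_leI power_mono)
      then show ?thesis by (intro Liminf_le) auto
    qed
    finally have fin: "(\<integral>\<^sup>+z. ennreal ((u z - app g z) * (u z - app g z)) \<partial>?M) \<le> ennreal (c\<^sup>2)" .
    have int: "integrable ?M (\<lambda>z. (u z - app g z) * (u z - app g z))"
    proof (rule integrableI_bounded)
      have "(\<integral>\<^sup>+z. ennreal (norm ((u z - app g z) * (u z - app g z))) \<partial>?M) = (\<integral>\<^sup>+z. ennreal ((u z - app g z) * (u z - app g z)) \<partial>?M)" by simp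
      also have "\<dots> < \<infinity>" using fin by (metis ennreal_less_top infinity_ennreal_def order_le_less_trans)
      finally show "(\<integral>\<^sup>+z. ennreal (norm ((u z - app g z) * (u z - app g z))) \<partial>?M) < \<infinity>" .
    qed measurable
    moreover have "ennreal (l2ip \<Omega> (\<lambda>z. u z - app g z) (\<lambda>z. u z - app g z)) \<le> ennreal (c\<^sup>2)"
      unfolding l2ip_def using nn_integral_eq_integral[OF int] fin by simp
    ultimately show ?thesis by (simp add: ennreal_le_iff)
  qed
  have conv: "\<exists>N. \<forall>m\<ge>N. \<forall>\<^sub>F i in sequentially. norm (f (r i) - f m) \<le> e" if e: "e > 0" for e
  proof -
    obtain N where N: "\<And>i j. i \<ge> N \<Longrightarrow> j \<ge> N \<Longrightarrow> dist (f i) (f j) < e" using metric_CauchyD[OF C e] by blast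
    have "\<forall>\<^sub>F i in sequentially. norm (f (r i) - f m) \<le> e" if "m \<ge> N" for m
      using eventually_ge_at_top[of N]
    proof eventually_elim
      case (elim i)
      have "r i \<ge> N" using elim seq_suble[OF r(1), of i] by linarith
      then show ?case using N[of "r i" m] that by (simp add: dist_norm)
    qed
    then show ?thesis by blast
  qed
  have u: "u \<in> L2_on \<Omega>"
  proof -
    obtain N where N: "\<forall>\<^sub>F i in sequentially. norm (f (r i) - f N) \<le> 1" using conv[of 1] by auto
    have "(\<lambda>z. u z - app (f N) z) \<in> L2_on \<Omega>"
      using fatou[OF t N] by (simp add: L2_on_def power2_eq_square)
    from L2_on_add[OF this app_L2[of "f N"]] show ?thesis by simp
  qed
  have "(\<lambda>m. l2ip \<Omega> (\<lambda>z. u z - app (f m) z) (\<lambda>z. u z - app (f m) z)) \<longlonglongrightarrow> 0"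
  proof (rule LIMSEQ_I)
    fix e :: real assume e: "0 < e"
    define c where "c = sqrt (e / 2)"
    have c: "c > 0" "c\<^sup>2 < e" using e by (auto simp: c_def)
    obtain N where N: "\<And>m. m \<ge> N \<Longrightarrow> \<forall>\<^sub>F i in sequentially. norm (f (r i) - f m) \<le> c" using conv[OF c(1)] by blast
    have "norm (l2ip \<Omega> (\<lambda>z. u z - app (f m) z) (\<lambda>z. u z - app (f m) z) - 0) < e" if "m \<ge> N" for m
      using fatou[OF t N[OF that]] c l2ip_nonneg[of \<Omega> "\<lambda>z. u z - app (f m) z"] by auto
    then show "\<exists>N. \<forall>m\<ge>N. norm (l2ip \<Omega> (\<lambda>z. u z - app (f m) z) (\<lambda>z. u z - app (f m) z) - 0) < e" by blast
  qed
  then show ?thesis using u t unfolding converges_def by blast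
qed

end

section \<open>Sobolev spaces through test functions\<close>

definition dop :: "('n::finite) + 'n \<Rightarrow> ('n heis \<Rightarrow> real) \<Rightarrow> 'n heis \<Rightarrow> real" where
  "dop i = (case i of Inl p \<Rightarrow> X_op p | Inr p \<Rightarrow> Y_op p)"

lemma dop_app: "dop i (app f) = app (Z i f)"
  by (cases i) (auto simp: dop_def app_Z_Inl app_Z_Inr)

lemma dop_pow_app: "(dop i ^^ d) (app f) = app ((Z i ^^ d) f)"
  by (induction d) (simp_all add: dop_app)

lemma sum_UNIV_plus: "(\<Sum>i\<in>UNIV. h i) = (\<Sum>p\<in>UNIV. h (Inl p) + h (Inr p))"
  for h :: "('n::finite) + 'n \<Rightarrow> real"
proof -
  have "(\<Sum>i\<in>UNIV. h i) = (\<Sum>i\<in>UNIV <+> UNIV. h i)" by simp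
  also have "\<dots> = (\<Sum>p\<in>UNIV. h (Inl p)) + (\<Sum>p\<in>UNIV. h (Inr p))" by (subst sum.Plus) (auto simp: o_def)
  finally show ?thesis by (simp add: sum.distrib)
qed

lemma app_sum: "app (\<Sum>i\<in>I. f i) z = (\<Sum>i\<in>I. app (f i) z)"
  by (induction I rule: infinite_finite_induct) (simp_all add: app_zero app_add)

lemma poly_kohn_app: "poly_kohn l (app f) = app ((A ^^ l) f)"
proof (induction l)
  case 0
  show ?case by (simp add: poly_kohn_def)
next
  case (Suc l)
  have "(\<lambda>z. - kohn_laplacian (app g) z) = app (A g)" for g :: "'n::finite htf"
    by (auto simp: kohn_laplacian_def A_def app_uminus app_sum sum_UNIV_plus app_Z_Inl app_Z_Inr)
  then show ?case using Suc by (simp add: poly_kohn_def)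
qed

lemma test_functions_eq: "test_functions S = app ` tfs S"
proof (intro set_eqI iffI)
  fix \<phi> assume p: "\<phi> \<in> test_functions S"
  then have "app (Abs_tf \<phi>) = \<phi>" by (intro Abs_tf_inverse) (auto simp: test_functions_def)
  moreover from p this have "Abs_tf \<phi> \<in> tfs S" by (auto simp: test_functions_def tfs_def)
  ultimately show "\<phi> \<in> app ` tfs S" by (metis imageI)
next
  fix \<phi> assume "\<phi> \<in> app ` tfs S"
  then show "\<phi> \<in> test_functions S"
    using smooth_app compact_supp unfolding test_functions_def tfs_def by blast
qed

lemma is_weak_pow_iff:
  "is_weak_pow (dop i) d \<Omega> u w \<longleftrightarrow> w \<in> L2_on \<Omega> \<and>
     (\<forall>f\<in>tfs \<Omega>. l2ip \<Omega> w (app f) = (-1) ^ d * l2ip \<Omega> u (app ((Z i ^^ d) f)))"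
  by (simp add: is_weak_pow_def test_functions_eq l2ip_def dop_pow_app)

lemma S_space_iff: "u \<in> S_space l \<Omega> \<longleftrightarrow> u \<in> L2_on \<Omega> \<and> (\<forall>d\<in>{1..l}. \<forall>i. \<exists>w. is_weak_pow (dop i) d \<Omega> u w)"
  unfolding S_space_def by (auto simp: dop_def split: sum.splits)

lemma eigenspace_iff:
  "u \<in> eigenspace l \<Omega> \<mu> \<longleftrightarrow> u \<in> S0_space l \<Omega> \<and>
     (\<forall>f\<in>tfs \<Omega>. l2ip \<Omega> u (app ((A ^^ l) f)) = \<mu> * l2ip \<Omega> u (app f))"
  by (simp add: eigenspace_def test_functions_eq l2ip_def poly_kohn_app)

lemma inner_Z_pow: "(Z i ^^ d) f \<bullet> g = (-1) ^ d * (f \<bullet> (Z i ^^ d) g)"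
  by (induction d arbitrary: f g) (simp_all add: inner_Z funpow_swap1)

lemma Z_pow_diff: "(Z i ^^ d) (f - g) = (Z i ^^ d) f - (Z i ^^ d) g"
  by (induction d) (simp_all add: Z_lin)

lemma l2ip_cong_AE:
  assumes "u \<in> L2_on \<Omega>" "v \<in> L2_on \<Omega>" "AE z in lebesgue_on \<Omega>. u z - v z = 0"
  shows "l2ip \<Omega> u u = l2ip \<Omega> v v"
  unfolding l2ip_def
  using L2_onD(1)[OF assms(1)] L2_onD(1)[OF assms(2)] assms(3)
  by (intro Bochner_Integration.integral_cong_AE borel_measurable_times) auto

locale heis_domain = bounded_open \<Omega> for \<Omega> :: "('n::finite) heis set"
begin

lemma is_weak_pow_diff:
  assumes u: "u \<in> L2_on \<Omega>" and w: "is_weak_pow (dop i) d \<Omega> u w" and f: "f \<in> tfs \<Omega>"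
  shows "is_weak_pow (dop i) d \<Omega> (\<lambda>z. u z - app f z) (\<lambda>z. w z - app ((Z i ^^ d) f) z)"
  using w unfolding is_weak_pow_iff
  by (auto simp: L2_on_diff u app_L2 l2ip_diff_left l2ip_app tfs_Z_pow f inner_Z_pow algebra_simps)

text \<open>Weak derivatives are unique almost everywhere, so the one chosen by \<open>SOME\<close>
  has the same integrals as any other.\<close>

lemma l2ip_weak_pow:
  assumes u: "u \<in> L2_on \<Omega>" and w: "is_weak_pow (dop i) d \<Omega> u w"
  shows "weak_pow (dop i) d \<Omega> u \<in> L2_on \<Omega>"
    and "l2ip \<Omega> (weak_pow (dop i) d \<Omega> u) (weak_pow (dop i) d \<Omega> u) = l2ip \<Omega> w w"
proof -
  let ?w = "weak_pow (dop i) d \<Omega> u"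
  have *: "is_weak_pow (dop i) d \<Omega> u ?w" unfolding weak_pow_def using w by (rule someI[where P = "is_weak_pow (dop i) d \<Omega> u"])
  then show L: "?w \<in> L2_on \<Omega>" by (simp add: is_weak_pow_iff)
  have W: "w \<in> L2_on \<Omega>" using w by (simp add: is_weak_pow_iff)
  have "AE z in lebesgue_on \<Omega>. ?w z - w z = 0"
  proof (rule weak_unique_L2)
    show "(\<lambda>z. ?w z - w z) \<in> L2_on \<Omega>" by (intro L2_on_diff L W)
    show "l2ip \<Omega> (\<lambda>z. ?w z - w z) (app f) = 0" if "f \<in> tfs \<Omega>" for f
      using * w that by (simp add: l2ip_diff_left L W app_L2 is_weak_pow_iff)
  qed
  then show "l2ip \<Omega> ?w ?w = l2ip \<Omega> w w" by (intro l2ip_cong_AE L W)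
qed

lemma S_norm_power2:
  assumes u: "u \<in> L2_on \<Omega>" and w: "\<And>d i. d \<in> {1..l} \<Longrightarrow> is_weak_pow (dop i) d \<Omega> u (w d i)"
  shows "(S_norm l \<Omega> u)\<^sup>2 = (\<Sum>d=1..l. \<Sum>i\<in>UNIV. l2ip \<Omega> (w d i) (w d i)) + l2ip \<Omega> u u"
proof -
  let ?W = "\<lambda>d i. weak_pow (dop i) d \<Omega> u"
  have W: "?W d i \<in> L2_on \<Omega>" "l2ip \<Omega> (?W d i) (?W d i) = l2ip \<Omega> (w d i) (w d i)" if "d \<in> {1..l}" for d i
    using l2ip_weak_pow[OF u w[OF that]] by auto
  have "(LINT z|lebesgue_on \<Omega>.
     (\<Sum>d=1..l. \<Sum>p\<in>UNIV. \<bar>weak_pow (X_op p) d \<Omega> u z\<bar>\<^sup>2 + \<bar>weak_pow (Y_op p) d \<Omega> u z\<bar>\<^sup>2) + \<bar>u z\<bar>\<^sup>2)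
    = (LINT z|lebesgue_on \<Omega>. (\<Sum>d=1..l. \<Sum>i\<in>UNIV. ?W d i z * ?W d i z) + u z * u z)"
    unfolding sum_UNIV_plus by (simp add: dop_def power2_eq_square)
  also have "\<dots> = (\<Sum>d=1..l. \<Sum>i\<in>UNIV. l2ip \<Omega> (?W d i) (?W d i)) + l2ip \<Omega> u u"
    unfolding l2ip_def
  proof (subst Bochner_Integration.integral_add)
    have int: "integrable (lebesgue_on \<Omega>) (\<lambda>z. ?W d i z * ?W d i z)" if "d \<in> {1..l}" for d i
      by (rule L2_onD(2)[OF W(1)[OF that]])
    then show "integrable (lebesgue_on \<Omega>) (\<lambda>z. \<Sum>d=1..l. \<Sum>i\<in>UNIV. ?W d i z * ?W d i z)"
      by (intro Bochner_Integration.integrable_sum)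
    show "integrable (lebesgue_on \<Omega>) (\<lambda>z. u z * u z)" by (rule L2_onD(2)[OF u])
    show "(LINT z|lebesgue_on \<Omega>. (\<Sum>d=1..l. \<Sum>i\<in>UNIV. ?W d i z * ?W d i z)) + (LINT z|lebesgue_on \<Omega>. u z * u z)
      = (\<Sum>d=1..l. \<Sum>i\<in>UNIV. (LINT z|lebesgue_on \<Omega>. ?W d i z * ?W d i z)) + (LINT z|lebesgue_on \<Omega>. u z * u z)"
      using int by (subst Bochner_Integration.integral_sum)
        (auto intro!: Bochner_Integration.integrable_sum sum.cong Bochner_Integration.integral_sum)
  qed
  also have "\<dots> = (\<Sum>d=1..l. \<Sum>i\<in>UNIV. l2ip \<Omega> (w d i) (w d i)) + l2ip \<Omega> u u"
    using W(2) by simp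
  finally show ?thesis unfolding S_norm_def
    by (simp add: add_nonneg_nonneg sum_nonneg l2ip_nonneg)
qed

text \<open>Replaces convergence in the norm of \<open>S_space\<close>, with the one energy of order
  \<open>l\<close> in place of all pure powers. For \<open>l \<ge> 1\<close> the possible limits are
  exactly the members of \<open>S0_space\<close>.\<close>

definition econv :: "nat \<Rightarrow> (nat \<Rightarrow> 'n htf) \<Rightarrow> ('n heis \<Rightarrow> real) \<Rightarrow> bool" where
  "econv l f u \<longleftrightarrow> converges f u \<and> (\<forall>e>0. \<exists>N. \<forall>m\<ge>N. \<forall>k\<ge>N. en l (f m - f k) < e)"

lemma Cauchy_square:
  fixes f :: "nat \<Rightarrow> 'b::real_inner"
  shows "Cauchy f \<longleftrightarrow> (\<forall>e>0. \<exists>N. \<forall>m\<ge>N. \<forall>k\<ge>N. (f m - f k) \<bullet> (f m - f k) < e)"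
proof
  assume C: "Cauchy f"
  show "\<forall>e>0. \<exists>N. \<forall>m\<ge>N. \<forall>k\<ge>N. (f m - f k) \<bullet> (f m - f k) < e"
  proof (intro allI impI)
    fix e :: real assume e: "e > 0"
    obtain N where N: "\<And>m k. m \<ge> N \<Longrightarrow> k \<ge> N \<Longrightarrow> dist (f m) (f k) < sqrt e"
      using metric_CauchyD[OF C, of "sqrt e"] e by auto
    have "(f m - f k) \<bullet> (f m - f k) < e" if "m \<ge> N" "k \<ge> N" for m k
      using N[OF that] by (simp add: dist_norm norm_eq_sqrt_inner)
    then show "\<exists>N. \<forall>m\<ge>N. \<forall>k\<ge>N. (f m - f k) \<bullet> (f m - f k) < e" by blast
  qed
next
  assume *: "\<forall>e>0. \<exists>N. \<forall>m\<ge>N. \<forall>k\<ge>N. (f m - f k) \<bullet> (f m - f k) < e"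
  show "Cauchy f"
  proof (rule metric_CauchyI)
    fix e :: real assume e: "0 < e"
    then have "e\<^sup>2 > 0" by simp
    with * obtain N where N: "\<And>m k. m \<ge> N \<Longrightarrow> k \<ge> N \<Longrightarrow> (f m - f k) \<bullet> (f m - f k) < e\<^sup>2" by blast
    have "dist (f m) (f k) < e" if "m \<ge> N" "k \<ge> N" for m k
    proof -
      have "(dist (f m) (f k))\<^sup>2 < e\<^sup>2" using N[OF that] by (simp add: dist_norm power2_norm_eq_inner)
      then show ?thesis using e by (simp add: power2_less_imp_less)
    qed
    then show "\<exists>M. \<forall>m\<ge>M. \<forall>n\<ge>M. dist (f m) (f n) < e" by blast
  qed
qed

text \<open>Convergence in norm makes the pure powers of order \<open>l\<close> Cauchy, and
  \<open>q_le_pure_ip\<close> passes from these to all words and so to the energy. Here the absence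
  of mixed derivatives in the norm is overcome.\<close>

lemma S0_space_imp_econv:
  assumes u: "u \<in> S0_space l \<Omega>" and l: "l \<ge> 1"
  shows "\<exists>f. econv l f u"
proof -
  have uL: "u \<in> L2_on \<Omega>" using u by (simp add: S0_space_def S_space_iff)
  have "\<forall>d i. d \<in> {1..l} \<longrightarrow> (\<exists>w. is_weak_pow (dop i) d \<Omega> u w)" using u unfolding S0_space_def S_space_iff by blast
  then obtain w where w: "\<And>d i. d \<in> {1..l} \<Longrightarrow> is_weak_pow (dop i) d \<Omega> u (w d i)" by metis
  have "\<exists>f\<in>tfs \<Omega>. S_norm l \<Omega> (\<lambda>z. u z - app f z) < inverse (Suc m)" for m
    using u unfolding S0_space_def test_functions_eq by (auto simp del: of_nat_Suc)
  then obtain f where f: "\<And>m. f m \<in> tfs \<Omega>" "\<And>m. S_norm l \<Omega> (\<lambda>z. u z - app (f m) z) < inverse (Suc m)" by metis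
  have eq: "(S_norm l \<Omega> (\<lambda>z. u z - app (f m) z))\<^sup>2
    = (\<Sum>d=1..l. \<Sum>i\<in>UNIV. l2ip \<Omega> (\<lambda>z. w d i z - app ((Z i ^^ d) (f m)) z) (\<lambda>z. w d i z - app ((Z i ^^ d) (f m)) z))
      + l2ip \<Omega> (\<lambda>z. u z - app (f m) z) (\<lambda>z. u z - app (f m) z)" (is "_ = ?S m + ?u m") for m
    using is_weak_pow_diff[OF uL w f(1)] by (intro S_norm_power2 L2_on_diff uL app_L2)
  have "(\<lambda>m. (S_norm l \<Omega> (\<lambda>z. u z - app (f m) z))\<^sup>2) \<longlonglongrightarrow> 0"
  proof (rule tendsto_sandwich[OF _ _ tendsto_const])
    have "(\<lambda>m. (inverse (real (Suc m)))\<^sup>2) \<longlonglongrightarrow> 0\<^sup>2" by (intro tendsto_intros LIMSEQ_inverse_real_of_nat)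
    then show "(\<lambda>m. (inverse (real (Suc m)))\<^sup>2) \<longlonglongrightarrow> 0" by simp
    show "\<forall>\<^sub>F m in sequentially. (S_norm l \<Omega> (\<lambda>z. u z - app (f m) z))\<^sup>2 \<le> (inverse (real (Suc m)))\<^sup>2"
    proof (intro always_eventually allI power_mono)
      fix m
      show "S_norm l \<Omega> (\<lambda>z. u z - app (f m) z) \<le> inverse (real (Suc m))" using f(2)[of m] by simp
      have "0 \<le> ?S m + ?u m" by (intro add_nonneg_nonneg sum_nonneg l2ip_nonneg)
      then show "0 \<le> S_norm l \<Omega> (\<lambda>z. u z - app (f m) z)"
        unfolding S_norm_def by (intro real_sqrt_ge_zero integral_nonneg_AE AE_I2 add_nonneg_nonneg sum_nonneg) auto
    qed
  qed simp
  then have sum0: "(\<lambda>m. ?S m + ?u m) \<longlonglongrightarrow> 0" unfolding eq .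
  have null: "g \<longlonglongrightarrow> 0" if "\<And>m. 0 \<le> g m" "\<And>m. g m \<le> ?S m + ?u m" for g :: "nat \<Rightarrow> real"
    by (rule tendsto_sandwich[OF _ _ tendsto_const sum0]) (use that in simp_all)
  have S0: "0 \<le> ?S m" for m by (intro sum_nonneg l2ip_nonneg)
  have "?u \<longlonglongrightarrow> 0" by (rule null) (use S0 l2ip_nonneg in auto)
  then have u0: "converges f u" unfolding converges_def using f(1) uL by simp
  have Zc: "converges (\<lambda>m. (Z i ^^ d) (f m)) (w d i)" if d: "d \<in> {1..l}" for d i
  proof -
    let ?g = "\<lambda>m. l2ip \<Omega> (\<lambda>z. w d i z - app ((Z i ^^ d) (f m)) z) (\<lambda>z. w d i z - app ((Z i ^^ d) (f m)) z)"
    have "?g m \<le> ?S m + ?u m" for m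
    proof -
      have "?g m \<le> (\<Sum>i\<in>UNIV. l2ip \<Omega> (\<lambda>z. w d i z - app ((Z i ^^ d) (f m)) z) (\<lambda>z. w d i z - app ((Z i ^^ d) (f m)) z))"
        by (rule member_le_sum) (auto simp: l2ip_nonneg)
      also have "\<dots> \<le> ?S m" using d by (intro member_le_sum) (auto intro!: sum_nonneg l2ip_nonneg)
      finally show ?thesis using l2ip_nonneg[of \<Omega> "\<lambda>z. u z - app (f m) z"] by linarith
    qed
    from null[of ?g, OF l2ip_nonneg this] show ?thesis
      unfolding converges_def using w[OF d] f(1) by (simp add: is_weak_pow_iff tfs_Z_pow)
  qed
  obtain l' where l': "l = Suc l'" using l by (cases l) auto
  obtain C1 where C1: "C1 \<ge> 0" "\<And>g :: 'n htf. en l g \<le> C1 * q ip l g" using en_le_q by blast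
  obtain C2 where C2: "C2 \<ge> 0" "\<And>g :: 'n htf. q ip l g \<le> C2 * pure ip l g" using q_le_pure_ip l' by blast
  have "\<exists>N. \<forall>m\<ge>N. \<forall>k\<ge>N. en l (f m - f k) < e" if e: "e > 0" for e
  proof -
    \<comment> \<open>Each field may contribute e / c; the product accounts for the number of fields
      and both comparison constants, and the added 1 makes the last inequality strict.\<close>
    define c where "c = C1 * C2 * CARD('n + 'n) + 1"
    have c: "c > 0" using C1 C2 by (simp add: c_def add_nonneg_pos del: card_UNIV_sum)
    have "\<exists>N. \<forall>m\<ge>N. \<forall>k\<ge>N. ((Z i ^^ l) (f m) - (Z i ^^ l) (f k)) \<bullet> ((Z i ^^ l) (f m) - (Z i ^^ l) (f k)) < e / c" for i
      using converges_Cauchy[OF Zc[of l i]] l e c unfolding Cauchy_square by simp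
    then obtain N where N: "\<And>i m k. m \<ge> N i \<Longrightarrow> k \<ge> N i \<Longrightarrow>
      ((Z i ^^ l) (f m) - (Z i ^^ l) (f k)) \<bullet> ((Z i ^^ l) (f m) - (Z i ^^ l) (f k)) < e / c" by metis
    have "en l (f m - f k) < e" if "m \<ge> Max (range N)" "k \<ge> Max (range N)" for m k
    proof -

      have "pure ip l (f m - f k) \<le> (\<Sum>i\<in>(UNIV :: ('n + 'n) set). e / c)"
        unfolding pure_def Z_pow_diff
      proof (rule sum_mono)
        fix i
        have "m \<ge> N i" "k \<ge> N i" using that Max_ge[of "range N" "N i"] by auto
        from N[OF this] show "ip ((Z i ^^ l) (f m) - (Z i ^^ l) (f k)) ((Z i ^^ l) (f m) - (Z i ^^ l) (f k)) \<le> e / c" by simp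
      qed
      then have "pure ip l (f m - f k) \<le> CARD('n + 'n) * (e / c)" by simp
      then have "C1 * (C2 * pure ip l (f m - f k)) \<le> C1 * (C2 * (CARD('n + 'n) * (e / c)))"
        using C1 C2 by (intro mult_left_mono) auto
      moreover have "en l (f m - f k) \<le> C1 * (C2 * pure ip l (f m - f k))"
        using C1 C2 by (meson mult_left_mono order_trans)
      moreover have "C1 * (C2 * (CARD('n + 'n) * (e / c))) = (c - 1) * (e / c)" by (simp add: c_def)
      moreover have "(c - 1) * (e / c) < e" using c e by (simp add: field_simps)
      ultimately show ?thesis by linarith
    qed
    then show ?thesis by blast
  qed
  with u0 show ?thesis unfolding econv_def by blast
qed

text \<open>Energy and L2 norm control all pure powers up to order \<open>l\<close>, so these
  converge in L2. Their limits are the weak derivatives of \<open>u\<close>, because the defining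
  identity survives L2 limits.\<close>

lemma econv_imp_S0_space:
  assumes "econv l f u"
  shows "u \<in> S0_space l \<Omega>"
proof -
  have fu: "converges f u" using assms by (simp add: econv_def)
  then have uL: "u \<in> L2_on \<Omega>" and f: "\<And>m. f m \<in> tfs \<Omega>" by (auto simp: converges_def)
  obtain C where C: "C \<ge> 0" "\<And>g :: 'n htf. \<And>j. j \<le> l \<Longrightarrow> q ip j g \<le> C * (en l g + g \<bullet> g)"
    using q_le_energy by blast
  have "\<exists>w. converges (\<lambda>m. (Z i ^^ d) (f m)) w" if d: "d \<in> {1..l}" for d i
  proof (rule Cauchy_converges)
    show "(Z i ^^ d) (f m) \<in> tfs \<Omega>" for m by (rule tfs_Z_pow[OF f])
    show "Cauchy (\<lambda>m. (Z i ^^ d) (f m))" unfolding Cauchy_square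
    proof (intro allI impI)
      fix e :: real assume e: "e > 0"
      define c where "c = e / (C + 1) / 2"
      have c: "c > 0" using e C by (simp add: c_def)
      obtain N1 where N1: "\<And>m k. m \<ge> N1 \<Longrightarrow> k \<ge> N1 \<Longrightarrow> (f m - f k) \<bullet> (f m - f k) < c"
        using converges_Cauchy[OF fu] c unfolding Cauchy_square by blast
      obtain N2 where N2: "\<And>m k. m \<ge> N2 \<Longrightarrow> k \<ge> N2 \<Longrightarrow> en l (f m - f k) < c"
        using assms c unfolding econv_def by blast
      have "((Z i ^^ d) (f m) - (Z i ^^ d) (f k)) \<bullet> ((Z i ^^ d) (f m) - (Z i ^^ d) (f k)) < e"
        if "m \<ge> max N1 N2" "k \<ge> max N1 N2" for m k
      proof -

        have "((Z i ^^ d) (f m) - (Z i ^^ d) (f k)) \<bullet> ((Z i ^^ d) (f m) - (Z i ^^ d) (f k)) \<le> q ip d (f m - f k)"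
          unfolding Z_pow_diff[symmetric] by (rule pow_le_q[OF sform_ip])
        also have "\<dots> \<le> C * (en l (f m - f k) + (f m - f k) \<bullet> (f m - f k))" using d by (intro C(2)) auto
        also have "\<dots> \<le> C * (c + c)" using N1[of m k] N2[of m k] that C(1) by (intro mult_left_mono) auto
        also have "\<dots> < (C + 1) * (c + c)" using c by (simp add: algebra_simps)
        also have "\<dots> = e"
        proof -
          have "C + 1 \<noteq> 0" using C(1) by linarith
          moreover have "c + c = e / (C + 1)" unfolding c_def by (rule field_sum_of_halves)
          ultimately show ?thesis by simp
        qed
        finally show ?thesis .
      qed
      then show "\<exists>N. \<forall>m\<ge>N. \<forall>k\<ge>N. ((Z i ^^ d) (f m) - (Z i ^^ d) (f k)) \<bullet> ((Z i ^^ d) (f m) - (Z i ^^ d) (f k)) < e" by blast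
    qed
  qed
  then obtain w where w: "\<And>d i. d \<in> {1..l} \<Longrightarrow> converges (\<lambda>m. (Z i ^^ d) (f m)) (w d i)" by metis
  have wp: "is_weak_pow (dop i) d \<Omega> u (w d i)" if d: "d \<in> {1..l}" for d i
    unfolding is_weak_pow_iff
  proof (intro conjI ballI)
    show "w d i \<in> L2_on \<Omega>" using w[OF d] by (simp add: converges_def)
    fix g assume g: "g \<in> tfs \<Omega>"
    have 1: "(\<lambda>m. (Z i ^^ d) (f m) \<bullet> g) \<longlonglongrightarrow> l2ip \<Omega> (w d i) (app g)" by (rule converges_inner_tf[OF w[OF d]])
    have "(\<lambda>m. (-1) ^ d * (f m \<bullet> (Z i ^^ d) g)) \<longlonglongrightarrow> (-1) ^ d * l2ip \<Omega> u (app ((Z i ^^ d) g))"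
      by (intro tendsto_intros converges_inner_tf[OF fu])
    with 1 show "l2ip \<Omega> (w d i) (app g) = (-1) ^ d * l2ip \<Omega> u (app ((Z i ^^ d) g))"
      unfolding inner_Z_pow by (rule LIMSEQ_unique)
  qed
  have eq: "(S_norm l \<Omega> (\<lambda>z. u z - app (f m) z))\<^sup>2
    = (\<Sum>d=1..l. \<Sum>i\<in>UNIV. l2ip \<Omega> (\<lambda>z. w d i z - app ((Z i ^^ d) (f m)) z) (\<lambda>z. w d i z - app ((Z i ^^ d) (f m)) z))
      + l2ip \<Omega> (\<lambda>z. u z - app (f m) z) (\<lambda>z. u z - app (f m) z)" for m
    using is_weak_pow_diff[OF uL wp f] by (intro S_norm_power2 L2_on_diff uL app_L2)
  have "(\<lambda>m. (S_norm l \<Omega> (\<lambda>z. u z - app (f m) z))\<^sup>2) \<longlonglongrightarrow> (\<Sum>d=1..l. \<Sum>i\<in>(UNIV :: ('n + 'n) set). 0) + 0"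
    unfolding eq using w fu unfolding converges_def by (intro tendsto_intros) auto
  then have S0: "(\<lambda>m. (S_norm l \<Omega> (\<lambda>z. u z - app (f m) z))\<^sup>2) \<longlonglongrightarrow> 0" by simp
  show ?thesis unfolding S0_space_def S_space_iff
  proof (intro CollectI conjI allI impI ballI uL)
    show "\<exists>w. is_weak_pow (dop i) d \<Omega> u w" if "d \<in> {1..l}" for d i using wp[OF that] by blast
    fix e :: real assume e: "0 < e"
    then have "\<forall>\<^sub>F m in sequentially. (S_norm l \<Omega> (\<lambda>z. u z - app (f m) z))\<^sup>2 < e\<^sup>2"
      by (intro order_tendstoD(2)[OF S0]) simp
    then obtain m where "(S_norm l \<Omega> (\<lambda>z. u z - app (f m) z))\<^sup>2 < e\<^sup>2" by (auto simp: eventually_sequentially)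
    then have "S_norm l \<Omega> (\<lambda>z. u z - app (f m) z) < e" using e by (simp add: power2_less_imp_less)
    then show "\<exists>\<phi>\<in>test_functions \<Omega>. S_norm l \<Omega> (\<lambda>z. u z - \<phi> z) < e" unfolding test_functions_eq using f by blast
  qed
qed

lemma econv_bounded:
  assumes "econv l f u"
  shows "\<exists>B\<ge>0. \<forall>m. en l (f m) \<le> B"
proof -
  obtain N where N: "\<And>m k. m \<ge> N \<Longrightarrow> k \<ge> N \<Longrightarrow> en l (f m - f k) < 1"
    using assms zero_less_one unfolding econv_def by blast
  define B where "B = 2 + 2 * en l (f N) + (\<Sum>m<N. en l (f m))"
  have S: "0 \<le> (\<Sum>m<N. en l (f m))" by (intro sum_nonneg en_nonneg)
  have "en l (f m) \<le> B" for m
  proof (cases "m < N")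
    case True
    then have "en l (f m) \<le> (\<Sum>m<N. en l (f m))" by (intro member_le_sum) (auto simp: en_nonneg)
    then show ?thesis using en_nonneg[of l "f N"] by (simp add: B_def)
  next
    case False
    \<comment> \<open>Expanded, this says that the energy of a sum is at most twice the sum of the
      energies.\<close>
    have "0 \<le> en l (f m - f N - f N)" by (rule en_nonneg)
    then have "en l (f m) \<le> 2 * en l (f m - f N) + 2 * en l (f N)"
      unfolding en_def by (simp add: sform_lin[OF sform_en[of l]] sform_sym[OF sform_en[of l], of "f N" "f m"])
    then show ?thesis using N[of m N] False S by (simp add: B_def)
  qed
  moreover have "B \<ge> 0" using S en_nonneg[of l "f N"] by (simp add: B_def)
  ultimately show ?thesis by blast
qed

text \<open>The equation holds for each fixed test function. The common bound on the energies of
  \<open>h\<close> makes it uniform, by Cauchy-Schwarz in the energy form for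
  \<open>f m - f r\<close> and \<open>h m\<close>, so both sequences may move together.\<close>

lemma econv_eigenfunction:
  assumes f: "econv l f u" and u: "u \<in> eigenspace l \<Omega> \<mu>"
    and h: "\<And>m. h m \<in> tfs \<Omega>" "\<And>m. en l (h m) \<le> B" and c: "(\<lambda>m. l2ip \<Omega> u (app (h m))) \<longlonglongrightarrow> c"
  shows "(\<lambda>m. (A ^^ l) (f m) \<bullet> h m) \<longlonglongrightarrow> \<mu> * c"
proof -
  have fu: "converges f u" using f by (simp add: econv_def)
  have lim: "(\<lambda>r. (A ^^ l) (f r) \<bullet> h m) \<longlonglongrightarrow> \<mu> * l2ip \<Omega> u (app (h m))" for m
  proof -
    have "(\<lambda>r. f r \<bullet> (A ^^ l) (h m)) \<longlonglongrightarrow> l2ip \<Omega> u (app ((A ^^ l) (h m)))" by (rule converges_inner_tf[OF fu])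
    then show ?thesis using u h(1) by (simp add: eigenspace_iff inner_A_pow)
  qed
  have B: "B \<ge> 0" using h(2)[of 0] en_nonneg[of l "h 0"] by linarith
  have "(\<lambda>m. (A ^^ l) (f m) \<bullet> h m - \<mu> * l2ip \<Omega> u (app (h m))) \<longlonglongrightarrow> 0"
  proof (rule LIMSEQ_I)
    fix e :: real assume e: "0 < e"
    define d where "d = (e / 2)\<^sup>2 / (B + 1)"
    have d: "d > 0" using e B by (simp add: d_def)
    obtain N where N: "\<And>m r. m \<ge> N \<Longrightarrow> r \<ge> N \<Longrightarrow> en l (f m - f r) < d" using f d unfolding econv_def by blast
    have "norm ((A ^^ l) (f m) \<bullet> h m - \<mu> * l2ip \<Omega> u (app (h m)) - 0) < e" if m: "m \<ge> N" for m
    proof -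
      have "norm ((A ^^ l) (f m) \<bullet> h m - (A ^^ l) (f r) \<bullet> h m) \<le> e / 2" if r: "r \<ge> N" for r
      proof -
        have eq: "(A ^^ l) (f m) \<bullet> h m - (A ^^ l) (f r) \<bullet> h m = (A ^^ l) (f m - f r) \<bullet> h m"
          by (simp add: sform_lin[OF sform_en])
        have "((A ^^ l) (f m - f r) \<bullet> h m)\<^sup>2 \<le> en l (f m - f r) * en l (h m)"
          using sform_cauchy[OF sform_en, of l "f m - f r" "h m"] by (simp add: en_def)
        moreover have "en l (f m - f r) * en l (h m) \<le> d * (B + 1)"
          using N[OF m r] h(2)[of m] d by (intro mult_mono en_nonneg) auto
        moreover have "d * (B + 1) = (e / 2)\<^sup>2" using B by (simp add: d_def)
        ultimately have "(norm ((A ^^ l) (f m) \<bullet> h m - (A ^^ l) (f r) \<bullet> h m))\<^sup>2 \<le> (e / 2)\<^sup>2"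
          unfolding eq real_norm_def power2_abs by linarith
        from this show ?thesis by (rule power2_le_imp_le) (use e in simp)
      qed
      then have "norm ((A ^^ l) (f m) \<bullet> h m - \<mu> * l2ip \<Omega> u (app (h m))) \<le> e / 2"
        by (intro LIMSEQ_le_const2[OF tendsto_norm[OF tendsto_diff[OF tendsto_const lim]]]) blast
      then show ?thesis using e by simp
    qed
    then show "\<exists>N. \<forall>m\<ge>N. norm ((A ^^ l) (f m) \<bullet> h m - \<mu> * l2ip \<Omega> u (app (h m)) - 0) < e" by blast
  qed
  from tendsto_add[OF this tendsto_mult[OF tendsto_const[of \<mu>] c]] show ?thesis by simp
qed

end

section \<open>The variational inequality\<close>

context heis_domain
begin

lemma linear_l2ip_app:
  assumes "u \<in> L2_on \<Omega>"
  shows "linear (\<lambda>f. l2ip \<Omega> u (app f))"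
proof (rule linearI)
  have eq: "l2ip \<Omega> u (app (f + c *\<^sub>R g)) = l2ip \<Omega> u (app f) + c * l2ip \<Omega> u (app g)" for f g c
  proof -
    have "app (f + c *\<^sub>R g) = (\<lambda>z. app f z + c * app g z)" by (auto simp: app_add app_scaleR)
    then show ?thesis using l2ip_lincomb[OF app_L2 app_L2 assms, of f c g] by (simp add: l2ip_sym[of \<Omega> u])
  qed
  show "l2ip \<Omega> u (app (f + g)) = l2ip \<Omega> u (app f) + l2ip \<Omega> u (app g)" for f g using eq[of f 1 g] by simp
  have "l2ip \<Omega> u (app 0) = 0" by (simp add: l2ip_def app_zero)
  then show "l2ip \<Omega> u (app (c *\<^sub>R f)) = c *\<^sub>R l2ip \<Omega> u (app f)" for c f using eq[of 0 c f] by simp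
qed

text \<open>Minimise the energy penalised by the first \<open>k\<close> eigenfunctions over the unit sphere: a minimum
  below \<open>lam (k + 1)\<close> would be attained at an eigenfunction orthogonal to \<open>u 1, \<dots>, u k\<close>, contrary
  to the completeness of the list.\<close>

lemma spectral_inequality:
  assumes l: "l \<ge> 2"
    and eig: "\<And>i. i \<ge> 1 \<Longrightarrow> u i \<in> eigenspace l \<Omega> (lam i)"
    and orth: "\<And>i j. i \<ge> 1 \<Longrightarrow> j \<ge> 1 \<Longrightarrow> l2ip \<Omega> (u i) (u j) = (if i = j then 1 else 0)"
    and compl: "\<And>\<mu> v. v \<in> eigenspace l \<Omega> \<mu> \<Longrightarrow>
      \<exists>c :: nat \<Rightarrow> real. AE z in lebesgue_on \<Omega>. v z = (\<Sum>i | i \<ge> 1 \<and> lam i = \<mu>. c i * u i z)"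
    and mono: "\<And>i j. 1 \<le> i \<Longrightarrow> i \<le> j \<Longrightarrow> lam i \<le> lam j"
    and f: "f \<in> tfs \<Omega>"
  shows "lam (Suc k) * (f \<bullet> f) \<le> en l f + (\<Sum>i=1..k. (lam (Suc k) - lam i) * (l2ip \<Omega> (u i) (app f))\<^sup>2)"
proof -
  define L where "L i g = l2ip \<Omega> (u i) (app g)" for i and g :: "'n htf"
  \<comment> \<open>The penalty lifts the eigenvalue of each of \<open>u 1, ..., u k\<close> to
    \<open>lam (Suc k)\<close>.\<close>
  define F where "F g h = (A ^^ l) g \<bullet> h + (\<Sum>i=1..k. (lam (Suc k) - lam i) * (L i g * L i h))" for g h :: "'n htf"
  have uS0: "u i \<in> S0_space l \<Omega>" if "i \<ge> 1" for i using eig[OF that] by (simp add: eigenspace_iff)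
  have uL: "u i \<in> L2_on \<Omega>" if "i \<ge> 1" for i using uS0[OF that] by (simp add: S0_space_def S_space_iff)
  have Llin: "linear (L i)" if "i \<ge> 1" for i unfolding L_def using uL[OF that] by (rule linear_l2ip_app)
  have gap: "0 \<le> lam (Suc k) - lam i" if "i \<in> {1..k}" for i using mono[of i "Suc k"] that by simp
  have pen: "0 \<le> (\<Sum>i=1..k. (lam (Suc k) - lam i) * (L i g * L i g))" for g
  proof (rule sum_nonneg)
    fix i assume "i \<in> {1..k}"
    then show "0 \<le> (lam (Suc k) - lam i) * (L i g * L i g)" by (intro mult_nonneg_nonneg gap zero_le_square)
  qed
  have F: "sform F"
    unfolding sform_def
  proof (intro conjI allI)
    fix g h
    show "linear (F g)" unfolding F_def
      by (intro linear_compose_add linear_compose_sum ballI)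
        (use Llin in \<open>auto intro!: linearI simp: inner_add_right linear_add linear_scale algebra_simps\<close>)
    show "F g h = F h g" unfolding F_def using sform_sym[OF sform_en, of l g h] by (simp add: mult.commute)
    show "0 \<le> F g g" unfolding F_def
      using sform_nonneg[OF sform_en, of l g] pen[of g] by (rule add_nonneg_nonneg)
  qed
  have en_F: "en l g \<le> F g g" for g
    unfolding F_def en_def using pen[of g] by linarith
  have "lam (Suc k) * (f \<bullet> f) \<le> F f f"
  proof (rule ccontr)
    assume neg: "\<not> lam (Suc k) * (f \<bullet> f) \<le> F f f"
    define V where "V = {F g g |g. g \<in> tfs \<Omega> \<and> g \<bullet> g = 1}"
    define \<mu> where "\<mu> = Inf V"
    have f0: "f \<noteq> 0"
    proof
      assume "f = 0"
      then have "F f f = 0" "f \<bullet> f = 0" using sform_lin(3)[OF F, of 0 0] by auto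
      then show False using neg by simp
    qed
    have bV: "bdd_below V" unfolding V_def by (rule bdd_belowI[of _ 0]) (auto simp: sform_nonneg[OF F])
    have norml: "F g g / (g \<bullet> g) \<in> V" if "g \<in> tfs \<Omega>" "g \<noteq> 0" for g
    proof -
      let ?h = "(1 / norm g) *\<^sub>R g"
      have gg: "g \<bullet> g = norm g * norm g" by (simp add: dot_square_norm power2_eq_square)
      show ?thesis unfolding V_def
      proof (intro CollectI exI[of _ ?h] conjI)
        show "F g g / (g \<bullet> g) = F ?h ?h" by (simp add: sform_lin[OF F] gg)
        show "?h \<bullet> ?h = 1" using that by (simp add: gg)
        show "?h \<in> tfs \<Omega>" using that by (intro tfs_scale)
      qed
    qed
    have Fmu: "\<mu> * (g \<bullet> g) \<le> F g g" if g: "g \<in> tfs \<Omega>" for g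
    proof (cases "g = 0")
      case True
      then show ?thesis using sform_nonneg[OF F, of g] by simp
    next
      case False
      then have "\<mu> \<le> F g g / (g \<bullet> g)" unfolding \<mu>_def by (intro cInf_lower norml g bV)
      then show ?thesis using False by (simp add: field_simps)
    qed
    have Vne: "V \<noteq> {}" using norml[OF f f0] by auto
    have mu0: "\<mu> \<ge> 0" unfolding \<mu>_def using Vne by (rule cInf_greatest) (auto simp: V_def sform_nonneg[OF F])
    have mu: "\<mu> < lam (Suc k)"
    proof -
      have "\<mu> \<le> F f f / (f \<bullet> f)" unfolding \<mu>_def by (intro cInf_lower norml f f0 bV)
      also have "\<dots> < lam (Suc k)" using neg f0 by (simp add: field_simps)
      finally show ?thesis .
    qed
    have "\<exists>g. g \<in> tfs \<Omega> \<and> g \<bullet> g = 1 \<and> F g g < \<mu> + inverse (Suc m)" for m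
    proof -
      have "\<exists>y\<in>V. y < \<mu> + inverse (Suc m)" using Vne bV unfolding \<mu>_def by (subst cInf_less_iff[symmetric]) auto
      then show ?thesis unfolding V_def by blast
    qed
    then obtain h where h: "\<And>m. h m \<in> tfs \<Omega>" "\<And>m. h m \<bullet> h m = 1" "\<And>m. F (h m) (h m) < \<mu> + inverse (Suc m)" by metis
    obtain R where R: "\<And>z. z \<in> \<Omega> \<Longrightarrow> norm z \<le> R" using bd unfolding bounded_iff by blast
    obtain K where K: "K \<ge> 0" "\<And>g b. g \<in> tfs \<Omega> \<Longrightarrow> b \<in> Basis \<Longrightarrow> pd b g \<bullet> pd b g \<le> K * (en l g + g \<bullet> g)"
      using gradient_bound[OF R l, of \<Omega>] by blast
    have hn: "norm (h m) = 1" for m using h(2) by (simp add: norm_eq_sqrt_inner)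
    have inv1: "inverse (real (Suc m)) \<le> 1" for m by (simp add: field_simps)
    have hpd: "norm (pd b (h m)) \<le> sqrt (K * (\<mu> + 2))" if b: "b \<in> Basis" for b m
    proof -
      have "en l (h m) \<le> \<mu> + 1" using en_F[of "h m"] h(3)[of m] inv1[of m] by linarith
      then have "K * (en l (h m) + h m \<bullet> h m) \<le> K * (\<mu> + 2)" using K(1) h(2) by (intro mult_left_mono) auto
      with K(2)[OF h(1) b, of m] show ?thesis unfolding norm_eq_sqrt_inner by (intro real_sqrt_le_mono) linarith
    qed
    obtain r where r: "strict_mono r" "Cauchy (h \<circ> r)"
    proof (rule rellich[of \<Omega> h "max 1 (sqrt (K * (\<mu> + 2)))"])
      show "bounded \<Omega>" by (rule bd)
      show "h m \<in> tfs \<Omega>" for m by (rule h)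
      show "norm (h m) \<le> max 1 (sqrt (K * (\<mu> + 2)))" for m by (simp add: hn)
      show "norm (pd b (h m)) \<le> max 1 (sqrt (K * (\<mu> + 2)))" if "b \<in> Basis" for m b using hpd[OF that, of m] by simp
    qed
    define \<phi> where "\<phi> m = h (r m)" for m
    define G where "G m = F (\<phi> m) (\<phi> m) - \<mu>" for m
    have pt: "\<phi> m \<in> tfs \<Omega>" and p1: "\<phi> m \<bullet> \<phi> m = 1" for m by (simp_all add: \<phi>_def h)
    have pC: "Cauchy \<phi>" using r(2) by (simp add: \<phi>_def[abs_def] o_def)
    have G0: "0 \<le> G m" for m using Fmu[OF pt, of m] by (simp add: G_def p1)
    have Glim: "G \<longlonglongrightarrow> 0"
    proof (rule tendsto_sandwich[OF _ _ tendsto_const LIMSEQ_inverse_real_of_nat])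
      show "\<forall>\<^sub>F m in sequentially. G m \<le> inverse (real (Suc m))"
      proof (intro always_eventually allI)
        fix m
        have "inverse (real (Suc (r m))) \<le> inverse (real (Suc m))" using seq_suble[OF r(1), of m] by simp
        then show "G m \<le> inverse (real (Suc m))" using h(3)[of "r m"] unfolding G_def \<phi>_def by linarith
      qed
    qed (simp add: G0)
    \<comment> \<open>\<open>F\<close> minus \<mu> times the inner product is nonnegative on
      \<open>tfs \<Omega>\<close>. Cauchy-Schwarz for it turns the small excess \<open>G m\<close>
      into an approximate Euler-Lagrange equation.\<close>
    have CS: "(F (\<phi> m) g - \<mu> * (\<phi> m \<bullet> g))\<^sup>2 \<le> G m * (F g g - \<mu> * (g \<bullet> g))" if g: "g \<in> tfs \<Omega>" for m g
    proof (rule discriminant_le)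
      show "0 \<le> F g g - \<mu> * (g \<bullet> g)" using Fmu[OF g] by simp
      fix s
      have "\<phi> m + s *\<^sub>R g \<in> tfs \<Omega>" by (intro tfs_add tfs_scale pt g)
      from Fmu[OF this] show "0 \<le> G m + 2 * s * (F (\<phi> m) g - \<mu> * (\<phi> m \<bullet> g)) + s * s * (F g g - \<mu> * (g \<bullet> g))"
        by (simp add: sform_lin[OF F] sform_sym[OF F, of g "\<phi> m"] inner_add_left inner_add_right inner_commute[of g "\<phi> m"] p1 G_def algebra_simps)
    qed
    have null: "X \<longlonglongrightarrow> 0" if "\<And>m. (X m)\<^sup>2 \<le> G m * B" for X :: "nat \<Rightarrow> real" and B
    proof -
      have "(\<lambda>m. G m * B) \<longlonglongrightarrow> 0 * B" by (intro tendsto_intros Glim)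
      then have "(\<lambda>m. G m * B) \<longlonglongrightarrow> 0" by simp
      then have "(\<lambda>m. (X m)\<^sup>2) \<longlonglongrightarrow> 0" by (rule tendsto_sandwich[OF _ _ tendsto_const, rotated 2]) (use that in simp_all)
      from tendsto_real_sqrt[OF this] have "(\<lambda>m. \<bar>X m\<bar>) \<longlonglongrightarrow> 0" by simp
      then show ?thesis by (rule tendsto_rabs_zero_cancel)
    qed
    have EL: "(\<lambda>m. F (\<phi> m) g - \<mu> * (\<phi> m \<bullet> g)) \<longlonglongrightarrow> 0" if "g \<in> tfs \<Omega>" for g
      by (rule null[OF CS[OF that]])
    \<comment> \<open>Testing the approximate equation with a sequence tending to \<open>u i\<close>
      gives \<open>lam (Suc k) - \<mu>\<close> times the coefficient of \<phi> m at
      \<open>u i\<close>; the first factor is positive, so the coefficient tends to 0.\<close>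
    have Lnull: "(\<lambda>m. L i (\<phi> m)) \<longlonglongrightarrow> 0" if i: "i \<in> {1..k}" for i
    proof -
      have i1: "i \<ge> 1" using i by simp
      obtain g where g: "econv l g (u i)" using S0_space_imp_econv[OF uS0[OF i1]] l by auto
      then have gc: "converges g (u i)" and gt: "\<And>m. g m \<in> tfs \<Omega>" by (auto simp: econv_def converges_def)
      have e1: "(\<lambda>m. (A ^^ l) p \<bullet> g m) \<longlonglongrightarrow> lam i * L i p" if "p \<in> tfs \<Omega>" for p
      proof -
        have "(\<lambda>m. g m \<bullet> (A ^^ l) p) \<longlonglongrightarrow> l2ip \<Omega> (u i) (app ((A ^^ l) p))" by (rule converges_inner_tf[OF gc])
        also have "l2ip \<Omega> (u i) (app ((A ^^ l) p)) = lam i * L i p" using eig[OF i1] that by (simp add: eigenspace_iff L_def)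
        finally show ?thesis by (simp add: inner_commute)
      qed
      have e2: "(\<lambda>m. L j (g m)) \<longlonglongrightarrow> (if j = i then 1 else 0)" if j: "j \<in> {1..k}" for j
        using converges_inner[OF gc, of "u j"] uL[of j] orth[of i j] that i by (auto simp: L_def l2ip_sym[of \<Omega> "u j"])
      have e3: "(\<lambda>m. p \<bullet> g m) \<longlonglongrightarrow> L i p" for p
        using converges_inner_tf[OF gc, of p] by (simp add: L_def inner_commute)
      have FL: "(\<lambda>m. F p (g m) - \<mu> * (p \<bullet> g m)) \<longlonglongrightarrow> (lam (Suc k) - \<mu>) * L i p" if p: "p \<in> tfs \<Omega>" for p
      proof -
        have "(\<lambda>m. F p (g m) - \<mu> * (p \<bullet> g m)) \<longlonglongrightarrow>
          lam i * L i p + (\<Sum>j=1..k. (lam (Suc k) - lam j) * (L j p * (if j = i then 1 else 0))) - \<mu> * L i p"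
          unfolding F_def by (intro tendsto_intros e1 e2 e3 p)
        also have "(\<Sum>j=1..k. (lam (Suc k) - lam j) * (L j p * (if j = i then 1 else 0))) = (lam (Suc k) - lam i) * L i p"
        proof -
          have "(\<Sum>j=1..k. (lam (Suc k) - lam j) * (L j p * (if j = i then 1 else 0)))
            = (\<Sum>j=1..k. if j = i then (lam (Suc k) - lam j) * L j p else 0)" by (rule sum.cong) auto
          then show ?thesis using i by (simp add: sum.delta)
        qed
        finally show ?thesis by (simp add: algebra_simps)
      qed
      obtain Q where Q: "\<And>m. F (g m) (g m) - \<mu> * (g m \<bullet> g m) \<le> Q"
      proof -
        obtain B where B: "\<And>m. en l (g m) \<le> B" using econv_bounded[OF g] by blast
        obtain P where P: "\<And>m. norm (g m) \<le> P" using Cauchy_Bseq[OF converges_Cauchy[OF gc]] unfolding Bseq_def by blast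
        have "F (g m) (g m) - \<mu> * (g m \<bullet> g m) \<le> B + (\<Sum>j=1..k. (lam (Suc k) - lam j) * P\<^sup>2)" for m
        proof -
          have "L j (g m) * L j (g m) \<le> P\<^sup>2" if j: "j \<in> {1..k}" for j
          proof -
            have "\<bar>L j (g m)\<bar> \<le> P"
              using l2ip_cauchy[OF uL app_L2, of j "g m"] orth[of j j] j P[of m]
              by (simp add: L_def l2ip_app gt norm_eq_sqrt_inner)
            then show ?thesis using power_mono[of "\<bar>L j (g m)\<bar>" P 2] by (simp add: power2_eq_square)
          qed
          then have "(\<Sum>j=1..k. (lam (Suc k) - lam j) * (L j (g m) * L j (g m))) \<le> (\<Sum>j=1..k. (lam (Suc k) - lam j) * P\<^sup>2)"
            using gap by (intro sum_mono mult_left_mono) auto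
          moreover have "0 \<le> \<mu> * (g m \<bullet> g m)" using mu0 by simp
          ultimately show ?thesis using B[of m] unfolding F_def en_def by linarith
        qed
        then show ?thesis by (rule that)
      qed
      have "((lam (Suc k) - \<mu>) * L i (\<phi> m))\<^sup>2 \<le> G m * Q" for m
      proof (rule LIMSEQ_le_const2)
        show "(\<lambda>r. (F (\<phi> m) (g r) - \<mu> * (\<phi> m \<bullet> g r))\<^sup>2) \<longlonglongrightarrow> ((lam (Suc k) - \<mu>) * L i (\<phi> m))\<^sup>2"
          by (intro tendsto_power FL pt)
        have "(F (\<phi> m) (g r) - \<mu> * (\<phi> m \<bullet> g r))\<^sup>2 \<le> G m * Q" for r
          using CS[OF gt, of m r] mult_left_mono[OF Q G0, of m r] by linarith
        then show "\<exists>N. \<forall>r\<ge>N. (F (\<phi> m) (g r) - \<mu> * (\<phi> m \<bullet> g r))\<^sup>2 \<le> G m * Q" by blast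
      qed
      then have "(\<lambda>m. (lam (Suc k) - \<mu>) * L i (\<phi> m)) \<longlonglongrightarrow> 0" by (rule null)
      then have "(\<lambda>m. inverse (lam (Suc k) - \<mu>) * ((lam (Suc k) - \<mu>) * L i (\<phi> m))) \<longlonglongrightarrow> inverse (lam (Suc k) - \<mu>) * 0"
        by (intro tendsto_intros)
      then show ?thesis using mu by (simp add: mult.assoc[symmetric])
    qed
    obtain v where v: "converges \<phi> v" using Cauchy_converges[OF pt pC] by blast
    have vL: "v \<in> L2_on \<Omega>" using v by (simp add: converges_def)
    \<comment> \<open>Parallelogram law: the sum of two near-minimisers has quotient at least \<mu>,
      so their difference has little energy.\<close>
    have "econv l \<phi> v" unfolding econv_def
    proof (intro conjI allI impI v)
      fix e :: real assume e: "e > 0"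
      \<comment> \<open>The two excesses cost less than 4 c and the L2 distance at most \<mu>
        c.\<close>
      define c where "c = e / (5 + \<mu>)"
      have c: "c > 0" using e mu0 by (simp add: c_def)
      obtain N1 where N1: "\<And>m k. m \<ge> N1 \<Longrightarrow> k \<ge> N1 \<Longrightarrow> (\<phi> m - \<phi> k) \<bullet> (\<phi> m - \<phi> k) < c"
        using pC c unfolding Cauchy_square by blast
      obtain N2 where N2: "\<And>m. m \<ge> N2 \<Longrightarrow> G m < c"
        using order_tendstoD(2)[OF Glim c] unfolding eventually_sequentially by blast
      have "en l (\<phi> m - \<phi> j) < e" if "m \<ge> max N1 N2" "j \<ge> max N1 N2" for m j
      proof -
        have "F (\<phi> m - \<phi> j) (\<phi> m - \<phi> j) = 2 * F (\<phi> m) (\<phi> m) + 2 * F (\<phi> j) (\<phi> j) - F (\<phi> m + \<phi> j) (\<phi> m + \<phi> j)"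
          by (simp add: sform_lin[OF F] algebra_simps)
        moreover have "(\<phi> m - \<phi> j) \<bullet> (\<phi> m - \<phi> j) = 4 - (\<phi> m + \<phi> j) \<bullet> (\<phi> m + \<phi> j)"
          by (simp add: inner_add_left inner_add_right inner_diff_left inner_diff_right p1 inner_commute)
        then have "\<mu> * ((\<phi> m - \<phi> j) \<bullet> (\<phi> m - \<phi> j)) = \<mu> * 4 - \<mu> * ((\<phi> m + \<phi> j) \<bullet> (\<phi> m + \<phi> j))"
          by (simp only: right_diff_distrib)
        moreover have "\<mu> * ((\<phi> m + \<phi> j) \<bullet> (\<phi> m + \<phi> j)) \<le> F (\<phi> m + \<phi> j) (\<phi> m + \<phi> j)"
          by (intro Fmu tfs_add pt)
        moreover have "\<mu> * ((\<phi> m - \<phi> j) \<bullet> (\<phi> m - \<phi> j)) \<le> \<mu> * c"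
          using N1[of m j] that mu0 by (intro mult_left_mono) auto
        moreover have "G m < c" "G j < c" using N2 that by auto
        ultimately have "en l (\<phi> m - \<phi> j) < 4 * c + \<mu> * c" using en_F[of "\<phi> m - \<phi> j"] unfolding G_def by linarith
        also have "\<dots> < (5 + \<mu>) * c" using c by (simp add: algebra_simps)
        also have "\<dots> = e" using mu0 by (simp add: c_def)
        finally show ?thesis .
      qed
      then show "\<exists>N. \<forall>m\<ge>N. \<forall>k\<ge>N. en l (\<phi> m - \<phi> k) < e" by blast
    qed
    then have vS: "v \<in> S0_space l \<Omega>" by (rule econv_imp_S0_space)
    have "v \<in> eigenspace l \<Omega> \<mu>" unfolding eigenspace_iff
    proof (intro conjI ballI vS)
      fix g assume g: "g \<in> tfs \<Omega>"
      have "(\<lambda>m. (F (\<phi> m) g - \<mu> * (\<phi> m \<bullet> g)) + \<mu> * (\<phi> m \<bullet> g) - (\<Sum>i=1..k. (lam (Suc k) - lam i) * (L i (\<phi> m) * L i g)))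
        \<longlonglongrightarrow> 0 + \<mu> * l2ip \<Omega> v (app g) - (\<Sum>i=1..k. (lam (Suc k) - lam i) * (0 * L i g))"
        by (intro tendsto_intros EL g Lnull converges_inner_tf[OF v])
      then have "(\<lambda>m. (A ^^ l) (\<phi> m) \<bullet> g) \<longlonglongrightarrow> \<mu> * l2ip \<Omega> v (app g)" unfolding F_def by simp
      moreover have "(\<lambda>m. (A ^^ l) (\<phi> m) \<bullet> g) \<longlonglongrightarrow> l2ip \<Omega> v (app ((A ^^ l) g))"
        unfolding inner_A_pow by (rule converges_inner_tf[OF v])
      ultimately show "l2ip \<Omega> v (app ((A ^^ l) g)) = \<mu> * l2ip \<Omega> v (app g)" by (rule LIMSEQ_unique[rotated])
    qed
    then obtain c :: "nat \<Rightarrow> real" where c: "AE z in lebesgue_on \<Omega>. v z = (\<Sum>i | i \<ge> 1 \<and> lam i = \<mu>. c i * u i z)"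
      using compl by blast
    \<comment> \<open>Completeness expands \<open>v\<close> in eigenfunctions of eigenvalue \<mu>,
      and as \<mu> lies below \<open>lam (Suc k)\<close> these are among the first \<open>k\<close>.
      But \<open>v\<close> is orthogonal to them and has norm 1.\<close>
    define I where "I = {i. i \<ge> 1 \<and> lam i = \<mu>}"
    have I: "I \<subseteq> {1..k}"
    proof
      fix i assume i: "i \<in> I"
      then have "\<not> Suc k \<le> i" using mono[of "Suc k" i] mu by (auto simp: I_def)
      then show "i \<in> {1..k}" using i by (auto simp: I_def)
    qed
    have vu: "l2ip \<Omega> v (u i) = 0" if i: "i \<in> I" for i
    proof (rule LIMSEQ_unique)
      show "(\<lambda>m. l2ip \<Omega> (app (\<phi> m)) (u i)) \<longlonglongrightarrow> l2ip \<Omega> v (u i)"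
        by (rule converges_inner[OF v uL]) (use i I_def in auto)
      show "(\<lambda>m. l2ip \<Omega> (app (\<phi> m)) (u i)) \<longlonglongrightarrow> 0" using Lnull[of i] i I by (auto simp: L_def l2ip_sym[of \<Omega> "u i"])
    qed
    have fin: "finite I" using I by (rule finite_subset) simp
    have iv: "integrable (lebesgue_on \<Omega>) (\<lambda>z. v z * u i z)" if "i \<in> I" for i
      using that by (intro L2_on_integrable_mult vL uL) (auto simp: I_def)
    have "l2ip \<Omega> v v = (LINT z|lebesgue_on \<Omega>. (\<Sum>i\<in>I. c i * (v z * u i z)))"
      unfolding l2ip_def
    proof (rule Bochner_Integration.integral_cong_AE)
      show "(\<lambda>z. v z * v z) \<in> borel_measurable (lebesgue_on \<Omega>)" using L2_onD(1)[OF vL] by simp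
      show "(\<lambda>z. \<Sum>i\<in>I. c i * (v z * u i z)) \<in> borel_measurable (lebesgue_on \<Omega>)"
        using iv by (intro borel_measurable_integrable Bochner_Integration.integrable_sum integrable_mult_right)
      show "AE z in lebesgue_on \<Omega>. v z * v z = (\<Sum>i\<in>I. c i * (v z * u i z))"
        using c
      proof eventually_elim
        case (elim z)
        have "v z * v z = v z * (\<Sum>i\<in>I. c i * u i z)" by (subst (2) elim) (simp add: I_def)
        then show ?case by (simp add: sum_distrib_left mult.left_commute)
      qed
    qed
    also have "\<dots> = (\<Sum>i\<in>I. c i * l2ip \<Omega> v (u i))"
      unfolding l2ip_def using iv by (subst Bochner_Integration.integral_sum) (auto intro!: integrable_mult_right)
    also have "\<dots> = 0" using vu by simp
    finally have "l2ip \<Omega> v v = 0" .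
    moreover have "l2ip \<Omega> v v = 1" using converges_inner_both[OF v v] unfolding p1 by (simp add: LIMSEQ_const_iff)
    ultimately show False by simp
  qed
  then show ?thesis by (simp add: F_def en_def L_def power2_eq_square)
qed

end

section \<open>Yang's inequality\<close>

text \<open>The approximating vectors \<open>e j\<close> are orthonormal only in the limit. The
  projections therefore use limiting coefficients, and the usual formula for projected inner
  products is recovered in the limit.\<close>

lemma projected_inner_tendsto:
  fixes \<alpha> \<beta> :: "nat \<Rightarrow> 'v::real_inner" and e :: "nat \<Rightarrow> nat \<Rightarrow> 'v"
  assumes J: "finite J"
    and s: "(\<lambda>m. \<alpha> m \<bullet> \<beta> m) \<longlonglongrightarrow> s"
    and a: "\<And>j. j \<in> J \<Longrightarrow> (\<lambda>m. \<alpha> m \<bullet> e j m) \<longlonglongrightarrow> a j"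
    and b: "\<And>j. j \<in> J \<Longrightarrow> (\<lambda>m. \<beta> m \<bullet> e j m) \<longlonglongrightarrow> b j"
    and e: "\<And>i j. i \<in> J \<Longrightarrow> j \<in> J \<Longrightarrow> (\<lambda>m. e i m \<bullet> e j m) \<longlonglongrightarrow> (if i = j then 1 else 0)"
  shows "(\<lambda>m. (\<alpha> m - (\<Sum>j\<in>J. a j *\<^sub>R e j m)) \<bullet> (\<beta> m - (\<Sum>j\<in>J. b j *\<^sub>R e j m))) \<longlonglongrightarrow> s - (\<Sum>j\<in>J. a j * b j)"
proof -
  have "(\<alpha> m - (\<Sum>j\<in>J. a j *\<^sub>R e j m)) \<bullet> (\<beta> m - (\<Sum>j\<in>J. b j *\<^sub>R e j m))
    = \<alpha> m \<bullet> \<beta> m - (\<Sum>j\<in>J. b j * (\<alpha> m \<bullet> e j m)) - (\<Sum>j\<in>J. a j * (\<beta> m \<bullet> e j m))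
      + (\<Sum>i\<in>J. \<Sum>j\<in>J. a i * b j * (e i m \<bullet> e j m))" for m
  proof -
    have "\<alpha> m \<bullet> (\<Sum>j\<in>J. b j *\<^sub>R e j m) = (\<Sum>j\<in>J. b j * (\<alpha> m \<bullet> e j m))"
      by (simp add: inner_sum_right)
    moreover have "(\<Sum>j\<in>J. a j *\<^sub>R e j m) \<bullet> \<beta> m = (\<Sum>j\<in>J. a j * (\<beta> m \<bullet> e j m))"
      unfolding inner_commute[of _ "\<beta> m"] by (simp add: inner_sum_right)
    moreover have "(\<Sum>j\<in>J. a j *\<^sub>R e j m) \<bullet> (\<Sum>j\<in>J. b j *\<^sub>R e j m) = (\<Sum>i\<in>J. \<Sum>j\<in>J. a i * b j * (e i m \<bullet> e j m))"
      unfolding inner_sum_left by (simp add: inner_sum_right sum_distrib_left mult_ac)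
    ultimately show ?thesis by (simp add: inner_diff_left inner_diff_right)
  qed
  moreover have "(\<lambda>m. \<alpha> m \<bullet> \<beta> m - (\<Sum>j\<in>J. b j * (\<alpha> m \<bullet> e j m)) - (\<Sum>j\<in>J. a j * (\<beta> m \<bullet> e j m))
      + (\<Sum>i\<in>J. \<Sum>j\<in>J. a i * b j * (e i m \<bullet> e j m)))
    \<longlonglongrightarrow> s - (\<Sum>j\<in>J. b j * a j) - (\<Sum>j\<in>J. a j * b j) + (\<Sum>i\<in>J. \<Sum>j\<in>J. a i * b j * (if i = j then 1 else 0))"
    by (intro tendsto_intros s a b e)
  moreover have "(\<Sum>i\<in>J. \<Sum>j\<in>J. a i * b j * (if i = j then 1 else 0)) = (\<Sum>j\<in>J. a j * b j)"
    by (rule sum.cong) (use J in \<open>simp_all add: if_distrib sum.delta cong: if_cong\<close>)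
  ultimately show ?thesis by (simp add: mult.commute)
qed

lemma sum_antisym:
  fixes h :: "nat \<Rightarrow> nat \<Rightarrow> real"
  assumes "\<And>i j. i \<in> J \<Longrightarrow> j \<in> J \<Longrightarrow> h j i = - h i j"
  shows "(\<Sum>i\<in>J. \<Sum>j\<in>J. h i j) = 0"
proof -
  have "(\<Sum>i\<in>J. \<Sum>j\<in>J. h i j) = (\<Sum>j\<in>J. \<Sum>i\<in>J. h i j)" by (rule sum.swap)
  also have "\<dots> = (\<Sum>j\<in>J. \<Sum>i\<in>J. - h j i)" by (intro sum.cong refl assms)
  also have "\<dots> = - (\<Sum>i\<in>J. \<Sum>j\<in>J. h i j)" unfolding sum_negf ..
  finally show ?thesis by linarith
qed

text \<open>After (anti)symmetrising the double sums, the terms containing \<open>a\<close> and \<open>b\<close> combine to minus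
  \<open>w i * (\<delta> * (w i - w j) * a i j + b i j)\<^sup>2 / \<delta>\<close>.\<close>

lemma yang_sum:
  fixes w D N G :: "nat \<Rightarrow> real" and a b :: "nat \<Rightarrow> nat \<Rightarrow> real"
  assumes \<delta>: "\<delta> > 0" and w: "\<And>i. i \<in> J \<Longrightarrow> 0 \<le> w i"
    and a: "\<And>i j. i \<in> J \<Longrightarrow> j \<in> J \<Longrightarrow> a j i = a i j"
    and b: "\<And>i j. i \<in> J \<Longrightarrow> j \<in> J \<Longrightarrow> b j i = - b i j"
    and N: "\<And>i. i \<in> J \<Longrightarrow> w i * N i \<le> D i + (\<Sum>j\<in>J. w j * (a i j)\<^sup>2)"
    and CS: "\<And>i. i \<in> J \<Longrightarrow> (1 / 2 + (\<Sum>j\<in>J. a i j * b i j))\<^sup>2 \<le> (N i - (\<Sum>j\<in>J. (a i j)\<^sup>2)) * (G i - (\<Sum>j\<in>J. (b i j)\<^sup>2))"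
    and P: "\<And>i. i \<in> J \<Longrightarrow> 0 \<le> N i - (\<Sum>j\<in>J. (a i j)\<^sup>2)"
    and Q: "\<And>i. i \<in> J \<Longrightarrow> 0 \<le> G i - (\<Sum>j\<in>J. (b i j)\<^sup>2)"
  shows "(\<Sum>i\<in>J. (w i)\<^sup>2) \<le> \<delta> * (\<Sum>i\<in>J. (w i)\<^sup>2 * D i) + (\<Sum>i\<in>J. w i * G i) / \<delta>"
proof -
  define p where "p i = N i - (\<Sum>j\<in>J. (a i j)\<^sup>2)" for i
  define r where "r i = G i - (\<Sum>j\<in>J. (b i j)\<^sup>2)" for i
  have amgm: "2 * c \<le> t * x + y / t" if "c\<^sup>2 \<le> x * y" "0 \<le> x" "0 \<le> y" "t > 0" for c x y t :: real
  proof -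
    have "c\<^sup>2 \<le> ((t * x + y / t) / 2)\<^sup>2"
    proof -
      have "(X * Y :: real) \<le> ((X + Y) / 2)\<^sup>2" for X Y
      proof -
        have "((X + Y) / 2)\<^sup>2 = X * Y + ((X - Y) / 2)\<^sup>2" by (simp add: power2_eq_square field_simps)
        then show ?thesis by simp
      qed
      from this[of "t * x" "y / t"] show ?thesis using that(1,4) by simp
    qed
    then have "c \<le> (t * x + y / t) / 2" using that by (intro power2_le_imp_le[of c]) auto
    then show ?thesis by simp
  qed
  \<comment> \<open>The arithmetic-geometric mean with weight \<open>\<delta> * w i\<close>: the
    factor \<open>w i\<close> brings in the bound \<open>N\<close>, and multiplication by the square
    of \<open>w i\<close> then yields the powers of \<open>w i\<close> in front of
    \<open>D i\<close> and \<open>G i\<close>.\<close>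
  have one: "(w i)\<^sup>2 + 2 * (\<Sum>j\<in>J. (w i)\<^sup>2 * (a i j * b i j))
      \<le> \<delta> * ((w i)\<^sup>2 * D i) + \<delta> * (\<Sum>j\<in>J. (w i)\<^sup>2 * (w j - w i) * (a i j)\<^sup>2) + w i * G i / \<delta> - (\<Sum>j\<in>J. w i * (b i j)\<^sup>2) / \<delta>"
    if i: "i \<in> J" for i
  proof (cases "w i = 0")
    case False
    then have wi: "w i > 0" using w[OF i] by simp
    have "2 * (1 / 2 + (\<Sum>j\<in>J. a i j * b i j)) \<le> (\<delta> * w i) * p i + r i / (\<delta> * w i)"
      using CS[OF i] P[OF i] Q[OF i] \<delta> wi by (intro amgm) (simp_all add: p_def r_def)
    then have "(w i)\<^sup>2 * (2 * (1 / 2 + (\<Sum>j\<in>J. a i j * b i j))) \<le> (w i)\<^sup>2 * ((\<delta> * w i) * p i + r i / (\<delta> * w i))"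
      by (intro mult_left_mono) auto
    also have "\<dots> = \<delta> * ((w i)\<^sup>2 * (w i * p i)) + w i * r i / \<delta>"
      using wi \<delta> by (simp add: field_simps power2_eq_square)
    also have "\<dots> \<le> \<delta> * ((w i)\<^sup>2 * (D i + (\<Sum>j\<in>J. (w j - w i) * (a i j)\<^sup>2))) + w i * r i / \<delta>"
    proof -
      have "w i * p i \<le> D i + (\<Sum>j\<in>J. (w j - w i) * (a i j)\<^sup>2)"
        using N[OF i] by (simp add: p_def left_diff_distrib sum_subtractf right_diff_distrib sum_distrib_left)
      then show ?thesis using \<delta> by (intro add_right_mono mult_left_mono) auto
    qed
    finally have *: "(w i)\<^sup>2 * (2 * (1 / 2 + (\<Sum>j\<in>J. a i j * b i j)))
      \<le> \<delta> * ((w i)\<^sup>2 * (D i + (\<Sum>j\<in>J. (w j - w i) * (a i j)\<^sup>2))) + w i * r i / \<delta>" .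
    have "(\<Sum>j\<in>J. (w i)\<^sup>2 * (a i j * b i j)) = (w i)\<^sup>2 * (\<Sum>j\<in>J. a i j * b i j)"
      "(\<Sum>j\<in>J. (w i)\<^sup>2 * (w j - w i) * (a i j)\<^sup>2) = (w i)\<^sup>2 * (\<Sum>j\<in>J. (w j - w i) * (a i j)\<^sup>2)"
      "(\<Sum>j\<in>J. w i * (b i j)\<^sup>2) = w i * (\<Sum>j\<in>J. (b i j)\<^sup>2)"
      by (simp_all only: sum_distrib_left mult.assoc)
    note eqs = this
    show ?thesis using * unfolding eqs r_def
      by (simp add: algebra_simps diff_divide_distrib)
  qed simp
  have A: "(\<Sum>i\<in>J. \<Sum>j\<in>J. (w i)\<^sup>2 * (a i j * b i j)) = (\<Sum>i\<in>J. \<Sum>j\<in>J. w i * (w i - w j) * (a i j * b i j))"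
  proof -
    have "(\<Sum>i\<in>J. \<Sum>j\<in>J. w i * w j * (a i j * b i j)) = 0"
    proof (rule sum_antisym)
      show "w j * w i * (a j i * b j i) = - (w i * w j * (a i j * b i j))" if "i \<in> J" "j \<in> J" for i j
        unfolding a[OF that] b[OF that] by simp
    qed
    then have "(\<Sum>i\<in>J. \<Sum>j\<in>J. (w i)\<^sup>2 * (a i j * b i j) - w i * w j * (a i j * b i j)) = (\<Sum>i\<in>J. \<Sum>j\<in>J. (w i)\<^sup>2 * (a i j * b i j))"
      by (simp add: sum_subtractf)
    moreover have "(w i)\<^sup>2 * (a i j * b i j) - w i * w j * (a i j * b i j) = w i * (w i - w j) * (a i j * b i j)" for i j
      by (simp add: power2_eq_square algebra_simps)
    ultimately show ?thesis by simp
  qed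
  have B: "(\<Sum>i\<in>J. \<Sum>j\<in>J. (w i)\<^sup>2 * (w j - w i) * (a i j)\<^sup>2) = - (\<Sum>i\<in>J. \<Sum>j\<in>J. w i * (w i - w j)\<^sup>2 * (a i j)\<^sup>2)"
  proof -
    have "(\<Sum>i\<in>J. \<Sum>j\<in>J. w i * w j * (w j - w i) * (a i j)\<^sup>2) = 0"
    proof (rule sum_antisym)
      show "w j * w i * (w i - w j) * (a j i)\<^sup>2 = - (w i * w j * (w j - w i) * (a i j)\<^sup>2)" if "i \<in> J" "j \<in> J" for i j
        unfolding a[OF that] by (simp add: algebra_simps)
    qed
    moreover have "(w i)\<^sup>2 * (w j - w i) * (a i j)\<^sup>2 + w i * (w i - w j)\<^sup>2 * (a i j)\<^sup>2 = w i * w j * (w j - w i) * (a i j)\<^sup>2" for i j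
      by (simp add: power2_eq_square algebra_simps)
    then have "(\<Sum>i\<in>J. \<Sum>j\<in>J. (w i)\<^sup>2 * (w j - w i) * (a i j)\<^sup>2 + w i * (w i - w j)\<^sup>2 * (a i j)\<^sup>2)
      = (\<Sum>i\<in>J. \<Sum>j\<in>J. w i * w j * (w j - w i) * (a i j)\<^sup>2)"
      by (simp only:)
    ultimately show ?thesis by (simp add: sum.distrib)
  qed
  have S: "0 \<le> 2 * (w i * (w i - w j) * (a i j * b i j)) + \<delta> * (w i * (w i - w j)\<^sup>2 * (a i j)\<^sup>2) + w i * (b i j)\<^sup>2 / \<delta>"
    if "i \<in> J" for i j
  proof -
    have "0 \<le> w i * (\<delta> * (w i - w j) * a i j + b i j)\<^sup>2 / \<delta>" using w[OF that] \<delta> by simp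
    also have "\<dots> = 2 * (w i * (w i - w j) * (a i j * b i j)) + \<delta> * (w i * (w i - w j)\<^sup>2 * (a i j)\<^sup>2) + w i * (b i j)\<^sup>2 / \<delta>"
      using \<delta> by (simp add: power2_eq_square field_simps)
    finally show ?thesis .
  qed
  define s1 where "s1 i = (\<Sum>j\<in>J. (w i)\<^sup>2 * (a i j * b i j))" for i
  define s2 where "s2 i = (\<Sum>j\<in>J. (w i)\<^sup>2 * (w j - w i) * (a i j)\<^sup>2)" for i
  define s3 where "s3 i = (\<Sum>j\<in>J. w i * (b i j)\<^sup>2)" for i
  define t1 where "t1 i j = w i * (w i - w j) * (a i j * b i j)" for i j
  define t2 where "t2 i j = w i * (w i - w j)\<^sup>2 * (a i j)\<^sup>2" for i j
  define t3 where "t3 i j = w i * (b i j)\<^sup>2" for i j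
  have "(\<Sum>i\<in>J. (w i)\<^sup>2 + 2 * s1 i)
      \<le> (\<Sum>i\<in>J. \<delta> * ((w i)\<^sup>2 * D i) + \<delta> * s2 i + w i * G i / \<delta> - s3 i / \<delta>)"
    unfolding s1_def s2_def s3_def by (rule sum_mono[OF one])
  then have "(\<Sum>i\<in>J. (w i)\<^sup>2) + 2 * (\<Sum>i\<in>J. s1 i)
      \<le> \<delta> * (\<Sum>i\<in>J. (w i)\<^sup>2 * D i) + \<delta> * (\<Sum>i\<in>J. s2 i) + (\<Sum>i\<in>J. w i * G i) / \<delta> - (\<Sum>i\<in>J. s3 i) / \<delta>"
    by (simp only: sum.distrib sum_subtractf sum_distrib_left sum_divide_distrib)
  moreover have "(\<Sum>i\<in>J. s1 i) = (\<Sum>i\<in>J. \<Sum>j\<in>J. t1 i j)" unfolding s1_def t1_def by (rule A)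
  moreover have "(\<Sum>i\<in>J. s2 i) = - (\<Sum>i\<in>J. \<Sum>j\<in>J. t2 i j)" unfolding s2_def t2_def by (rule B)
  then have "\<delta> * (\<Sum>i\<in>J. s2 i) = - (\<delta> * (\<Sum>i\<in>J. \<Sum>j\<in>J. t2 i j))" by simp
  moreover have "(\<Sum>i\<in>J. s3 i) = (\<Sum>i\<in>J. \<Sum>j\<in>J. t3 i j)" unfolding s3_def t3_def ..
  then have "(\<Sum>i\<in>J. s3 i) / \<delta> = (\<Sum>i\<in>J. \<Sum>j\<in>J. t3 i j) / \<delta>" by simp
  moreover have "0 \<le> (\<Sum>i\<in>J. \<Sum>j\<in>J. 2 * t1 i j + \<delta> * t2 i j + t3 i j / \<delta>)"
    unfolding t1_def t2_def t3_def by (intro sum_nonneg S)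
  then have "0 \<le> 2 * (\<Sum>i\<in>J. \<Sum>j\<in>J. t1 i j) + \<delta> * (\<Sum>i\<in>J. \<Sum>j\<in>J. t2 i j) + (\<Sum>i\<in>J. \<Sum>j\<in>J. t3 i j) / \<delta>"
    by (simp only: sum.distrib sum_distrib_left sum_divide_distrib)
  ultimately show ?thesis by linarith
qed

text \<open>Validity for all scalings means that a quadratic polynomial in s is nonnegative, so its
  discriminant bound applies. This covers \<open>U = 0\<close> and \<open>V = 0\<close>, where an
  optimal \<delta> does not exist.\<close>

lemma le_sqrt_of_scaling:
  fixes S U V :: real
  assumes *: "\<And>\<delta>. \<delta> > 0 \<Longrightarrow> S \<le> \<delta> * U + V / \<delta>" and "0 \<le> S" "0 \<le> U" "0 \<le> V"
  shows "S \<le> 2 * sqrt V * sqrt U"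
proof -
  have "(- S / 2)\<^sup>2 \<le> V * U"
  proof (rule discriminant_le)
    fix s :: real
    show "0 \<le> V + 2 * s * (- S / 2) + s * s * U"
    proof (cases "s > 0")
      case True
      have "s * S \<le> s * (s * U + V / s)" using True by (intro mult_left_mono *) auto
      also have "\<dots> = s * s * U + V" using True by (simp add: algebra_simps)
      finally show ?thesis by simp
    next
      case False
      then have "s * S \<le> 0" using assms by (simp add: mult_nonpos_nonneg)
      moreover have "0 \<le> s * s * U" using assms by simp
      ultimately show ?thesis using assms(4) by simp
    qed
  qed fact
  then have "sqrt ((- S / 2)\<^sup>2) \<le> sqrt (V * U)" by (rule real_sqrt_le_mono)
  then show ?thesis using assms(2) by (simp add: real_sqrt_mult)
qed

lemma Z_le_en_1: "Z i f \<bullet> Z i f \<le> en 1 f"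
  using member_le_sum[of i UNIV "\<lambda>i. Z i f \<bullet> Z i f"] by (simp add: en_def inner_A_self)

context heis_domain
begin

lemma crd_Cauchy:
  assumes f: "\<And>m. f m \<in> tfs \<Omega>" and C: "Cauchy f" and b: "norm b \<le> 1"
  shows "Cauchy (\<lambda>m. crd b (f m))"
proof -
  obtain R where R: "\<And>z. z \<in> \<Omega> \<Longrightarrow> norm z \<le> R" using bd unfolding bounded_iff by blast
  show ?thesis unfolding Cauchy_square
  proof (intro allI impI)
    fix e :: real assume e: "e > 0"
    define c where "c = e / (R\<^sup>2 + 1)"
    have R1: "R\<^sup>2 + 1 > 0" by (simp add: add_nonneg_pos)
    have c: "c > 0" using e R1 by (simp add: c_def)
    obtain N where N: "\<And>m k. m \<ge> N \<Longrightarrow> k \<ge> N \<Longrightarrow> (f m - f k) \<bullet> (f m - f k) < c"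
      using C c unfolding Cauchy_square by blast
    have "(crd b (f m) - crd b (f k)) \<bullet> (crd b (f m) - crd b (f k)) < e" if "m \<ge> N" "k \<ge> N" for m k
    proof -
      have "(crd b (f m) - crd b (f k)) \<bullet> (crd b (f m) - crd b (f k)) \<le> R\<^sup>2 * ((f m - f k) \<bullet> (f m - f k))"
        unfolding crd_lin(2)[symmetric] by (rule crd_bound[OF tfs_diff[OF f f] R b])
      also have "\<dots> \<le> R\<^sup>2 * c" using N[OF that] by (intro mult_left_mono) auto
      also have "\<dots> < (R\<^sup>2 + 1) * c" using c by (simp add: algebra_simps)
      also have "\<dots> = e" using R1 by (simp add: c_def)
      finally show ?thesis .
    qed
    then show "\<exists>N. \<forall>m\<ge>N. \<forall>k\<ge>N. (crd b (f m) - crd b (f k)) \<bullet> (crd b (f m) - crd b (f k)) < e" by blast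
  qed
qed

lemma Z_Cauchy:
  assumes f: "econv l f u" and l: "l \<ge> 1"
  shows "Cauchy (\<lambda>m. Z i (f m))"
proof -
  have fc: "converges f u" using f by (simp add: econv_def)
  have le: "en 1 g \<le> g \<bullet> g + en l g" for g :: "'n htf"
    using log_convex_le[of "\<lambda>j. en j g" 1 l] l by (simp add: en_nonneg en_log_convex en_0)
  show ?thesis unfolding Cauchy_square
  proof (intro allI impI)
    fix e :: real assume e: "e > 0"
    then have e2: "e / 2 > 0" by simp
    obtain N1 where N1: "\<And>m k. m \<ge> N1 \<Longrightarrow> k \<ge> N1 \<Longrightarrow> (f m - f k) \<bullet> (f m - f k) < e / 2"
      using converges_Cauchy[OF fc] e2 unfolding Cauchy_square by blast
    obtain N2 where N2: "\<And>m k. m \<ge> N2 \<Longrightarrow> k \<ge> N2 \<Longrightarrow> en l (f m - f k) < e / 2" using f e2 unfolding econv_def by blast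
    have "(Z i (f m) - Z i (f k)) \<bullet> (Z i (f m) - Z i (f k)) < e" if "m \<ge> max N1 N2" "k \<ge> max N1 N2" for m k
      using Z_le_en_1[of i "f m - f k"] le[of "f m - f k"] N1[of m k] N2[of m k] that by (simp add: Z_lin)
    then show "\<exists>N. \<forall>m\<ge>N. \<forall>k\<ge>N. (Z i (f m) - Z i (f k)) \<bullet> (Z i (f m) - Z i (f k)) < e" by blast
  qed
qed

text \<open>With x the coordinate and X its field, \<open>a i j\<close> is (x u_i, u_j), symmetric,
  and \<open>b i j\<close> is (X u_i, u_j), skew. Both x u_i and X u_i are projected off the first
  \<open>k\<close> eigenfunctions, and their pairing is bounded below through [X, x] = 1, which is
  the origin of the 1/2 in \<open>CS\<close>.\<close>

lemma yang_inequality: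
  fixes p :: 'n and l :: nat and lam :: "nat \<Rightarrow> real"
  assumes l: "l = Suc l'" "l \<ge> 2"
    and C: "C \<ge> 0" "\<And>f :: 'n htf. en l (crd (ex p) f) \<le> (A ^^ l) f \<bullet> crd (ex p) (crd (ex p) f) + C * en l' f"
    and eig: "\<And>i. i \<ge> 1 \<Longrightarrow> u i \<in> eigenspace l \<Omega> (lam i)"
    and orth: "\<And>i j. i \<ge> 1 \<Longrightarrow> j \<ge> 1 \<Longrightarrow> l2ip \<Omega> (u i) (u j) = (if i = j then 1 else 0)"
    and compl: "\<And>\<mu> v. v \<in> eigenspace l \<Omega> \<mu> \<Longrightarrow>
      \<exists>c :: nat \<Rightarrow> real. AE z in lebesgue_on \<Omega>. v z = (\<Sum>i | i \<ge> 1 \<and> lam i = \<mu>. c i * u i z)"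
    and mono: "\<And>i j. 1 \<le> i \<Longrightarrow> i \<le> j \<Longrightarrow> lam i \<le> lam j"
    and pos: "0 < lam 1"
  shows "(\<Sum>i=1..k. (lam (Suc k) - lam i)\<^sup>2) \<le>
    2 * sqrt (\<Sum>i=1..k. (lam (Suc k) - lam i) * lam i powr (1 / l))
      * sqrt (\<Sum>i=1..k. (lam (Suc k) - lam i)\<^sup>2 * (C * lam i powr (l' / l)))"
proof -
  let ?x = "crd (ex p) :: 'n htf \<Rightarrow> 'n htf" and ?X = "Z (Inl p) :: 'n htf \<Rightarrow> 'n htf"
  define w where "w i = lam (Suc k) - lam i" for i
  define J where "J = {1..k}"
  have l0: "l > 0" using l by simp
  have lp: "0 < lam i" if "i \<in> J" for i using mono[of 1 i] pos that by (simp add: J_def)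
  have w0: "0 \<le> w i" if "i \<in> J" for i using mono[of i "Suc k"] that by (simp add: w_def J_def)
  have i1: "i \<ge> 1" if "i \<in> J" for i using that by (simp add: J_def)
  have ex1: "norm (ex p :: 'n heis) \<le> 1" by (simp add: norm_Pair norm_axis_1)
  obtain R where R: "\<And>z. z \<in> \<Omega> \<Longrightarrow> norm z \<le> R" using bd unfolding bounded_iff by blast
  have "\<exists>f. econv l f (u i)" if "i \<in> J" for i
    using eig[OF i1[OF that]] l by (intro S0_space_imp_econv) (auto simp: eigenspace_iff)
  then obtain f where f: "\<And>i. i \<in> J \<Longrightarrow> econv l (f i) (u i)" by metis
  have fc: "converges (f i) (u i)" if "i \<in> J" for i using f[OF that] by (simp add: econv_def)
  have ft: "f i m \<in> tfs \<Omega>" if "i \<in> J" for i m using fc[OF that] by (simp add: converges_def)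
  have uL: "u i \<in> L2_on \<Omega>" if "i \<in> J" for i using fc[OF that] by (simp add: converges_def)
  have ff: "(\<lambda>m. f i m \<bullet> f j m) \<longlonglongrightarrow> (if i = j then 1 else 0)" if "i \<in> J" "j \<in> J" for i j
    using converges_inner_both[OF fc fc, OF that] orth[OF i1 i1, OF that] by simp
  have "\<exists>v. converges (\<lambda>m. ?x (f i m)) v" if "i \<in> J" for i
    by (intro Cauchy_converges tfs_crd ft that crd_Cauchy converges_Cauchy[OF fc] ex1)
  then obtain U where U: "\<And>i. i \<in> J \<Longrightarrow> converges (\<lambda>m. ?x (f i m)) (U i)" by metis
  have "\<exists>v. converges (\<lambda>m. ?x (?x (f i m))) v" if "i \<in> J" for i
    by (intro Cauchy_converges tfs_crd ft that crd_Cauchy converges_Cauchy[OF fc] ex1)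
  then obtain U2 where U2: "\<And>i. i \<in> J \<Longrightarrow> converges (\<lambda>m. ?x (?x (f i m))) (U2 i)" by metis
  have "\<exists>v. converges (\<lambda>m. ?X (f i m)) v" if "i \<in> J" for i
    using l by (intro Cauchy_converges tfs_Z ft that Z_Cauchy[OF f]) auto
  then obtain W where W: "\<And>i. i \<in> J \<Longrightarrow> converges (\<lambda>m. ?X (f i m)) (W i)" by metis
  define a where "a i j = l2ip \<Omega> (U i) (u j)" for i j
  define b where "b i j = l2ip \<Omega> (W i) (u j)" for i j
  define N where "N i = l2ip \<Omega> (U i) (U i)" for i
  define G where "G i = l2ip \<Omega> (W i) (W i)" for i
  have al: "(\<lambda>m. ?x (f i m) \<bullet> f j m) \<longlonglongrightarrow> a i j" if "i \<in> J" "j \<in> J" for i j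
    unfolding a_def by (rule converges_inner_both[OF U[OF that(1)] fc[OF that(2)]])
  have bl: "(\<lambda>m. ?X (f i m) \<bullet> f j m) \<longlonglongrightarrow> b i j" if "i \<in> J" "j \<in> J" for i j
    unfolding b_def by (rule converges_inner_both[OF W[OF that(1)] fc[OF that(2)]])
  have Nl: "(\<lambda>m. ?x (f i m) \<bullet> ?x (f i m)) \<longlonglongrightarrow> N i" if "i \<in> J" for i
    unfolding N_def by (rule converges_inner_both[OF U[OF that] U[OF that]])
  have Gl: "(\<lambda>m. ?X (f i m) \<bullet> ?X (f i m)) \<longlonglongrightarrow> G i" if "i \<in> J" for i
    unfolding G_def by (rule converges_inner_both[OF W[OF that] W[OF that]])
  have a_sym: "a j i = a i j" if "i \<in> J" "j \<in> J" for i j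
  proof (rule LIMSEQ_unique[OF al[OF that(2,1)]])
    show "(\<lambda>m. ?x (f j m) \<bullet> f i m) \<longlonglongrightarrow> a i j"
    proof -
      have "?x (f j m) \<bullet> f i m = ?x (f i m) \<bullet> f j m" for m by (subst inner_crd) (rule inner_commute)
      then show ?thesis using al[OF that] by (simp only:)
    qed
  qed
  have b_sym: "b j i = - b i j" if "i \<in> J" "j \<in> J" for i j
  proof (rule LIMSEQ_unique[OF bl[OF that(2,1)]])
    have "?X (f j m) \<bullet> f i m = - (?X (f i m) \<bullet> f j m)" for m
      unfolding inner_Z[of _ "f j m"] by (simp add: inner_commute)
    then show "(\<lambda>m. ?X (f j m) \<bullet> f i m) \<longlonglongrightarrow> - b i j"
      using tendsto_minus[OF bl[OF that]] by simp
  qed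
  have xX: "?x g \<bullet> ?X g = - (1 / 2) * (g \<bullet> g)" for g
  proof -
    have "?X (?x g) \<bullet> g = ?X g \<bullet> ?x g + g \<bullet> g" by (simp add: Z_crd_ex inner_add_left inner_crd)
    moreover have "?X (?x g) \<bullet> g = - (?x g \<bullet> ?X g)" by (rule inner_Z)
    ultimately show ?thesis by (simp add: inner_commute)
  qed
  have xXl: "(\<lambda>m. ?x (f i m) \<bullet> ?X (f i m)) \<longlonglongrightarrow> - (1 / 2)" if "i \<in> J" for i
    unfolding xX using tendsto_mult[OF tendsto_const[of "- (1 / 2)"] ff[OF that that]] by simp
  have fJ: "finite J" by (simp add: J_def)
  define P where "P i m = ?x (f i m) - (\<Sum>j\<in>J. a i j *\<^sub>R f j m)" for i m
  define Q where "Q i m = ?X (f i m) - (\<Sum>j\<in>J. b i j *\<^sub>R f j m)" for i m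
  have PQ: "(\<lambda>m. P i m \<bullet> Q i m) \<longlonglongrightarrow> - (1 / 2) - (\<Sum>j\<in>J. a i j * b i j)" if "i \<in> J" for i
    unfolding P_def Q_def using that by (intro projected_inner_tendsto fJ xXl al bl ff)
  have PP: "(\<lambda>m. P i m \<bullet> P i m) \<longlonglongrightarrow> N i - (\<Sum>j\<in>J. a i j * a i j)" if "i \<in> J" for i
    unfolding P_def using that by (intro projected_inner_tendsto fJ Nl al ff)
  have QQ: "(\<lambda>m. Q i m \<bullet> Q i m) \<longlonglongrightarrow> G i - (\<Sum>j\<in>J. b i j * b i j)" if "i \<in> J" for i
    unfolding Q_def using that by (intro projected_inner_tendsto fJ Gl bl ff)
  have P0: "0 \<le> N i - (\<Sum>j\<in>J. (a i j)\<^sup>2)" if "i \<in> J" for i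
    using LIMSEQ_le_const[OF PP[OF that], of 0] by (simp add: power2_eq_square)
  have Q0: "0 \<le> G i - (\<Sum>j\<in>J. (b i j)\<^sup>2)" if "i \<in> J" for i
    using LIMSEQ_le_const[OF QQ[OF that], of 0] by (simp add: power2_eq_square)
  have CS: "(1 / 2 + (\<Sum>j\<in>J. a i j * b i j))\<^sup>2 \<le> (N i - (\<Sum>j\<in>J. (a i j)\<^sup>2)) * (G i - (\<Sum>j\<in>J. (b i j)\<^sup>2))"
    if "i \<in> J" for i
  proof -
    have "(- (1 / 2) - (\<Sum>j\<in>J. a i j * b i j))\<^sup>2 \<le> (N i - (\<Sum>j\<in>J. a i j * a i j)) * (G i - (\<Sum>j\<in>J. b i j * b i j))"
    proof (rule LIMSEQ_le[OF tendsto_power[OF PQ[OF that]] tendsto_mult[OF PP[OF that] QQ[OF that]]])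
      show "\<exists>N. \<forall>m\<ge>N. (P i m \<bullet> Q i m)\<^sup>2 \<le> (P i m \<bullet> P i m) * (Q i m \<bullet> Q i m)"
        using Cauchy_Schwarz_ineq by blast
    qed
    moreover have "(- (1 / 2) - (\<Sum>j\<in>J. a i j * b i j))\<^sup>2 = (1 / 2 + (\<Sum>j\<in>J. a i j * b i j))\<^sup>2"
      by (simp add: power2_eq_square algebra_simps)
    ultimately show ?thesis by (simp add: power2_eq_square)
  qed
  have flip: "l2ip \<Omega> (u i) (app g) = l2ip \<Omega> (app g) (u i)" for i g by (rule l2ip_sym)
  have enl: "(\<lambda>m. en l (f i m)) \<longlonglongrightarrow> lam i" if i: "i \<in> J" for i
  proof -
    obtain B where B: "\<And>m. en l (f i m) \<le> B" using econv_bounded[OF f[OF i]] by blast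
    have "(\<lambda>m. l2ip \<Omega> (u i) (app (f i m))) \<longlonglongrightarrow> 1"
      using converges_inner[OF fc uL, OF i i] orth[OF i1 i1, OF i i] by (simp add: flip)
    from econv_eigenfunction[OF f[OF i] eig[OF i1[OF i]] ft[OF i] B this] show ?thesis by (simp add: en_def)
  qed
  have en0: "(\<lambda>m. en 0 (f i m)) \<longlonglongrightarrow> 1" if "i \<in> J" for i using ff[OF that that] by (simp add: en_0)
  have lam_powr: "root l (lam i ^ j) = lam i powr (j / l)" if "i \<in> J" for i j
    using lp[OF that] l0 by (simp add: root_powr_inverse powr_realpow[symmetric] powr_powr divide_inverse)
  \<comment> \<open>The squared norm of X u_i is at most the energy of order one, which is
    interpolated between norm 1 and energy \<open>lam i\<close>.\<close>
  have Gle: "G i \<le> lam i powr (1 / l)" if i: "i \<in> J" for i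
  proof -
    have "G i \<le> root l (1 ^ l' * lam i)"
    proof (rule LIMSEQ_le[OF Gl[OF i] tendsto_real_root[OF tendsto_mult[OF tendsto_power[OF en0[OF i]] enl[OF i]]]])
      have "?X g \<bullet> ?X g \<le> root l (en 0 g ^ l' * en l g)" for g
      proof -
        have "en 1 g ^ l \<le> en 0 g ^ l' * en l g"
          using log_convex_first[of "\<lambda>j. en j g" l'] by (simp add: en_nonneg en_log_convex l)
        then have "root l (en 1 g ^ l) \<le> root l (en 0 g ^ l' * en l g)" using l0 by (simp only: real_root_le_iff)
        then show ?thesis using Z_le_en_1[of "Inl p" g] l0 by (simp add: real_root_power_cancel en_nonneg)
      qed
      then show "\<exists>N. \<forall>m\<ge>N. ?X (f i m) \<bullet> ?X (f i m) \<le> root l (en 0 (f i m) ^ l' * en l (f i m))" by blast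
    qed
    then show ?thesis using lam_powr[OF i, of 1] by simp
  qed
  \<comment> \<open>The variational inequality for x u_i combined with the double commutator bound.
    The leading part tends to \<open>lam i * N i\<close>; subtracting it from
    \<open>lam (Suc k) * N i\<close> leaves the gap \<open>w i\<close>.\<close>
  have main: "w i * N i \<le> C * lam i powr (l' / l) + (\<Sum>j\<in>J. w j * (a i j)\<^sup>2)" if i: "i \<in> J" for i
  proof -
    obtain B where B: "B \<ge> 0" "\<And>m. en l (f i m) \<le> B" using econv_bounded[OF f[OF i]] by blast
    obtain F where F: "\<And>m. norm (f i m) \<le> F" using Cauchy_Bseq[OF converges_Cauchy[OF fc[OF i]]] unfolding Bseq_def by blast
    obtain D where D: "D \<ge> 0" "\<And>g. g \<in> tfs \<Omega> \<Longrightarrow> en l (?x (?x g)) \<le> D * (en l g + g \<bullet> g)"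
      using en_crd_crd_le[OF R, of \<Omega> l p] by blast
    have "f i m \<bullet> f i m \<le> F\<^sup>2" for m
      using power_mono[OF F, of m 2] by (simp add: power2_norm_eq_inner)
    then have "D * (en l (f i m) + f i m \<bullet> f i m) \<le> D * (B + F\<^sup>2)" for m
      using B D(1) by (intro mult_left_mono add_mono)
    then have xxB: "en l (?x (?x (f i m))) \<le> D * (B + F\<^sup>2)" for m using D(2)[OF ft[OF i]] order_trans by blast
    have "(\<lambda>m. ?x (?x (f i m)) \<bullet> f i m) \<longlonglongrightarrow> l2ip \<Omega> (U2 i) (u i)" by (rule converges_inner_both[OF U2[OF i] fc[OF i]])
    then have "(\<lambda>m. ?x (f i m) \<bullet> ?x (f i m)) \<longlonglongrightarrow> l2ip \<Omega> (U2 i) (u i)" by (simp add: inner_crd[of _ "?x (f i _)"])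
    then have "l2ip \<Omega> (U2 i) (u i) = N i" using Nl[OF i] by (rule LIMSEQ_unique)
    then have "(\<lambda>m. l2ip \<Omega> (u i) (app (?x (?x (f i m))))) \<longlonglongrightarrow> N i"
      using converges_inner[OF U2 uL, OF i i] by (simp add: flip)
    note lxx = this
    have "?x (?x (f i m)) \<in> tfs \<Omega>" for m by (intro tfs_crd ft i)
    from econv_eigenfunction[OF f[OF i] eig[OF i1[OF i]] this xxB lxx]
    have Axx: "(\<lambda>m. (A ^^ l) (f i m) \<bullet> ?x (?x (f i m))) \<longlonglongrightarrow> lam i * N i" .
    have la: "(\<lambda>m. l2ip \<Omega> (u j) (app (?x (f i m)))) \<longlonglongrightarrow> a i j" if j: "j \<in> J" for j
      using converges_inner[OF U uL, OF i j] by (simp add: flip a_def)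
    have R: "(\<lambda>m. root l (en 0 (f i m) * en l (f i m) ^ l')) \<longlonglongrightarrow> root l (1 * lam i ^ l')"
      by (intro tendsto_intros en0 enl i)
    have "lam (Suc k) * N i \<le> lam i * N i + C * root l (1 * lam i ^ l') + (\<Sum>j\<in>J. w j * (a i j)\<^sup>2)"
    proof (rule LIMSEQ_le)
      show "(\<lambda>m. lam (Suc k) * (?x (f i m) \<bullet> ?x (f i m))) \<longlonglongrightarrow> lam (Suc k) * N i" by (intro tendsto_intros Nl i)
      show "(\<lambda>m. (A ^^ l) (f i m) \<bullet> ?x (?x (f i m)) + C * root l (en 0 (f i m) * en l (f i m) ^ l')
          + (\<Sum>j\<in>J. w j * (l2ip \<Omega> (u j) (app (?x (f i m))))\<^sup>2))
        \<longlonglongrightarrow> lam i * N i + C * root l (1 * lam i ^ l') + (\<Sum>j\<in>J. w j * (a i j)\<^sup>2)"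
        by (intro tendsto_add tendsto_mult[OF tendsto_const] tendsto_sum tendsto_power Axx R la)
      have "lam (Suc k) * (?x (f i m) \<bullet> ?x (f i m)) \<le> (A ^^ l) (f i m) \<bullet> ?x (?x (f i m)) + C * root l (en 0 (f i m) * en l (f i m) ^ l')
          + (\<Sum>j\<in>J. w j * (l2ip \<Omega> (u j) (app (?x (f i m))))\<^sup>2)" for m
      proof -
        have "lam (Suc k) * (?x (f i m) \<bullet> ?x (f i m)) \<le> en l (?x (f i m)) + (\<Sum>j\<in>J. w j * (l2ip \<Omega> (u j) (app (?x (f i m))))\<^sup>2)"
          unfolding w_def J_def by (rule spectral_inequality[OF l(2) eig orth compl mono]) (auto intro: tfs_crd ft i)
        moreover have "C * en l' (f i m) \<le> C * root l (en 0 (f i m) * en l (f i m) ^ l')"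
        proof (rule mult_left_mono[OF _ C(1)])
          have "en l' (f i m) ^ l \<le> en 0 (f i m) * en l (f i m) ^ l'"
            using log_convex_last[of "\<lambda>j. en j (f i m)" l'] by (simp add: en_nonneg en_log_convex l)
          then have "root l (en l' (f i m) ^ l) \<le> root l (en 0 (f i m) * en l (f i m) ^ l')" using l0 by (simp only: real_root_le_iff)
          then show "en l' (f i m) \<le> root l (en 0 (f i m) * en l (f i m) ^ l')" using l0 by (simp add: real_root_power_cancel en_nonneg)
        qed
        ultimately show ?thesis using C(2)[of "f i m"] by linarith
      qed
      then show "\<exists>M. \<forall>m\<ge>M. lam (Suc k) * (?x (f i m) \<bullet> ?x (f i m)) \<le> (A ^^ l) (f i m) \<bullet> ?x (?x (f i m)) + C * root l (en 0 (f i m) * en l (f i m) ^ l')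
          + (\<Sum>j\<in>J. w j * (l2ip \<Omega> (u j) (app (?x (f i m))))\<^sup>2)" by blast
    qed
    then show ?thesis using lam_powr[OF i, of l'] by (simp add: w_def left_diff_distrib)
  qed
  have G0: "0 \<le> G i" for i unfolding G_def by (rule l2ip_nonneg)
  have "(\<Sum>i\<in>J. (w i)\<^sup>2) \<le> 2 * sqrt (\<Sum>i\<in>J. w i * G i) * sqrt (\<Sum>i\<in>J. (w i)\<^sup>2 * (C * lam i powr (l' / l)))"
  proof (rule le_sqrt_of_scaling)
    show "(\<Sum>i\<in>J. (w i)\<^sup>2) \<le> \<delta> * (\<Sum>i\<in>J. (w i)\<^sup>2 * (C * lam i powr (l' / l))) + (\<Sum>i\<in>J. w i * G i) / \<delta>" if "\<delta> > 0" for \<delta>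
      by (rule yang_sum[OF that w0 a_sym b_sym main CS P0 Q0])
    show "0 \<le> (\<Sum>i\<in>J. (w i)\<^sup>2)" by (rule sum_nonneg) simp
    show "0 \<le> (\<Sum>i\<in>J. (w i)\<^sup>2 * (C * lam i powr (l' / l)))" using C(1) by (intro sum_nonneg mult_nonneg_nonneg) auto
    show "0 \<le> (\<Sum>i\<in>J. w i * G i)" by (intro sum_nonneg mult_nonneg_nonneg w0 G0)
  qed
  also have "\<dots> \<le> 2 * sqrt (\<Sum>i\<in>J. w i * lam i powr (1 / l)) * sqrt (\<Sum>i\<in>J. (w i)\<^sup>2 * (C * lam i powr (l' / l)))"
  proof (intro mult_right_mono mult_left_mono real_sqrt_le_mono sum_mono)
    show "G i \<le> lam i powr (1 / l)" if "i \<in> J" for i by (rule Gle[OF that])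
    show "0 \<le> w i" if "i \<in> J" for i by (rule w0[OF that])
    have "0 \<le> (\<Sum>i\<in>J. (w i)\<^sup>2 * (C * lam i powr (l' / l)))" using C(1) by (intro sum_nonneg mult_nonneg_nonneg) auto
    then show "0 \<le> sqrt (\<Sum>i\<in>J. (w i)\<^sup>2 * (C * lam i powr (l' / l)))" by simp
  qed simp
  finally show ?thesis unfolding w_def J_def .
qed

end

text \<open>The first summand dominates for x at least 1, the second below 1. It serves odd l, where
  the constant multiplies these two powers.\<close>

lemma powr_interpolate:
  fixes x :: real
  assumes x: "x > 0" and l: "l \<ge> 1"
  shows "x powr ((real l - 1) / l) \<le> x + x powr ((real l - 2) / l)"
proof (cases "x \<ge> 1")
  case True
  have "x powr ((real l - 1) / l) \<le> x powr 1" using True l by (intro powr_mono) auto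
  then show ?thesis using x by (simp add: add_increasing2)
next
  case False
  have "x powr ((real l - 1) / l) \<le> x powr ((real l - 2) / l)"
    using False x by (intro powr_mono' divide_right_mono) auto
  then show ?thesis using x by simp
qed

theorem theorem4p3:
  fixes l :: nat
  assumes "l \<ge> 3"
  shows "\<exists>c1 c2 :: real. \<forall>(\<Omega> :: ('n::finite) heis set) (lam :: nat \<Rightarrow> real) (k :: nat).
    bounded_smooth_domain \<Omega> \<longrightarrow> eigenvalue_listing l \<Omega> lam \<longrightarrow> k \<ge> 1 \<longrightarrow>
    (odd l \<longrightarrow>
      (\<Sum>i=1..k. (lam (k+1) - lam i)\<^sup>2) \<le>
        1 / real CARD('n) * sqrt (\<Sum>i=1..k. (lam (k+1) - lam i) * lam i powr (1 / real l)) *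
        sqrt (\<Sum>i=1..k. (lam (k+1) - lam i)\<^sup>2 *
          (2 * real l * (real CARD('n) + real l - 1) * lam i powr ((real l - 1) / real l)
            + c1 * (lam i + lam i powr ((real l - 2) / real l))))) \<and>
    (even l \<longrightarrow>
      (\<Sum>i=1..k. (lam (k+1) - lam i)\<^sup>2) \<le>
        1 / real CARD('n) * sqrt (\<Sum>i=1..k. (lam (k+1) - lam i) * lam i powr (1 / real l)) *
        sqrt (\<Sum>i=1..k. (lam (k+1) - lam i)\<^sup>2 *
          ((2 * real l * real CARD('n) + 4 * (real l - 1)) * lam i powr ((real l - 1) / real l)
            + c2 * lam i powr ((real l - 1) / real l))))"
proof -
  obtain l' where l': "l = Suc l'" using assms by (cases l) auto
  have l'l: "real l' = real l - 1" by (simp add: l')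
  define n where "n = real CARD('n)"
  have n: "n > 0" by (simp add: n_def)
  \<comment> \<open>A single coordinate is enough; \<open>undefined\<close> is an arbitrary
    index.\<close>
  obtain C where C: "C \<ge> 0" "\<And>f :: 'n htf. en l (crd (ex undefined) f)
      \<le> (A ^^ l) f \<bullet> crd (ex undefined) (crd (ex undefined) f) + C * en l' f"
    using double_commutator l' by blast
  \<comment> \<open>The factor 2 of \<open>yang_inequality\<close> is 2 n times the prefactor 1 / n,
    and 2 n enters the second square root as 4 n^2.\<close>
  define c where "c = 4 * n\<^sup>2 * C"
  have c: "c \<ge> 0" using C by (simp add: c_def)
  \<comment> \<open>\<open>h\<close> abstracts the bracket of the theorem, so that odd and even l
    differ only in a pointwise lower bound for it.\<close>
  have key: "(\<Sum>i=1..k. (lam (k+1) - lam i)\<^sup>2) \<le>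
      1 / n * sqrt (\<Sum>i=1..k. (lam (k+1) - lam i) * lam i powr (1 / real l)) *
      sqrt (\<Sum>i=1..k. (lam (k+1) - lam i)\<^sup>2 * h (lam i))"
    if \<Omega>: "bounded_smooth_domain \<Omega>" and lam: "eigenvalue_listing l \<Omega> lam"
      and h: "\<And>x. x > 0 \<Longrightarrow> c * x powr ((real l - 1) / real l) \<le> h x"
    for \<Omega> :: "'n heis set" and lam :: "nat \<Rightarrow> real" and k and h :: "real \<Rightarrow> real"
  proof -
    interpret heis_domain \<Omega> by unfold_locales (use \<Omega> in \<open>auto simp: bounded_smooth_domain_def\<close>)
    obtain u where u: "\<And>i. i \<ge> 1 \<Longrightarrow> u i \<in> eigenspace l \<Omega> (lam i)"
      "\<And>i j. i \<ge> 1 \<Longrightarrow> j \<ge> 1 \<Longrightarrow> l2ip \<Omega> (u i) (u j) = (if i = j then 1 else 0)"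
      "\<And>\<mu> v. v \<in> eigenspace l \<Omega> \<mu> \<Longrightarrow>
        \<exists>c :: nat \<Rightarrow> real. AE z in lebesgue_on \<Omega>. v z = (\<Sum>i | i \<ge> 1 \<and> lam i = \<mu>. c i * u i z)"
      using lam unfolding eigenvalue_listing_def l2ip_def by blast
    have pos: "0 < lam 1" and step: "\<And>i. i \<ge> 1 \<Longrightarrow> lam i \<le> lam (i + 1)" using lam by (auto simp: eigenvalue_listing_def)
    have mono: "lam i \<le> lam j" if "1 \<le> i" "i \<le> j" for i j
      using that(2)
    proof (induction j rule: dec_induct)
      case (step m)
      then show ?case using \<open>\<And>i. i \<ge> 1 \<Longrightarrow> lam i \<le> lam (i + 1)\<close>[of m] that(1) by simp
    qed simp
    let ?V = "\<Sum>i=1..k. (lam (k+1) - lam i) * lam i powr (1 / real l)"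
    let ?U = "\<Sum>i=1..k. (lam (k+1) - lam i)\<^sup>2 * (C * lam i powr ((real l - 1) / real l))"
    have "(\<Sum>i=1..k. (lam (k+1) - lam i)\<^sup>2) \<le> 2 * sqrt ?V * sqrt ?U"
      using yang_inequality[OF l' _ C u mono pos, of k] assms by (simp add: l'l)
    also have "\<dots> = 1 / n * sqrt ?V * sqrt ((2 * n)\<^sup>2 * ?U)"
      using n by (simp add: real_sqrt_mult)
    also have "(2 * n)\<^sup>2 * ?U = (\<Sum>i=1..k. (lam (k+1) - lam i)\<^sup>2 * (c * lam i powr ((real l - 1) / real l)))"
      by (simp add: sum_distrib_left c_def power2_eq_square mult_ac)
    also have "1 / n * sqrt ?V * sqrt \<dots> \<le> 1 / n * sqrt ?V * sqrt (\<Sum>i=1..k. (lam (k+1) - lam i)\<^sup>2 * h (lam i))"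
    proof (intro mult_left_mono real_sqrt_le_mono sum_mono h)
      show "0 < lam i" if "i \<in> {1..k}" for i using mono[of 1 i] pos that by simp
      have "0 \<le> ?V"
      proof (intro sum_nonneg mult_nonneg_nonneg)
        show "0 \<le> lam (k + 1) - lam i" if "i \<in> {1..k}" for i using mono[of i "k + 1"] that by simp
      qed simp
      then show "0 \<le> 1 / n * sqrt ?V" using n by simp
    qed simp
    finally show ?thesis .
  qed
  show ?thesis
  proof (rule exI[of _ c], rule exI[of _ c], intro allI impI conjI)
    fix \<Omega> :: "'n heis set" and lam :: "nat \<Rightarrow> real" and k :: nat
    assume \<Omega>: "bounded_smooth_domain \<Omega>" and lam: "eigenvalue_listing l \<Omega> lam" and "k \<ge> 1"
    \<comment> \<open>The explicit summand is nonnegative, so the term with the constant alone gives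
      the bound, through \<open>powr_interpolate\<close>.\<close>
    have odd: "c * x powr ((real l - 1) / real l)
        \<le> 2 * real l * (n + real l - 1) * x powr ((real l - 1) / real l) + c * (x + x powr ((real l - 2) / real l))"
      if "x > 0" for x
    proof -
      have "c * x powr ((real l - 1) / real l) \<le> c * (x + x powr ((real l - 2) / real l))"
        using powr_interpolate[OF that, of l] assms c by (intro mult_left_mono) auto
      moreover have "0 \<le> 2 * real l * (n + real l - 1) * x powr ((real l - 1) / real l)"
        using n assms by (intro mult_nonneg_nonneg) auto
      ultimately show ?thesis by linarith
    qed
    show "(\<Sum>i=1..k. (lam (k+1) - lam i)\<^sup>2) \<le>
        1 / real CARD('n) * sqrt (\<Sum>i=1..k. (lam (k+1) - lam i) * lam i powr (1 / real l)) *
        sqrt (\<Sum>i=1..k. (lam (k+1) - lam i)\<^sup>2 *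
          (2 * real l * (real CARD('n) + real l - 1) * lam i powr ((real l - 1) / real l)
            + c * (lam i + lam i powr ((real l - 2) / real l))))"
      using key[OF \<Omega> lam odd] unfolding n_def by simp
    have even: "c * x powr ((real l - 1) / real l)
        \<le> (2 * real l * n + 4 * (real l - 1)) * x powr ((real l - 1) / real l) + c * x powr ((real l - 1) / real l)" for x
      using n assms by simp
    show "(\<Sum>i=1..k. (lam (k+1) - lam i)\<^sup>2) \<le>
        1 / real CARD('n) * sqrt (\<Sum>i=1..k. (lam (k+1) - lam i) * lam i powr (1 / real l)) *
        sqrt (\<Sum>i=1..k. (lam (k+1) - lam i)\<^sup>2 *
          ((2 * real l * real CARD('n) + 4 * (real l - 1)) * lam i powr ((real l - 1) / real l)
            + c * lam i powr ((real l - 1) / real l)))"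
      using key[OF \<Omega> lam even] unfolding n_def by simp
  qed
qed

end
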